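(* Let $G$ be a Fuchsian group of the first kind with a cusp at $\infty$ and let $\rho:G\to\mathrm{GL}_d(\mathbb{C})$ be any admissible representation of finite image. Then there exists a weakly holomorphic vector-valued modular function for $G$ with multiplier $\rho$ (that is, an element $\mathbb{X}=(\mathbb{X}_1,\ldots,\mathbb{X}_d)^{\mathfrak t}$ of $\mathcal{M}^!_0(\rho)$) whose components $\mathbb{X}_1,\ldots,\mathbb{X}_d$ are linearly independent over $\mathbb{C}$.
   Context: $\mathrm{PSL}_2(\mathbb{R})$ acts by Möbius transformations on the upper half plane $\mathbb{H}$ and on $\mathbb{R}\cup\{\infty\}$. $\mathfrak t$ denotes transpose. A Fuchsian group of the first kind is a discrete subgroup $G$ of $\mathrm{PSL}_2(\mathbb{R})$ having a fundamental domain in $\mathbb{H}$ of finite hyperbolic area. A cusp of $G$ is a point of $\mathbb{R}\cup\{\infty\}$ fixed by a nontrivial parabolic element of $G$. Put $t^{h}=\pm\begin{pmatrix}1&h\\0&1\end{pmatrix}$, $A_\infty=I$ and, for $\mathfrak{c}\in\mathbb{R}$, $A_{\mathfrak{c}}=\pm\begin{pmatrix}\mathfrak{c}&-1\\1&0\end{pmatrix}$. For a cusp $\mathfrak{c}$ of $G$, the stabilizer $G_{\mathfrak{c}}$ is infinite cyclic, generated by $t_{\mathfrak{c}}=A_{\mathfrak{c}}t^{h_{\mathfrak{c}}}A_{\mathfrak{c}}^{-1}$ with $h_{\mathfrak{c}}>0$ minimal. Put $\widetilde q_{\mathfrak{c}}=\exp(2\pi \mathrm{i}\,A_{\mathfrak{c}}^{-1}\tau/h_{\mathfrak{c}})$.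 Admissible representation: $\rho:G\to\mathrm{GL}_d(\mathbb{C})$ is admissible if $\rho(t_\infty)$ is diagonal and $\rho(t_{\mathfrak{c}})$ is diagonalizable for every cusp $\mathfrak{c}\ne\infty$ in a set of representatives of the $G$-orbits of cusps. For each cusp choose $\mathcal{P}_{\mathfrak{c}}\in\mathrm{GL}_d(\mathbb{C})$ ($\mathcal{P}_\infty=I$) and the diagonal matrix $\Lambda_{\mathfrak{c}}$ with entries in $[0,1)$ such that $\mathcal{P}_{\mathfrak{c}}^{-1}\rho(t_{\mathfrak{c}})\mathcal{P}_{\mathfrak{c}}=\exp(2\pi \mathrm{i}\Lambda_{\mathfrak{c}})$. $\mathcal{M}^!_0(\rho)$ is the set of holomorphic functions $\mathbb{X}:\mathbb{H}\to\mathbb{C}^d$ such that $\mathbb{X}(\gamma\tau)=\rho(\gamma)\mathbb{X}(\tau)$ for all $\gamma\in G$, $\tau\in\mathbb{H}$, and such that at every cusp $\mathfrak{c}$ (including $\infty$) there is an expansion $\mathbb{X}(\tau)=\mathcal{P}_{\mathfrak{c}}\,\widetilde q_{\mathfrak{c}}^{\,\Lambda_{\mathfrak{c}}}\mathcal{P}_{\mathfrak{c}}^{-1}\sum_{n\ge -M_{\mathfrak{c}}}\mathbb{X}^{\mathfrak{c}}_{[n]}\widetilde q_{\mathfrak{c}}^{\,n}$ with coefficients $\mathbb{X}^{\mathfrak{c}}_{[n]}\in\mathbb{C}^d$ and only finitely many negative powers. Here $\widetilde q_{\mathfrak{c}}^{\,\Lambda}=\exp(2\pi \mathrm{i}\Lambda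 A_{\mathfrak{c}}^{-1}\tau/h_{\mathfrak{c}})$. "Modular function" means weight $0$. *)

theory Defs
  imports "HOL-Analysis.Analysis" "HOL-Algebra.Generated_Groups" "HOL-Algebra.Group_Action"
begin

definition SL2R :: "(real^2^2) monoid" where
  "SL2R = \<lparr>carrier = {M. det M = 1}, mult = (**), one = mat 1\<rparr>"

definition PSL2R :: "(real^2^2) set monoid" where
  "PSL2R = SL2R Mod {mat 1, - mat 1}"

definition psl :: "real^2^2 \<Rightarrow> (real^2^2) set" where
  "psl M = {mat 1, - mat 1} #>\<^bsub>SL2R\<^esub> M"

definition psl2r :: "real \<Rightarrow> real \<Rightarrow> real \<Rightarrow> real \<Rightarrow> (real^2^2) set" where
  "psl2r a b c d = psl (vector [vector [a, b], vector [c, d]])"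

lemma matrix_mul_left_minus: "(- A) ** B = - (A ** B)" for A :: "real^2^2"
  by (simp add: matrix_matrix_mult_def vec_eq_iff sum_negf)

lemma matrix_mul_right_minus: "A ** (- B) = - (A ** B)" for A :: "real^2^2"
  by (simp add: matrix_matrix_mult_def vec_eq_iff sum_negf)

lemma psl_eq: "psl M = {M, - M}"
  by (auto simp: psl_def r_coset_def SL2R_def matrix_mul_left_minus)

lemma group_SL2R: "group SL2R"
proof (rule groupI)
  fix M assume "M \<in> carrier SL2R"
  then have "det M = 1" by (simp add: SL2R_def)
  then have "invertible M" by (simp add: invertible_det_nz)
  then obtain N where N: "M ** N = mat 1" "N ** M = mat 1" by (auto simp: invertible_def)
  from N(2) have "det N * det M = 1" by (simp flip: det_mul)
  then show "\<exists>N\<in>carrier SL2R. N \<otimes>\<^bsub>SL2R\<^esub> M = \<one>\<^bsub>SL2R\<^esub>"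
    using \<open>det M = 1\<close> N(2) by (auto simp: SL2R_def intro!: bexI[of _ N])
qed (auto simp: SL2R_def det_mul matrix_mul_assoc)

lemma det_uminus_2: "det (- M :: real^2^2) = det M"
  by (simp add: det_2)

lemma normal_pm_one: "{mat 1, - mat 1} \<lhd> SL2R"
proof -
  interpret group SL2R by (rule group_SL2R)
  have mem: "mat 1 \<in> carrier SL2R" "- mat 1 \<in> carrier SL2R"
    by (simp_all add: SL2R_def det_uminus_2)
  have mult: "(- mat 1) \<otimes>\<^bsub>SL2R\<^esub> (- mat 1) = mat 1" "mat 1 \<otimes>\<^bsub>SL2R\<^esub> M = M" "M \<otimes>\<^bsub>SL2R\<^esub> mat 1 = M"
    "(- mat 1) \<otimes>\<^bsub>SL2R\<^esub> M = - M" "M \<otimes>\<^bsub>SL2R\<^esub> (- mat 1) = - M" for M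
    by (simp_all add: SL2R_def matrix_mul_left_minus matrix_mul_right_minus)
  have inv: "inv\<^bsub>SL2R\<^esub> (- mat 1) = - mat 1"
    by (rule inv_equality) (use mem mult in \<open>simp_all add: SL2R_def\<close>)
  have one: "inv\<^bsub>SL2R\<^esub> (mat 1) = mat 1"
    using inv_one by (simp add: SL2R_def)
  have "subgroup {mat 1, - mat 1} SL2R"
    by (rule subgroupI) (use mem in \<open>auto simp: inv one mult\<close>)
  then show ?thesis
    by (rule normalI) (simp add: r_coset_def l_coset_def mult)
qed

lemma group_PSL2R: "group PSL2R"
  unfolding PSL2R_def by (rule normal.factorgroup_is_group[OF normal_pm_one])

lemma carrier_PSL2R: "carrier PSL2R = psl ` {M. det M = 1}"
  unfolding PSL2R_def carrier_FactGroup psl_def by (simp add: SL2R_def)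

definition PSL2R_topology :: "(real^2^2) set topology" where
  "PSL2R_topology = topology (\<lambda>U. U \<subseteq> carrier PSL2R \<and>
     openin (top_of_set (carrier SL2R)) {M \<in> carrier SL2R. psl M \<in> U})"

lemma openin_PSL2R_topology:
  "openin PSL2R_topology U \<longleftrightarrow> U \<subseteq> carrier PSL2R \<and>
     openin (top_of_set (carrier SL2R)) {M \<in> carrier SL2R. psl M \<in> U}"
proof -
  have "istopology (\<lambda>U. U \<subseteq> carrier PSL2R \<and>
     openin (top_of_set (carrier SL2R)) {M \<in> carrier SL2R. psl M \<in> U})"
    unfolding istopology_def
  proof (intro conjI allI impI)
    fix S T
    assume S: "S \<subseteq> carrier PSL2R \<and> openin (top_of_set (carrier SL2R)) {M \<in> carrier SL2R. psl M \<in> S}"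
      and T: "T \<subseteq> carrier PSL2R \<and> openin (top_of_set (carrier SL2R)) {M \<in> carrier SL2R. psl M \<in> T}"
    show "S \<inter> T \<subseteq> carrier PSL2R" using S by blast
    have "{M \<in> carrier SL2R. psl M \<in> S \<inter> T} = {M \<in> carrier SL2R. psl M \<in> S} \<inter> {M \<in> carrier SL2R. psl M \<in> T}"
      by blast
    then show "openin (top_of_set (carrier SL2R)) {M \<in> carrier SL2R. psl M \<in> S \<inter> T}"
      using S T by (simp add: openin_Int)
  next
    fix K
    assume K: "\<forall>S\<in>K. S \<subseteq> carrier PSL2R \<and> openin (top_of_set (carrier SL2R)) {M \<in> carrier SL2R. psl M \<in> S}"
    show "\<Union>K \<subseteq> carrier PSL2R" using K by blast
    have "{M \<in> carrier SL2R. psl M \<in> \<Union>K} = (\<Union>S\<in>K. {M \<in> carrier SL2R. psl M \<in> S})"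
      by blast
    then show "openin (top_of_set (carrier SL2R)) {M \<in> carrier SL2R. psl M \<in> \<Union>K}"
      using K by (simp only:) (rule openin_Union, blast)
  qed
  then show ?thesis by (simp add: PSL2R_topology_def)
qed

definition upper_half_plane :: "complex set" where
  "upper_half_plane = {\<tau>. Im \<tau> > 0}"

datatype boundary_point = Fin real | Infty

text \<open>
  An element of PSL(2,R) is a set of two matrices inducing the same map, so the image sets
  below are singletons.
\<close>

definition act :: "(real^2^2) set \<Rightarrow> complex \<Rightarrow> complex" where
  "act g \<tau> = the_elem ((\<lambda>M. moebius (of_real (M$1$1)) (of_real (M$1$2))
     (of_real (M$2$1)) (of_real (M$2$2)) \<tau>) ` g)"

fun boundary_moebius :: "real^2^2 \<Rightarrow> boundary_point \<Rightarrow> boundary_point" where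
  "boundary_moebius M (Fin x) = (if M$2$1 * x + M$2$2 = 0 then Infty
     else Fin ((M$1$1 * x + M$1$2) / (M$2$1 * x + M$2$2)))"
| "boundary_moebius M Infty = (if M$2$1 = 0 then Infty else Fin (M$1$1 / M$2$1))"

definition boundary_act :: "(real^2^2) set \<Rightarrow> boundary_point \<Rightarrow> boundary_point" where
  "boundary_act g x = the_elem ((\<lambda>M. boundary_moebius M x) ` g)"

lemma act_psl2r: "act (psl2r a b c d) \<tau> = (of_real a * \<tau> + of_real b) / (of_real c * \<tau> + of_real d)"
proof -
  have neg: "(- (of_real a * \<tau>) - of_real b) / (- (of_real c * \<tau>) - of_real d) =
      (of_real a * \<tau> + of_real b) / (of_real c * \<tau> + (of_real d :: complex))"
    using minus_divide_divide[of "of_real a * \<tau> + of_real b" "of_real c * \<tau> + of_real d"]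
    by (simp only: minus_add_distrib diff_conv_add_uminus)
  show ?thesis
    by (simp only: act_def psl2r_def psl_eq moebius_def image_insert image_empty vector_2
        vector_uminus_component of_real_minus mult_minus_left neg flip: diff_conv_add_uminus) simp
qed

lemma boundary_act_psl: "boundary_act (psl M) x = boundary_moebius M x"
proof -
  have "boundary_moebius (- M) x = boundary_moebius M x"
  proof (cases x)
    case (Fin r)
    have "(- (M$1$1 * r) - M$1$2) / (- (M$2$1 * r) - M$2$2) = (M$1$1 * r + M$1$2) / (M$2$1 * r + M$2$2)"
      using minus_divide_divide[of "M$1$1 * r + M$1$2" "M$2$1 * r + M$2$2"]
      by (simp only: minus_add_distrib diff_conv_add_uminus)
    moreover have "(- (M$2$1 * r) - M$2$2 = 0) = (M$2$1 * r + M$2$2 = 0)" by linarith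
    ultimately show ?thesis by (simp add: Fin)
  qed simp
  then show ?thesis by (simp add: boundary_act_def psl_eq)
qed

definition hyperbolic_area :: "complex set \<Rightarrow> ennreal" where
  "hyperbolic_area S = (\<integral>\<^sup>+\<tau>\<in>S. ennreal (1 / (Im \<tau>)\<^sup>2) \<partial>lborel)"

text \<open>
  Without the condition on the boundary, the area of D could be smaller than that of a
  measurable set of orbit representatives.
\<close>

definition fundamental_domain :: "(real^2^2) set set \<Rightarrow> complex set \<Rightarrow> bool" where
  "fundamental_domain G D \<longleftrightarrow>
     D \<noteq> {} \<and> open D \<and> connected D \<and> D \<subseteq> upper_half_plane \<and>
     (\<forall>g\<in>G. g \<noteq> \<one>\<^bsub>PSL2R\<^esub> \<longrightarrow> act g ` D \<inter> D = {}) \<and>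
     (\<Union>g\<in>G. act g ` (closure D \<inter> upper_half_plane)) = upper_half_plane \<and>
     hyperbolic_area (frontier D \<inter> upper_half_plane) = 0"

definition fuchsian_first_kind :: "(real^2^2) set set \<Rightarrow> bool" where
  "fuchsian_first_kind G \<longleftrightarrow>
     subgroup G PSL2R \<and>
     subtopology PSL2R_topology G = discrete_topology G \<and>
     (\<exists>D. fundamental_domain G D \<and> hyperbolic_area D < \<infinity>)"

definition parabolic :: "(real^2^2) set \<Rightarrow> bool" where
  "parabolic g \<longleftrightarrow> g \<in> carrier PSL2R \<and> g \<noteq> \<one>\<^bsub>PSL2R\<^esub> \<and> (\<forall>M\<in>g. \<bar>trace M\<bar> = 2)"

definition cusps :: "(real^2^2) set set \<Rightarrow> boundary_point set" where
  "cusps G = {c. \<exists>g\<in>G. parabolic g \<and> boundary_act g c = c}"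

definition cusp_representatives ::
  "(real^2^2) set set \<Rightarrow> boundary_point set \<Rightarrow> bool" where
  "cusp_representatives G C \<longleftrightarrow>
     C \<subseteq> cusps G \<and>
     (\<forall>c\<in>cusps G. \<exists>!r. r \<in> C \<and> r \<in> orbit (PSL2R\<lparr>carrier := G\<rparr>) boundary_act c)"

fun cusp_matrix :: "boundary_point \<Rightarrow> (real^2^2) set" where
  "cusp_matrix Infty = \<one>\<^bsub>PSL2R\<^esub>"
| "cusp_matrix (Fin x) = psl2r x (-1) 1 0"

definition cusp_translation :: "boundary_point \<Rightarrow> real \<Rightarrow> (real^2^2) set" where
  "cusp_translation c h =
     cusp_matrix c \<otimes>\<^bsub>PSL2R\<^esub> psl2r 1 h 0 1 \<otimes>\<^bsub>PSL2R\<^esub> inv\<^bsub>PSL2R\<^esub> cusp_matrix c"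

text \<open>
  The only generators of an infinite cyclic group are a generator and its inverse, so
  positivity determines the width; it is then also the least positive h for which
  \<^term>\<open>cusp_translation c h\<close> lies in G.
\<close>

definition cusp_width :: "(real^2^2) set set \<Rightarrow> boundary_point \<Rightarrow> real" where
  "cusp_width G c = (THE h. h > 0 \<and>
     stabilizer (PSL2R\<lparr>carrier := G\<rparr>) boundary_act c = generate PSL2R {cusp_translation c h})"

definition cusp_generator :: "(real^2^2) set set \<Rightarrow> boundary_point \<Rightarrow> (real^2^2) set" where
  "cusp_generator G c = cusp_translation c (cusp_width G c)"

definition cusp_coord :: "(real^2^2) set set \<Rightarrow> boundary_point \<Rightarrow> complex \<Rightarrow> complex" where
  "cusp_coord G c \<tau> = act (inv\<^bsub>PSL2R\<^esub> cusp_matrix c) \<tau> / of_real (cusp_width G c)"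

definition cusp_q :: "(real^2^2) set set \<Rightarrow> boundary_point \<Rightarrow> complex \<Rightarrow> complex" where
  "cusp_q G c \<tau> = exp (2 * of_real pi * \<i> * cusp_coord G c \<tau>)"

definition GL :: "(complex^'d^'d) monoid" where
  "GL = \<lparr>carrier = {M. invertible M}, mult = (**), one = mat 1\<rparr>"

definition is_diagonal :: "complex^'d^'d \<Rightarrow> bool" where
  "is_diagonal M \<longleftrightarrow> (\<forall>i j. i \<noteq> j \<longrightarrow> M$i$j = 0)"

definition diagonalizable :: "complex^'d^'d \<Rightarrow> bool" where
  "diagonalizable M \<longleftrightarrow> (\<exists>P :: complex^'d^'d. invertible P \<and> is_diagonal (matrix_inv P ** M ** P))"

definition representation ::
  "(real^2^2) set set \<Rightarrow> ((real^2^2) set \<Rightarrow> complex^'d^'d) \<Rightarrow> bool" where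
  "representation G \<rho> \<longleftrightarrow> \<rho> \<in> hom (PSL2R\<lparr>carrier := G\<rparr>) GL"

text \<open>
  Cusps in the same orbit have conjugate generators, so the condition does not depend on the
  set of representatives.
\<close>

definition admissible ::
  "(real^2^2) set set \<Rightarrow> ((real^2^2) set \<Rightarrow> complex^'d^'d) \<Rightarrow> bool" where
  "admissible G \<rho> \<longleftrightarrow>
     representation G \<rho> \<and>
     is_diagonal (\<rho> (cusp_generator G Infty)) \<and>
     (\<exists>C. cusp_representatives G C \<and>
        (\<forall>c\<in>C. c \<noteq> Infty \<longrightarrow> diagonalizable (\<rho> (cusp_generator G c))))"

text \<open>
  A real diagonal matrix \<open>\<Lambda>\<close> is given by its diagonal, a vector \<open>l\<close>;
  then \<open>diag_exp l z\<close> is \<open>exp (2 \<pi> i z \<Lambda>)\<close>.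
\<close>

definition diag_exp :: "real^'d \<Rightarrow> complex \<Rightarrow> complex^'d^'d" where
  "diag_exp l z = (\<chi> i j. if i = j then exp (2 * of_real pi * \<i> * of_real (l$i) * z) else 0)"

definition cusp_diagonalization ::
  "(real^2^2) set set \<Rightarrow> ((real^2^2) set \<Rightarrow> complex^'d^'d) \<Rightarrow> boundary_point \<Rightarrow>
     complex^'d^'d \<Rightarrow> real^'d \<Rightarrow> bool" where
  "cusp_diagonalization G \<rho> c P l \<longleftrightarrow>
     invertible P \<and> (c = Infty \<longrightarrow> P = mat 1) \<and>
     (\<forall>i. 0 \<le> l$i \<and> l$i < 1) \<and>
     matrix_inv P ** \<rho> (cusp_generator G c) ** P = diag_exp l 1"

definition has_cusp_expansion ::
  "(real^2^2) set set \<Rightarrow> boundary_point \<Rightarrow> complex^'d^'d \<Rightarrow> real^'d \<Rightarrow>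
     (complex \<Rightarrow> complex^'d) \<Rightarrow> bool" where
  "has_cusp_expansion G c P l X \<longleftrightarrow>
     (\<exists>(M::int) (a :: int \<Rightarrow> complex^'d). \<forall>\<tau>\<in>upper_half_plane. \<exists>S.
        ((\<lambda>n. (cusp_q G c \<tau> powi n) *s a n) has_sum S) {-M..} \<and>
        X \<tau> = (P ** diag_exp l (cusp_coord G c \<tau>) ** matrix_inv P) *v S)"

text \<open>
  The choice of \<open>P\<close> and \<open>l\<close> at each cusp is a parameter. The resulting space does not depend
  on it: since the entries of \<open>l\<close> lie in [0,1), the matrix \<open>P \<Lambda> P\<inverse>\<close> is determined by
  \<open>\<rho>\<close> at the generator. Functions are only considered on the upper half plane; their values
  elsewhere are irrelevant.
\<close>

definition weakly_holomorphic_modular_functions ::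
  "(real^2^2) set set \<Rightarrow> ((real^2^2) set \<Rightarrow> complex^'d^'d) \<Rightarrow>
     (boundary_point \<Rightarrow> complex^'d^'d) \<Rightarrow> (boundary_point \<Rightarrow> real^'d) \<Rightarrow>
     (complex \<Rightarrow> complex^'d) set" where
  "weakly_holomorphic_modular_functions G \<rho> P l = {X.
     (\<forall>i. (\<lambda>\<tau>. X \<tau> $ i) holomorphic_on upper_half_plane) \<and>
     (\<forall>g\<in>G. \<forall>\<tau>\<in>upper_half_plane. X (act g \<tau>) = \<rho> g *v X \<tau>) \<and>
     (\<forall>c\<in>cusps G. has_cusp_expansion G c (P c) (l c) X)}"

definition independent_components :: "(complex \<Rightarrow> complex^'d) \<Rightarrow> bool" where
  "independent_components X \<longleftrightarrow>
     (\<forall>a :: 'd \<Rightarrow> complex.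
        (\<forall>\<tau>\<in>upper_half_plane. (\<Sum>i\<in>UNIV. a i * X \<tau> $ i) = 0) \<longrightarrow> (\<forall>i. a i = 0))"

end

theory Submission
  imports Defs "HOL-Complex_Analysis.Complex_Analysis"
begin

text \<open>
  A Poincare series of weight six, with values in \<open>\<rho>\<close> and with the seed
  \<open>exp (- 2 \<pi> i (n + 1 - l) \<tau> / h)\<close> in component j, grows at infinity like its seed in component j
  and is bounded in the other components; since the image of \<open>\<rho>\<close> is finite, convergence reduces to the
  scalar case, where it follows from the finite area by unfolding. Dividing by the Eisenstein series E
  of weight six gives weight zero but introduces poles at the zeros of E. By Jensen's
  formula, averaged over hyperbolic annuli and integrated over the fundamental domain, E has
  only finitely many zeros modulo G. Hence cancelling them imposes finitely many linear conditions, and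
  for every j some nontrivial combination of seeds with distinct n satisfies all of them. Using disjoint sets of
  exponents n for different j, the components of the quotient have leading exponential growth rates
  that cannot cancel, so they are linearly independent. At a cusp the vector form
  has moderate growth and E is bounded below by its leading term, so the quotient is
  meromorphic there.
\<close>

section \<open>Matrices and their action\<close>

text \<open>The hypotheses give a domain \<open>D\<close> of finite area and nothing about its sides
  or its cusps, so neither truncated fundamental domains nor a compactified quotient surface are at
  hand. Every global statement about \<open>G\<close> is therefore obtained by integrating over
  \<open>D\<close>. The difficulty is that a power y^s is integrable against dy/y^2 near 0 only for
  s > 1 and near infinity only for s < 1, so unfolding cannot be applied to a series of powers
  directly. The function ln(1 + y^2) is integrable at both ends; its sum over the cosets is finite
  almost everywhere on \<open>D\<close>, and one point of finiteness already yields the series of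
  weight four, hence locally uniform convergence everywhere. Weight six leaves one more factor of
  modulus 1/|c tau + d|^2, which is uniformly bounded on compact sets and decays like y^-2 towards
  infinity. The same sum of logarithms bounds ln(1 + Im^3 |E|), which makes the truncated logarithm
  of the Eisenstein series integrable over \<open>D\<close> and lets Jensen's inequality be
  integrated there.\<close>

definition mat22 :: "real \<Rightarrow> real \<Rightarrow> real \<Rightarrow> real \<Rightarrow> real^2^2" where
  "mat22 a b c d = vector [vector [a, b], vector [c, d]]"

lemma mat22_nth [simp]:
  "mat22 a b c d $ 1 $ 1 = a" "mat22 a b c d $ 1 $ 2 = b"
  "mat22 a b c d $ 2 $ 1 = c" "mat22 a b c d $ 2 $ 2 = d"
  by (simp_all add: mat22_def)

lemma mat2_eqI:
  fixes M N :: "'a^2^2"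
  assumes "M$1$1 = N$1$1" "M$1$2 = N$1$2" "M$2$1 = N$2$1" "M$2$2 = N$2$2"
  shows "M = N"
  using assms by (simp add: vec_eq_iff forall_2)

lemma mat2_mult_nth:
  fixes M N :: "real^2^2"
  shows "(M ** N)$1$1 = M$1$1 * N$1$1 + M$1$2 * N$2$1"
    "(M ** N)$1$2 = M$1$1 * N$1$2 + M$1$2 * N$2$2"
    "(M ** N)$2$1 = M$2$1 * N$1$1 + M$2$2 * N$2$1"
    "(M ** N)$2$2 = M$2$1 * N$1$2 + M$2$2 * N$2$2"
  by (simp_all add: matrix_matrix_mult_def sum_2)

lemma mat1_nth:
  "(mat 1 :: real^2^2)$1$1 = 1" "(mat 1 :: real^2^2)$1$2 = 0"
  "(mat 1 :: real^2^2)$2$1 = 0" "(mat 1 :: real^2^2)$2$2 = 1"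
  by (simp_all add: mat_def)

lemma mat22_1: "mat22 1 0 0 1 = mat 1"
  by (rule mat2_eqI) (simp_all add: mat1_nth)

lemma mat22_mult:
  "mat22 a b c d ** mat22 a' b' c' d' =
     mat22 (a * a' + b * c') (a * b' + b * d') (c * a' + d * c') (c * b' + d * d')"
  by (rule mat2_eqI) (simp_all add: mat2_mult_nth)

lemma det_mat22 [simp]: "det (mat22 a b c d) = a * d - b * c"
  by (simp add: det_2)

definition adj2 :: "real^2^2 \<Rightarrow> real^2^2" where
  "adj2 M = mat22 (M$2$2) (- M$1$2) (- M$2$1) (M$1$1)"

lemma det_adj2 [simp]: "det (adj2 M) = det M"
  by (simp add: adj2_def det_2)

lemma adj2_mult: "det M = 1 \<Longrightarrow> adj2 M ** M = mat 1" "det M = 1 \<Longrightarrow> M ** adj2 M = mat 1"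
  by (rule mat2_eqI; simp add: adj2_def mat2_mult_nth mat1_nth det_2 algebra_simps)+

definition mob :: "real^2^2 \<Rightarrow> complex \<Rightarrow> complex" where
  "mob M \<tau> = (of_real (M$1$1) * \<tau> + of_real (M$1$2)) / (of_real (M$2$1) * \<tau> + of_real (M$2$2))"

definition aut :: "real^2^2 \<Rightarrow> complex \<Rightarrow> complex" where
  "aut M \<tau> = of_real (M$2$1) * \<tau> + of_real (M$2$2)"

lemma aut_uminus: "aut (- M) \<tau> = - aut M \<tau>"
  by (simp add: aut_def)

lemma mob_uminus: "mob (- M) \<tau> = mob M \<tau>"
proof -
  have "mob (- M) \<tau> = (- (of_real (M$1$1) * \<tau> + of_real (M$1$2))) /
      (- (of_real (M$2$1) * \<tau> + of_real (M$2$2)))"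
    by (simp add: mob_def)
  then show ?thesis unfolding mob_def by (simp only: minus_divide_divide)
qed

lemma aut_nonzero:
  assumes "det M = 1" "Im \<tau> > 0"
  shows "aut M \<tau> \<noteq> 0"
proof
  assume 0: "aut M \<tau> = 0"
  then have "M$2$1 * Im \<tau> = 0" by (auto simp: aut_def complex_eq_iff)
  with assms have c: "M$2$1 = 0" by auto
  with 0 have "M$2$2 = 0" by (simp add: aut_def)
  with c assms show False by (simp add: det_2)
qed

lemma Im_mob:
  assumes "det M = 1" "Im \<tau> > 0"
  shows "Im (mob M \<tau>) = Im \<tau> / (cmod (aut M \<tau>))\<^sup>2"
proof -
  have "mob M \<tau> = (of_real (M$1$1) * \<tau> + of_real (M$1$2)) * cnj (aut M \<tau>) / (cmod (aut M \<tau>))\<^sup>2"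
    unfolding mob_def aut_def[symmetric] by (rule complex_div_cnj)
  then have "Im (mob M \<tau>) = Im ((of_real (M$1$1) * \<tau> + of_real (M$1$2)) * cnj (aut M \<tau>)) / (cmod (aut M \<tau>))\<^sup>2"
    by (simp only: Im_divide_of_real)
  also have "Im ((of_real (M$1$1) * \<tau> + of_real (M$1$2)) * cnj (aut M \<tau>)) = det M * Im \<tau>"
    by (simp add: aut_def det_2 algebra_simps)
  finally show ?thesis using assms by simp
qed

lemma Im_mob_pos: "det M = 1 \<Longrightarrow> Im \<tau> > 0 \<Longrightarrow> Im (mob M \<tau>) > 0"
  by (simp add: Im_mob aut_nonzero)

lemma mob_mult:
  assumes "det N = 1" "Im \<tau> > 0"
  shows "mob (M ** N) \<tau> = mob M (mob N \<tau>)" "aut (M ** N) \<tau> = aut M (mob N \<tau>) * aut N \<tau>"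
proof -
  have nz: "aut N \<tau> \<noteq> 0" using aut_nonzero assms by blast
  define n where "n = of_real (N$1$1) * \<tau> + of_real (N$1$2)"
  have mN: "mob N \<tau> = n / aut N \<tau>" by (simp add: mob_def aut_def n_def)
  have *: "of_real a * mob N \<tau> + of_real b = (of_real a * n + of_real b * aut N \<tau>) / aut N \<tau>" for a b
    using nz by (simp add: mN field_simps)
  show "aut (M ** N) \<tau> = aut M (mob N \<tau>) * aut N \<tau>"
    unfolding aut_def[of M] * using nz
    by (simp add: n_def) (simp add: aut_def mat2_mult_nth algebra_simps)
  have "mob M (mob N \<tau>) = (of_real (M$1$1) * n + of_real (M$1$2) * aut N \<tau>) /
     (of_real (M$2$1) * n + of_real (M$2$2) * aut N \<tau>)"
    unfolding mob_def[of M] * using nz by simp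
  then show "mob (M ** N) \<tau> = mob M (mob N \<tau>)"
    by (simp add: mob_def n_def aut_def mat2_mult_nth algebra_simps)
qed

lemma mob_1 [simp]: "mob (mat 1) \<tau> = \<tau>" "aut (mat 1) \<tau> = 1"
  by (simp_all add: mob_def aut_def mat1_nth)

text \<open>Clearing denominators leaves the determinant times \<open>\<tau> - w\<close>. This is
  the first-order behaviour of \<open>mob M\<close>, used for zeros at fixed points; together with
  \<open>mob_diff_cnj\<close> it makes \<open>pdist\<close> invariant, because the automorphy
  factors in the two formulas have the same moduli.\<close>

lemma mob_diff:
  assumes "det M = 1" "Im \<tau> > 0" "Im w > 0"
  shows "mob M \<tau> - mob M w = (\<tau> - w) / (aut M \<tau> * aut M w)"
proof -
  have nz: "aut M \<tau> \<noteq> 0" "aut M w \<noteq> 0" using aut_nonzero assms by auto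
  have "(of_real (M$1$1) * \<tau> + of_real (M$1$2)) * aut M w - (of_real (M$1$1) * w + of_real (M$1$2)) * aut M \<tau>
     = of_real (det M) * (\<tau> - w)"
    by (simp add: aut_def det_2 algebra_simps)
  moreover have "mob M \<tau> - mob M w = ((of_real (M$1$1) * \<tau> + of_real (M$1$2)) * aut M w - (of_real (M$1$1) * w + of_real (M$1$2)) * aut M \<tau>) / (aut M \<tau> * aut M w)"
    unfolding mob_def aut_def[symmetric] using nz by (simp add: diff_frac_eq)
  ultimately show ?thesis using assms by simp
qed

lemma mob_diff_cnj:
  assumes "det M = 1" "Im \<tau> > 0" "Im w > 0"
  shows "mob M \<tau> - cnj (mob M w) = (\<tau> - cnj w) / (aut M \<tau> * cnj (aut M w))"
proof -
  have nz: "aut M \<tau> \<noteq> 0" "cnj (aut M w) \<noteq> 0" using aut_nonzero assms by auto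
  have "(of_real (M$1$1) * \<tau> + of_real (M$1$2)) * cnj (aut M w) - (of_real (M$1$1) * cnj w + of_real (M$1$2)) * aut M \<tau>
     = of_real (det M) * (\<tau> - cnj w)"
    by (simp add: aut_def det_2 algebra_simps)
  moreover have "mob M \<tau> - cnj (mob M w) = ((of_real (M$1$1) * \<tau> + of_real (M$1$2)) * cnj (aut M w) - (of_real (M$1$1) * cnj w + of_real (M$1$2)) * aut M \<tau>) / (aut M \<tau> * cnj (aut M w))"
    using nz by (simp add: mob_def aut_def diff_frac_eq)
  ultimately show ?thesis using assms by simp
qed

lemma holomorphic_aut [holomorphic_intros]: "aut M holomorphic_on A"
  unfolding aut_def [abs_def] by (intro holomorphic_intros)

lemma holomorphic_mob:
  assumes "det M = 1" "A \<subseteq> upper_half_plane"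
  shows "mob M holomorphic_on A"
proof -
  have "mob M = (\<lambda>\<tau>. (of_real (M$1$1) * \<tau> + of_real (M$1$2)) / aut M \<tau>)"
    by (simp add: fun_eq_iff mob_def aut_def)
  moreover have "(\<lambda>\<tau>. (of_real (M$1$1) * \<tau> + of_real (M$1$2)) / aut M \<tau>) holomorphic_on A"
    using assms aut_nonzero by (intro holomorphic_intros) (auto simp: upper_half_plane_def)
  ultimately show ?thesis by simp
qed

lemma mob_in_upper [simp]: "det M = 1 \<Longrightarrow> \<tau> \<in> upper_half_plane \<Longrightarrow> mob M \<tau> \<in> upper_half_plane"
  by (simp add: upper_half_plane_def Im_mob_pos)

lemma open_upper: "open upper_half_plane"
  unfolding upper_half_plane_def by (simp add: open_halfspace_Im_gt)

lemma convex_upper: "convex upper_half_plane"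
  unfolding upper_half_plane_def by (rule convex_halfspace_Im_gt)

lemma connected_upper: "connected upper_half_plane"
  using convex_upper convex_connected by blast

subsection \<open>Elements of the projective group\<close>

lemma psl2r_mat22: "psl2r a b c d = psl (mat22 a b c d)"
  by (simp add: psl2r_def mat22_def)

lemma psl_eq_iff: "psl M = psl N \<longleftrightarrow> M = N \<or> M = - N"
  by (auto simp: psl_eq doubleton_eq_iff)

lemma psl_in_carrier: "det M = 1 \<Longrightarrow> psl M \<in> carrier PSL2R"
  by (auto simp: carrier_PSL2R)

lemma act_psl: "act (psl M) \<tau> = mob M \<tau>"
proof -
  have "(\<lambda>M. moebius (of_real (M$1$1)) (of_real (M$1$2)) (of_real (M$2$1)) (of_real (M$2$2)) \<tau>) = (\<lambda>M::real^2^2. mob M \<tau>)"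
    by (simp add: mob_def moebius_def fun_eq_iff)
  then show ?thesis unfolding act_def psl_eq by (simp only:) (simp add: mob_uminus)
qed

lemma psl_mult:
  assumes "det M = 1" "det N = 1"
  shows "psl M \<otimes>\<^bsub>PSL2R\<^esub> psl N = psl (M ** N)"
proof -
  interpret normal "{mat 1, - mat 1}" SL2R by (rule normal_pm_one)
  have "psl M <#>\<^bsub>SL2R\<^esub> psl N = {mat 1, - mat 1} #>\<^bsub>SL2R\<^esub> (M \<otimes>\<^bsub>SL2R\<^esub> N)"
    unfolding psl_def using assms by (intro rcos_sum) (simp_all add: SL2R_def)
  then show ?thesis by (simp add: PSL2R_def FactGroup_def psl_def SL2R_def)
qed

lemma psl_one: "\<one>\<^bsub>PSL2R\<^esub> = psl (mat 1)"
  by (simp add: PSL2R_def FactGroup_def psl_eq)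

lemma psl_inv:
  assumes "det M = 1"
  shows "inv\<^bsub>PSL2R\<^esub> (psl M) = psl (adj2 M)"
proof -
  interpret group PSL2R by (rule group_PSL2R)
  show ?thesis
    by (rule inv_equality) (use assms in \<open>auto simp: psl_mult adj2_mult psl_one psl_in_carrier\<close>)
qed

text \<open>Either of the two representatives will do, since only quantities independent of the sign
  are formed from it.\<close>

definition lift :: "(real^2^2) set \<Rightarrow> real^2^2" where
  "lift g = (SOME M. det M = 1 \<and> psl M = g)"

lemma lift:
  assumes "g \<in> carrier PSL2R"
  shows "det (lift g) = 1" "psl (lift g) = g"
proof -
  have "\<exists>M. det M = 1 \<and> psl M = g" using assms by (auto simp: carrier_PSL2R)
  from someI_ex[OF this] show "det (lift g) = 1" "psl (lift g) = g" by (auto simp: lift_def)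
qed

lemma carrier_PSL2R_cases:
  assumes "g \<in> carrier PSL2R"
  obtains M where "det M = 1" "g = psl M"
  using assms by (auto simp: carrier_PSL2R)

text \<open>The square of the automorphy factor, unlike the factor itself, is a function on the projective group.\<close>

definition aut2 :: "(real^2^2) set \<Rightarrow> complex \<Rightarrow> complex" where
  "aut2 g \<tau> = (aut (lift g) \<tau>)\<^sup>2"

lemma aut2_psl:
  assumes "det M = 1" shows "aut2 (psl M) \<tau> = (aut M \<tau>)\<^sup>2"
proof -
  have "psl (lift (psl M)) = psl M" using lift psl_in_carrier assms by blast
  then have "lift (psl M) = M \<or> lift (psl M) = - M" by (simp add: psl_eq_iff)
  then show ?thesis by (auto simp: aut2_def aut_uminus)
qed

lemma act_mult:
  assumes "g \<in> carrier PSL2R" "g' \<in> carrier PSL2R" "Im \<tau> > 0"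
  shows "act (g \<otimes>\<^bsub>PSL2R\<^esub> g') \<tau> = act g (act g' \<tau>)"
    "aut2 (g \<otimes>\<^bsub>PSL2R\<^esub> g') \<tau> = aut2 g (act g' \<tau>) * aut2 g' \<tau>"
proof -
  obtain M M' where M: "det M = 1" "g = psl M" "det M' = 1" "g' = psl M'"
    using assms carrier_PSL2R_cases by metis
  then show "act (g \<otimes>\<^bsub>PSL2R\<^esub> g') \<tau> = act g (act g' \<tau>)"
    "aut2 (g \<otimes>\<^bsub>PSL2R\<^esub> g') \<tau> = aut2 g (act g' \<tau>) * aut2 g' \<tau>"
    using assms by (simp_all add: psl_mult act_psl mob_mult aut2_psl det_mul power_mult_distrib)
qed

lemma act_one [simp]: "act \<one>\<^bsub>PSL2R\<^esub> \<tau> = \<tau>" "aut2 \<one>\<^bsub>PSL2R\<^esub> \<tau> = 1"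
  by (simp_all add: psl_one act_psl aut2_psl)

lemma act_inv:
  assumes "g \<in> carrier PSL2R" "Im \<tau> > 0"
  shows "act (inv\<^bsub>PSL2R\<^esub> g) (act g \<tau>) = \<tau>" "act g (act (inv\<^bsub>PSL2R\<^esub> g) \<tau>) = \<tau>"
proof -
  interpret group PSL2R by (rule group_PSL2R)
  show "act (inv\<^bsub>PSL2R\<^esub> g) (act g \<tau>) = \<tau>" "act g (act (inv\<^bsub>PSL2R\<^esub> g) \<tau>) = \<tau>"
    using assms by (simp_all flip: act_mult)
qed

lemma Im_act:
  assumes "g \<in> carrier PSL2R" "Im \<tau> > 0"
  shows "Im (act g \<tau>) = Im \<tau> / cmod (aut2 g \<tau>)" "Im (act g \<tau>) > 0" "aut2 g \<tau> \<noteq> 0"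
proof -
  obtain M where M: "det M = 1" "g = psl M" using assms carrier_PSL2R_cases by metis
  show "Im (act g \<tau>) = Im \<tau> / cmod (aut2 g \<tau>)" "Im (act g \<tau>) > 0" "aut2 g \<tau> \<noteq> 0"
    using assms M by (simp_all add: act_psl Im_mob aut2_psl Im_mob_pos norm_power aut_nonzero)
qed

lemma act_in_upper [simp]: "g \<in> carrier PSL2R \<Longrightarrow> \<tau> \<in> upper_half_plane \<Longrightarrow> act g \<tau> \<in> upper_half_plane"
  by (simp add: upper_half_plane_def Im_act)

lemma holomorphic_act:
  assumes "g \<in> carrier PSL2R" "A \<subseteq> upper_half_plane"
  shows "act g holomorphic_on A" "aut2 g holomorphic_on A"
proof -
  obtain M where M: "det M = 1" "g = psl M" using assms carrier_PSL2R_cases by metis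
  have "act g = mob M" "aut2 g = (\<lambda>\<tau>. (aut M \<tau>)\<^sup>2)"
    using M by (simp_all add: fun_eq_iff act_psl aut2_psl)
  then show "act g holomorphic_on A" "aut2 g holomorphic_on A"
    using M holomorphic_mob assms by (auto intro!: holomorphic_intros)
qed

section \<open>The hyperbolic measure\<close>

text \<open>Lebesgue measure on the complex plane is pinned down by its values on boxes, which the
  product measure shares; this opens the way to iterated integrals in x and y.\<close>

lemma lborel_complex: "(lborel :: complex measure) = distr (lborel \<Otimes>\<^sub>M lborel) borel (\<lambda>(x, y). Complex x y)"
proof (rule lborel_eqI)
  have [measurable]: "(\<lambda>(x, y). Complex x y) \<in> borel_measurable (lborel \<Otimes>\<^sub>M lborel)"
    unfolding borel_measurable_complex_iff by (simp add: case_prod_beta)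
  fix l u :: complex assume le: "\<And>b. b \<in> Basis \<Longrightarrow> l \<bullet> b \<le> u \<bullet> b"
  then have le': "Re l \<le> Re u" "Im l \<le> Im u" using le[of 1] le[of \<i>] by (simp_all add: Basis_complex_def inner_complex_def)
  have "(\<lambda>(x, y). Complex x y) -` box l u \<inter> space (lborel \<Otimes>\<^sub>M lborel) = {Re l<..<Re u} \<times> {Im l<..<Im u}"
    by (auto simp: in_box_complex_iff space_pair_measure)
  then show "emeasure (distr (lborel \<Otimes>\<^sub>M lborel) borel (\<lambda>(x, y). Complex x y)) (box l u) = (\<Prod>b\<in>Basis. (u - l) \<bullet> b)"
    using le' by (simp add: emeasure_distr lborel.emeasure_pair_measure_Times Basis_complex_def
        inner_complex_def ennreal_mult)
qed simp

lemma nn_integral_lborel_complex: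
  fixes F :: "complex \<Rightarrow> ennreal"
  assumes [measurable]: "F \<in> borel_measurable borel"
  shows "(\<integral>\<^sup>+z. F z \<partial>lborel) = (\<integral>\<^sup>+y. \<integral>\<^sup>+x. F (Complex x y) \<partial>lborel \<partial>lborel)"
proof -
  have [measurable]: "(\<lambda>(x, y). Complex x y) \<in> borel_measurable (lborel \<Otimes>\<^sub>M lborel)"
    unfolding borel_measurable_complex_iff by (simp add: case_prod_beta)
  have [measurable]: "(\<lambda>p. F (case_prod Complex p)) \<in> borel_measurable (lborel \<Otimes>\<^sub>M lborel)"
    by (rule measurable_compose[of _ _ borel]) auto
  have "(\<integral>\<^sup>+z. F z \<partial>lborel) = (\<integral>\<^sup>+p. F (case_prod Complex p) \<partial>(lborel \<Otimes>\<^sub>M lborel))"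
    by (subst lborel_complex) (simp add: nn_integral_distr case_prod_beta)
  also have "\<dots> = (\<integral>\<^sup>+y. \<integral>\<^sup>+x. F (case_prod Complex (x, y)) \<partial>lborel \<partial>lborel)"
    by (rule lborel_pair.nn_integral_snd[symmetric]) simp
  finally show ?thesis by simp
qed

lemma measurable_Complex [measurable (raw)]:
  "f \<in> borel_measurable M \<Longrightarrow> g \<in> borel_measurable M \<Longrightarrow> (\<lambda>x. Complex (f x) (g x)) \<in> borel_measurable M"
  unfolding borel_measurable_complex_iff by simp

text \<open>The density lives on the whole plane and vanishes off the upper half plane: the
  sigma-algebra stays \<open>borel\<close>, and restriction to the half plane becomes an
  almost-everywhere fact.\<close>

definition hyp :: "complex measure" where
  "hyp = density lborel (\<lambda>\<tau>. ennreal (indicator upper_half_plane \<tau> / (Im \<tau>)\<^sup>2))"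

lemma sets_hyp [simp, measurable_cong]: "sets hyp = sets borel"
  by (simp add: hyp_def)

lemma space_hyp [simp]: "space hyp = UNIV"
  by (simp add: hyp_def)

lemma upper_measurable [measurable]: "upper_half_plane \<in> sets borel"
  using open_upper by simp

lemma AE_hyp_upper: "AE \<tau> in hyp. \<tau> \<in> upper_half_plane"
  unfolding hyp_def by (subst AE_density) (auto simp: indicator_def)

lemma nn_integral_hyp_cong:
  assumes "\<And>\<tau>. \<tau> \<in> upper_half_plane \<Longrightarrow> F \<tau> = F' \<tau>"
  shows "(\<integral>\<^sup>+\<tau>. F \<tau> \<partial>hyp) = (\<integral>\<^sup>+\<tau>. F' \<tau> \<partial>hyp)"
  by (rule nn_integral_cong_AE) (use AE_hyp_upper assms in auto)

lemma nn_integral_hyp_mono: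
  assumes "\<And>\<tau>. \<tau> \<in> upper_half_plane \<Longrightarrow> F \<tau> \<le> F' \<tau>"
  shows "(\<integral>\<^sup>+\<tau>. F \<tau> \<partial>hyp) \<le> (\<integral>\<^sup>+\<tau>. F' \<tau> \<partial>hyp)"
  by (rule nn_integral_mono_AE) (use AE_hyp_upper assms in auto)

lemma nn_integral_hyp:
  assumes [measurable]: "F \<in> borel_measurable borel"
  shows "(\<integral>\<^sup>+\<tau>. F \<tau> \<partial>hyp) =
    (\<integral>\<^sup>+y. \<integral>\<^sup>+x. ennreal (indicator {0<..} y / y\<^sup>2) * F (Complex x y) \<partial>lborel \<partial>lborel)"
proof -
  have "(\<integral>\<^sup>+\<tau>. F \<tau> \<partial>hyp) = (\<integral>\<^sup>+\<tau>. ennreal (indicator upper_half_plane \<tau> / (Im \<tau>)\<^sup>2) * F \<tau> \<partial>lborel)"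
    unfolding hyp_def by (subst nn_integral_density) auto
  also have "\<dots> = (\<integral>\<^sup>+y. \<integral>\<^sup>+x. ennreal (indicator {0<..} y / y\<^sup>2) * F (Complex x y) \<partial>lborel \<partial>lborel)"
    by (subst nn_integral_lborel_complex) (auto intro!: nn_integral_cong simp: indicator_def upper_half_plane_def)
  finally show ?thesis .
qed

text \<open>dy/y is Haar measure on the positive half line. Its image under \<open>ln\<close> gives
  every interval its length, and this alone identifies it with Lebesgue measure, so the substitution
  holds for arbitrary measurable integrands.\<close>

lemma nn_integral_exp_substitution:
  fixes \<phi> :: "real \<Rightarrow> ennreal"
  assumes [measurable]: "\<phi> \<in> borel_measurable borel"
  shows "(\<integral>\<^sup>+y. ennreal (indicator {0<..} y / y) * \<phi> y \<partial>lborel) = (\<integral>\<^sup>+t. \<phi> (exp t) \<partial>lborel)"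
proof -
  define \<nu> :: "real measure" where "\<nu> = density lborel (\<lambda>y. ennreal (indicator {0<..} y / y))"
  have [measurable_cong, simp]: "sets \<nu> = sets borel" by (simp add: \<nu>_def)
  have "lborel = distr \<nu> borel ln"
  proof (rule lborel_eqI)
    fix l u :: real assume "\<And>b. b \<in> Basis \<Longrightarrow> l \<bullet> b \<le> u \<bullet> b"
    then have le: "l \<le> u" by simp
    have [measurable]: "ln -` {l<..<u} \<in> sets borel"
      using measurable_sets[of ln borel borel "{l<..<u}"] by simp
    have "emeasure (distr \<nu> borel ln) {l<..<u} = emeasure \<nu> (ln -` {l<..<u} \<inter> space \<nu>)"
      by (subst emeasure_distr) (auto simp: measurable_cong_sets[OF \<open>sets \<nu> = sets borel\<close> refl] \<nu>_def)
    also have "\<dots> = (\<integral>\<^sup>+y. ennreal (indicator {0<..} y / y) * indicator (ln -` {l<..<u} \<inter> space \<nu>) y \<partial>lborel)"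
      unfolding \<nu>_def by (subst emeasure_density) auto
    also have "\<dots> = (\<integral>\<^sup>+y. ennreal (1 / y) * indicator {exp l..exp u} y \<partial>lborel)"
    proof (rule nn_integral_cong_AE)
      have "AE y in lborel. y \<noteq> exp l" "AE y in lborel. y \<noteq> exp u"
        by (rule AE_lborel_singleton)+
      then show "AE y in lborel. ennreal (indicator {0<..} y / y) * indicator (ln -` {l<..<u} \<inter> space \<nu>) y =
           ennreal (1 / y) * indicator {exp l..exp u} y"
      proof eventually_elim
        case (elim y)
        have pos: "0 < y" if "exp l \<le> y" using that exp_gt_zero[of l] by linarith
        have "y \<in> {exp l..exp u}" if "y > 0" "ln y \<in> {l<..<u}"
          using that exp_less_mono[of l "ln y"] exp_less_mono[of "ln y" u] by simp
        moreover have "ln y \<in> {l<..<u}" if "y > 0" "y \<in> {exp l..exp u}"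
        proof -
          from that have "exp l < exp (ln y)" "exp (ln y) < exp u" using elim by auto
          then show ?thesis by simp
        qed
        ultimately have "y > 0 \<Longrightarrow> ln y \<in> {l<..<u} \<longleftrightarrow> y \<in> {exp l..exp u}" by blast
        with pos show ?case by (auto simp: indicator_def \<nu>_def)
      qed
    qed
    also have "\<dots> = ennreal (ln (exp u) - ln (exp l))"
    proof (rule nn_integral_FTC_Icc)
      fix x assume "x \<in> {exp l..exp u}"
      then have "x > 0" by (auto intro: less_le_trans[OF exp_gt_zero])
      then show "(ln has_real_derivative 1 / x) (at x)" "0 \<le> 1 / x"
        by (auto intro!: derivative_eq_intros)
    qed (use le in auto)
    finally show "emeasure (distr \<nu> borel ln) (box l u) = (\<Prod>b\<in>Basis. (u - l) \<bullet> b)"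
      using le by simp
  qed simp
  then have "(\<integral>\<^sup>+t. \<phi> (exp t) \<partial>lborel) = (\<integral>\<^sup>+t. \<phi> (exp t) \<partial>distr \<nu> borel ln)" by simp
  also have "\<dots> = (\<integral>\<^sup>+y. \<phi> (exp (ln y)) \<partial>\<nu>)"
    by (subst nn_integral_distr) auto
  also have "\<dots> = (\<integral>\<^sup>+y. ennreal (indicator {0<..} y / y) * \<phi> (exp (ln y)) \<partial>lborel)"
    unfolding \<nu>_def by (subst nn_integral_density) auto
  also have "\<dots> = (\<integral>\<^sup>+y. ennreal (indicator {0<..} y / y) * \<phi> y \<partial>lborel)"
    by (rule nn_integral_cong) (auto simp: indicator_def)
  finally show ?thesis by simp
qed

text \<open>With y = exp t and x = y s the measure dx dy / y^2 becomes ds dt. In these coordinates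
  scalings shift t, and inversion reflects both coordinates with an extra shift of t depending on s;
  all of these preserve Lebesgue measure.\<close>

lemma nn_integral_hyp_polar:
  assumes [measurable]: "F \<in> borel_measurable borel"
  shows "(\<integral>\<^sup>+\<tau>. F \<tau> \<partial>hyp) = (\<integral>\<^sup>+s. \<integral>\<^sup>+t. F (Complex (exp t * s) (exp t)) \<partial>lborel \<partial>lborel)"
proof -
  have "(\<integral>\<^sup>+\<tau>. F \<tau> \<partial>hyp) =
    (\<integral>\<^sup>+y. \<integral>\<^sup>+x. ennreal (indicator {0<..} y / y\<^sup>2) * F (Complex x y) \<partial>lborel \<partial>lborel)"
    by (rule nn_integral_hyp) simp
  also have "\<dots> = (\<integral>\<^sup>+y. \<integral>\<^sup>+s. ennreal (indicator {0<..} y / y) * F (Complex (y * s) y) \<partial>lborel \<partial>lborel)"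
  proof (rule nn_integral_cong)
    fix y :: real
    show "(\<integral>\<^sup>+x. ennreal (indicator {0<..} y / y\<^sup>2) * F (Complex x y) \<partial>lborel) =
      (\<integral>\<^sup>+s. ennreal (indicator {0<..} y / y) * F (Complex (y * s) y) \<partial>lborel)"
    proof (cases "y > 0")
      case True
      have "(\<integral>\<^sup>+x. ennreal (indicator {0<..} y / y\<^sup>2) * F (Complex x y) \<partial>lborel) =
        \<bar>y\<bar> * (\<integral>\<^sup>+x. ennreal (indicator {0<..} y / y\<^sup>2) * F (Complex (0 + y * x) y) \<partial>lborel)"
        using True by (intro nn_integral_real_affine) auto
      also have "\<dots> = (\<integral>\<^sup>+x. ennreal y * (ennreal (indicator {0<..} y / y\<^sup>2) * F (Complex (0 + y * x) y)) \<partial>lborel)"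
        using True by (subst nn_integral_cmult) auto
      also have "\<dots> = (\<integral>\<^sup>+s. ennreal (indicator {0<..} y / y) * F (Complex (y * s) y) \<partial>lborel)"
        using True by (intro nn_integral_cong)
          (simp add: mult.assoc[symmetric] ennreal_mult'[symmetric] power2_eq_square)
      finally show ?thesis .
    qed simp
  qed
  also have "\<dots> = (\<integral>\<^sup>+s. \<integral>\<^sup>+y. ennreal (indicator {0<..} y / y) * F (Complex (y * s) y) \<partial>lborel \<partial>lborel)"
    by (rule lborel_pair.Fubini') measurable
  also have "\<dots> = (\<integral>\<^sup>+s. \<integral>\<^sup>+t. F (Complex (exp t * s) (exp t)) \<partial>lborel \<partial>lborel)"
    by (intro nn_integral_cong nn_integral_exp_substitution) measurable
  finally show ?thesis .
qed

lemma nn_integral_hyp_translate: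
  fixes b :: real
  assumes [measurable]: "F \<in> borel_measurable borel"
  shows "(\<integral>\<^sup>+\<tau>. F (\<tau> + of_real b) \<partial>hyp) = (\<integral>\<^sup>+\<tau>. F \<tau> \<partial>hyp)"
proof -
  have "(\<integral>\<^sup>+x. ennreal (indicator {0<..} y / y\<^sup>2) * F (Complex x y) \<partial>lborel) =
     (\<integral>\<^sup>+x. ennreal (indicator {0<..} y / y\<^sup>2) * F (Complex (x + b) y) \<partial>lborel)" for y
    by (subst nn_integral_real_affine[where c = 1 and t = b]) (auto simp: add.commute)
  moreover have "Complex x y + of_real b = Complex (x + b) y" for x y
    by (simp add: complex_eq_iff)
  ultimately show ?thesis by (simp add: nn_integral_hyp)
qed

lemma nn_integral_hyp_scale:
  fixes a :: real
  assumes [measurable]: "F \<in> borel_measurable borel" and "a > 0"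
  shows "(\<integral>\<^sup>+\<tau>. F (of_real a * \<tau>) \<partial>hyp) = (\<integral>\<^sup>+\<tau>. F \<tau> \<partial>hyp)"
proof -
  have "(\<integral>\<^sup>+t. F (Complex (exp t * s) (exp t)) \<partial>lborel) =
     (\<integral>\<^sup>+t. F (of_real a * Complex (exp t * s) (exp t)) \<partial>lborel)" for s
    using assms by (subst nn_integral_real_affine[where c = 1 and t = "ln a"])
     (auto simp: exp_add complex_eq_iff mult_ac Complex_eq algebra_simps)
  then show ?thesis by (simp add: nn_integral_hyp_polar)
qed

lemma nn_integral_hyp_invert:
  assumes [measurable]: "F \<in> borel_measurable borel"
  shows "(\<integral>\<^sup>+\<tau>. F (- 1 / \<tau>) \<partial>hyp) = (\<integral>\<^sup>+\<tau>. F \<tau> \<partial>hyp)"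
proof -
  \<comment> \<open>For tau = exp t (s + i) the inversion gives -1/tau = exp(-t) (-s + i) / (1 +
    s^2), and the factor 1 / (1 + s^2) is absorbed into the exponent.\<close>
  have *: "- 1 / Complex (exp t * s) (exp t) = Complex (exp (- t - ln (1 + s\<^sup>2)) * (- s)) (exp (- t - ln (1 + s\<^sup>2)))" for s t :: real
  proof -
    have pos: "1 + s\<^sup>2 > 0" by (simp add: add_pos_nonneg)
    define e where "e = exp (- t - ln (1 + s\<^sup>2))"
    have "e * exp t * (1 + s\<^sup>2) = 1"
      unfolding e_def using pos by (simp add: exp_diff exp_minus)
    then have "Complex (e * (- s)) e * Complex (exp t * s) (exp t) = -1"
      by (simp add: complex_eq_iff algebra_simps power2_eq_square)
    moreover have "Complex (exp t * s) (exp t) \<noteq> 0" by (simp add: complex_eq_iff)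
    ultimately show ?thesis unfolding e_def[symmetric] by (simp add: field_simps)
  qed
  have "(\<integral>\<^sup>+\<tau>. F (- 1 / \<tau>) \<partial>hyp) =
     (\<integral>\<^sup>+s. \<integral>\<^sup>+t. F (Complex (exp (- t - ln (1 + s\<^sup>2)) * (- s)) (exp (- t - ln (1 + s\<^sup>2)))) \<partial>lborel \<partial>lborel)"
    by (subst nn_integral_hyp_polar) (measurable, simp only: *)
  also have "\<dots> = (\<integral>\<^sup>+s. \<integral>\<^sup>+t. F (Complex (exp t * (- s)) (exp t)) \<partial>lborel \<partial>lborel)"
  proof (rule nn_integral_cong)
    fix s :: real
    show "(\<integral>\<^sup>+t. F (Complex (exp (- t - ln (1 + s\<^sup>2)) * (- s)) (exp (- t - ln (1 + s\<^sup>2)))) \<partial>lborel) =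
      (\<integral>\<^sup>+t. F (Complex (exp t * (- s)) (exp t)) \<partial>lborel)"
      by (subst (2) nn_integral_real_affine[where c = "-1" and t = "- ln (1 + s\<^sup>2)"]) (auto simp: algebra_simps)
  qed
  also have "\<dots> = (\<integral>\<^sup>+s. \<integral>\<^sup>+t. F (Complex (exp t * s) (exp t)) \<partial>lborel \<partial>lborel)"
    by (subst (2) nn_integral_real_affine[where c = "-1" and t = 0]) auto
  also have "\<dots> = (\<integral>\<^sup>+\<tau>. F \<tau> \<partial>hyp)"
    by (simp add: nn_integral_hyp_polar)
  finally show ?thesis .
qed

lemma mob_measurable [measurable]: "mob M \<in> borel_measurable borel"
  unfolding mob_def [abs_def] by measurable

text \<open>Bruhat decomposition: an upper triangular matrix acts by a scaling and a translation,
  any other matrix by an affine map, the inversion and a translation. Each of these preserves the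
  measure.\<close>

lemma nn_integral_hyp_mob:
  assumes [measurable]: "F \<in> borel_measurable borel" and M: "det M = 1"
  shows "(\<integral>\<^sup>+\<tau>. F (mob M \<tau>) \<partial>hyp) = (\<integral>\<^sup>+\<tau>. F \<tau> \<partial>hyp)"
proof (cases "M$2$1 = 0")
  case True
  define a where "a = M$1$1"
  define b where "b = M$1$2"
  from True M have ad: "a * M$2$2 = 1" by (simp add: det_2 a_def)
  then have nz: "a \<noteq> 0" "M$2$2 \<noteq> 0" by auto
  then have d: "M$2$2 = 1 / a" using ad by (simp add: field_simps)
  have "mob M \<tau> = of_real (a\<^sup>2) * \<tau> + of_real (a * b)" for \<tau>
    using nz True unfolding mob_def d by (simp add: field_simps power2_eq_square flip: a_def b_def)
  then have "(\<integral>\<^sup>+\<tau>. F (mob M \<tau>) \<partial>hyp) = (\<integral>\<^sup>+\<tau>. F (of_real (a\<^sup>2) * \<tau> + of_real (a * b)) \<partial>hyp)"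
    by simp
  also have "\<dots> = (\<integral>\<^sup>+\<tau>. F (\<tau> + of_real (a * b)) \<partial>hyp)"
    using nz by (intro nn_integral_hyp_scale) auto
  also have "\<dots> = (\<integral>\<^sup>+\<tau>. F \<tau> \<partial>hyp)"
    by (intro nn_integral_hyp_translate) auto
  finally show ?thesis .
next
  case False
  define a where "a = M$1$1"
  define c where "c = M$2$1"
  define d where "d = M$2$2"
  have c: "c \<noteq> 0" using False by (simp add: c_def)
  have b: "M$1$2 = (a * d - 1) / c" using M c by (simp add: det_2 a_def c_def d_def field_simps)
  \<comment> \<open>Division with remainder of a tau + b by c tau + d, using a d - b c = 1: the
    quotient is a/c and the remainder gives -1 / (c (c tau + d)).\<close>
  have eq: "mob M \<tau> = - 1 / (of_real (c\<^sup>2) * \<tau> + of_real (c * d)) + of_real (a / c)"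
    if "\<tau> \<in> upper_half_plane" for \<tau>
  proof -
    have nz: "of_real c * \<tau> + of_real d \<noteq> 0" using that aut_nonzero[of M \<tau>] M
      by (simp add: aut_def c_def d_def upper_half_plane_def)
    have "of_real (c\<^sup>2) * \<tau> + of_real (c * d) = of_real c * (of_real c * \<tau> + of_real d)"
      by (simp add: algebra_simps power2_eq_square)
    then show ?thesis unfolding mob_def b a_def[symmetric] c_def[symmetric] d_def[symmetric]
      using nz c by (simp add: divide_simps) (simp add: algebra_simps)
  qed
  have "(\<integral>\<^sup>+\<tau>. F (mob M \<tau>) \<partial>hyp) = (\<integral>\<^sup>+\<tau>. F (- 1 / (of_real (c\<^sup>2) * \<tau> + of_real (c * d)) + of_real (a / c)) \<partial>hyp)"
    by (rule nn_integral_hyp_cong) (simp only: eq)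
  also have "\<dots> = (\<integral>\<^sup>+\<tau>. F (- 1 / (\<tau> + of_real (c * d)) + of_real (a / c)) \<partial>hyp)"
    using c by (intro nn_integral_hyp_scale) auto
  also have "\<dots> = (\<integral>\<^sup>+\<tau>. F (- 1 / \<tau> + of_real (a / c)) \<partial>hyp)"
    by (rule nn_integral_hyp_translate[where F = "\<lambda>\<tau>. F (- 1 / \<tau> + of_real (a / c))"]) measurable
  also have "\<dots> = (\<integral>\<^sup>+\<tau>. F (\<tau> + of_real (a / c)) \<partial>hyp)"
    by (rule nn_integral_hyp_invert) auto
  also have "\<dots> = (\<integral>\<^sup>+\<tau>. F \<tau> \<partial>hyp)"
    by (intro nn_integral_hyp_translate) auto
  finally show ?thesis .
qed

lemma act_eq_mob:
  assumes "g \<in> carrier PSL2R" shows "act g = mob (lift g)"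
  using lift[OF assms] act_psl[of "lift g"] by (metis ext)

lemma act_measurable: "g \<in> carrier PSL2R \<Longrightarrow> act g \<in> borel_measurable borel"
  by (simp add: act_eq_mob)

lemma nn_integral_hyp_act:
  assumes "F \<in> borel_measurable borel" "g \<in> carrier PSL2R"
  shows "(\<integral>\<^sup>+\<tau>. F (act g \<tau>) \<partial>hyp) = (\<integral>\<^sup>+\<tau>. F \<tau> \<partial>hyp)"
  using assms by (simp add: act_eq_mob nn_integral_hyp_mob lift)

lemma nn_integral_hyp_strip:
  fixes \<phi> :: "real \<Rightarrow> ennreal"
  assumes [measurable]: "\<phi> \<in> borel_measurable borel" and "h > 0"
  shows "(\<integral>\<^sup>+\<tau>. indicator {\<tau>. 0 \<le> Re \<tau> \<and> Re \<tau> < h} \<tau> * \<phi> (Im \<tau>) \<partial>hyp) =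
     ennreal h * (\<integral>\<^sup>+y. ennreal (indicator {0<..} y / y\<^sup>2) * \<phi> y \<partial>lborel)"
proof -
  have "(\<integral>\<^sup>+\<tau>. indicator {\<tau>. 0 \<le> Re \<tau> \<and> Re \<tau> < h} \<tau> * \<phi> (Im \<tau>) \<partial>hyp) =
     (\<integral>\<^sup>+y. \<integral>\<^sup>+x. (ennreal (indicator {0<..} y / y\<^sup>2) * \<phi> y) * indicator {0..<h} x \<partial>lborel \<partial>lborel)"
    by (subst nn_integral_hyp) (auto intro!: nn_integral_cong simp: indicator_def)
  also have "\<dots> = (\<integral>\<^sup>+y. (ennreal (indicator {0<..} y / y\<^sup>2) * \<phi> y) * ennreal h \<partial>lborel)"
    using \<open>h > 0\<close> by (intro nn_integral_cong) (subst nn_integral_cmult_indicator, auto)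
  also have "\<dots> = ennreal h * (\<integral>\<^sup>+y. ennreal (indicator {0<..} y / y\<^sup>2) * \<phi> y \<partial>lborel)"
    by (subst nn_integral_multc) (auto simp: mult.commute)
  finally show ?thesis .
qed

lemma sigma_finite_hyp: "sigma_finite_measure hyp"
  unfolding hyp_def
  by (subst sigma_finite_measure.sigma_finite_iff_density_finite[OF lborel.sigma_finite_measure_axioms]) auto

lemma hyperbolic_area_eq:
  assumes "S \<in> sets borel" "S \<subseteq> upper_half_plane"
  shows "hyperbolic_area S = emeasure hyp S"
proof -
  have "emeasure hyp S = (\<integral>\<^sup>+\<tau>. ennreal (indicator upper_half_plane \<tau> / (Im \<tau>)\<^sup>2) * indicator S \<tau> \<partial>lborel)"
    unfolding hyp_def using assms by (subst emeasure_density) auto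
  also have "\<dots> = hyperbolic_area S"
    unfolding hyperbolic_area_def using assms by (intro nn_integral_cong) (auto simp: indicator_def)
  finally show ?thesis ..
qed

section \<open>Unfolding and convergence\<close>

interpretation PSL: group PSL2R
  by (rule group_PSL2R)

lemma nn_integral_count_space_subset:
  assumes "A \<subseteq> B"
  shows "(\<integral>\<^sup>+x. f x \<partial>count_space A) \<le> (\<integral>\<^sup>+x. f x \<partial>count_space B)"
proof -
  have "(\<integral>\<^sup>+x. f x \<partial>count_space A) = (\<integral>\<^sup>+x. f x * indicator A x \<partial>count_space UNIV)"
    by (rule nn_integral_count_space_indicator) simp
  also have "\<dots> \<le> (\<integral>\<^sup>+x. f x * indicator B x \<partial>count_space UNIV)"
    using assms by (intro nn_integral_mono) (auto simp: indicator_def)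
  also have "\<dots> = (\<integral>\<^sup>+x. f x \<partial>count_space B)"
    by (rule nn_integral_count_space_indicator[symmetric]) simp
  finally show ?thesis .
qed

lemma sum_le_nn_integral_count_space:
  assumes "finite F" "F \<subseteq> B"
  shows "(\<Sum>x\<in>F. f x) \<le> (\<integral>\<^sup>+x. f x \<partial>count_space B)"
proof -
  have "(\<Sum>x\<in>F. f x) = (\<integral>\<^sup>+x. f x \<partial>count_space F)"
    using assms by (simp add: nn_integral_count_space_finite)
  also have "\<dots> \<le> (\<integral>\<^sup>+x. f x \<partial>count_space B)"
    by (rule nn_integral_count_space_subset) fact
  finally show ?thesis .
qed

lemma ln_1_plus_square_le:
  assumes "y \<ge> (0::real)" shows "ln (1 + y\<^sup>2) \<le> y\<^sup>2" "ln (1 + y\<^sup>2) \<le> 4 * sqrt y"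
proof -
  show "ln (1 + y\<^sup>2) \<le> y\<^sup>2" by (rule ln_add_one_self_le_self) simp
  have "1 + y\<^sup>2 \<le> (1 + y)^2" using assms by (simp add: power2_eq_square algebra_simps)
  also have "1 + y \<le> (1 + sqrt y)^2" using assms by (simp add: power2_eq_square algebra_simps)
  then have "(1 + y)^2 \<le> ((1 + sqrt y)^2)^2" using assms by (intro power_mono) auto
  finally have "1 + y\<^sup>2 \<le> (1 + sqrt y)^4" by simp
  then have "ln (1 + y\<^sup>2) \<le> ln ((1 + sqrt y)^4)" using assms
    by (intro ln_mono) (auto simp: add_pos_nonneg)
  also have "\<dots> = 4 * ln (1 + sqrt y)" using assms by (simp add: ln_realpow add_pos_nonneg)
  also have "\<dots> \<le> 4 * sqrt y" using ln_add_one_self_le_self[of "sqrt y"] assms by simp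
  finally show "ln (1 + y\<^sup>2) \<le> 4 * sqrt y" .
qed

text \<open>Up to 1 the integrand is at most 1 since ln(1 + y^2) \<le> y^2; beyond 1 the bound 4
  sqrt y leaves 4 y^(-3/2), whose primitive -8 y^(-1/2) vanishes at infinity.\<close>

lemma ln_1_plus_square_integral_finite:
  "(\<integral>\<^sup>+y. ennreal (indicator {0<..} y / y\<^sup>2) * ennreal (ln (1 + y\<^sup>2)) \<partial>lborel) < \<infinity>"
proof -
  define f where "f = (\<lambda>y::real. 4 * (y powr (-3/2)))"
  have le: "ennreal (indicator {0<..} y / y\<^sup>2) * ennreal (ln (1 + y\<^sup>2)) \<le>
      indicator {0..1} y + ennreal (f y) * indicator {1..} y" for y :: real
  proof -
    consider "y \<le> 0" | "0 < y" "y \<le> 1" | "1 < y" by linarith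
    then show ?thesis
    proof cases
      case 2
      then have "ln (1 + y\<^sup>2) / y\<^sup>2 \<le> 1" using ln_1_plus_square_le(1)[of y] by simp
      then have "ennreal (indicator {0<..} y / y\<^sup>2) * ennreal (ln (1 + y\<^sup>2)) \<le> 1"
        using 2 by (simp add: ennreal_mult'[symmetric] ennreal_le_1)
      also have "1 \<le> indicator {0..1} y + ennreal (f y) * indicator {1..} y"
        using 2 by (auto simp: indicator_def)
      finally show ?thesis .
    next
      case 3
      have "y powr (-3/2) = sqrt y / y\<^sup>2"
      proof -
        have "y powr (-3/2) = y powr (1/2 - 2)" by simp
        also have "\<dots> = y powr (1/2) / y powr 2" by (rule powr_diff)
        also have "\<dots> = sqrt y / y\<^sup>2" using 3 by (simp add: powr_half_sqrt)
        finally show ?thesis .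
      qed
      then have "ln (1 + y\<^sup>2) / y\<^sup>2 \<le> f y" using ln_1_plus_square_le(2)[of y] 3
        by (simp add: f_def divide_right_mono)
      then show ?thesis using 3 by (auto simp: ennreal_mult'[symmetric] indicator_def intro: ennreal_leI)
    qed (auto simp: indicator_def)
  qed
  have "(\<integral>\<^sup>+y. ennreal (f y) * indicator {1..} y \<partial>lborel) = ennreal (0 - (- 8 * (1 powr (-1/2))))"
  proof (rule nn_integral_FTC_atLeast[where F = "\<lambda>y. - 8 * (y powr (-1/2))"])
    show "f \<in> borel_measurable borel" unfolding f_def by measurable
    show "((\<lambda>y. - 8 * (y powr (-1/2))) has_real_derivative f x) (at x)" if "1 \<le> x" for x :: real
      unfolding f_def using that by (auto intro!: derivative_eq_intros)
    show "0 \<le> f x" for x by (simp add: f_def)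
    have "((\<lambda>y::real. y powr (-1/2)) \<longlongrightarrow> 0) at_top"
      by (rule tendsto_neg_powr) (auto intro: filterlim_ident)
    from tendsto_mult_left[OF this, of "-8"] show "((\<lambda>y::real. - 8 * (y powr (-1/2))) \<longlongrightarrow> 0) at_top" by simp
  qed
  moreover have "(\<integral>\<^sup>+y. indicator {0..1::real} y \<partial>lborel) = 1" by simp
  moreover have [measurable]: "f \<in> borel_measurable borel" unfolding f_def by measurable
  ultimately have "(\<integral>\<^sup>+y. indicator {0..1} y + ennreal (f y) * indicator {1..} y \<partial>lborel) < \<infinity>"
    by (subst nn_integral_add) auto
  with nn_integral_mono[of lborel, OF le] show ?thesis by (rule le_less_trans)
qed

section \<open>Unfolding over the fundamental domain\<close>

locale fuchsian_cusp =
  fixes G :: "(real^2^2) set set" and D :: "complex set" and h :: real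
  assumes sub: "subgroup G PSL2R"
    and D: "fundamental_domain G D"
    and area: "hyperbolic_area D < \<infinity>"
    and h: "h > 0"
    and stab: "{g\<in>G. boundary_act g Infty = Infty} = range (\<lambda>n::int. psl2r 1 (of_int n * h) 0 1)"
begin

definition T :: "int \<Rightarrow> (real^2^2) set" where
  "T n = psl2r 1 (of_int n * h) 0 1"

lemma T_psl: "T n = psl (mat22 1 (of_int n * h) 0 1)"
  by (simp add: T_def psl2r_mat22)

lemma T_in_G [simp]: "T n \<in> G"
  using stab unfolding T_def by blast

lemma G_carrier [simp]: "g \<in> G \<Longrightarrow> g \<in> carrier PSL2R"
  using sub by (meson subgroup.mem_carrier)

lemma G_closed [simp]: "g \<in> G \<Longrightarrow> g' \<in> G \<Longrightarrow> g \<otimes>\<^bsub>PSL2R\<^esub> g' \<in> G" "\<one>\<^bsub>PSL2R\<^esub> \<in> G"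
  "g \<in> G \<Longrightarrow> inv\<^bsub>PSL2R\<^esub> g \<in> G"
  using sub by (auto intro: subgroup.m_closed subgroup.one_closed subgroup.m_inv_closed)

lemma T_add: "T m \<otimes>\<^bsub>PSL2R\<^esub> T n = T (m + n)"
  by (simp add: T_psl psl_mult mat22_mult algebra_simps)

lemma T_0: "T 0 = \<one>\<^bsub>PSL2R\<^esub>"
  by (simp add: T_psl psl_one mat22_1)

lemma act_T: "act (T n) \<tau> = \<tau> + of_int n * of_real h" "aut2 (T n) \<tau> = 1"
  by (simp_all add: T_psl act_psl aut2_psl mob_def aut_def)

lemma act_T_mult:
  assumes "g \<in> G" "Im \<tau> > 0"
  shows "act (T n \<otimes>\<^bsub>PSL2R\<^esub> g) \<tau> = act g \<tau> + of_int n * of_real h"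
    "aut2 (T n \<otimes>\<^bsub>PSL2R\<^esub> g) \<tau> = aut2 g \<tau>"
  using assms by (simp_all add: act_mult act_T)

lemma D_sub: "D \<subseteq> upper_half_plane" and D_open: "open D" and D_nonempty: "D \<noteq> {}"
  using D by (auto simp: fundamental_domain_def)

lemma D_measurable [measurable]: "D \<in> sets borel"
  using D_open by simp

lemma D_disjoint:
  assumes "g \<in> G" "g' \<in> G" "\<tau> \<in> upper_half_plane" "act g \<tau> \<in> D" "act g' \<tau> \<in> D"
  shows "g = g'"
proof (rule ccontr)
  assume ne: "g \<noteq> g'"
  define k where "k = g' \<otimes>\<^bsub>PSL2R\<^esub> inv\<^bsub>PSL2R\<^esub> g"
  have k: "k \<in> G" using assms by (simp add: k_def)
  have "k \<noteq> \<one>\<^bsub>PSL2R\<^esub>"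
  proof
    assume "k = \<one>\<^bsub>PSL2R\<^esub>"
    then have "g' = g" using assms unfolding k_def
      by (metis G_carrier PSL.inv_closed PSL.inv_equality PSL.inv_inv)
    with ne show False by simp
  qed
  with k D have "act k ` D \<inter> D = {}" by (auto simp: fundamental_domain_def)
  moreover have "act k (act g \<tau>) = act g' \<tau>"
    using assms by (simp add: k_def PSL.m_assoc upper_half_plane_def Im_act flip: act_mult(1))
  ultimately show False using assms by force
qed

text \<open>The sets of points carried into \<open>D\<close> by different elements are disjoint,
  nonempty and open, and the plane has room for only countably many such sets.\<close>

lemma countable_G: "countable G"
proof -
  obtain z where z: "z \<in> D" using D_nonempty by blast
  define U where "U g = {\<tau>. \<tau> \<in> upper_half_plane \<and> act g \<tau> \<in> D}" for g
  have op: "open (U g)" if "g \<in> G" for g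
  proof -
    have "continuous_on upper_half_plane (act g)"
      using that by (intro holomorphic_on_imp_continuous_on holomorphic_act) auto
    then have "open (upper_half_plane \<inter> act g -` D)"
      using open_upper D_open by (rule continuous_open_preimage)
    moreover have "U g = upper_half_plane \<inter> act g -` D" by (auto simp: U_def)
    ultimately show ?thesis by simp
  qed
  have ne: "act (inv\<^bsub>PSL2R\<^esub> g) z \<in> U g" if "g \<in> G" for g
    using that z D_sub by (auto simp: U_def act_inv upper_half_plane_def Im_act subset_iff)
  have disj: "U g \<inter> U g' = {}" if "g \<in> G" "g' \<in> G" "g \<noteq> g'" for g g'
    using D_disjoint that by (auto simp: U_def)
  have "inj_on U G"
    by (rule inj_onI) (metis disj ne Int_absorb empty_iff)
  moreover have "countable (U ` G)"
  proof (rule countable_disjoint_open_subsets)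
    show "\<And>S. S \<in> U ` G \<Longrightarrow> open S" using op by auto
    show "disjoint (U ` G)" using disj by (auto simp: pairwise_def disjnt_def)
  qed
  ultimately show ?thesis by (rule countable_image_inj_on[rotated])
qed

lemma nn_integral_D_act:
  assumes [measurable]: "F \<in> borel_measurable borel" and "g \<in> G"
  shows "(\<integral>\<^sup>+\<tau>. indicator D \<tau> * F (act g \<tau>) \<partial>hyp) =
    (\<integral>\<^sup>+\<tau>. indicator D (act (inv\<^bsub>PSL2R\<^esub> g) \<tau>) * F \<tau> \<partial>hyp)"
proof -
  have [measurable]: "act (inv\<^bsub>PSL2R\<^esub> g) \<in> borel_measurable borel" using assms by (simp add: act_measurable)
  have "(\<integral>\<^sup>+\<tau>. indicator D (act (inv\<^bsub>PSL2R\<^esub> g) \<tau>) * F \<tau> \<partial>hyp) =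
     (\<integral>\<^sup>+\<tau>. indicator D (act (inv\<^bsub>PSL2R\<^esub> g) (act g \<tau>)) * F (act g \<tau>) \<partial>hyp)"
    using assms by (subst nn_integral_hyp_act[where g = g, symmetric]) auto
  also have "\<dots> = (\<integral>\<^sup>+\<tau>. indicator D \<tau> * F (act g \<tau>) \<partial>hyp)"
    using assms by (intro nn_integral_hyp_cong) (simp add: act_inv upper_half_plane_def)
  finally show ?thesis ..
qed

text \<open>Tonelli: the inner sum on the right counts the translates of \<open>D\<close> through a
  point. \<open>unfold_le\<close> uses that this count is at most 1, \<open>unfold_ge\<close> that
  it is at least 1 almost everywhere.\<close>

lemma unfold_sum:
  assumes [measurable]: "F \<in> borel_measurable borel"
  shows "(\<integral>\<^sup>+g. (\<integral>\<^sup>+\<tau>. indicator D \<tau> * F (act g \<tau>) \<partial>hyp) \<partial>count_space G) =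
     (\<integral>\<^sup>+\<tau>. (\<integral>\<^sup>+g. indicator D (act (inv\<^bsub>PSL2R\<^esub> g) \<tau>) \<partial>count_space G) * F \<tau> \<partial>hyp)"
proof -
  have "(\<integral>\<^sup>+g. (\<integral>\<^sup>+\<tau>. indicator D \<tau> * F (act g \<tau>) \<partial>hyp) \<partial>count_space G) =
     (\<integral>\<^sup>+g. (\<integral>\<^sup>+\<tau>. indicator D (act (inv\<^bsub>PSL2R\<^esub> g) \<tau>) * F \<tau> \<partial>hyp) \<partial>count_space G)"
    by (intro nn_integral_cong nn_integral_D_act) auto
  also have "\<dots> = (\<integral>\<^sup>+\<tau>. (\<integral>\<^sup>+g. indicator D (act (inv\<^bsub>PSL2R\<^esub> g) \<tau>) * F \<tau> \<partial>count_space G) \<partial>hyp)"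
  proof (rule nn_integral_count_space_nn_integral[symmetric])
    fix g assume "g \<in> G"
    then have [measurable]: "act (inv\<^bsub>PSL2R\<^esub> g) \<in> borel_measurable borel" by (simp add: act_measurable)
    show "(\<lambda>\<tau>. indicator D (act (inv\<^bsub>PSL2R\<^esub> g) \<tau>) * F \<tau>) \<in> borel_measurable hyp" by measurable
  qed (rule countable_G)
  also have "\<dots> = (\<integral>\<^sup>+\<tau>. (\<integral>\<^sup>+g. indicator D (act (inv\<^bsub>PSL2R\<^esub> g) \<tau>) \<partial>count_space G) * F \<tau> \<partial>hyp)"
    by (intro nn_integral_cong nn_integral_multc) auto
  finally show ?thesis .
qed

lemma unfold_le:
  assumes [measurable]: "F \<in> borel_measurable borel"
  shows "(\<integral>\<^sup>+g. (\<integral>\<^sup>+\<tau>. indicator D \<tau> * F (act g \<tau>) \<partial>hyp) \<partial>count_space G) \<le> (\<integral>\<^sup>+\<tau>. F \<tau> \<partial>hyp)"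
proof -
  have "(\<integral>\<^sup>+g. indicator D (act (inv\<^bsub>PSL2R\<^esub> g) \<tau>) \<partial>count_space G) \<le> 1"
    if "\<tau> \<in> upper_half_plane" for \<tau>
  proof (cases "\<exists>g\<in>G. act (inv\<^bsub>PSL2R\<^esub> g) \<tau> \<in> D")
    case True
    then obtain g where g: "g \<in> G" "act (inv\<^bsub>PSL2R\<^esub> g) \<tau> \<in> D" by blast
    have "indicator D (act (inv\<^bsub>PSL2R\<^esub> g') \<tau>) \<le> (indicator {g} g' :: ennreal)" if "g' \<in> G" for g'
    proof (cases "act (inv\<^bsub>PSL2R\<^esub> g') \<tau> \<in> D")
      case True
      then have "inv\<^bsub>PSL2R\<^esub> g' = inv\<^bsub>PSL2R\<^esub> g"
        using g that \<open>\<tau> \<in> upper_half_plane\<close> by (intro D_disjoint) auto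
      then have "g' = g" using that g by (metis G_carrier PSL.inv_inv)
      then show ?thesis by (simp add: indicator_def)
    qed simp
    then have "(\<integral>\<^sup>+g. indicator D (act (inv\<^bsub>PSL2R\<^esub> g) \<tau>) \<partial>count_space G) \<le> (\<integral>\<^sup>+g'. indicator {g} g' \<partial>count_space G)"
      by (intro nn_integral_mono) auto
    also have "\<dots> = 1" using g by (simp add: one_ennreal_def)
    finally show ?thesis .
  next
    case False
    then have "(\<integral>\<^sup>+g. indicator D (act (inv\<^bsub>PSL2R\<^esub> g) \<tau>) \<partial>count_space G) = (\<integral>\<^sup>+g. 0 \<partial>count_space G)"
      by (intro nn_integral_cong) auto
    then show ?thesis by simp
  qed
  then have "(\<integral>\<^sup>+\<tau>. (\<integral>\<^sup>+g. indicator D (act (inv\<^bsub>PSL2R\<^esub> g) \<tau>) \<partial>count_space G) * F \<tau> \<partial>hyp) \<le> (\<integral>\<^sup>+\<tau>. 1 * F \<tau> \<partial>hyp)"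
    by (intro nn_integral_hyp_mono mult_right_mono) auto
  then show ?thesis by (simp add: unfold_sum)
qed

lemma frontier_null: "emeasure hyp (frontier D \<inter> upper_half_plane) = 0"
  using D by (subst hyperbolic_area_eq[symmetric]) (auto simp: fundamental_domain_def)

lemma null_translate:
  assumes "g \<in> G"
  shows "AE \<tau> in hyp. act (inv\<^bsub>PSL2R\<^esub> g) \<tau> \<notin> frontier D \<inter> upper_half_plane"
proof -
  have [measurable]: "act (inv\<^bsub>PSL2R\<^esub> g) \<in> borel_measurable borel" using assms by (simp add: act_measurable)
  have [measurable]: "frontier D \<inter> upper_half_plane \<in> sets borel" by simp
  have "(\<integral>\<^sup>+\<tau>. indicator (frontier D \<inter> upper_half_plane) (act (inv\<^bsub>PSL2R\<^esub> g) \<tau>) \<partial>hyp) =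
     (\<integral>\<^sup>+\<tau>. indicator (frontier D \<inter> upper_half_plane) \<tau> \<partial>hyp)"
    using assms by (intro nn_integral_hyp_act) auto
  also have "\<dots> = 0" by (simp add: frontier_null)
  finally have "AE \<tau> in hyp. indicator (frontier D \<inter> upper_half_plane) (act (inv\<^bsub>PSL2R\<^esub> g) \<tau>) = (0::ennreal)"
    by (subst (asm) nn_integral_0_iff_AE) auto
  then show ?thesis by eventually_elim (auto simp: indicator_def split: if_splits)
qed

text \<open>The translates of the closure of \<open>D\<close> cover the half plane, and a point in
  no translate of \<open>D\<close> itself lies on a translate of the frontier. There are countably
  many of those, all null.\<close>

lemma unfold_ge:
  assumes [measurable]: "F \<in> borel_measurable borel"
  shows "(\<integral>\<^sup>+\<tau>. F \<tau> \<partial>hyp) \<le> (\<integral>\<^sup>+g. (\<integral>\<^sup>+\<tau>. indicator D \<tau> * F (act g \<tau>) \<partial>hyp) \<partial>count_space G)"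
proof -
  have "AE \<tau> in hyp. \<forall>g\<in>G. act (inv\<^bsub>PSL2R\<^esub> g) \<tau> \<notin> frontier D \<inter> upper_half_plane"
    using null_translate countable_G by (simp add: AE_ball_countable)
  then have "AE \<tau> in hyp. 1 * F \<tau> \<le> (\<integral>\<^sup>+g. indicator D (act (inv\<^bsub>PSL2R\<^esub> g) \<tau>) \<partial>count_space G) * F \<tau>"
    using AE_hyp_upper
  proof eventually_elim
    case (elim \<tau>)
    from D elim(2) have "\<tau> \<in> (\<Union>g\<in>G. act g ` (closure D \<inter> upper_half_plane))"
      by (auto simp: fundamental_domain_def)
    then obtain g w where g: "g \<in> G" "w \<in> closure D" "w \<in> upper_half_plane" "\<tau> = act g w" by blast
    then have w: "act (inv\<^bsub>PSL2R\<^esub> g) \<tau> = w" by (simp add: act_inv upper_half_plane_def)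
    have "act (inv\<^bsub>PSL2R\<^esub> g) \<tau> \<notin> frontier D \<inter> upper_half_plane" using elim(1) g(1) by blast
    with w g have "w \<notin> frontier D" by simp
    with g have wD: "w \<in> D" using D_open by (auto simp: frontier_def interior_open)
    have "(1::ennreal) = indicator D (act (inv\<^bsub>PSL2R\<^esub> g) \<tau>)" using w wD by simp
    also have "\<dots> \<le> (\<integral>\<^sup>+g. indicator D (act (inv\<^bsub>PSL2R\<^esub> g) \<tau>) \<partial>count_space G)"
      using sum_le_nn_integral_count_space[of "{g}" G "\<lambda>g. indicator D (act (inv\<^bsub>PSL2R\<^esub> g) \<tau>)"] g by simp
    finally show ?case by (rule mult_right_mono) simp
  qed
  then have "(\<integral>\<^sup>+\<tau>. 1 * F \<tau> \<partial>hyp) \<le> (\<integral>\<^sup>+\<tau>. (\<integral>\<^sup>+g. indicator D (act (inv\<^bsub>PSL2R\<^esub> g) \<tau>) \<partial>count_space G) * F \<tau> \<partial>hyp)"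
    by (rule nn_integral_mono_AE)
  then show ?thesis by (simp add: unfold_sum)
qed

subsection \<open>Representatives modulo translations\<close>

text \<open>The choice depends only on the coset of \<open>g\<close> modulo translations on the
  left. The coset of the translations themselves gets the identity, so that the main term of a
  Poincare series stands out explicitly.\<close>

definition rep :: "(real^2^2) set \<Rightarrow> (real^2^2) set" where
  "rep g = (if g \<in> range T then \<one>\<^bsub>PSL2R\<^esub> else (SOME g'. g' \<in> range (\<lambda>n. T n \<otimes>\<^bsub>PSL2R\<^esub> g)))"

definition R :: "(real^2^2) set set" where "R = rep ` G"

lemma rep_ex:
  assumes "g \<in> G"
  shows "\<exists>n. rep g = T n \<otimes>\<^bsub>PSL2R\<^esub> g"
proof (cases "g \<in> range T")
  case True
  then obtain m where m: "g = T m" by blast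
  have "rep g = T (- m) \<otimes>\<^bsub>PSL2R\<^esub> g" using True by (simp add: rep_def m T_add T_0)
  then show ?thesis by blast
next
  case False
  have "(SOME g'. g' \<in> range (\<lambda>n. T n \<otimes>\<^bsub>PSL2R\<^esub> g)) \<in> range (\<lambda>n. T n \<otimes>\<^bsub>PSL2R\<^esub> g)"
    by (rule someI_ex) blast
  then show ?thesis using False by (auto simp: rep_def)
qed

lemma rep_T_mult:
  assumes "g \<in> G"
  shows "rep (T n \<otimes>\<^bsub>PSL2R\<^esub> g) = rep g"
proof -
  have a: "T m \<otimes>\<^bsub>PSL2R\<^esub> (T n \<otimes>\<^bsub>PSL2R\<^esub> g) = T (m + n) \<otimes>\<^bsub>PSL2R\<^esub> g" for m n
    using assms by (simp add: T_add flip: PSL.m_assoc)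
  have "T n \<otimes>\<^bsub>PSL2R\<^esub> g \<in> range T \<longleftrightarrow> g \<in> range T"
  proof
    assume "g \<in> range T" then show "T n \<otimes>\<^bsub>PSL2R\<^esub> g \<in> range T" by (auto simp: T_add)
  next
    assume "T n \<otimes>\<^bsub>PSL2R\<^esub> g \<in> range T"
    then obtain m where "T n \<otimes>\<^bsub>PSL2R\<^esub> g = T m" by blast
    then have "T (- n) \<otimes>\<^bsub>PSL2R\<^esub> (T n \<otimes>\<^bsub>PSL2R\<^esub> g) = T (m - n)" by (simp add: T_add)
    then have "g = T (m - n)" using assms by (simp add: a T_0)
    then show "g \<in> range T" by blast
  qed
  moreover have "range (\<lambda>m. T m \<otimes>\<^bsub>PSL2R\<^esub> (T n \<otimes>\<^bsub>PSL2R\<^esub> g)) = range (\<lambda>m. T m \<otimes>\<^bsub>PSL2R\<^esub> g)"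
    unfolding a
  proof (intro equalityI image_subsetI)
    fix m show "T m \<otimes>\<^bsub>PSL2R\<^esub> g \<in> range (\<lambda>m. T (m + n) \<otimes>\<^bsub>PSL2R\<^esub> g)"
      by (rule image_eqI[of _ _ "m - n"]) auto
  qed auto
  ultimately show ?thesis by (simp add: rep_def)
qed

lemma rep_in_G: "g \<in> G \<Longrightarrow> rep g \<in> G"
  using rep_ex[of g] by auto

lemma R_sub: "R \<subseteq> G"
  using rep_in_G by (auto simp: R_def)

lemma R_G [simp]: "r \<in> R \<Longrightarrow> r \<in> G"
  using R_sub by blast

lemma countable_R: "countable R"
  using countable_G by (simp add: R_def)

lemma rep_R: "r \<in> R \<Longrightarrow> rep r = r"
  unfolding R_def using rep_ex rep_T_mult by fastforce

lemma rep_one: "rep \<one>\<^bsub>PSL2R\<^esub> = \<one>\<^bsub>PSL2R\<^esub>"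
proof -
  have "\<one>\<^bsub>PSL2R\<^esub> \<in> range T" by (metis T_0 rangeI)
  then show ?thesis by (simp add: rep_def)
qed

lemma one_in_R [simp]: "\<one>\<^bsub>PSL2R\<^esub> \<in> R"
  unfolding R_def by (metis rep_one G_closed(2) image_eqI)

lemma R_stab:
  assumes "r \<in> R" "r \<in> range T" shows "r = \<one>\<^bsub>PSL2R\<^esub>"
  using assms rep_R[of r] by (simp add: rep_def)

text \<open>Right multiplication permutes the cosets modulo left translations, and multiplying by
  the inverse of \<open>a\<close> undoes it. This is the source of the transformation law of series
  over \<open>R\<close>.\<close>

lemma bij_R:
  assumes "a \<in> G"
  shows "bij_betw (\<lambda>r. rep (r \<otimes>\<^bsub>PSL2R\<^esub> a)) R R"
proof -
  have *: "rep (rep (r \<otimes>\<^bsub>PSL2R\<^esub> a) \<otimes>\<^bsub>PSL2R\<^esub> inv\<^bsub>PSL2R\<^esub> a) = r" if "r \<in> R" "a \<in> G" for r a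
  proof -
    have "r \<otimes>\<^bsub>PSL2R\<^esub> a \<in> G" using that by simp
    from rep_ex[OF this] obtain n where "rep (r \<otimes>\<^bsub>PSL2R\<^esub> a) = T n \<otimes>\<^bsub>PSL2R\<^esub> (r \<otimes>\<^bsub>PSL2R\<^esub> a)"
      by blast
    then have "rep (r \<otimes>\<^bsub>PSL2R\<^esub> a) \<otimes>\<^bsub>PSL2R\<^esub> inv\<^bsub>PSL2R\<^esub> a = T n \<otimes>\<^bsub>PSL2R\<^esub> r"
      using that by (simp add: PSL.m_assoc)
    then show ?thesis using that by (simp add: rep_T_mult rep_R)
  qed
  show ?thesis
  proof (rule bij_betw_byWitness[where f' = "\<lambda>r. rep (r \<otimes>\<^bsub>PSL2R\<^esub> inv\<^bsub>PSL2R\<^esub> a)"])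
    show "\<forall>r\<in>R. rep (rep (r \<otimes>\<^bsub>PSL2R\<^esub> a) \<otimes>\<^bsub>PSL2R\<^esub> inv\<^bsub>PSL2R\<^esub> a) = r" using * assms by blast
    show "\<forall>r\<in>R. rep (rep (r \<otimes>\<^bsub>PSL2R\<^esub> inv\<^bsub>PSL2R\<^esub> a) \<otimes>\<^bsub>PSL2R\<^esub> a) = r"
      using *[of _ "inv\<^bsub>PSL2R\<^esub> a"] assms by simp
  qed (use assms in \<open>auto simp: R_def intro!: imageI G_closed rep_in_G\<close>)
qed

lemma infsum_R_shift:
  fixes F :: "(real^2^2) set \<Rightarrow> 'a :: {comm_monoid_add, t2_space}"
  assumes "a \<in> G" and F: "\<And>n g. g \<in> G \<Longrightarrow> F (T n \<otimes>\<^bsub>PSL2R\<^esub> g) = F g"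
  shows "(\<Sum>\<^sub>\<infinity>r\<in>R. F (r \<otimes>\<^bsub>PSL2R\<^esub> a)) = (\<Sum>\<^sub>\<infinity>r\<in>R. F r)"
proof -
  have Frep: "F (rep g) = F g" if "g \<in> G" for g using that F rep_ex[of g] by auto
  have "(\<Sum>\<^sub>\<infinity>r\<in>R. F (r \<otimes>\<^bsub>PSL2R\<^esub> a)) = (\<Sum>\<^sub>\<infinity>r\<in>R. F (rep (r \<otimes>\<^bsub>PSL2R\<^esub> a)))"
    using assms by (intro infsum_cong) (simp add: Frep)
  also have "\<dots> = (\<Sum>\<^sub>\<infinity>r\<in>R. F r)"
    by (rule infsum_reindex_bij_betw) (rule bij_R[OF \<open>a \<in> G\<close>])
  finally show ?thesis .
qed

text \<open>Each class modulo translations has exactly one member moving a given point into the strip of width h.\<close>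

lemma sum_R_le_strip:
  fixes \<phi> :: "real \<Rightarrow> ennreal"
  assumes "\<tau> \<in> upper_half_plane"
  shows "(\<integral>\<^sup>+r. \<phi> (Im (act r \<tau>)) \<partial>count_space R) \<le>
    (\<integral>\<^sup>+g. indicator {z. 0 \<le> Re z \<and> Re z < h} (act g \<tau>) * \<phi> (Im (act g \<tau>)) \<partial>count_space G)"
proof -
  define k where "k r = T (- \<lfloor>Re (act r \<tau>) / h\<rfloor>) \<otimes>\<^bsub>PSL2R\<^esub> r" for r
  have pos: "Im \<tau> > 0" using assms by (simp add: upper_half_plane_def)
  have kG: "k r \<in> G" if "r \<in> R" for r using that by (simp add: k_def)
  have inj: "inj_on k R"
  proof (rule inj_onI)
    fix r r' assume "r \<in> R" "r' \<in> R" "k r = k r'"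
    then show "r = r'" by (metis k_def rep_T_mult rep_R R_G)
  qed
  have act_k: "act (k r) \<tau> = act r \<tau> - of_int \<lfloor>Re (act r \<tau>) / h\<rfloor> * of_real h" if "r \<in> R" for r
    using that pos by (simp add: k_def act_T_mult)
  have strip: "act (k r) \<tau> \<in> {z. 0 \<le> Re z \<and> Re z < h}" if "r \<in> R" for r
  proof -
    have "of_int \<lfloor>Re (act r \<tau>) / h\<rfloor> \<le> Re (act r \<tau>) / h" "Re (act r \<tau>) / h < of_int \<lfloor>Re (act r \<tau>) / h\<rfloor> + 1"
      by (auto simp: floor_correct)
    then have "of_int \<lfloor>Re (act r \<tau>) / h\<rfloor> * h \<le> Re (act r \<tau>)" "Re (act r \<tau>) < (of_int \<lfloor>Re (act r \<tau>) / h\<rfloor> + 1) * h"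
      using h by (simp_all only: pos_le_divide_eq pos_divide_less_eq)
    then show ?thesis by (simp add: act_k[OF that] algebra_simps)
  qed
  let ?f = "\<lambda>g. indicator {z. 0 \<le> Re z \<and> Re z < h} (act g \<tau>) * \<phi> (Im (act g \<tau>))"
  have "(\<integral>\<^sup>+r. \<phi> (Im (act r \<tau>)) \<partial>count_space R) = (\<integral>\<^sup>+r. ?f (k r) \<partial>count_space R)"
    using strip act_k by (intro nn_integral_cong) auto
  also have "\<dots> = (\<integral>\<^sup>+g. ?f g \<partial>count_space (k ` R))"
    by (rule nn_integral_bij_count_space) (use inj in \<open>auto simp: bij_betw_def\<close>)
  also have "\<dots> \<le> (\<integral>\<^sup>+g. ?f g \<partial>count_space G)"
    by (rule nn_integral_count_space_subset) (use kG in auto)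
  finally show ?thesis .
qed

text \<open>The logarithm stands in for the power (Im(r tau))^2: it is of the same size at small
  heights and stays integrable over large ones.\<close>

definition logsum :: "complex \<Rightarrow> ennreal" where
  "logsum \<tau> = (\<integral>\<^sup>+r. ennreal (ln (1 + (Im (act r \<tau>))\<^sup>2)) \<partial>count_space R)"

text \<open>Representatives can be chosen to move tau into the strip, so the coset sum is at most a
  sum over \<open>G\<close> of a function supported there. Unfolding turns the integral over
  \<open>D\<close> into one over the strip, which is \<open>h\<close> times a radial
  integral.\<close>

lemma logsum_integral_finite: "(\<integral>\<^sup>+\<tau>. indicator D \<tau> * logsum \<tau> \<partial>hyp) < \<infinity>"
proof -
  let ?S = "{z. 0 \<le> Re z \<and> Re z < h}"
  let ?\<phi> = "\<lambda>y. ennreal (ln (1 + y\<^sup>2))"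
  have [measurable]: "?S \<in> sets borel" by measurable
  have "(\<integral>\<^sup>+\<tau>. indicator D \<tau> * logsum \<tau> \<partial>hyp) \<le>
     (\<integral>\<^sup>+\<tau>. indicator D \<tau> * (\<integral>\<^sup>+g. indicator ?S (act g \<tau>) * ?\<phi> (Im (act g \<tau>)) \<partial>count_space G) \<partial>hyp)"
    unfolding logsum_def by (intro nn_integral_hyp_mono mult_left_mono sum_R_le_strip) auto
  also have "\<dots> = (\<integral>\<^sup>+\<tau>. (\<integral>\<^sup>+g. indicator D \<tau> * (indicator ?S (act g \<tau>) * ?\<phi> (Im (act g \<tau>))) \<partial>count_space G) \<partial>hyp)"
    by (intro nn_integral_cong nn_integral_cmult[symmetric]) auto
  also have "\<dots> = (\<integral>\<^sup>+g. (\<integral>\<^sup>+\<tau>. indicator D \<tau> * (indicator ?S (act g \<tau>) * ?\<phi> (Im (act g \<tau>))) \<partial>hyp) \<partial>count_space G)"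
  proof (rule nn_integral_count_space_nn_integral)
    fix g assume "g \<in> G"
    then have [measurable]: "act g \<in> borel_measurable borel" by (simp add: act_measurable)
    show "(\<lambda>\<tau>. indicator D \<tau> * (indicator ?S (act g \<tau>) * ?\<phi> (Im (act g \<tau>)))) \<in> borel_measurable hyp"
      by measurable
  qed (rule countable_G)
  also have "\<dots> \<le> (\<integral>\<^sup>+\<tau>. indicator ?S \<tau> * ?\<phi> (Im \<tau>) \<partial>hyp)"
    by (rule unfold_le[where F = "\<lambda>\<tau>. indicator ?S \<tau> * ?\<phi> (Im \<tau>)"]) measurable
  also have "\<dots> = ennreal h * (\<integral>\<^sup>+y. ennreal (indicator {0<..} y / y\<^sup>2) * ?\<phi> y \<partial>lborel)"
    using h by (intro nn_integral_hyp_strip) auto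
  also have "\<dots> < \<infinity>"
    using ln_1_plus_square_integral_finite by (simp add: ennreal_mult_less_top)
  finally show ?thesis .
qed

lemma logsum_measurable [measurable]: "logsum \<in> borel_measurable borel"
  unfolding logsum_def[abs_def]
proof (rule sigma_finite_measure.borel_measurable_nn_integral)
  show "sigma_finite_measure (count_space R)"
    by (rule sigma_finite_measure_count_space_countable[OF countable_R])
  have "(\<lambda>(r, \<tau>). ennreal (ln (1 + (Im (act r \<tau>))\<^sup>2))) \<in> borel_measurable (count_space R \<Otimes>\<^sub>M borel)"
  proof (rule measurable_pair_measure_countable1[OF countable_R])
    fix r assume "r \<in> R"
    then have [measurable]: "act r \<in> borel_measurable borel" by (simp add: act_measurable)
    show "(\<lambda>\<tau>. case (r, \<tau>) of (r, \<tau>) \<Rightarrow> ennreal (ln (1 + (Im (act r \<tau>))\<^sup>2))) \<in> borel_measurable borel"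
      by simp
  qed
  from measurable_pair_swap[OF this]
  show "(\<lambda>(\<tau>, r). ennreal (ln (1 + (Im (act r \<tau>))\<^sup>2))) \<in> borel_measurable (borel \<Otimes>\<^sub>M count_space R)"
    by (simp add: case_prod_beta)
qed

end

section \<open>Convergence of the majorant series at one point and then locally uniformly\<close>

lemma emeasure_hyp_open_pos:
  assumes "open U" "U \<noteq> {}" "U \<subseteq> upper_half_plane"
  shows "emeasure hyp U > 0"
proof (rule ccontr)
  assume "\<not> emeasure hyp U > 0"
  then have "emeasure hyp U = 0" by simp
  moreover have [measurable]: "U \<in> sets borel" using assms by simp
  ultimately have "U \<in> null_sets hyp" by auto
  then have "AE \<tau> in hyp. \<tau> \<notin> U" by (rule AE_not_in)
  then have "AE \<tau> in density lborel (\<lambda>\<tau>. ennreal (indicator upper_half_plane \<tau> / (Im \<tau>)\<^sup>2)). \<tau> \<notin> U"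
    by (simp only: hyp_def)
  moreover have "(\<lambda>\<tau>. ennreal (indicator upper_half_plane \<tau> / (Im \<tau>)\<^sup>2)) \<in> borel_measurable lborel"
    by simp
  ultimately have "AE \<tau> in lborel. 0 < ennreal (indicator upper_half_plane \<tau> / (Im \<tau>)\<^sup>2) \<longrightarrow> \<tau> \<notin> U"
    by (simp only: AE_density)
  then have "AE \<tau> in lborel. \<tau> \<notin> U"
  proof eventually_elim
    case (elim \<tau>)
    show ?case
    proof
      assume \<tau>: "\<tau> \<in> U"
      then have "\<tau> \<in> upper_half_plane" "Im \<tau> > 0" using assms(3) by (auto simp: upper_half_plane_def)
      with elim \<tau> show False by simp
    qed
  qed
  then have "U \<in> null_sets lborel" by (subst (asm) AE_iff_null_sets[symmetric]) auto
  then have "negligible U" by (simp add: negligible_iff_null_sets null_sets_completionI)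
  then show False using open_not_negligible assms by blast
qed

text \<open>The imaginary part of c tau + d is c Im tau, so |c| is at most |c tau + d| / Im tau, and
  moving the point from tau to w costs no more than |c| |tau - w|.\<close>

lemma aut_change_point:
  assumes "det M = 1" "Im \<tau> > 0"
  shows "cmod (aut M w) \<le> cmod (aut M \<tau>) * (1 + cmod (\<tau> - w) / Im \<tau>)"
proof -
  have "\<bar>M$2$1\<bar> * Im \<tau> = \<bar>Im (aut M \<tau>)\<bar>" using assms by (simp add: aut_def abs_mult)
  also have "\<dots> \<le> cmod (aut M \<tau>)" by (rule abs_Im_le_cmod)
  finally have c: "\<bar>M$2$1\<bar> \<le> cmod (aut M \<tau>) / Im \<tau>" using assms by (simp add: field_simps)
  have "aut M w = aut M \<tau> - of_real (M$2$1) * (\<tau> - w)" by (simp add: aut_def algebra_simps)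
  then have "cmod (aut M w) \<le> cmod (aut M \<tau>) + \<bar>M$2$1\<bar> * cmod (\<tau> - w)"
    by (metis norm_triangle_ineq4 norm_mult norm_of_real real_norm_def)
  also have "\<dots> \<le> cmod (aut M \<tau>) + cmod (aut M \<tau>) / Im \<tau> * cmod (\<tau> - w)"
    using c by (intro add_left_mono mult_right_mono) auto
  finally show ?thesis by (simp add: algebra_simps)
qed

text \<open>|c w + d|^2 is the sum of (c Re w + d)^2 and (c Im w)^2. Estimates on a segment at
  height 1 therefore propagate up the whole strip above it.\<close>

lemma aut_mono_Im:
  assumes "Im w \<ge> 1"
  shows "cmod (aut M w) \<ge> cmod (aut M (Complex (Re w) 1))"
proof -
  have "1 \<le> (Im w)\<^sup>2" using assms by simp
  then have "(M$2$1)\<^sup>2 * 1 \<le> (M$2$1)\<^sup>2 * (Im w)\<^sup>2" by (rule mult_left_mono) simp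
  then show ?thesis unfolding cmod_def by (intro real_sqrt_le_mono) (simp add: aut_def power_mult_distrib)
qed

lemma norm_infsum_le_infsum:
  fixes f :: "'a \<Rightarrow> 'b::banach"
  assumes "g summable_on A" "\<And>x. x \<in> A \<Longrightarrow> norm (f x) \<le> g x"
  shows "f summable_on A" "norm (infsum f A) \<le> infsum g A"
proof -
  show f: "f summable_on A"
    by (rule abs_summable_summable, rule Infinite_Sum.abs_summable_on_comparison_test'[OF assms])
  show "norm (infsum f A) \<le> infsum g A"
    by (rule norm_infsum_le[OF has_sum_infsum[OF f] has_sum_infsum[OF assms(1)] assms(2)])
qed

context fuchsian_cusp
begin

text \<open>\<open>logsum\<close> has finite integral over \<open>D\<close>, and \<open>D\<close>
  has positive measure, so \<open>logsum\<close> is finite at some point of \<open>D\<close>. There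
  the heights are bounded, and for bounded a the quantities a and ln(1 + a) are comparable.\<close>

lemma convergence_at_point:
  obtains \<tau>0 where "\<tau>0 \<in> upper_half_plane" "(\<lambda>r. 1 / (cmod (aut2 r \<tau>0))\<^sup>2) summable_on R"
proof -
  have "AE \<tau> in hyp. indicator D \<tau> * logsum \<tau> \<noteq> \<infinity>"
    using logsum_integral_finite by (intro nn_integral_noteq_infinite) auto
  moreover have "\<not> (AE \<tau> in hyp. \<tau> \<notin> D)"
  proof
    assume "AE \<tau> in hyp. \<tau> \<notin> D"
    then have "D \<in> null_sets hyp" by (subst (asm) AE_iff_null_sets[symmetric]) auto
    then show False using emeasure_hyp_open_pos[OF D_open D_nonempty D_sub] by auto
  qed
  moreover have "AE \<tau> in hyp. \<tau> \<notin> D" if "\<And>\<tau>. \<tau> \<in> D \<Longrightarrow> logsum \<tau> = \<infinity>"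
    using calculation(1) by eventually_elim (use that in auto)
  ultimately obtain \<tau>0 where \<tau>0: "\<tau>0 \<in> D" "logsum \<tau>0 \<noteq> \<infinity>"
    by blast
  then have up: "\<tau>0 \<in> upper_half_plane" "Im \<tau>0 > 0" using D_sub by (auto simp: upper_half_plane_def)
  define L where "L = enn2real (logsum \<tau>0)"
  have L: "logsum \<tau>0 = ennreal L" "L \<ge> 0" using \<tau>0 by (simp_all add: L_def less_top)
  define a where "a r = (Im (act r \<tau>0))\<^sup>2" for r
  have a0: "a r \<ge> 0" for r by (simp add: a_def)
  have fin: "(\<Sum>r\<in>F. ln (1 + a r)) \<le> L" if "finite F" "F \<subseteq> R" for F
  proof -
    have "ennreal (\<Sum>r\<in>F. ln (1 + a r)) = (\<Sum>r\<in>F. ennreal (ln (1 + a r)))"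
      using a0 by (simp add: sum_ennreal)
    also have "\<dots> \<le> ennreal L"
      using sum_le_nn_integral_count_space[OF that] unfolding L(1)[symmetric] logsum_def a_def .
    finally show ?thesis using L by simp
  qed
  \<comment> \<open>A single term of the sum is at most L, so 1 + a r \<le> exp L; the lower bound
    ln(1 + a) \<ge> a / (1 + a) then produces the factor exp L.\<close>
  have le: "a r \<le> exp L * ln (1 + a r)" if "r \<in> R" for r
  proof -
    have pos: "1 + a r > 0" using a0[of r] by linarith
    have "ln (1 + a r) \<le> L" using fin[of "{r}"] that by simp
    then have "1 + a r \<le> exp L" using pos by (metis exp_ln exp_le_cancel_iff)
    have "ln (1 / (1 + a r)) \<le> 1 / (1 + a r) - 1" using pos by (intro ln_le_minus_one) auto
    then have "a r / (1 + a r) \<le> ln (1 + a r)" using pos by (simp add: ln_div field_simps)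
    then have "a r \<le> (1 + a r) * ln (1 + a r)" using pos by (simp add: field_simps)
    also have "\<dots> \<le> exp L * ln (1 + a r)" using \<open>1 + a r \<le> exp L\<close> a0[of r] by (intro mult_right_mono) auto
    finally show ?thesis .
  qed
  have "a summable_on R"
  proof (rule nonneg_bdd_above_summable_on)
    show "bdd_above (sum a ` {F. F \<subseteq> R \<and> finite F})"
    proof (rule bdd_aboveI2)
      fix F assume F: "F \<in> {F. F \<subseteq> R \<and> finite F}"
      have "sum a F \<le> (\<Sum>r\<in>F. exp L * ln (1 + a r))" using F le by (intro sum_mono) auto
      also have "\<dots> = exp L * (\<Sum>r\<in>F. ln (1 + a r))" by (simp add: sum_distrib_left)
      also have "\<dots> \<le> exp L * L" using fin F by (intro mult_left_mono) auto
      finally show "sum a F \<le> exp L * L" .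
    qed
  qed (rule a0)
  then have "(\<lambda>r. (1 / (Im \<tau>0)\<^sup>2) * a r) summable_on R" by (rule summable_on_cmult_right)
  moreover have "(1 / (Im \<tau>0)\<^sup>2) * a r = 1 / (cmod (aut2 r \<tau>0))\<^sup>2" if "r \<in> R" for r
    using that up by (simp add: a_def Im_act power_divide)
  ultimately have "(\<lambda>r. 1 / (cmod (aut2 r \<tau>0))\<^sup>2) summable_on R"
    by (subst summable_on_cong[where g = "\<lambda>r. (1 / (Im \<tau>0)\<^sup>2) * a r"]) auto
  with that up show ?thesis by blast
qed

lemma aut2_change_point:
  assumes "g \<in> G" "Im \<tau> > 0"
  shows "cmod (aut2 g w) \<le> cmod (aut2 g \<tau>) * (1 + cmod (\<tau> - w) / Im \<tau>)\<^sup>2"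
proof -
  obtain M where M: "det M = 1" "g = psl M" using assms carrier_PSL2R_cases by (metis G_carrier)
  have "(cmod (aut M w))\<^sup>2 \<le> (cmod (aut M \<tau>) * (1 + cmod (\<tau> - w) / Im \<tau>))\<^sup>2"
    by (rule power_mono[OF aut_change_point[OF M(1) assms(2)]]) simp
  then show ?thesis using M by (simp add: aut2_psl norm_power power_mult_distrib)
qed

text \<open>Automorphy factors at two points differ by a factor depending only on the points, and
  this factor is bounded while one of them ranges over a compact set. So convergence at one point
  carries over uniformly.\<close>

lemma majorant:
  assumes "compact K" "K \<subseteq> upper_half_plane"
  obtains m where "m summable_on R" "\<And>r \<tau>. r \<in> R \<Longrightarrow> \<tau> \<in> K \<Longrightarrow> 1 / (cmod (aut2 r \<tau>))\<^sup>2 \<le> m r"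
    "\<And>r. m r \<ge> 0"
proof -
  obtain \<tau>0 where t0: "\<tau>0 \<in> upper_half_plane" "(\<lambda>r. 1 / (cmod (aut2 r \<tau>0))\<^sup>2) summable_on R"
    by (rule convergence_at_point)
  have "continuous_on K (\<lambda>\<tau>. (1 + cmod (\<tau> - \<tau>0) / Im \<tau>)\<^sup>2)"
    using assms by (intro continuous_intros) (auto simp: upper_half_plane_def)
  then have "bounded ((\<lambda>\<tau>. (1 + cmod (\<tau> - \<tau>0) / Im \<tau>)\<^sup>2) ` K)"
    using assms compact_continuous_image compact_imp_bounded by blast
  then obtain C where C: "C > 0" "\<And>\<tau>. \<tau> \<in> K \<Longrightarrow> (1 + cmod (\<tau> - \<tau>0) / Im \<tau>)\<^sup>2 \<le> C"
    by (auto simp: bounded_pos)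
  show ?thesis
  proof (rule that)
    show "(\<lambda>r. C\<^sup>2 * (1 / (cmod (aut2 r \<tau>0))\<^sup>2)) summable_on R"
      by (rule summable_on_cmult_right) (rule t0)
    fix r \<tau> assume r: "r \<in> R" "\<tau> \<in> K"
    then have pos: "Im \<tau> > 0" using assms by (auto simp: upper_half_plane_def)
    have "cmod (aut2 r \<tau>0) \<le> cmod (aut2 r \<tau>) * (1 + cmod (\<tau> - \<tau>0) / Im \<tau>)\<^sup>2"
      using r pos by (intro aut2_change_point) auto
    also have "\<dots> \<le> cmod (aut2 r \<tau>) * C" using C r by (intro mult_left_mono) auto
    finally have le: "cmod (aut2 r \<tau>0) \<le> cmod (aut2 r \<tau>) * C" .
    have "(cmod (aut2 r \<tau>0))\<^sup>2 \<le> (cmod (aut2 r \<tau>) * C)\<^sup>2" by (rule power_mono[OF le]) simp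
    moreover have "cmod (aut2 r \<tau>) > 0" "cmod (aut2 r \<tau>0) > 0"
      using r pos t0 by (auto simp: Im_act upper_half_plane_def)
    ultimately show "1 / (cmod (aut2 r \<tau>))\<^sup>2 \<le> C\<^sup>2 * (1 / (cmod (aut2 r \<tau>0))\<^sup>2)"
      by (simp add: field_simps power_mult_distrib)
  qed auto
qed

text \<open>A single term of a convergent series of nonnegative terms is at most its sum. Passing to
  the coset representative does not change \<open>aut2\<close>, which extends the bound from
  \<open>R\<close> to all of \<open>G\<close>.\<close>

lemma aut2_lower:
  assumes "compact K" "K \<subseteq> upper_half_plane"
  obtains B where "B > 0" "\<And>g \<tau>. g \<in> G \<Longrightarrow> \<tau> \<in> K \<Longrightarrow> 1 / cmod (aut2 g \<tau>) \<le> B"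
proof -
  obtain m where m: "m summable_on R" "\<And>r \<tau>. r \<in> R \<Longrightarrow> \<tau> \<in> K \<Longrightarrow> 1 / (cmod (aut2 r \<tau>))\<^sup>2 \<le> m r"
    "\<And>r. m r \<ge> 0"
    using majorant[OF assms] by metis
  define S where "S = infsum m R"
  have S0: "S \<ge> 0" unfolding S_def by (rule infsum_nonneg) (use m in auto)
  have *: "1 / cmod (aut2 g \<tau>) \<le> sqrt S" if "g \<in> G" "\<tau> \<in> K" for g \<tau>
  proof -
    have pos: "Im \<tau> > 0" using assms that by (auto simp: upper_half_plane_def)
    obtain n where n: "rep g = T n \<otimes>\<^bsub>PSL2R\<^esub> g" using rep_ex[OF \<open>g \<in> G\<close>] by blast
    have r: "rep g \<in> R" using that by (simp add: R_def)
    have "(1 / cmod (aut2 g \<tau>))\<^sup>2 = 1 / (cmod (aut2 (rep g) \<tau>))\<^sup>2"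
      using that pos by (simp add: n act_T_mult power_divide)
    also have "\<dots> \<le> m (rep g)" using m r that by blast
    also have "\<dots> = sum m {rep g}" by simp
    also have "\<dots> \<le> S" unfolding S_def using m r by (intro finite_sum_le_infsum) auto
    finally show ?thesis by (rule real_le_rsqrt)
  qed
  \<comment> \<open>The summand 1 makes the bound strictly positive.\<close>
  show ?thesis
    by (rule that[of "sqrt S + 1"]) (use * S0 in \<open>force intro: add_nonneg_pos\<close>)+
qed

section \<open>Poincare series of weight six\<close>

text \<open>Weight six appears as \<open>aut2 r \<tau> ^ 3\<close>. The coefficients
  \<open>b\<close> leave room for matrix entries of a representation, so that a vector-valued series
  is handled one scalar component at a time.\<close>

definition poincare_series :: "((real^2^2) set \<Rightarrow> complex) \<Rightarrow> (complex \<Rightarrow> complex) \<Rightarrow> complex \<Rightarrow> complex" where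
  "poincare_series b s \<tau> = (\<Sum>\<^sub>\<infinity>r\<in>R. b r * s (act r \<tau>) / aut2 r \<tau> ^ 3)"

text \<open>The factor |aut2|^-3 is split: |aut2|^-2 is summable, and the remaining |aut2|^-1 is
  bounded by \<open>B\<close>, which also bounds the height of r tau and with it the growth of the
  seed.\<close>

lemma poincare_series_term_bound:
  assumes b: "cmod (b r) \<le> B0" and s: "cmod (s (act r \<tau>)) \<le> exp (C * Im (act r \<tau>))"
    and "r \<in> R" "Im \<tau> > 0" and B: "1 / cmod (aut2 r \<tau>) \<le> B" and m: "1 / (cmod (aut2 r \<tau>))\<^sup>2 \<le> m"
    and "C \<ge> 0" and Y: "Im \<tau> \<le> Y"
  shows "cmod (b r * s (act r \<tau>) / aut2 r \<tau> ^ 3) \<le> B0 * exp (C * (B * Y)) * B * m"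
proof -
  have B0: "B0 \<ge> 0" using b norm_ge_zero order_trans by blast
  have B00: "B \<ge> 0" using B by (meson divide_nonneg_nonneg norm_ge_zero order_trans zero_le_one)
  have "Im (act r \<tau>) = Im \<tau> * (1 / cmod (aut2 r \<tau>))" using assms by (simp add: Im_act)
  also have "\<dots> \<le> Y * B" using assms B00 by (intro mult_mono) auto
  finally have "C * Im (act r \<tau>) \<le> C * (B * Y)" using \<open>C \<ge> 0\<close> by (intro mult_left_mono) (auto simp: mult.commute)
  then have s': "cmod (s (act r \<tau>)) \<le> exp (C * (B * Y))" using s by (meson exp_le_cancel_iff order_trans)
  have "cmod (b r * s (act r \<tau>) / aut2 r \<tau> ^ 3) =
    cmod (b r) * cmod (s (act r \<tau>)) * (1 / cmod (aut2 r \<tau>)) * (1 / (cmod (aut2 r \<tau>))\<^sup>2)"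
    by (simp add: norm_mult norm_divide norm_power power3_eq_cube power2_eq_square)
  also have "\<dots> \<le> B0 * exp (C * (B * Y)) * B * m"
    using b s' B m B0 B00 by (intro mult_mono) auto
  finally show ?thesis .
qed

context
  fixes b :: "(real^2^2) set \<Rightarrow> complex" and s :: "complex \<Rightarrow> complex" and B0 C :: real
  assumes b: "\<And>r. r \<in> R \<Longrightarrow> cmod (b r) \<le> B0"
    and s: "\<And>w. Im w > 0 \<Longrightarrow> cmod (s w) \<le> exp (C * Im w)"
    and C: "C \<ge> 0"
begin

lemma B0_nonneg: "B0 \<ge> 0"
  using b[OF one_in_R] norm_ge_zero order_trans by blast

lemma poincare_series_majorant:
  assumes "compact K" "K \<subseteq> upper_half_plane"
  obtains m where "m summable_on R" "\<And>r \<tau>. r \<in> R \<Longrightarrow> \<tau> \<in> K \<Longrightarrow> cmod (b r * s (act r \<tau>) / aut2 r \<tau> ^ 3) \<le> m r"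
proof -
  obtain m where m: "m summable_on R" "\<And>r \<tau>. r \<in> R \<Longrightarrow> \<tau> \<in> K \<Longrightarrow> 1 / (cmod (aut2 r \<tau>))\<^sup>2 \<le> m r"
    "\<And>r. m r \<ge> 0"
    using majorant[OF assms] by metis
  obtain B where B: "B > 0" "\<And>g \<tau>. g \<in> G \<Longrightarrow> \<tau> \<in> K \<Longrightarrow> 1 / cmod (aut2 g \<tau>) \<le> B"
    using aut2_lower[OF assms] by metis
  have "bounded (Im ` K)" using assms by (intro compact_imp_bounded compact_continuous_image continuous_intros)
  then obtain Y where Y: "\<And>\<tau>. \<tau> \<in> K \<Longrightarrow> \<bar>Im \<tau>\<bar> \<le> Y" unfolding bounded_iff by auto
  show ?thesis
  proof (rule that)
    show "(\<lambda>r. B0 * exp (C * (B * Y)) * B * m r) summable_on R"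
      by (rule summable_on_cmult_right) (rule m)
    fix r \<tau> assume r: "r \<in> R" "\<tau> \<in> K"
    then have pos: "Im \<tau> > 0" using assms by (auto simp: upper_half_plane_def)
    have "cmod (s (act r \<tau>)) \<le> exp (C * Im (act r \<tau>))"
      by (rule s) (use r pos in \<open>simp add: Im_act(2)\<close>)
    then show "cmod (b r * s (act r \<tau>) / aut2 r \<tau> ^ 3) \<le> B0 * exp (C * (B * Y)) * B * m r"
      using r pos B m Y[of \<tau>] C b by (intro poincare_series_term_bound) auto
  qed
qed

lemma poincare_series_summable:
  assumes "\<tau> \<in> upper_half_plane"
  shows "(\<lambda>r. b r * s (act r \<tau>) / aut2 r \<tau> ^ 3) summable_on R"
proof -
  obtain m where "m summable_on R" "\<And>r \<tau>'. r \<in> R \<Longrightarrow> \<tau>' \<in> {\<tau>} \<Longrightarrow> cmod (b r * s (act r \<tau>') / aut2 r \<tau>' ^ 3) \<le> m r"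
    by (rule poincare_series_majorant[of "{\<tau>}"]) (use assms in auto)
  then show ?thesis by (rule norm_infsum_le_infsum(1)) auto
qed

lemma poincare_series_holomorphic:
  assumes hol: "s holomorphic_on upper_half_plane"
  shows "poincare_series b s holomorphic_on upper_half_plane"
proof (rule analytic_imp_holomorphic, unfold analytic_on_def, intro ballI)
  fix z assume "z \<in> upper_half_plane"
  then obtain e where e: "e > 0" "cball z e \<subseteq> upper_half_plane"
    using open_upper by (meson open_contains_cball)
  obtain m where m: "m summable_on R" "\<And>r \<tau>. r \<in> R \<Longrightarrow> \<tau> \<in> cball z e \<Longrightarrow> cmod (b r * s (act r \<tau>) / aut2 r \<tau> ^ 3) \<le> m r"
    using poincare_series_majorant[of "cball z e"] e by auto
  have ulim: "uniform_limit (cball z e) (\<lambda>F \<tau>. \<Sum>r\<in>F. b r * s (act r \<tau>) / aut2 r \<tau> ^ 3) (poincare_series b s) (finite_subsets_at_top R)"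
    unfolding poincare_series_def [abs_def] by (rule Weierstrass_m_test_general[OF m(2) m(1)])
  have hol_term: "(\<lambda>\<tau>. b r * s (act r \<tau>) / aut2 r \<tau> ^ 3) holomorphic_on upper_half_plane" if "r \<in> R" for r
  proof -
    have "s \<circ> act r holomorphic_on upper_half_plane"
      using that by (intro holomorphic_on_compose_gen[OF holomorphic_act(1) hol]) auto
    then show ?thesis using that
      by (intro holomorphic_intros holomorphic_act) (auto simp: o_def upper_half_plane_def Im_act)
  qed
  have hol_sum: "(\<lambda>\<tau>. \<Sum>r\<in>F. b r * s (act r \<tau>) / aut2 r \<tau> ^ 3) holomorphic_on upper_half_plane" if "F \<subseteq> R" for F
    by (rule holomorphic_on_sum) (use that hol_term in auto)
  have ev: "\<forall>\<^sub>F F in finite_subsets_at_top R.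
     continuous_on (cball z e) (\<lambda>\<tau>. \<Sum>r\<in>F. b r * s (act r \<tau>) / aut2 r \<tau> ^ 3) \<and>
     (\<lambda>\<tau>. \<Sum>r\<in>F. b r * s (act r \<tau>) / aut2 r \<tau> ^ 3) holomorphic_on ball z e"
  proof (rule eventually_finite_subsets_at_top_weakI)
    fix F assume "F \<subseteq> R"
    then have "(\<lambda>\<tau>. \<Sum>r\<in>F. b r * s (act r \<tau>) / aut2 r \<tau> ^ 3) holomorphic_on upper_half_plane" by (rule hol_sum)
    then have "(\<lambda>\<tau>. \<Sum>r\<in>F. b r * s (act r \<tau>) / aut2 r \<tau> ^ 3) holomorphic_on cball z e"
      "(\<lambda>\<tau>. \<Sum>r\<in>F. b r * s (act r \<tau>) / aut2 r \<tau> ^ 3) holomorphic_on ball z e"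
      using e by (meson ball_subset_cball holomorphic_on_subset order_trans)+
    then show "continuous_on (cball z e) (\<lambda>\<tau>. \<Sum>r\<in>F. b r * s (act r \<tau>) / aut2 r \<tau> ^ 3) \<and>
     (\<lambda>\<tau>. \<Sum>r\<in>F. b r * s (act r \<tau>) / aut2 r \<tau> ^ 3) holomorphic_on ball z e"
      using holomorphic_on_imp_continuous_on by blast
  qed
  show "\<exists>\<epsilon>>0. poincare_series b s holomorphic_on ball z \<epsilon>"
    by (rule holomorphic_uniform_limit[OF ev ulim]) (use e in auto)
qed

text \<open>The estimate is for the series transported by \<open>A\<close>, so that it serves every
  cusp. The factors of r A at w are compared with those at the point below w on the segment
  \<open>L\<close>, whose image under \<open>A\<close> is compact.\<close>

lemma poincare_series_growth:
  assumes A: "A \<in> carrier PSL2R" and h': "h' \<ge> 0"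
  obtains K1 K2 where "\<And>w. 0 \<le> Re w \<Longrightarrow> Re w \<le> h' \<Longrightarrow> Im w \<ge> 1 \<Longrightarrow>
    cmod (poincare_series b s (act A w) / aut2 A w ^ 3) \<le> K1 * exp (K2 * Im w)"
proof -
  define L where "L = cbox (Complex 0 1) (Complex h' 1)"
  define K where "K = act A ` L"
  have L: "compact L" "L \<subseteq> upper_half_plane" by (auto simp: L_def in_cbox_complex_iff upper_half_plane_def)
  have K: "compact K" "K \<subseteq> upper_half_plane"
    unfolding K_def using L A by (auto intro!: compact_continuous_image holomorphic_on_imp_continuous_on holomorphic_act)
  obtain m where m: "m summable_on R" "\<And>r \<tau>. r \<in> R \<Longrightarrow> \<tau> \<in> K \<Longrightarrow> 1 / (cmod (aut2 r \<tau>))\<^sup>2 \<le> m r"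
    "\<And>r. m r \<ge> 0"
    using majorant[OF K] by metis
  obtain B where B: "B > 0" "\<And>g \<tau>. g \<in> G \<Longrightarrow> \<tau> \<in> K \<Longrightarrow> 1 / cmod (aut2 g \<tau>) \<le> B"
    using aut2_lower[OF K] by metis
  have "continuous_on L (\<lambda>w. 1 / cmod (aut2 A w))"
    using L A by (intro continuous_intros holomorphic_on_imp_continuous_on holomorphic_act)
      (auto simp: upper_half_plane_def Im_act subset_iff)
  then have "bounded ((\<lambda>w. 1 / cmod (aut2 A w)) ` L)"
    using L compact_continuous_image compact_imp_bounded by blast
  then obtain a where a: "a > 0" "\<And>w. w \<in> L \<Longrightarrow> 1 / cmod (aut2 A w) \<le> a" unfolding bounded_pos by auto
  show ?thesis
  proof (rule that[of "B0 * (B * a) * (a\<^sup>2 * infsum m R)" "C * (B * a)"])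
    fix w assume w: "0 \<le> Re w" "Re w \<le> h'" "Im w \<ge> 1"
    define w0 where "w0 = Complex (Re w) 1"
    have w0: "w0 \<in> L" "act A w0 \<in> K" using w by (auto simp: w0_def L_def K_def in_cbox_complex_iff)
    have pos: "Im w > 0" "Im w0 > 0" using w by (auto simp: w0_def)
    have mono: "cmod (aut2 g w0) \<le> cmod (aut2 g w)" if g: "g \<in> carrier PSL2R" for g
    proof -
      from g obtain M where M: "det M = 1" "g = psl M" by (rule carrier_PSL2R_cases)
      then show ?thesis using aut_mono_Im[OF w(3), of M] by (simp add: aut2_psl norm_power w0_def power_mono)
    qed
    have bound: "cmod (b r * s (act r (act A w)) / (aut2 r (act A w) ^ 3 * aut2 A w ^ 3)) \<le>
        B0 * exp (C * ((B * a) * Im w)) * (B * a) * (m r * a\<^sup>2)" if r: "r \<in> R" for r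
    proof -
      define g where "g = r \<otimes>\<^bsub>PSL2R\<^esub> A"
      have g: "g \<in> carrier PSL2R" using r A by (simp add: g_def)
      have eq: "aut2 g w = aut2 r (act A w) * aut2 A w" "act g w = act r (act A w)"
        "aut2 g w0 = aut2 r (act A w0) * aut2 A w0"
        using r A pos by (simp_all add: g_def act_mult)
      have nz: "cmod (aut2 g w0) > 0" "cmod (aut2 g w) > 0" using g pos by (simp_all add: Im_act)
      have 1: "1 / cmod (aut2 g w) \<le> 1 / cmod (aut2 g w0)"
        using mono[OF g] nz by (intro divide_left_mono) auto
      also have "\<dots> = (1 / cmod (aut2 r (act A w0))) * (1 / cmod (aut2 A w0))" by (simp add: eq norm_mult)
      also have "\<dots> \<le> B * a" using B a w0 r by (intro mult_mono) (auto intro: less_imp_le)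
      finally have 2: "1 / cmod (aut2 g w) \<le> B * a" .
      have "1 / (cmod (aut2 g w))\<^sup>2 \<le> 1 / (cmod (aut2 g w0))\<^sup>2"
        using power_mono[OF 1, of 2] by (simp add: power_divide)
      also have "\<dots> = (1 / (cmod (aut2 r (act A w0)))\<^sup>2) * (1 / cmod (aut2 A w0))\<^sup>2"
        by (simp add: eq norm_mult power_mult_distrib power_divide)
      also have "\<dots> \<le> m r * a\<^sup>2" using m a w0 r by (intro mult_mono power_mono) auto
      finally have 3: "1 / (cmod (aut2 g w))\<^sup>2 \<le> m r * a\<^sup>2" .
      have 4: "Im (act g w) \<le> (B * a) * Im w"
      proof -
        have "Im (act g w) = (1 / cmod (aut2 g w)) * Im w" using g pos by (simp add: Im_act)
        also have "\<dots> \<le> (B * a) * Im w" using 2 pos by (intro mult_right_mono) auto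
        finally show ?thesis .
      qed
      have "cmod (s (act g w)) \<le> exp (C * Im (act g w))"
        by (rule s) (use g pos in \<open>simp add: Im_act(2)\<close>)
      also have "\<dots> \<le> exp (C * ((B * a) * Im w))" using 4 C by (simp add: mult_left_mono)
      finally have 5: "cmod (s (act g w)) \<le> exp (C * ((B * a) * Im w))" .
      have "cmod (b r * s (act r (act A w)) / (aut2 r (act A w) ^ 3 * aut2 A w ^ 3)) =
        cmod (b r) * cmod (s (act g w)) * (1 / cmod (aut2 g w)) * (1 / (cmod (aut2 g w))\<^sup>2)"
        by (simp add: eq norm_mult norm_divide norm_power power3_eq_cube power2_eq_square)
      also have "\<dots> \<le> B0 * exp (C * ((B * a) * Im w)) * (B * a) * (m r * a\<^sup>2)"
        using b[OF r] 5 2 3 B0_nonneg B a by (intro mult_mono) auto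
      finally show ?thesis .
    qed
    have "poincare_series b s (act A w) / aut2 A w ^ 3 = (\<Sum>\<^sub>\<infinity>r\<in>R. b r * s (act r (act A w)) / aut2 r (act A w) ^ 3 * (1 / aut2 A w ^ 3))"
      unfolding poincare_series_def by (subst infsum_cmult_left') simp
    also have "\<dots> = (\<Sum>\<^sub>\<infinity>r\<in>R. b r * s (act r (act A w)) / (aut2 r (act A w) ^ 3 * aut2 A w ^ 3))"
      by (rule infsum_cong) simp
    finally have eq: "poincare_series b s (act A w) / aut2 A w ^ 3 = \<dots>" .
    have "(\<lambda>r. (B0 * exp (C * ((B * a) * Im w)) * (B * a) * a\<^sup>2) * m r) summable_on R"
      by (rule summable_on_cmult_right) (rule m)
    then have "(\<lambda>r. B0 * exp (C * ((B * a) * Im w)) * (B * a) * (m r * a\<^sup>2)) summable_on R"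
      by (simp add: mult_ac)
    from norm_infsum_le_infsum(2)[OF this bound]
    have "cmod (poincare_series b s (act A w) / aut2 A w ^ 3) \<le> (\<Sum>\<^sub>\<infinity>r\<in>R. B0 * exp (C * ((B * a) * Im w)) * (B * a) * (m r * a\<^sup>2))"
      unfolding eq .
    also have "\<dots> = (\<Sum>\<^sub>\<infinity>r\<in>R. (B0 * exp (C * ((B * a) * Im w)) * (B * a) * a\<^sup>2) * m r)"
      by (simp add: mult_ac)
    also have "\<dots> = (B0 * exp (C * ((B * a) * Im w)) * (B * a) * a\<^sup>2) * infsum m R"
      by (rule infsum_cmult_right')
    also have "\<dots> = B0 * (B * a) * (a\<^sup>2 * infsum m R) * exp (C * (B * a) * Im w)" by (simp add: mult_ac)
    finally show "cmod (poincare_series b s (act A w) / aut2 A w ^ 3) \<le> \<dots>" .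
  qed
qed

text \<open>Every coset other than that of the translations has lower left entry bounded away from
  0, so |c tau + d|^2 grows at least like y^2 on the imaginary axis. One factor 1/|aut2| supplies
  the decay, the other two the summability.\<close>

lemma poincare_series_at_infinity:
  obtains K where "\<And>y. y \<ge> 1 \<Longrightarrow> cmod (poincare_series b s (Complex 0 y) - b \<one>\<^bsub>PSL2R\<^esub> * s (Complex 0 y)) \<le> K / y\<^sup>2"
proof -
  define K where "K = cbox (Complex 0 1) (Complex h 1)"
  have K: "compact K" "K \<subseteq> upper_half_plane" by (auto simp: K_def in_cbox_complex_iff upper_half_plane_def)
  obtain m where m: "m summable_on R" "\<And>r \<tau>. r \<in> R \<Longrightarrow> \<tau> \<in> K \<Longrightarrow> 1 / (cmod (aut2 r \<tau>))\<^sup>2 \<le> m r"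
    "\<And>r. m r \<ge> 0"
    using majorant[OF K] by metis
  obtain B where B: "B > 0" "\<And>g \<tau>. g \<in> G \<Longrightarrow> \<tau> \<in> K \<Longrightarrow> 1 / cmod (aut2 g \<tau>) \<le> B"
    using aut2_lower[OF K] by metis
  have c: "1 \<le> B * (M$2$1)\<^sup>2" if M: "det M = 1" "psl M \<in> G" "psl M \<notin> range T" for M :: "real^2^2"
  proof -
    have c0: "M$2$1 \<noteq> 0"
    proof
      assume "M$2$1 = 0"
      then have "boundary_act (psl M) Infty = Infty" by (simp add: boundary_act_psl)
      then show False using stab M by (auto simp: T_def)
    qed
    text \<open>Translating the zero of the denominator into the compact segment bounds the lower left entry from below.\<close>
    define n where "n = \<lfloor>- (M$2$2) / M$2$1 / h\<rfloor>"
    define x where "x = - (M$2$2) / M$2$1 - of_int n * h"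
    have "of_int n * h \<le> - (M$2$2) / M$2$1" "- (M$2$2) / M$2$1 < (of_int n + 1) * h"
      using h floor_correct[of "- (M$2$2) / M$2$1 / h"]
      unfolding n_def by (simp_all only: pos_le_divide_eq pos_divide_less_eq of_int_add of_int_1)
    then have x: "Complex x 1 \<in> K" by (simp add: K_def x_def in_cbox_complex_iff algebra_simps)
    have g: "psl M \<otimes>\<^bsub>PSL2R\<^esub> T n \<in> G" using M by simp
    have "aut2 (psl M \<otimes>\<^bsub>PSL2R\<^esub> T n) (Complex x 1) = aut2 (psl M) (Complex x 1 + of_int n * of_real h)"
      using M by (simp add: act_mult psl_in_carrier act_T)
    also have "\<dots> = (aut M (Complex x 1 + of_int n * of_real h))\<^sup>2" using M by (simp add: aut2_psl)
    also have "aut M (Complex x 1 + of_int n * of_real h) = of_real (M$2$1) * \<i>"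
      using c0 by (simp add: aut_def x_def complex_eq_iff algebra_simps)
    finally have "cmod (aut2 (psl M \<otimes>\<^bsub>PSL2R\<^esub> T n) (Complex x 1)) = (M$2$1)\<^sup>2"
      by (simp add: norm_power norm_mult)
    then have "1 / (M$2$1)\<^sup>2 \<le> B" using B(2)[OF g x] by simp
    then show ?thesis using c0 by (simp add: field_simps)
  qed
  show ?thesis
  proof (rule that)
    fix y :: real assume y: "y \<ge> 1"
    define \<tau> where "\<tau> = Complex 0 y"
    have up: "\<tau> \<in> upper_half_plane" "Im \<tau> > 0" using y by (auto simp: \<tau>_def upper_half_plane_def)
    have i: "\<i> \<in> K" using h by (auto simp: K_def in_cbox_complex_iff)
    have bound: "cmod (b r * s (act r \<tau>) / aut2 r \<tau> ^ 3) \<le> (B0 * exp (C * B) * (B / y\<^sup>2)) * m r"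
      if r: "r \<in> R - {\<one>\<^bsub>PSL2R\<^esub>}" for r
    proof -
      have rG: "r \<in> G" "r \<in> carrier PSL2R" using r by auto
      then obtain M where M: "det M = 1" "r = psl M" using carrier_PSL2R_cases by metis
      have "r \<notin> range T" using r R_stab by auto
      then have c1: "1 \<le> B * (M$2$1)\<^sup>2" using c M rG by simp
      have a: "cmod (aut2 r \<tau>) = (M$2$1)\<^sup>2 * y\<^sup>2 + (M$2$2)\<^sup>2"
        unfolding M(2) by (simp add: aut2_psl[OF M(1)] norm_power cmod_power2 aut_def \<tau>_def power_mult_distrib)
      have "y\<^sup>2 * 1 \<le> y\<^sup>2 * (B * (M$2$1)\<^sup>2)" using c1 by (intro mult_left_mono) auto
      also have "\<dots> \<le> B * cmod (aut2 r \<tau>)" using B a by (simp add: algebra_simps)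
      finally have y2: "y\<^sup>2 \<le> B * cmod (aut2 r \<tau>)" by simp
      have nz: "cmod (aut2 r \<tau>) > 0" using rG up by (simp add: Im_act)
      have 1: "1 / cmod (aut2 r \<tau>) \<le> B / y\<^sup>2" using y2 nz y by (simp add: field_simps)
      have ai: "cmod (aut2 r \<i>) = (M$2$1)\<^sup>2 + (M$2$2)\<^sup>2"
        unfolding M(2) by (simp add: aut2_psl[OF M(1)] norm_power cmod_power2 aut_def)
      have nzi: "cmod (aut2 r \<i>) > 0" using rG by (simp add: Im_act)
      have "(M$2$1)\<^sup>2 * 1 \<le> (M$2$1)\<^sup>2 * y\<^sup>2" using y by (intro mult_left_mono) auto
      then have "cmod (aut2 r \<i>) \<le> cmod (aut2 r \<tau>)" by (simp add: a ai)
      then have "(cmod (aut2 r \<i>))\<^sup>2 \<le> (cmod (aut2 r \<tau>))\<^sup>2" by (intro power_mono) auto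
      then have "1 / (cmod (aut2 r \<tau>))\<^sup>2 \<le> 1 / (cmod (aut2 r \<i>))\<^sup>2" using nz nzi by (intro divide_left_mono) auto
      also have "\<dots> \<le> m r" using m i r by blast
      finally have 2: "1 / (cmod (aut2 r \<tau>))\<^sup>2 \<le> m r" .
      have "Im (act r \<tau>) = y * (1 / cmod (aut2 r \<tau>))" using rG up by (simp add: Im_act \<tau>_def)
      also have "\<dots> \<le> y * (B / y\<^sup>2)" using 1 y by (intro mult_left_mono) auto
      also have "\<dots> = B / y" using y by (simp add: power2_eq_square)
      also have "\<dots> \<le> B" using y B by (simp add: field_simps)
      finally have "C * Im (act r \<tau>) \<le> C * B" using C by (rule mult_left_mono)
      moreover have "cmod (s (act r \<tau>)) \<le> exp (C * Im (act r \<tau>))"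
        by (rule s) (use rG up in \<open>simp add: Im_act(2)\<close>)
      ultimately have 3: "cmod (s (act r \<tau>)) \<le> exp (C * B)" by (meson exp_le_cancel_iff order_trans)
      have "cmod (b r * s (act r \<tau>) / aut2 r \<tau> ^ 3) =
        cmod (b r) * cmod (s (act r \<tau>)) * (1 / cmod (aut2 r \<tau>)) * (1 / (cmod (aut2 r \<tau>))\<^sup>2)"
        by (simp add: norm_mult norm_divide norm_power power3_eq_cube power2_eq_square)
      also have "\<dots> \<le> B0 * exp (C * B) * (B / y\<^sup>2) * m r"
        using b[of r] r 1 2 3 B0_nonneg B by (intro mult_mono) auto
      finally show ?thesis .
    qed
    have sm: "m summable_on (R - {\<one>\<^bsub>PSL2R\<^esub>})"
      by (rule summable_on_subset_banach[OF m(1)]) auto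
    then have sm': "(\<lambda>r. (B0 * exp (C * B) * (B / y\<^sup>2)) * m r) summable_on (R - {\<one>\<^bsub>PSL2R\<^esub>})"
      by (rule summable_on_cmult_right)
    have Rins: "R = insert \<one>\<^bsub>PSL2R\<^esub> (R - {\<one>\<^bsub>PSL2R\<^esub>})" by auto
    have "poincare_series b s \<tau> = b \<one>\<^bsub>PSL2R\<^esub> * s (act \<one>\<^bsub>PSL2R\<^esub> \<tau>) / aut2 \<one>\<^bsub>PSL2R\<^esub> \<tau> ^ 3 +
       (\<Sum>\<^sub>\<infinity>r\<in>R - {\<one>\<^bsub>PSL2R\<^esub>}. b r * s (act r \<tau>) / aut2 r \<tau> ^ 3)"
      unfolding poincare_series_def by (subst Rins, subst infsum_insert)
        (use norm_infsum_le_infsum(1)[OF sm' bound] in auto)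
    then have "cmod (poincare_series b s \<tau> - b \<one>\<^bsub>PSL2R\<^esub> * s \<tau>) = cmod (\<Sum>\<^sub>\<infinity>r\<in>R - {\<one>\<^bsub>PSL2R\<^esub>}. b r * s (act r \<tau>) / aut2 r \<tau> ^ 3)"
      by simp
    also have "\<dots> \<le> (\<Sum>\<^sub>\<infinity>r\<in>R - {\<one>\<^bsub>PSL2R\<^esub>}. (B0 * exp (C * B) * (B / y\<^sup>2)) * m r)"
      by (rule norm_infsum_le_infsum(2)[OF sm' bound])
    also have "\<dots> = (B0 * exp (C * B) * (B / y\<^sup>2)) * infsum m (R - {\<one>\<^bsub>PSL2R\<^esub>})"
      by (rule infsum_cmult_right')
    finally show "cmod (poincare_series b s (Complex 0 y) - b \<one>\<^bsub>PSL2R\<^esub> * s (Complex 0 y)) \<le>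
       (B0 * exp (C * B) * B * infsum m (R - {\<one>\<^bsub>PSL2R\<^esub>})) / y\<^sup>2"
      by (simp add: \<tau>_def)
  qed
qed

end

end

section \<open>Jensen's inequality\<close>

abbreviation unit_exp :: "real \<Rightarrow> complex" where
  "unit_exp t \<equiv> exp (2 * of_real pi * \<i> * of_real t)"

text \<open>On a disc without zeros \<open>E\<close> has a holomorphic logarithm, and ln |E| is its
  real part. The circle mean is then the value at the centre by Cauchy's formula.\<close>

lemma mean_ln_nonvanishing:
  assumes hol: "E holomorphic_on ball 0 s" and nz: "\<And>w. w \<in> ball 0 s \<Longrightarrow> E w \<noteq> 0" and \<zeta>: "cmod \<zeta> < s"
  shows "((\<lambda>t. ln (cmod (E (\<zeta> * unit_exp t)))) has_integral ln (cmod (E 0))) {0..1}"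
proof -
  have s: "s > 0" using \<zeta> norm_ge_zero le_less_trans by blast
  obtain e where e: "e holomorphic_on ball 0 s" "\<And>x. x \<in> ball 0 s \<Longrightarrow> exp (e x) = E x"
    using holomorphic_logarithm_exists[of "ball 0 s" E 0] hol nz s by auto
  have ln: "ln (cmod (E w)) = Re (e w)" if "w \<in> ball 0 s" for w
    using e(2)[OF that] by (metis norm_exp_eq_Re ln_exp)
  have sub: "(\<lambda>z. \<zeta> * z) ` cball 0 1 \<subseteq> ball 0 s"
  proof
    fix w assume "w \<in> (\<lambda>z. \<zeta> * z) ` cball 0 1"
    then obtain z where "w = \<zeta> * z" "z \<in> cball 0 1" by (rule imageE)
    then have "w = \<zeta> * z" "cmod z \<le> 1" by auto
    then have "cmod w \<le> cmod \<zeta> * 1" unfolding norm_mult \<open>w = \<zeta> * z\<close> by (intro mult_left_mono) auto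
    then show "w \<in> ball 0 s" using \<zeta> by simp
  qed
  have hol': "(\<lambda>z. e (\<zeta> * z)) holomorphic_on cball 0 1"
    using holomorphic_on_compose_gen[OF _ e(1) sub, unfolded o_def] by (simp add: holomorphic_intros)
  have vd: "vector_derivative unit_exp (at x) = 2 * of_real pi * \<i> * unit_exp x" for x
    using vector_derivative_circlepath[of 0 1 x] by (simp add: circlepath)
  from Cauchy_integral_circlepath_simple[OF hol', of 0]
  have "((\<lambda>t. e (\<zeta> * unit_exp t) / unit_exp t * (2 * of_real pi * \<i> * unit_exp t)) has_integral 2 * of_real pi * \<i> * e 0) {0..1}"
    by (simp add: has_contour_integral circlepath vd)
  then have "((\<lambda>t. (2 * of_real pi * \<i>) * e (\<zeta> * unit_exp t)) has_integral 2 * of_real pi * \<i> * e 0) {0..1}"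
    by (simp add: mult_ac)
  from has_integral_mult_right[OF this, of "1 / (2 * of_real pi * \<i>)"]
  have "((\<lambda>t. e (\<zeta> * unit_exp t)) has_integral e 0) {0..1}" by simp
  then have "((\<lambda>t. Re (e (\<zeta> * unit_exp t))) has_integral Re (e 0)) {0..1}" by (rule has_integral_Re)
  moreover have "Re (e (\<zeta> * unit_exp t)) = ln (cmod (E (\<zeta> * unit_exp t)))" for t
    using \<zeta> by (intro ln[symmetric]) (simp add: norm_mult)
  ultimately show ?thesis using s by (simp add: ln)
qed

text \<open>If a lies outside the circle, z - a has no zero inside. If a lies inside, z - a is
  replaced by a function of the same modulus on the circle whose zero is the mirror image of a in
  the circle.\<close>

lemma mean_ln_linear:
  assumes "cmod \<zeta> \<noteq> cmod a" "\<zeta> \<noteq> 0"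
  shows "((\<lambda>t. ln (cmod (\<zeta> * unit_exp t - a))) has_integral ln (max (cmod \<zeta>) (cmod a))) {0..1}"
proof (cases "cmod \<zeta> < cmod a")
  case True
  have "((\<lambda>t. ln (cmod (\<zeta> * unit_exp t - a))) has_integral ln (cmod (0 - a))) {0..1}"
    using True by (intro mean_ln_nonvanishing[where s = "cmod a" and E = "\<lambda>z. z - a"]) (auto intro!: holomorphic_intros)
  then show ?thesis using True by (simp add: max_def)
next
  case False
  then have lt: "cmod a < cmod \<zeta>" using assms by simp
  define r where "r = cmod \<zeta>"
  have r: "r > 0" using assms by (simp add: r_def)
  \<comment> \<open>For |z| = r one has r^2 - cnj a z = z cnj (z - a), hence |E z| = |z - a|; at 0
    the modulus of \<open>E\<close> is r.\<close>
  define E where "E z = (of_real (r\<^sup>2) - cnj a * z) / of_real r" for z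
  \<comment> \<open>The zero of \<open>E\<close> has modulus r^2 / |a|; for a = 0 there is none, and
    any radius beyond r will do.\<close>
  define s where "s = (if a = 0 then r + 1 else r\<^sup>2 / cmod a)"
  have "r < s" using lt r by (auto simp: s_def r_def[symmetric] field_simps power2_eq_square)
  have nz: "E z \<noteq> 0" if "z \<in> ball 0 s" for z
  proof
    assume "E z = 0"
    then have "cnj a * z = of_real (r\<^sup>2)" using r by (simp add: E_def)
    then have "cmod a * cmod z = r\<^sup>2" using r by (metis complex_mod_cnj norm_mult norm_of_real abs_power2)
    then show False using that r by (auto simp: s_def field_simps split: if_splits)
  qed
  have "((\<lambda>t. ln (cmod (E (\<zeta> * unit_exp t)))) has_integral ln (cmod (E 0))) {0..1}"
    using \<open>r < s\<close> nz r by (intro mean_ln_nonvanishing[where s = s]) (auto simp: E_def[abs_def] r_def intro!: holomorphic_intros)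
  moreover have "cmod (E 0) = r" using r by (simp add: E_def norm_divide power2_eq_square norm_mult)
  moreover have "cmod (E z) = cmod (z - a)" if "cmod z = r" for z
  proof -
    have "of_real (r\<^sup>2) - cnj a * z = z * cnj (z - a)"
      using complex_norm_square[of z] that by (simp add: algebra_simps)
    then have "cmod (E z) = cmod z * cmod (z - a) / r" using r by (simp add: E_def norm_divide norm_mult flip: complex_cnj_diff)
    then show ?thesis using that r by simp
  qed
  then have "cmod (E (\<zeta> * unit_exp t)) = cmod (\<zeta> * unit_exp t - a)" for t
    by (simp add: r_def norm_mult)
  ultimately show ?thesis using lt by (simp add: r_def max_def)
qed

text \<open>\<open>zorder_exist_zero\<close> factors f near a only. The cofactor extends to all of S
  because away from a it is f divided by a power of w - a. If f does not vanish at a, the exponent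
  is 0.\<close>

lemma factor_one_zero:
  assumes hol: "f holomorphic_on S" and S: "open S" "connected S" "a \<in> S" and nc: "\<exists>w\<in>S. f w \<noteq> 0"
  obtains g where "g holomorphic_on S" "g a \<noteq> 0" "\<And>w. w \<in> S \<Longrightarrow> f w = (w - a) ^ nat (zorder f a) * g w"
proof -
  define n where "n = nat (zorder f a)"
  obtain r where r: "r > 0" "cball a r \<subseteq> S" "zor_poly f a holomorphic_on cball a r"
    "\<And>w. w \<in> cball a r \<Longrightarrow> f w = zor_poly f a w * (w - a) ^ n \<and> zor_poly f a w \<noteq> 0"
    using zorder_exist_zero[OF hol S nc] unfolding n_def by blast
  define g where "g w = (if w = a then zor_poly f a a else f w / (w - a) ^ n)" for w
  have eq: "g w = zor_poly f a w" if "w \<in> ball a r" for w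
    using r(4)[of w] that by (auto simp: g_def)
  have "g holomorphic_on ball a r"
    by (rule holomorphic_transform[OF holomorphic_on_subset[OF r(3)]]) (auto simp: eq)
  moreover have "g holomorphic_on (S - {a})"
  proof (rule holomorphic_transform)
    show "(\<lambda>w. f w / (w - a) ^ n) holomorphic_on (S - {a})"
      by (intro holomorphic_intros holomorphic_on_subset[OF hol]) auto
  qed (auto simp: g_def)
  ultimately have "g holomorphic_on ball a r \<union> (S - {a})"
    using S by (intro holomorphic_on_Un) auto
  moreover have "ball a r \<union> (S - {a}) = S" using r by (auto simp: subset_iff)
  ultimately have "g holomorphic_on S" by simp
  moreover have "g a \<noteq> 0" using r by (simp add: g_def)
  moreover have "f w = (w - a) ^ n * g w" if "w \<in> S" for w
    using r(4)[of a] r(1) by (cases "w = a") (auto simp: g_def)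
  ultimately show ?thesis using that n_def by blast
qed

lemma factor_zeros:
  assumes "finite A" "f holomorphic_on S" "open S" "connected S" "A \<subseteq> S" "\<exists>w\<in>S. f w \<noteq> 0"
  obtains m :: "complex \<Rightarrow> nat" and g where "g holomorphic_on S" "\<And>a. a \<in> A \<Longrightarrow> g a \<noteq> 0"
    "\<And>w. w \<in> S \<Longrightarrow> f w = (\<Prod>a\<in>A. (w - a) ^ m a) * g w"
  using assms(1,5)
proof (induction A arbitrary: thesis rule: finite_induct)
  case empty
  show ?case by (rule empty(1)[of f]) (use assms in auto)
next
  case (insert b A)
  obtain m g where g: "g holomorphic_on S" "\<And>a. a \<in> A \<Longrightarrow> g a \<noteq> 0"
    "\<And>w. w \<in> S \<Longrightarrow> f w = (\<Prod>a\<in>A. (w - a) ^ m a) * g w"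
    by (rule insert.IH) (use insert.prems in auto)
  have ne: "\<exists>w\<in>S. g w \<noteq> 0" using assms(6) g(3) by force
  have bS: "b \<in> S" using insert.prems by simp
  obtain k where k: "k holomorphic_on S" "k b \<noteq> 0" "\<And>w. w \<in> S \<Longrightarrow> g w = (w - b) ^ nat (zorder g b) * k w"
    using factor_one_zero[OF g(1) assms(3,4) bS ne] by blast
  show ?case
  proof (rule insert.prems(1))
    show "k holomorphic_on S" by fact
    fix a assume "a \<in> insert b A"
    then consider "a = b" | "a \<in> A" "a \<in> S" using insert.prems by auto
    then show "k a \<noteq> 0"
    proof cases
      case 2
      then show ?thesis using g(2)[of a] k(3)[of a] by auto
    qed (use k in simp)
  next
    fix w assume "w \<in> S"
    have "(\<Prod>a\<in>A. (w - a) ^ (m(b := nat (zorder g b))) a) = (\<Prod>a\<in>A. (w - a) ^ m a)"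
      using insert.hyps by (intro prod.cong) auto
    then show "f w = (\<Prod>a\<in>insert b A. (w - a) ^ (m(b := nat (zorder g b))) a) * k w"
      using insert.hyps g(3) k(3) \<open>w \<in> S\<close> by (simp add: mult_ac)
  qed
qed

lemma finite_zeros_compact:
  assumes "f holomorphic_on S" "open S" "connected S" "compact K" "K \<subseteq> S" "\<exists>w\<in>S. f w \<noteq> 0"
  shows "finite {z\<in>K. f z = 0}"
proof (cases "f constant_on S")
  case True
  then have "{z\<in>K. f z = 0} = {}" using assms unfolding constant_on_def by (metis (mono_tags, lifting) empty_Collect_eq subsetD)
  then show ?thesis by (simp only: finite.emptyI)
next
  case False
  then show ?thesis using holomorphic_compact_finite_zeros assms by blast
qed

text \<open>Jensen's formula as an inequality. A zero of modulus below 1/8 gains at least ln 2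
  against a circle of radius above 1/4, once per multiplicity, and every other zero contributes
  something nonnegative. The radii in \<open>Bad\<close> are those of circles through a
  zero.\<close>

proposition jensen_disc:
  assumes hol: "F holomorphic_on ball 0 1" and F0: "F 0 \<noteq> 0"
  obtains Bad :: "real set" where "finite Bad"
    "\<And>\<zeta> Z. \<lbrakk>1/4 < cmod \<zeta>; cmod \<zeta> < 1/2; cmod \<zeta> \<notin> Bad; finite Z; Z \<subseteq> {a. cmod a < 1/8 \<and> F a = 0}\<rbrakk> \<Longrightarrow>
       (\<forall>t. F (\<zeta> * unit_exp t) \<noteq> 0) \<and>
       (\<exists>I. ((\<lambda>t. ln (cmod (F (\<zeta> * unit_exp t)))) has_integral I) {0..1} \<and>
         ln (cmod (F 0)) + ln 2 * (\<Sum>a\<in>Z. real_of_int (zorder F a)) \<le> I)"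
proof -
  \<comment> \<open>The radius 3/4 lies strictly between the circles in question, of radius below
    1/2, and the unit circle, where zeros may accumulate.\<close>
  define A where "A = {z\<in>cball 0 (3/4). F z = 0}"
  have nc: "\<exists>w\<in>ball 0 1. F w \<noteq> 0" using F0 by (intro bexI[of _ 0]) auto
  have sub: "cball 0 (3/4) \<subseteq> ball (0::complex) 1" by auto
  have finA: "finite A" unfolding A_def
    using hol nc sub by (intro finite_zeros_compact[where S = "ball 0 1"]) auto
  have Asub: "A \<subseteq> ball 0 1" using sub by (auto simp: A_def)
  obtain m g where g: "g holomorphic_on ball 0 1" "\<And>a. a \<in> A \<Longrightarrow> g a \<noteq> 0"
    "\<And>w. w \<in> ball 0 1 \<Longrightarrow> F w = (\<Prod>a\<in>A. (w - a) ^ m a) * g w"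
    by (rule factor_zeros[OF finA hol _ _ Asub nc]) auto
  have gnz: "g w \<noteq> 0" if "w \<in> ball 0 (3/4)" for w
    using g that A_def by (cases "w \<in> A") force+
  have zord: "zorder F a = int (m a)" if "a \<in> A" for a
  proof (rule zorder_eqI[of "ball 0 1" _ "\<lambda>w. (\<Prod>a'\<in>A - {a}. (w - a') ^ m a') * g w"])
    show "(\<lambda>w. (\<Prod>a'\<in>A - {a}. (w - a') ^ m a') * g w) holomorphic_on ball 0 1"
      by (intro holomorphic_intros g)
    show "(\<Prod>a'\<in>A - {a}. (a - a') ^ m a') * g a \<noteq> 0"
      using that finA g by auto
    show "F w = ((\<Prod>a'\<in>A - {a}. (w - a') ^ m a') * g w) * (w - a) powi int (m a)" if "w \<in> ball 0 1" for w
      using g(3)[OF that] finA \<open>a \<in> A\<close> by (simp add: prod.remove mult_ac)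
  qed (use that Asub in auto)
  show ?thesis
  proof (rule that[of "cmod ` A"])
    fix \<zeta> Z assume \<zeta>: "1/4 < cmod \<zeta>" "cmod \<zeta> < 1/2" "cmod \<zeta> \<notin> cmod ` A"
      and Z: "finite Z" "Z \<subseteq> {a. cmod a < 1/8 \<and> F a = 0}"
    have circ: "cmod (\<zeta> * unit_exp t) = cmod \<zeta>" for t by (simp add: norm_mult)
    have circ': "\<zeta> * unit_exp t \<noteq> a" if "a \<in> A" for t a using circ[of t] \<zeta>(3) that by (metis imageI)
    have ball: "\<zeta> * unit_exp t \<in> ball 0 1" "\<zeta> * unit_exp t \<in> ball 0 (3/4)" for t
      using circ[of t] \<zeta> by auto
    have nz: "F (\<zeta> * unit_exp t) \<noteq> 0" for t
      using g(3)[OF ball(1)[of t]] gnz[OF ball(2)[of t]] circ' finA by auto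
    have lnF: "ln (cmod (F w)) = (\<Sum>a\<in>A. real (m a) * ln (cmod (w - a))) + ln (cmod (g w))"
      if "w \<in> ball 0 (3/4)" "w \<notin> A" for w
    proof -
      have "cmod (F w) = (\<Prod>a\<in>A. cmod (w - a) ^ m a) * cmod (g w)"
        using g(3)[of w] that by (simp add: norm_mult prod_norm[symmetric] norm_power)
      moreover have pos: "cmod (w - a) ^ m a > 0" if "a \<in> A" for a using that \<open>w \<notin> A\<close> by (intro zero_less_power) auto
      moreover have "(\<Prod>a\<in>A. cmod (w - a) ^ m a) > 0" using pos by (rule prod_pos)
      ultimately have "ln (cmod (F w)) = ln (\<Prod>a\<in>A. cmod (w - a) ^ m a) + ln (cmod (g w))"
        using gnz[OF that(1)] by (simp add: ln_mult)
      also have "ln (\<Prod>a\<in>A. cmod (w - a) ^ m a) = (\<Sum>a\<in>A. ln (cmod (w - a) ^ m a))"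
        by (intro ln_prod finA) (metis pos less_irrefl)
      also have "\<dots> = (\<Sum>a\<in>A. real (m a) * ln (cmod (w - a)))"
        using that by (intro sum.cong) (auto simp: ln_realpow)
      finally show ?thesis .
    qed
    \<comment> \<open>The mean of ln |z - a| over the circle is ln max(|zeta|, |a|), and
      \<open>g\<close>, which has no zeros in the disc of radius 3/4, contributes its value at
      0.\<close>
    define I where "I = (\<Sum>a\<in>A. real (m a) * ln (max (cmod \<zeta>) (cmod a))) + ln (cmod (g 0))"
    have "((\<lambda>t. (\<Sum>a\<in>A. real (m a) * ln (cmod (\<zeta> * unit_exp t - a))) + ln (cmod (g (\<zeta> * unit_exp t)))) has_integral I) {0..1}"
      unfolding I_def
    proof (intro has_integral_add has_integral_sum finA has_integral_mult_right)
      fix a assume "a \<in> A"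
      then show "((\<lambda>t. ln (cmod (\<zeta> * unit_exp t - a))) has_integral ln (max (cmod \<zeta>) (cmod a))) {0..1}"
        using \<zeta> by (intro mean_ln_linear) auto
    next
      show "((\<lambda>t. ln (cmod (g (\<zeta> * unit_exp t)))) has_integral ln (cmod (g 0))) {0..1}"
      proof (rule mean_ln_nonvanishing[where s = "3/4"])
        show "g holomorphic_on ball 0 (3/4)" by (rule holomorphic_on_subset[OF g(1)]) auto
      qed (use \<zeta> gnz in auto)
    qed
    then have int: "((\<lambda>t. ln (cmod (F (\<zeta> * unit_exp t)))) has_integral I) {0..1}"
    proof (rule has_integral_eq[rotated])
      show "(\<Sum>a\<in>A. real (m a) * ln (cmod (\<zeta> * unit_exp t - a))) + ln (cmod (g (\<zeta> * unit_exp t))) =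
          ln (cmod (F (\<zeta> * unit_exp t)))" for t
        by (rule lnF[OF ball(2), symmetric]) (use circ' in blast)
    qed
    have ZA: "Z \<subseteq> A" using Z by (auto simp: A_def)
    have "0 \<notin> A" using F0 by (simp add: A_def)
    then have "ln (cmod (F 0)) = (\<Sum>a\<in>A. real (m a) * ln (cmod a)) + ln (cmod (g 0))"
      using lnF[of 0] by simp
    moreover have "ln 2 * (\<Sum>a\<in>Z. real_of_int (zorder F a)) = (\<Sum>a\<in>A. if a \<in> Z then ln 2 * real (m a) else 0)"
      using ZA zord finA by (simp add: sum_distrib_left sum.If_cases Int_absorb1) (intro sum.cong, auto)
    ultimately have "ln (cmod (F 0)) + ln 2 * (\<Sum>a\<in>Z. real_of_int (zorder F a)) =
      (\<Sum>a\<in>A. real (m a) * ln (cmod a) + (if a \<in> Z then ln 2 * real (m a) else 0)) + ln (cmod (g 0))"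
      by (simp add: sum.distrib)
    also have "\<dots> \<le> I"
      unfolding I_def
    proof (intro add_right_mono sum_mono)
      fix a assume a: "a \<in> A"
      then have pos: "cmod a > 0" using \<open>0 \<notin> A\<close> by auto
      show "real (m a) * ln (cmod a) + (if a \<in> Z then ln 2 * real (m a) else 0) \<le> real (m a) * ln (max (cmod \<zeta>) (cmod a))"
      proof (cases "a \<in> Z")
        case True
        then have "2 * cmod a \<le> max (cmod \<zeta>) (cmod a)" using Z \<zeta> by auto
        then have "ln (2 * cmod a) \<le> ln (max (cmod \<zeta>) (cmod a))" using pos by (intro ln_mono) auto
        then have "real (m a) * (ln (cmod a) + ln 2) \<le> real (m a) * ln (max (cmod \<zeta>) (cmod a))"
          using pos by (intro mult_left_mono) (auto simp: ln_mult)
        then show ?thesis using True by (simp add: algebra_simps)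
      next
        case False
        then show ?thesis using pos by (auto intro!: mult_left_mono ln_mono)
      qed
    qed
    finally show "(\<forall>t. F (\<zeta> * unit_exp t) \<noteq> 0) \<and>
       (\<exists>I. ((\<lambda>t. ln (cmod (F (\<zeta> * unit_exp t)))) has_integral I) {0..1} \<and>
         ln (cmod (F 0)) + ln 2 * (\<Sum>a\<in>Z. real_of_int (zorder F a)) \<le> I)"
      using nz int by blast
  qed (use finA in auto)
qed

section \<open>Averages over hyperbolic annuli\<close>

text \<open>The pseudo-hyperbolic distance, that is the modulus of the Cayley map sending
  \<open>\<tau>\<close> to 0. Its level sets around \<open>\<tau>\<close> are hyperbolic circles,
  and it is invariant under the group.\<close>

definition pdist :: "complex \<Rightarrow> complex \<Rightarrow> real" where
  "pdist \<tau> w = cmod ((w - \<tau>) / (w - cnj \<tau>))"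

text \<open>The radii 1/4 and 1/2, with 1/8 for \<open>pball\<close>, are those of
  \<open>jensen_disc\<close>.\<close>

definition ann :: "complex \<Rightarrow> complex set" where
  "ann \<tau> = {w \<in> upper_half_plane. 1/4 < pdist \<tau> w \<and> pdist \<tau> w < 1/2}"

text \<open>For a modular form f of weight six this is the invariant function \<open>max 0 (ln (E |f| Im\<^sup>3))\<close>, a truncation of the
  logarithm from below which tends to infinity with E.\<close>

definition logp :: "real \<Rightarrow> (complex \<Rightarrow> complex) \<Rightarrow> complex \<Rightarrow> real" where
  "logp E f w = indicator upper_half_plane w * ln (max 1 (E * (Im w)^3 * cmod (f w)))"

lemma logp_nonneg [simp]: "logp E f w \<ge> 0"
  by (auto simp: logp_def indicator_def)

lemma logp_measurable:
  assumes "f holomorphic_on upper_half_plane"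
  shows "logp E f \<in> borel_measurable borel"
proof -
  have "continuous_on upper_half_plane (\<lambda>w. ln (max 1 (E * (Im w)^3 * cmod (f w))))"
    by (intro continuous_intros holomorphic_on_imp_continuous_on assms) auto
  then show ?thesis unfolding logp_def[abs_def]
    using borel_measurable_continuous_on_indicator[OF upper_measurable, of "\<lambda>w. ln (max 1 (E * (Im w)^3 * cmod (f w)))"]
    by (simp only: real_scaleR_def)
qed

lemma pdist_measurable [measurable]: "(\<lambda>p. pdist (fst p) (snd p)) \<in> borel_measurable (borel \<Otimes>\<^sub>M borel)"
proof -
  have [measurable]: "cnj \<in> borel_measurable borel"
    by (intro borel_measurable_continuous_onI continuous_intros)
  show ?thesis unfolding pdist_def by measurable
qed

lemma pdist_measurable' [measurable]: "pdist \<tau> \<in> borel_measurable borel"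
  unfolding pdist_def[abs_def] by measurable

lemma ann_measurable [measurable]: "ann \<tau> \<in> sets borel"
  unfolding ann_def by measurable

lemma pdist_mob:
  assumes "det M = 1" "Im \<tau> > 0" "Im w > 0"
  shows "pdist (mob M \<tau>) (mob M w) = pdist \<tau> w"
proof -
  have nz: "cmod (aut M w) \<noteq> 0" "cmod (aut M \<tau>) \<noteq> 0" using assms aut_nonzero by auto
  then show ?thesis using assms unfolding pdist_def
    by (simp add: mob_diff mob_diff_cnj norm_divide norm_mult)
qed

lemma pdist_sym: "Im \<tau> > 0 \<Longrightarrow> Im w > 0 \<Longrightarrow> pdist \<tau> w = pdist w \<tau>"
proof -
  have "cmod (w - cnj \<tau>) = cmod (cnj (w - cnj \<tau>))" by (rule complex_mod_cnj[symmetric])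
  also have "\<dots> = cmod (\<tau> - cnj w)" by (simp add: norm_minus_commute)
  finally show ?thesis by (simp add: pdist_def norm_divide norm_minus_commute)
qed

lemma pdist_act:
  assumes "g \<in> carrier PSL2R" "Im \<tau> > 0" "Im w > 0"
  shows "pdist (act g \<tau>) (act g w) = pdist \<tau> w"
  using assms by (simp add: act_eq_mob pdist_mob lift)

text \<open>The affine map taking i to \<open>\<tau>\<close>. It preserves \<open>hyp\<close> and
  carries distances from i to distances from \<open>\<tau>\<close>, so that everything metric can be
  computed at i.\<close>

definition to_pt :: "complex \<Rightarrow> complex \<Rightarrow> complex" where
  "to_pt \<tau> w = of_real (Im \<tau>) * w + of_real (Re \<tau>)"

lemma to_pt_i: "to_pt \<tau> \<i> = \<tau>"
  by (simp add: to_pt_def complex_eq_iff)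

lemma Im_to_pt: "Im (to_pt \<tau> w) = Im \<tau> * Im w"
  by (simp add: to_pt_def)

lemma pdist_to_pt:
  assumes "Im \<tau> > 0"
  shows "pdist \<tau> (to_pt \<tau> w) = pdist \<i> w"
proof -
  have "to_pt \<tau> w - \<tau> = of_real (Im \<tau>) * (w - \<i>)" "to_pt \<tau> w - cnj \<tau> = of_real (Im \<tau>) * (w - cnj \<i>)"
    by (simp_all add: to_pt_def complex_eq_iff algebra_simps)
  then show ?thesis using assms by (simp add: pdist_def)
qed

lemma nn_integral_to_pt:
  assumes "F \<in> borel_measurable borel" "Im \<tau> > 0"
  shows "(\<integral>\<^sup>+w. F (to_pt \<tau> w) \<partial>hyp) = (\<integral>\<^sup>+w. F w \<partial>hyp)"
proof -
  have [measurable]: "F \<in> borel_measurable borel" by fact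
  have "(\<integral>\<^sup>+w. F (to_pt \<tau> w) \<partial>hyp) = (\<integral>\<^sup>+w. F (w + of_real (Re \<tau>)) \<partial>hyp)"
    unfolding to_pt_def using assms by (intro nn_integral_hyp_scale[where F = "\<lambda>w. F (w + of_real (Re \<tau>))"]) auto
  also have "\<dots> = (\<integral>\<^sup>+w. F w \<partial>hyp)" by (intro nn_integral_hyp_translate) auto
  finally show ?thesis .
qed

lemma to_pt_ann:
  assumes "Im \<tau> > 0"
  shows "to_pt \<tau> w \<in> ann \<tau> \<longleftrightarrow> w \<in> ann \<i>"
  using assms by (simp add: ann_def pdist_to_pt upper_half_plane_def Im_to_pt zero_less_mult_iff)

lemma emeasure_hyp_ann:
  assumes "Im \<tau> > 0" shows "emeasure hyp (ann \<tau>) = emeasure hyp (ann \<i>)"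
proof -
  have "(\<integral>\<^sup>+w. indicator (ann \<tau>) w \<partial>hyp) = (\<integral>\<^sup>+w. indicator (ann \<tau>) (to_pt \<tau> w) \<partial>hyp)"
    using assms by (intro nn_integral_to_pt[symmetric]) auto
  also have "\<dots> = (\<integral>\<^sup>+w. indicator (ann \<i>) w \<partial>hyp)"
    using to_pt_ann[OF assms] by (intro nn_integral_cong) (auto simp: indicator_def)
  finally show ?thesis by simp
qed

definition pball :: "complex \<Rightarrow> complex set" where
  "pball \<tau> = {w \<in> upper_half_plane. pdist \<tau> w < 1/8}"

lemma pball_measurable [measurable]: "pball \<tau> \<in> sets borel"
  unfolding pball_def by measurable

lemma emeasure_hyp_pball:
  assumes "Im \<tau> > 0" shows "emeasure hyp (pball \<tau>) = emeasure hyp (pball \<i>)"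
proof -
  have "(\<integral>\<^sup>+w. indicator (pball \<tau>) w \<partial>hyp) = (\<integral>\<^sup>+w. indicator (pball \<tau>) (to_pt \<tau> w) \<partial>hyp)"
    using assms by (intro nn_integral_to_pt[symmetric]) auto
  also have "\<dots> = (\<integral>\<^sup>+w. indicator (pball \<i>) w \<partial>hyp)"
    using assms by (intro nn_integral_cong) (auto simp: indicator_def pball_def pdist_to_pt upper_half_plane_def Im_to_pt zero_less_mult_iff)
  finally show ?thesis by simp
qed

lemma pdist_i_continuous: "continuous_on upper_half_plane (pdist \<i>)"
  unfolding pdist_def by (intro continuous_intros) (auto simp: upper_half_plane_def complex_eq_iff)

lemma pdist_2i: "pdist \<i> (2 * \<i>) = 1/3"
proof -
  have "2 * \<i> - \<i> = \<i>" "2 * \<i> - cnj \<i> = 3 * \<i>" by simp_all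
  then show ?thesis by (simp add: pdist_def norm_divide)
qed

lemma emeasure_hyp_ann_pos: "emeasure hyp (ann \<i>) > 0"
proof (rule emeasure_hyp_open_pos)
  have "open (upper_half_plane \<inter> pdist \<i> -` {1/4<..<1/2})"
    by (intro continuous_open_preimage pdist_i_continuous open_upper) auto
  moreover have "upper_half_plane \<inter> pdist \<i> -` {1/4<..<1/2} = ann \<i>" by (auto simp: ann_def)
  ultimately show "open (ann \<i>)" by simp
  have "2 * \<i> \<in> ann \<i>" by (simp add: ann_def pdist_2i upper_half_plane_def)
  then show "ann \<i> \<noteq> {}" by blast
qed (auto simp: ann_def)

lemma emeasure_hyp_pball_pos: "emeasure hyp (pball \<i>) > 0"
proof (rule emeasure_hyp_open_pos)
  have "open (upper_half_plane \<inter> pdist \<i> -` {..<1/8})"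
    by (intro continuous_open_preimage pdist_i_continuous open_upper) auto
  moreover have "upper_half_plane \<inter> pdist \<i> -` {..<1/8} = pball \<i>" by (auto simp: pball_def)
  ultimately show "open (pball \<i>)" by simp
  have "\<i> \<in> pball \<i>" by (simp add: pball_def upper_half_plane_def pdist_def)
  then show "pball \<i> \<noteq> {}" by blast
qed (auto simp: pball_def)

text \<open>A pseudo-hyperbolic disc is relatively compact: below distance 1/2 from i, points
  satisfy |w| \<le> 3 and Im w \<ge> 1/3, so the density is at most 9 on a bounded set.\<close>

lemma emeasure_hyp_ann_finite: "emeasure hyp (ann \<i>) < \<infinity>"
proof -
  have b: "cmod w \<le> 3 \<and> Im w \<ge> 1/3" if "w \<in> ann \<i>" for w
  proof -
    have w: "Im w > 0" "cmod (w - \<i>) / cmod (w + \<i>) < 1/2"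
      using that by (auto simp: ann_def pdist_def upper_half_plane_def norm_divide)
    then have "w + \<i> \<noteq> 0" by (auto simp: complex_eq_iff)
    with w have *: "cmod (w - \<i>) * 2 < cmod (w + \<i>)" by (simp add: field_simps)
    have "cmod w \<le> cmod (w - \<i>) + 1" using norm_triangle_ineq[of "w - \<i>" \<i>] by simp
    moreover have "cmod (w + \<i>) \<le> cmod (w - \<i>) + 2" using norm_triangle_ineq[of "w - \<i>" "2 * \<i>"] by (simp add: norm_mult add.commute)
    ultimately have 1: "cmod w \<le> 3" using * by linarith
    have "(cmod (w - \<i>) * 2)\<^sup>2 \<le> (cmod (w + \<i>))\<^sup>2" using * by (intro power_mono) auto
    then have "4 * ((Re w)\<^sup>2 + (Im w - 1)\<^sup>2) \<le> (Re w)\<^sup>2 + (Im w + 1)\<^sup>2"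
      by (simp add: power_mult_distrib cmod_power2)
    moreover have "4 * X \<le> Y" if "4 * (S + X) \<le> S + Y" "0 \<le> S" for S X Y :: real
      using that by (simp add: distrib_left)
    ultimately have "4 * (Im w - 1)\<^sup>2 \<le> (Im w + 1)\<^sup>2" using zero_le_power2 by blast
    \<comment> \<open>The difference 4 (y - 1)^2 - (y + 1)^2 equals (3 y - 1) (y - 3).\<close>
    then have "(3 * Im w - 1) * (Im w - 3) \<le> 0" by (simp add: power2_eq_square algebra_simps)
    then have "Im w \<ge> 1/3" by (simp add: mult_le_0_iff) linarith
    with 1 show ?thesis by simp
  qed
  have "emeasure hyp (ann \<i>) = (\<integral>\<^sup>+w. ennreal (indicator upper_half_plane w / (Im w)\<^sup>2) * indicator (ann \<i>) w \<partial>lborel)"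
    unfolding hyp_def by (subst emeasure_density) auto
  also have "\<dots> \<le> (\<integral>\<^sup>+w. ennreal 9 * indicator (cball (0::complex) 3) w \<partial>lborel)"
  proof (rule nn_integral_mono)
    fix w
    show "ennreal (indicator upper_half_plane w / (Im w)\<^sup>2) * indicator (ann \<i>) w \<le> ennreal 9 * indicator (cball (0::complex) 3) w"
    proof (cases "w \<in> ann \<i>")
      case True
      then have "(1/3)^2 \<le> (Im w)^2" using b by (intro power_mono) auto
      then have "1 / (Im w)^2 \<le> 9" using b[OF True] by (simp add: field_simps power2_eq_square)
      then have "ennreal (1 / (Im w)^2) \<le> ennreal 9" by (rule ennreal_leI)
      then show ?thesis using True b[OF True] by (auto simp: indicator_def)
    qed simp
  qed
  also have "\<dots> = ennreal 9 * emeasure lborel (cball (0::complex) 3)" by (rule nn_integral_cmult_indicator) simp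
  also have "\<dots> < \<infinity>" using emeasure_lborel_cball_finite[of "0::complex" 3] by (simp add: ennreal_mult_less_top less_top)
  finally show ?thesis .
qed

lemma AE_hyp_negligible:
  assumes "S \<in> sets borel" "negligible S"
  shows "AE w in hyp. w \<notin> S"
proof -
  have "S \<in> null_sets lebesgue" using assms negligible_iff_null_sets by blast
  then have "S \<in> null_sets lborel" using assms by (simp add: null_sets_completion_iff)
  then have "AE w in lborel. w \<notin> S" by (rule AE_not_in)
  then have "AE w in lborel. 0 < ennreal (indicator upper_half_plane w / (Im w)\<^sup>2) \<longrightarrow> w \<notin> S" by auto
  moreover have "(\<lambda>\<tau>. ennreal (indicator upper_half_plane \<tau> / (Im \<tau>)\<^sup>2)) \<in> borel_measurable lborel"
    by simp
  ultimately have "AE w in density lborel (\<lambda>\<tau>. ennreal (indicator upper_half_plane \<tau> / (Im \<tau>)\<^sup>2)). w \<notin> S"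
    by (simp only: AE_density)
  then show ?thesis by (simp only: hyp_def)
qed

lemma AE_hyp_circle:
  assumes "0 < r" "r < 1"
  shows "AE w in hyp. pdist \<i> w \<noteq> r"
proof -
  \<comment> \<open>The level set is a circle of Apollonius, with Euclidean centre k i and radius
    sqrt(k^2 - 1).\<close>
  define k where "k = (1 + r\<^sup>2) / (1 - r\<^sup>2)"
  have r2: "1 - r\<^sup>2 > 0" using assms by (simp add: power_less_one_iff)
  have "AE w in hyp. w \<notin> sphere (of_real k * \<i>) (sqrt (k\<^sup>2 - 1))"
    by (rule AE_hyp_negligible) (auto intro: negligible_sphere)
  then show ?thesis using AE_hyp_upper
  proof eventually_elim
    case (elim w)
    show ?case
    proof
      assume *: "pdist \<i> w = r"
      have pos: "Im w > 0" using elim by (simp add: upper_half_plane_def)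
      then have "w + \<i> \<noteq> 0" by (auto simp: complex_eq_iff)
      then have "cmod (w - \<i>) = r * cmod (w + \<i>)" using * by (simp add: pdist_def norm_divide field_simps)
      then have "(cmod (w - \<i>))\<^sup>2 = r\<^sup>2 * (cmod (w + \<i>))\<^sup>2" by (simp add: power_mult_distrib)
      then have "(Re w)\<^sup>2 + (Im w - 1)\<^sup>2 = r\<^sup>2 * ((Re w)\<^sup>2 + (Im w + 1)\<^sup>2)" by (simp add: cmod_power2)
      then have "(1 - r\<^sup>2) * ((Re w)\<^sup>2 + (Im w)\<^sup>2 + 1) = (1 + r\<^sup>2) * (2 * Im w)"
        by algebra
      moreover have "S = k * b" if "(1 - r\<^sup>2) * S = (1 + r\<^sup>2) * b" for S b
        using that r2 by (simp add: k_def eq_divide_eq mult.commute)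
      ultimately have "(Re w)\<^sup>2 + (Im w)\<^sup>2 + 1 = k * (2 * Im w)" by blast
      moreover have "(Im w - k)\<^sup>2 = (Im w)\<^sup>2 - k * (2 * Im w) + k\<^sup>2" by (simp add: power2_eq_square algebra_simps)
      ultimately have "(Re w)\<^sup>2 + (Im w - k)\<^sup>2 = k\<^sup>2 - 1" by linarith
      then have "cmod (w - of_real k * \<i>) = sqrt (k\<^sup>2 - 1)" by (simp add: cmod_def)
      then have "w \<in> sphere (of_real k * \<i>) (sqrt (k\<^sup>2 - 1))" by (simp add: dist_norm norm_minus_commute)
      with elim show False by simp
    qed
  qed
qed

subsection \<open>The disc model centred at a point\<close>

text \<open>The inverse Cayley map centred at \<open>\<tau>\<close>, a holomorphic chart of the half
  plane by the unit disc; \<open>pt_disc\<close> is its inverse.\<close>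

definition disc_pt :: "complex \<Rightarrow> complex \<Rightarrow> complex" where
  "disc_pt \<tau> \<zeta> = to_pt \<tau> (\<i> * (1 + \<zeta>) / (1 - \<zeta>))"

definition pt_disc :: "complex \<Rightarrow> complex \<Rightarrow> complex" where
  "pt_disc \<tau> z = (z - \<tau>) / (z - cnj \<tau>)"

lemma norm_pt_disc: "cmod (pt_disc \<tau> z) = pdist \<tau> z"
  by (simp add: pt_disc_def pdist_def)

lemma disc_pt_pt_disc:
  assumes "Im \<tau> > 0" "Im z > 0"
  shows "disc_pt \<tau> (pt_disc \<tau> z) = z"
proof -
  have nz: "z - cnj \<tau> \<noteq> 0" using assms by (auto simp: complex_eq_iff)
  have nz2: "\<tau> - cnj \<tau> \<noteq> 0" using assms by (auto simp: complex_eq_iff)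
  have a: "1 + pt_disc \<tau> z = (2 * z - (\<tau> + cnj \<tau>)) / (z - cnj \<tau>)" "1 - pt_disc \<tau> z = (\<tau> - cnj \<tau>) / (z - cnj \<tau>)"
    using nz by (simp_all add: pt_disc_def field_simps)
  have "\<i> * (1 + pt_disc \<tau> z) / (1 - pt_disc \<tau> z) = \<i> * (2 * z - (\<tau> + cnj \<tau>)) / (\<tau> - cnj \<tau>)"
    unfolding a using nz by simp
  also have "\<dots> = (z - of_real (Re \<tau>)) / of_real (Im \<tau>)"
    using assms by (simp add: complex_add_cnj complex_diff_cnj field_simps)
  finally show ?thesis using assms by (simp add: disc_pt_def to_pt_def)
qed

lemma disc_pt_0: "disc_pt \<tau> 0 = \<tau>"
  by (simp add: disc_pt_def to_pt_i)

lemma Im_disc_pt: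
  assumes "cmod \<zeta> < 1"
  shows "Im (disc_pt \<tau> \<zeta>) = Im \<tau> * (1 - (cmod \<zeta>)\<^sup>2) / (cmod (1 - \<zeta>))\<^sup>2"
proof -
  have "\<i> * (1 + \<zeta>) / (1 - \<zeta>) = \<i> * (1 + \<zeta>) * cnj (1 - \<zeta>) / (cmod (1 - \<zeta>))\<^sup>2" by (rule complex_div_cnj)
  then have "Im (\<i> * (1 + \<zeta>) / (1 - \<zeta>)) = Im (\<i> * (1 + \<zeta>) * cnj (1 - \<zeta>)) / (cmod (1 - \<zeta>))\<^sup>2"
    by (simp only: Im_divide_of_real)
  also have "Im (\<i> * (1 + \<zeta>) * cnj (1 - \<zeta>)) = 1 - (cmod \<zeta>)\<^sup>2"
    unfolding cmod_power2 by (simp add: algebra_simps power2_eq_square)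
  finally show ?thesis by (simp add: disc_pt_def Im_to_pt)
qed

lemma disc_pt_upper:
  assumes "cmod \<zeta> < 1" "Im \<tau> > 0"
  shows "disc_pt \<tau> \<zeta> \<in> upper_half_plane"
proof -
  have "(cmod \<zeta>)\<^sup>2 < 1" using assms by (simp add: power_less_one_iff)
  moreover have "\<zeta> \<noteq> 1" using assms by auto
  ultimately show ?thesis using assms by (simp add: upper_half_plane_def Im_disc_pt)
qed

lemma disc_pt_holomorphic: "disc_pt \<tau> holomorphic_on ball 0 1"
  unfolding disc_pt_def [abs_def] to_pt_def by (intro holomorphic_intros) auto

lemma disc_pt_diff:
  assumes "cmod \<zeta> < 1" "cmod a < 1"
  shows "disc_pt \<tau> \<zeta> - disc_pt \<tau> a = 2 * \<i> * of_real (Im \<tau>) / ((1 - \<zeta>) * (1 - a)) * (\<zeta> - a)"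
proof -
  have "1 - \<zeta> \<noteq> 0" "1 - a \<noteq> 0" using assms by auto
  then have "\<i> * (1 + \<zeta>) / (1 - \<zeta>) - \<i> * (1 + a) / (1 - a) = 2 * \<i> / ((1 - \<zeta>) * (1 - a)) * (\<zeta> - a)"
    by (simp add: diff_frac_eq) (simp add: algebra_simps)
  moreover have "disc_pt \<tau> \<zeta> - disc_pt \<tau> a = of_real (Im \<tau>) * (\<i> * (1 + \<zeta>) / (1 - \<zeta>) - \<i> * (1 + a) / (1 - a))"
    by (simp add: disc_pt_def to_pt_def right_diff_distrib)
  ultimately show ?thesis by simp
qed

text \<open>The division by (1 - zeta)^6 is the weight-six factor of the Cayley map. With it Im^3
  |f| turns into (Im tau)^3 (1 - |zeta|^2)^3 |disc_fun|, where the non-holomorphic part is constant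
  on circles around 0.\<close>

definition disc_fun :: "(complex \<Rightarrow> complex) \<Rightarrow> complex \<Rightarrow> complex \<Rightarrow> complex" where
  "disc_fun f \<tau> \<zeta> = f (disc_pt \<tau> \<zeta>) / (1 - \<zeta>) ^ 6"

lemma disc_fun_holomorphic:
  assumes "f holomorphic_on upper_half_plane" "Im \<tau> > 0"
  shows "disc_fun f \<tau> holomorphic_on ball 0 1"
proof -
  have "f \<circ> disc_pt \<tau> holomorphic_on ball 0 1"
    by (rule holomorphic_on_compose_gen[OF disc_pt_holomorphic assms(1)]) (use assms disc_pt_upper in auto)
  then show ?thesis unfolding disc_fun_def[abs_def] by (intro holomorphic_intros) (auto simp: o_def)
qed

lemma logp_disc_pt:
  assumes "cmod \<zeta> < 1" "Im \<tau> > 0"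
  shows "logp E f (disc_pt \<tau> \<zeta>) = ln (max 1 (E * (Im \<tau>)^3 * (1 - (cmod \<zeta>)\<^sup>2)^3 * cmod (disc_fun f \<tau> \<zeta>)))"
proof -
  have "1 - \<zeta> \<noteq> 0" using assms by auto
  then have "(Im (disc_pt \<tau> \<zeta>))^3 * cmod (f (disc_pt \<tau> \<zeta>)) = (Im \<tau>)^3 * (1 - (cmod \<zeta>)\<^sup>2)^3 * cmod (disc_fun f \<tau> \<zeta>)"
    using assms by (simp add: Im_disc_pt disc_fun_def norm_divide norm_power power_divide power_mult_distrib flip: power_mult)
  then show ?thesis using disc_pt_upper[OF assms] by (simp add: logp_def mult.assoc)
qed

text \<open>By \<open>disc_pt_diff\<close> the chart turns w - z into zeta - a times a nonvanishing
  factor, so the order of the zero does not change.\<close>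

lemma zorder_disc_fun:
  assumes f: "f holomorphic_on upper_half_plane" "\<exists>w\<in>upper_half_plane. f w \<noteq> 0"
    and \<tau>: "Im \<tau> > 0" and a: "cmod a < 1" "f (disc_pt \<tau> a) = 0"
  shows "zorder (disc_fun f \<tau>) a = zorder f (disc_pt \<tau> a)"
proof -
  define z where "z = disc_pt \<tau> a"
  define n where "n = nat (zorder f z)"
  have z: "z \<in> upper_half_plane" using disc_pt_upper a \<tau> by (simp add: z_def)
  obtain g where g: "g holomorphic_on upper_half_plane" "g z \<noteq> 0"
    "\<And>w. w \<in> upper_half_plane \<Longrightarrow> f w = (w - z) ^ n * g w"
    using factor_one_zero[OF f(1) open_upper connected_upper z f(2)] unfolding n_def by blast
  have n: "zorder f z = int n"
    using zorder_exist_zero[OF f(1) open_upper connected_upper z f(2)] a by (auto simp: n_def z_def)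
  define G where "G = (\<lambda>\<zeta>. g (disc_pt \<tau> \<zeta>) * (2 * \<i> * of_real (Im \<tau>) / ((1 - \<zeta>) * (1 - a))) ^ n / (1 - \<zeta>) ^ 6)"
  have "zorder (disc_fun f \<tau>) a = int n"
  proof (rule zorder_eqI[of "ball 0 1" _ G])
    have "g \<circ> disc_pt \<tau> holomorphic_on ball 0 1"
      by (rule holomorphic_on_compose_gen[OF disc_pt_holomorphic g(1)]) (use \<tau> disc_pt_upper in auto)
    then show "G holomorphic_on ball 0 1"
      unfolding G_def using a by (intro holomorphic_intros) (auto simp: o_def)
    show "G a \<noteq> 0" using a g \<tau> by (auto simp: G_def z_def)
    fix \<zeta> assume "\<zeta> \<in> ball 0 1" "\<zeta> \<noteq> a"
    then have \<zeta>: "cmod \<zeta> < 1" by simp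
    then have "f (disc_pt \<tau> \<zeta>) = (2 * \<i> * of_real (Im \<tau>) / ((1 - \<zeta>) * (1 - a))) ^ n * (\<zeta> - a) ^ n * g (disc_pt \<tau> \<zeta>)"
      unfolding power_mult_distrib[symmetric] using g(3)[OF disc_pt_upper[OF \<zeta> \<tau>]] disc_pt_diff[OF \<zeta> a(1), of \<tau>] by (simp add: z_def)
    then show "disc_fun f \<tau> \<zeta> = G \<zeta> * (\<zeta> - a) powi int n"
      by (simp add: disc_fun_def G_def)
  qed (use a in auto)
  then show ?thesis using n by (simp add: z_def)
qed

text \<open>Rotations about i, parametrised with the angle pi t because the action on the disc
  doubles angles: t in [0, 1] is one full turn.\<close>

definition rot :: "real \<Rightarrow> real^2^2" where
  "rot t = mat22 (cos (pi * t)) (sin (pi * t)) (- sin (pi * t)) (cos (pi * t))"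

lemma det_rot: "det (rot t) = 1"
  by (simp add: rot_def power2_eq_square[symmetric])

lemma pt_disc_rot:
  assumes "Im w > 0"
  shows "pt_disc \<i> (mob (rot t) w) = pt_disc \<i> w * unit_exp t"
proof -
  define c where "c = complex_of_real (cos (pi * t))"
  define s where "s = complex_of_real (sin (pi * t))"
  have nz: "- s * w + c \<noteq> 0" using aut_nonzero[OF det_rot assms, of t] by (simp add: aut_def rot_def c_def s_def)
  have m: "mob (rot t) w = (c * w + s) / (- s * w + c)" by (simp add: mob_def rot_def c_def s_def)
  have "mob (rot t) w - \<i> = ((c + \<i> * s) * (w - \<i>)) / (- s * w + c)"
    unfolding m using nz by (simp add: field_simps)
  moreover have "mob (rot t) w - cnj \<i> = ((c - \<i> * s) * (w + \<i>)) / (- s * w + c)"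
    unfolding m using nz by (simp add: field_simps)
  ultimately have "pt_disc \<i> (mob (rot t) w) = ((c + \<i> * s) / (c - \<i> * s)) * pt_disc \<i> w"
    unfolding pt_disc_def using nz by simp
  moreover have cs: "c + \<i> * s = exp (\<i> * (pi * t))" "c - \<i> * s = exp (- (\<i> * (pi * t)))"
    using cis_conv_exp[of "pi * t"] cis_conv_exp[of "- (pi * t)"]
    by (simp_all add: c_def s_def cis.ctr complex_eq_iff flip: of_real_mult)
  have "(c + \<i> * s) / (c - \<i> * s) = unit_exp t"
    unfolding cs by (simp flip: exp_diff) (simp add: algebra_simps)
  ultimately show ?thesis by simp
qed

lemma mob_rot_measurable [measurable]:
  "(\<lambda>(w, t). mob (rot t) w) \<in> borel_measurable (borel \<Otimes>\<^sub>M borel)"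
  unfolding mob_def rot_def mat22_nth case_prod_beta by measurable

lemma rot_ann:
  assumes "w \<in> upper_half_plane"
  shows "mob (rot t) w \<in> ann \<i> \<longleftrightarrow> w \<in> ann \<i>"
proof -
  have "pdist \<i> (mob (rot t) w) = pdist \<i> w"
    using pt_disc_rot[of w t] assms by (simp add: norm_mult upper_half_plane_def flip: norm_pt_disc)
  then show ?thesis using assms by (simp add: ann_def det_rot)
qed

text \<open>Averaging over all rotations about i turns an annulus into circles.\<close>

lemma nn_integral_ann_circles:
  assumes [measurable]: "F \<in> borel_measurable borel"
  shows "(\<integral>\<^sup>+w. indicator (ann \<i>) w * F w \<partial>hyp) =
    (\<integral>\<^sup>+w. indicator (ann \<i>) w * (\<integral>\<^sup>+t. F (mob (rot t) w) * indicator {0..1} t \<partial>lborel) \<partial>hyp)"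
proof -
  interpret hyp: sigma_finite_measure hyp by (rule sigma_finite_hyp)
  interpret pair_sigma_finite lborel hyp ..
  have meas: "(\<lambda>(t, w). indicator {0..1} t * (indicator (ann \<i>) (mob (rot t) w) * F (mob (rot t) w)))
      \<in> borel_measurable (lborel \<Otimes>\<^sub>M hyp)"
  proof -
    have [measurable]: "(\<lambda>p. mob (rot (fst p)) (snd p)) \<in> borel_measurable (lborel \<Otimes>\<^sub>M hyp)"
      using measurable_compose[of "\<lambda>p. (snd p, fst p)" "lborel \<Otimes>\<^sub>M hyp" "borel \<Otimes>\<^sub>M borel", OF _ mob_rot_measurable]
      by (simp add: case_prod_beta)
    show ?thesis unfolding case_prod_beta by measurable
  qed
  have "(\<integral>\<^sup>+w. indicator (ann \<i>) w * F w \<partial>hyp) = (\<integral>\<^sup>+t. indicator {0..1::real} t * (\<integral>\<^sup>+w. indicator (ann \<i>) w * F w \<partial>hyp) \<partial>lborel)"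
    by (subst nn_integral_multc) auto
  also have "\<dots> = (\<integral>\<^sup>+t. (\<integral>\<^sup>+w. indicator {0..1} t * (indicator (ann \<i>) (mob (rot t) w) * F (mob (rot t) w)) \<partial>hyp) \<partial>lborel)"
  proof (rule nn_integral_cong)
    fix t :: real
    have "(\<integral>\<^sup>+w. indicator {0..1} t * (indicator (ann \<i>) (mob (rot t) w) * F (mob (rot t) w)) \<partial>hyp) =
      indicator {0..1} t * (\<integral>\<^sup>+w. indicator (ann \<i>) (mob (rot t) w) * F (mob (rot t) w) \<partial>hyp)"
      by (rule nn_integral_cmult) measurable
    also have "(\<integral>\<^sup>+w. indicator (ann \<i>) (mob (rot t) w) * F (mob (rot t) w) \<partial>hyp) = (\<integral>\<^sup>+w. indicator (ann \<i>) w * F w \<partial>hyp)"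
      by (rule nn_integral_hyp_mob[where F = "\<lambda>w. indicator (ann \<i>) w * F w"]) (auto simp: det_rot)
    finally show "indicator {0..1} t * (\<integral>\<^sup>+w. indicator (ann \<i>) w * F w \<partial>hyp) =
      (\<integral>\<^sup>+w. indicator {0..1} t * (indicator (ann \<i>) (mob (rot t) w) * F (mob (rot t) w)) \<partial>hyp)" by simp
  qed
  also have "\<dots> = (\<integral>\<^sup>+w. (\<integral>\<^sup>+t. indicator {0..1} t * (indicator (ann \<i>) (mob (rot t) w) * F (mob (rot t) w)) \<partial>lborel) \<partial>hyp)"
    using Fubini'[OF meas] by simp
  also have "\<dots> = (\<integral>\<^sup>+w. indicator (ann \<i>) w * (\<integral>\<^sup>+t. F (mob (rot t) w) * indicator {0..1} t \<partial>lborel) \<partial>hyp)"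
  proof (rule nn_integral_hyp_cong)
    fix w assume w: "w \<in> upper_half_plane"
    have "(\<integral>\<^sup>+t. indicator {0..1} t * (indicator (ann \<i>) (mob (rot t) w) * F (mob (rot t) w)) \<partial>lborel) =
      (\<integral>\<^sup>+t. indicator (ann \<i>) w * (F (mob (rot t) w) * indicator {0..1} t) \<partial>lborel)"
      using rot_ann[OF w] by (intro nn_integral_cong) (auto simp: indicator_def)
    also have "\<dots> = indicator (ann \<i>) w * (\<integral>\<^sup>+t. F (mob (rot t) w) * indicator {0..1} t \<partial>lborel)"
    proof (rule nn_integral_cmult)
      have [measurable]: "(\<lambda>t. mob (rot t) w) \<in> borel_measurable borel"
        unfolding mob_def rot_def mat22_nth by measurable
      show "(\<lambda>t. F (mob (rot t) w) * indicator {0..1} t) \<in> borel_measurable lborel" by measurable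
    qed
    finally show "(\<integral>\<^sup>+t. indicator {0..1} t * (indicator (ann \<i>) (mob (rot t) w) * F (mob (rot t) w)) \<partial>lborel) =
       indicator (ann \<i>) w * (\<integral>\<^sup>+t. F (mob (rot t) w) * indicator {0..1} t \<partial>lborel)" .
  qed
  finally show ?thesis .
qed

text \<open>On almost every circle around \<open>\<tau>\<close> in the annulus Jensen applies to
  \<open>disc_fun\<close>, and the truncation in \<open>logp\<close> can only increase the circle
  mean. Averaging over the radii gives the annulus. The error 3 ln(4/3) comes from (1 - r^2)^3 with
  r < 1/2.\<close>

proposition annulus_mean_inequality:
  assumes f: "f holomorphic_on upper_half_plane" and \<tau>: "Im \<tau> > 0" and E: "E > 0" "E * (Im \<tau>)^3 * cmod (f \<tau>) \<ge> 1"
    and Z: "finite Z" "Z \<subseteq> {z. f z = 0} \<inter> pball \<tau>"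
  shows "ennreal (logp E f \<tau> + ln 2 * (\<Sum>z\<in>Z. real_of_int (zorder f z))) * emeasure hyp (ann \<i>) \<le>
    (\<integral>\<^sup>+w. indicator (ann \<tau>) w * ennreal (logp E f w) \<partial>hyp) + ennreal (3 * ln (4/3)) * emeasure hyp (ann \<i>)"
proof -
  define F where "F = disc_fun f \<tau>"
  define J where "J = logp E f \<tau> + ln 2 * (\<Sum>z\<in>Z. real_of_int (zorder f z))"
  have f\<tau>: "f \<tau> \<noteq> 0" using E by auto
  have up: "\<tau> \<in> upper_half_plane" using \<tau> by (simp add: upper_half_plane_def)
  have nc: "\<exists>w\<in>upper_half_plane. f w \<noteq> 0" using f\<tau> up by blast
  have holF: "F holomorphic_on ball 0 1" unfolding F_def by (rule disc_fun_holomorphic[OF f \<tau>])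
  have F0: "F 0 = f \<tau>" by (simp add: F_def disc_fun_def disc_pt_0)
  then have F0ne: "F 0 \<noteq> 0" using f\<tau> by simp
  note [measurable] = logp_measurable[OF f, of E]
  obtain Bad where Bad: "finite Bad"
    "\<And>\<zeta> Z. \<lbrakk>1/4 < cmod \<zeta>; cmod \<zeta> < 1/2; cmod \<zeta> \<notin> Bad; finite Z; Z \<subseteq> {a. cmod a < 1/8 \<and> F a = 0}\<rbrakk> \<Longrightarrow>
       (\<forall>t. F (\<zeta> * unit_exp t) \<noteq> 0) \<and>
       (\<exists>I. ((\<lambda>t. ln (cmod (F (\<zeta> * unit_exp t)))) has_integral I) {0..1} \<and>
         ln (cmod (F 0)) + ln 2 * (\<Sum>a\<in>Z. real_of_int (zorder F a)) \<le> I)"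
    by (rule jensen_disc[OF holF F0ne]) blast
  have Zup: "z \<in> upper_half_plane" "Im z > 0" "cmod (pt_disc \<tau> z) < 1/8" "f z = 0" if "z \<in> Z" for z
    using Z that by (auto simp: pball_def upper_half_plane_def norm_pt_disc)
  have inj: "inj_on (pt_disc \<tau>) Z"
    by (rule inj_onI) (metis disc_pt_pt_disc \<tau> Zup(2))
  define Z' where "Z' = pt_disc \<tau> ` Z"
  have sumZ: "(\<Sum>a\<in>Z'. real_of_int (zorder F a)) = (\<Sum>z\<in>Z. real_of_int (zorder f z))"
    unfolding Z'_def sum.reindex[OF inj] o_def
  proof (rule sum.cong[OF refl])
    fix z assume z: "z \<in> Z"
    have "zorder F (pt_disc \<tau> z) = zorder f (disc_pt \<tau> (pt_disc \<tau> z))"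
      unfolding F_def using z Zup[OF z] \<tau> by (intro zorder_disc_fun f nc) (auto simp: disc_pt_pt_disc)
    then show "real_of_int (zorder F (pt_disc \<tau> z)) = real_of_int (zorder f z)"
      using z Zup \<tau> by (simp add: disc_pt_pt_disc)
  qed
  have Z': "finite Z'" "Z' \<subseteq> {a. cmod a < 1/8 \<and> F a = 0}"
    using Z Zup \<tau> by (auto simp: Z'_def F_def disc_fun_def disc_pt_pt_disc)
  have pos3: "E * (Im \<tau>)^3 > 0" using E \<tau> by simp
  \<comment> \<open>At the centre the assumption E (Im tau)^3 |f tau| \<ge> 1 makes the truncation
    inactive, so \<open>logp\<close> is the true logarithm there and can be compared with ln |F
    0|.\<close>
  have vt: "logp E f \<tau> = ln (E * (Im \<tau>)^3) + ln (cmod (F 0))"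
    using E up \<tau> f\<tau> pos3 by (simp add: logp_def F0 max_def ln_mult)
  have circle: "ennreal J \<le> (\<integral>\<^sup>+t. ennreal (logp E f (to_pt \<tau> (mob (rot t) w))) * indicator {0..1} t \<partial>lborel) + ennreal (3 * ln (4/3))"
    if w: "w \<in> ann \<i>" "pdist \<i> w \<notin> Bad" for w
  proof -
    define \<zeta> where "\<zeta> = pt_disc \<i> w"
    have \<zeta>: "1/4 < cmod \<zeta>" "cmod \<zeta> < 1/2" "cmod \<zeta> \<notin> Bad" and wp: "Im w > 0"
      using w by (auto simp: \<zeta>_def norm_pt_disc ann_def upper_half_plane_def)
    have circ: "cmod (\<zeta> * unit_exp t) = cmod \<zeta>" for t by (simp add: norm_mult)
    define k where "k = E * (Im \<tau>)^3 * (1 - (cmod \<zeta>)\<^sup>2)^3"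
    have "(cmod \<zeta>)\<^sup>2 \<le> (1/2)\<^sup>2" using \<zeta> by (intro power_mono) auto
    then have r2: "3/4 \<le> 1 - (cmod \<zeta>)\<^sup>2" by (simp add: power2_eq_square)
    then have kpos: "k > 0" using pos3 by (simp add: k_def)
    have pt: "to_pt \<tau> (mob (rot t) w) = disc_pt \<tau> (\<zeta> * unit_exp t)" for t
    proof -
      have "disc_pt \<i> (pt_disc \<i> (mob (rot t) w)) = mob (rot t) w"
        using wp by (intro disc_pt_pt_disc) (auto simp: Im_mob_pos det_rot)
      then have "to_pt \<i> (\<i> * (1 + \<zeta> * unit_exp t) / (1 - \<zeta> * unit_exp t)) = mob (rot t) w"
        by (simp add: disc_pt_def pt_disc_rot[OF wp] \<zeta>_def)
      then show ?thesis by (simp add: disc_pt_def to_pt_def)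
    qed
    have lp: "logp E f (to_pt \<tau> (mob (rot t) w)) = ln (max 1 (k * cmod (F (\<zeta> * unit_exp t))))" for t
      unfolding pt using \<zeta> circ[of t] \<tau> by (subst logp_disc_pt) (simp_all add: k_def F_def)
    from Bad(2)[OF \<zeta> Z'] obtain I where nz: "\<And>t. F (\<zeta> * unit_exp t) \<noteq> 0" and
      I: "((\<lambda>t. ln (cmod (F (\<zeta> * unit_exp t)))) has_integral I) {0..1}"
         "ln (cmod (F 0)) + ln 2 * (\<Sum>z\<in>Z. real_of_int (zorder f z)) \<le> I"
      unfolding sumZ by blast
    have "continuous_on {0..1} (\<lambda>t. F (\<zeta> * unit_exp t))"
      by (rule continuous_on_compose2[OF holomorphic_on_imp_continuous_on[OF holF]])
        (use \<zeta> circ in \<open>auto intro!: continuous_intros\<close>)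
    then have "continuous_on {0..1} (\<lambda>t. ln (max 1 (k * cmod (F (\<zeta> * unit_exp t)))))"
      by (intro continuous_intros) auto
    then obtain I' where I': "((\<lambda>t. ln (max 1 (k * cmod (F (\<zeta> * unit_exp t))))) has_integral I') {0..1}"
      using integrable_continuous_interval by blast
    have int: "((\<lambda>t. ln k + ln (cmod (F (\<zeta> * unit_exp t)))) has_integral (ln k * (1 - 0) + I)) {0..1}"
      by (intro has_integral_add I) (use has_integral_const_real[of "ln k" 0 1] in simp)
    have le: "ln k + ln (cmod (F (\<zeta> * unit_exp t))) \<le> ln (max 1 (k * cmod (F (\<zeta> * unit_exp t))))" for t
    proof -
      have "ln k + ln (cmod (F (\<zeta> * unit_exp t))) = ln (k * cmod (F (\<zeta> * unit_exp t)))"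
        using kpos nz[of t] by (simp add: ln_mult)
      also have "\<dots> \<le> ln (max 1 (k * cmod (F (\<zeta> * unit_exp t))))"
        using kpos nz[of t] by (intro ln_mono) auto
      finally show ?thesis .
    qed
    have "ln k + I \<le> I'" using has_integral_le[OF int I' le] by simp
    moreover have "ln k \<ge> ln (E * (Im \<tau>)^3) - 3 * ln (4/3)"
    proof -
      have "ln ((3/4)^3) \<le> ln ((1 - (cmod \<zeta>)\<^sup>2)^3 :: real)" using r2 by (intro ln_mono power_mono) auto
      moreover have "ln ((3/4)^3 :: real) = - (3 * ln (4/3))" by (simp add: ln_realpow ln_div)
      ultimately show ?thesis using pos3 r2 unfolding k_def by (subst ln_mult) auto
    qed
    ultimately have J: "J \<le> I' + 3 * ln (4/3)" using I(2) by (simp add: J_def vt)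
    have I'0: "I' \<ge> 0" by (rule has_integral_nonneg[OF I']) simp
    have "(\<integral>\<^sup>+t. ennreal (logp E f (to_pt \<tau> (mob (rot t) w))) * indicator {0..1} t \<partial>lborel) = ennreal I'"
      unfolding lp by (rule nn_integral_has_integral_lebesgue'[OF _ I']) simp
    then show ?thesis using J I'0 by (simp add: ennreal_plus[symmetric] ennreal_leI del: ennreal_plus)
  qed
  \<comment> \<open>Only finitely many radii are excluded, and each of them gives a null
    circle.\<close>
  have "AE w in hyp. \<forall>r\<in>Bad \<inter> {0<..<1}. pdist \<i> w \<noteq> r"
    using Bad(1) by (intro AE_finite_allI) (auto intro: AE_hyp_circle)
  then have AE: "AE w in hyp. indicator (ann \<i>) w * ennreal J \<le> indicator (ann \<i>) w *
     ((\<integral>\<^sup>+t. ennreal (logp E f (to_pt \<tau> (mob (rot t) w))) * indicator {0..1} t \<partial>lborel) + ennreal (3 * ln (4/3)))"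
  proof eventually_elim
    case (elim w)
    show ?case
    proof (cases "w \<in> ann \<i>")
      case True
      then have "pdist \<i> w \<in> {0<..<1}" by (auto simp: ann_def)
      with elim have "pdist \<i> w \<notin> Bad" by blast
      then show ?thesis using circle[OF True] True by simp
    qed simp
  qed
  have [measurable]: "to_pt \<tau> \<in> borel_measurable borel" unfolding to_pt_def[abs_def] by measurable
  have [measurable]: "(\<lambda>w. \<integral>\<^sup>+t. ennreal (logp E f (to_pt \<tau> (mob (rot t) w))) * indicator {0..1} t \<partial>lborel) \<in> borel_measurable hyp"
  proof (rule lborel.borel_measurable_nn_integral)
    have [measurable]: "(\<lambda>p. mob (rot (snd p)) (fst p)) \<in> borel_measurable (hyp \<Otimes>\<^sub>M lborel)"
      using mob_rot_measurable by (simp add: case_prod_beta cong: measurable_cong_sets)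
    show "(\<lambda>(w, t). ennreal (logp E f (to_pt \<tau> (mob (rot t) w))) * indicator {0..1} t) \<in> borel_measurable (hyp \<Otimes>\<^sub>M lborel)"
      unfolding case_prod_beta by measurable
  qed
  have "ennreal J * emeasure hyp (ann \<i>) = (\<integral>\<^sup>+w. indicator (ann \<i>) w * ennreal J \<partial>hyp)"
    by (subst nn_integral_multc) (auto simp: mult.commute)
  also have "\<dots> \<le> (\<integral>\<^sup>+w. indicator (ann \<i>) w *
     ((\<integral>\<^sup>+t. ennreal (logp E f (to_pt \<tau> (mob (rot t) w))) * indicator {0..1} t \<partial>lborel) + ennreal (3 * ln (4/3))) \<partial>hyp)"
    by (rule nn_integral_mono_AE[OF AE])
  also have "\<dots> = (\<integral>\<^sup>+w. indicator (ann \<i>) w *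
     (\<integral>\<^sup>+t. ennreal (logp E f (to_pt \<tau> (mob (rot t) w))) * indicator {0..1} t \<partial>lborel) \<partial>hyp) +
     (\<integral>\<^sup>+w. indicator (ann \<i>) w * ennreal (3 * ln (4/3)) \<partial>hyp)"
    unfolding distrib_left by (rule nn_integral_add) measurable
  also have "(\<integral>\<^sup>+w. indicator (ann \<i>) w * ennreal (3 * ln (4/3)) \<partial>hyp) = ennreal (3 * ln (4/3)) * emeasure hyp (ann \<i>)"
    by (subst nn_integral_multc) (auto simp: mult.commute)
  also have "(\<integral>\<^sup>+w. indicator (ann \<i>) w *
     (\<integral>\<^sup>+t. ennreal (logp E f (to_pt \<tau> (mob (rot t) w))) * indicator {0..1} t \<partial>lborel) \<partial>hyp) =
     (\<integral>\<^sup>+w. indicator (ann \<i>) w * ennreal (logp E f (to_pt \<tau> w)) \<partial>hyp)"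
    by (rule nn_integral_ann_circles[symmetric]) measurable
  also have "\<dots> = (\<integral>\<^sup>+w. indicator (ann \<tau>) (to_pt \<tau> w) * ennreal (logp E f (to_pt \<tau> w)) \<partial>hyp)"
    using to_pt_ann[OF \<tau>] by (intro nn_integral_cong) (auto simp: indicator_def)
  also have "\<dots> = (\<integral>\<^sup>+w. indicator (ann \<tau>) w * ennreal (logp E f w) \<partial>hyp)"
    by (rule nn_integral_to_pt[OF _ \<tau>, where F = "\<lambda>w. indicator (ann \<tau>) w * ennreal (logp E f w)"]) measurable
  finally show ?thesis by (simp add: J_def)
qed

section \<open>Finiteness of zeros\<close>

lemma ann_sym: "\<tau> \<in> upper_half_plane \<Longrightarrow> w \<in> upper_half_plane \<Longrightarrow> w \<in> ann \<tau> \<longleftrightarrow> \<tau> \<in> ann w"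
  by (simp add: ann_def upper_half_plane_def pdist_sym)

lemma pball_sym: "\<tau> \<in> upper_half_plane \<Longrightarrow> w \<in> upper_half_plane \<Longrightarrow> w \<in> pball \<tau> \<longleftrightarrow> \<tau> \<in> pball w"
  by (simp add: pball_def upper_half_plane_def pdist_sym)

lemma ann_act:
  assumes "g \<in> carrier PSL2R" "\<tau> \<in> upper_half_plane" "w \<in> upper_half_plane"
  shows "act g w \<in> ann (act g \<tau>) \<longleftrightarrow> w \<in> ann \<tau>"
  using assms by (simp add: ann_def pdist_act upper_half_plane_def Im_act(2))

lemma pball_act:
  assumes "g \<in> carrier PSL2R" "\<tau> \<in> upper_half_plane" "w \<in> upper_half_plane"
  shows "act g w \<in> pball (act g \<tau>) \<longleftrightarrow> w \<in> pball \<tau>"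
  using assms by (simp add: pball_def pdist_act upper_half_plane_def Im_act(2))

lemma ann_pair_measurable [measurable]:
  "(\<lambda>p. indicator (ann (fst p)) (snd p) :: ennreal) \<in> borel_measurable (borel \<Otimes>\<^sub>M borel)"
proof -
  have [measurable]: "Measurable.pred (borel \<Otimes>\<^sub>M borel) (\<lambda>p :: complex \<times> complex. snd p \<in> upper_half_plane)"
    by measurable
  have "(\<lambda>p. indicator (ann (fst p)) (snd p) :: ennreal) =
    (\<lambda>p. if snd p \<in> upper_half_plane \<and> 1/4 < pdist (fst p) (snd p) \<and> pdist (fst p) (snd p) < 1/2 then 1 else 0)"
    by (auto simp: fun_eq_iff ann_def indicator_def)
  also have "\<dots> \<in> borel_measurable (borel \<Otimes>\<^sub>M borel)" by measurable
  finally show ?thesis .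
qed

text \<open>The derivative of the action at a fixed point is 1 / \<open>aut2\<close>, and it
  determines the element. If it is 1, then c z + d is 1 or -1, whose imaginary part forces c = 0,
  and the fixed point then forces b = 0.\<close>

lemma fixes_point_aut2:
  assumes "k \<in> carrier PSL2R" "Im z > 0" "act k z = z" "aut2 k z = 1"
  shows "k = \<one>\<^bsub>PSL2R\<^esub>"
proof -
  obtain M where M: "det M = 1" "k = psl M" using assms carrier_PSL2R_cases by metis
  have "(aut M z)\<^sup>2 = 1" using assms M by (simp add: aut2_psl)
  then have "aut M z = 1 \<or> aut M z = -1" by (simp add: power2_eq_1_iff)
  then have c: "M$2$1 = 0" and d: "M$2$2 = 1 \<or> M$2$2 = -1"
    using assms(2) by (auto simp: aut_def complex_eq_iff)
  have a: "M$1$1 = M$2$2" using M(1) c d by (auto simp: det_2)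
  have "mob M z = z" using assms M by (simp add: act_psl)
  then have "M$1$2 = 0" using c d a by (auto simp: mob_def complex_eq_iff)
  then have "M = mat 1 \<or> M = - mat 1" using a c d by (auto intro!: mat2_eqI simp: mat1_nth)
  then show ?thesis using M by (auto simp: psl_one psl_eq_iff)
qed

section \<open>Stabilizers of zeros, averages over \<open>D\<close> and orbit counts\<close>

context fuchsian_cusp
begin

text \<open>Comparing leading Taylor coefficients at z in the transformation law shows that the (m +
  3)-rd power of \<open>aut2 g z\<close> is 1, where m is the order of the zero. Since
  \<open>aut2 g z\<close> determines g within the stabilizer, there are at most m + 3 \<le> 4 m such
  elements.\<close>

lemma stab_card:
  assumes f: "f holomorphic_on upper_half_plane" "\<exists>w\<in>upper_half_plane. f w \<noteq> 0"
    and aut: "\<And>g \<tau>. g \<in> G \<Longrightarrow> \<tau> \<in> upper_half_plane \<Longrightarrow> f (act g \<tau>) = aut2 g \<tau> ^ 3 * f \<tau>"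
    and z: "z \<in> upper_half_plane" "f z = 0" and S: "S \<subseteq> {g\<in>G. act g z = z}"
  shows "finite S \<and> int (card S) \<le> 4 * zorder f z"
proof -
  define m where "m = nat (zorder f z)"
  have zo: "zorder f z > 0" using zorder_exist_zero[OF f(1) open_upper connected_upper z(1) f(2)] z(2) by auto
  then have m: "zorder f z = int m" "m > 0" by (auto simp: m_def)
  have zp: "Im z > 0" using z by (simp add: upper_half_plane_def)
  obtain k where k: "k holomorphic_on upper_half_plane" "k z \<noteq> 0"
    "\<And>w. w \<in> upper_half_plane \<Longrightarrow> f w = (w - z) ^ m * k w"
    using factor_one_zero[OF f(1) open_upper connected_upper z(1) f(2)] unfolding m_def by blast
  have kc: "isCont k w" if "w \<in> upper_half_plane" for w
    using holomorphic_on_imp_continuous_on[OF k(1)] that open_upper by (simp add: continuous_on_eq_continuous_at)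
  have root: "aut2 g z ^ (m + 3) = 1" if g: "g \<in> S" for g
  proof -
    have gG: "g \<in> G" "act g z = z" "g \<in> carrier PSL2R" using S g by auto
    obtain M where M: "det M = 1" "g = psl M" using gG carrier_PSL2R_cases by metis
    have mz: "mob M z = z" using gG M by (simp add: act_psl)
    \<comment> \<open>By \<open>mob_diff\<close> the fixed point z expresses mob M tau - z through
      tau - z, so the factor (tau - z)^m cancels and the limit tau -> z can be taken.\<close>
    have eq: "k (mob M \<tau>) = aut M \<tau> ^ (6 + m) * aut M z ^ m * k \<tau>" if \<tau>: "\<tau> \<in> upper_half_plane - {z}" for \<tau>
    proof -
      have tp: "Im \<tau> > 0" using \<tau> by (simp add: upper_half_plane_def)
      have nz: "aut M \<tau> \<noteq> 0" "aut M z \<noteq> 0" "\<tau> - z \<noteq> 0" using aut_nonzero M tp zp \<tau> by auto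
      have "f (mob M \<tau>) = aut M \<tau> ^ 6 * f \<tau>" using aut[OF gG(1), of \<tau>] \<tau> M
        by (simp add: act_psl aut2_psl flip: power_mult)
      moreover have "f (mob M \<tau>) = ((\<tau> - z) / (aut M \<tau> * aut M z)) ^ m * k (mob M \<tau>)"
        using k(3)[of "mob M \<tau>"] mob_diff[OF M(1) tp zp] mz \<tau> M by simp
      ultimately have "((\<tau> - z) / (aut M \<tau> * aut M z)) ^ m * k (mob M \<tau>) = aut M \<tau> ^ 6 * ((\<tau> - z) ^ m * k \<tau>)"
        using k(3) \<tau> by simp
      then show ?thesis using nz by (simp add: field_simps power_add)
    qed
    have "(\<lambda>\<tau>. k (mob M \<tau>)) \<midarrow>z\<rightarrow> k z"
    proof -
      have "isCont (mob M) z"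
        using holomorphic_on_imp_continuous_on[OF holomorphic_mob[OF M(1) order_refl]] z open_upper
        by (simp add: continuous_on_eq_continuous_at)
      then have "isCont (\<lambda>\<tau>. k (mob M \<tau>)) z" by (rule isCont_o2) (use kc mz z in simp)
      then show ?thesis using mz by (simp add: isCont_def)
    qed
    moreover have "(\<lambda>\<tau>. k (mob M \<tau>)) \<midarrow>z\<rightarrow> aut M z ^ (6 + m) * aut M z ^ m * k z"
    proof (rule Lim_transform_within_open)
      show "(\<lambda>\<tau>. aut M \<tau> ^ (6 + m) * aut M z ^ m * k \<tau>) \<midarrow>z\<rightarrow> aut M z ^ (6 + m) * aut M z ^ m * k z"
      proof -
        have "isCont (aut M) z" unfolding aut_def[abs_def] by (intro continuous_intros)
        then have "isCont (\<lambda>\<tau>. aut M \<tau> ^ (6 + m) * aut M z ^ m * k \<tau>) z"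
          by (intro continuous_intros kc z)
        then show ?thesis by (simp add: isCont_def)
      qed
      show "open upper_half_plane" "z \<in> upper_half_plane" using open_upper z by auto
      fix \<tau> assume "\<tau> \<in> upper_half_plane" "\<tau> \<noteq> z"
      then show "aut M \<tau> ^ (6 + m) * aut M z ^ m * k \<tau> = k (mob M \<tau>)" using eq[of \<tau>] by simp
    qed
    ultimately have "k z = aut M z ^ (6 + m) * aut M z ^ m * k z"
      by (rule LIM_unique)
    then have "aut M z ^ (6 + m) * aut M z ^ m = 1" using k(2) by simp
    moreover have "aut M z ^ (6 + m) * aut M z ^ m = (aut M z ^ 2) ^ (m + 3)"
      by (simp flip: power_add power_mult)
    ultimately show ?thesis using M by (simp add: aut2_psl)
  qed
  have inj: "inj_on (\<lambda>g. aut2 g z) S"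
  proof (rule inj_onI)
    fix g g' assume "g \<in> S" "g' \<in> S" and eq: "aut2 g z = aut2 g' z"
    then have g: "g \<in> G" "g' \<in> G" "act g z = z" "act g' z = z" using S by auto
    define p where "p = g' \<otimes>\<^bsub>PSL2R\<^esub> inv\<^bsub>PSL2R\<^esub> g"
    have p: "p \<in> carrier PSL2R" using g by (simp add: p_def)
    have gi: "act (inv\<^bsub>PSL2R\<^esub> g) z = z" using act_inv(1)[of g z] g zp by simp
    have pz: "act p z = z" using g gi zp by (simp add: p_def act_mult)
    have "p \<otimes>\<^bsub>PSL2R\<^esub> g = g'" using g by (simp add: p_def PSL.m_assoc)
    then have "aut2 p z * aut2 g z = aut2 g' z" using act_mult(2)[of p g z] p g zp by simp
    moreover have "aut2 g z \<noteq> 0" using g zp by (simp add: Im_act)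
    ultimately have "aut2 p z = 1" using eq by simp
    then have "p = \<one>\<^bsub>PSL2R\<^esub>" using fixes_point_aut2[OF p zp pz] by simp
    then show "g = g'" using \<open>p \<otimes>\<^bsub>PSL2R\<^esub> g = g'\<close> g by simp
  qed
  have sub: "(\<lambda>g. aut2 g z) ` S \<subseteq> {x. x ^ (m + 3) = 1}" using root by auto
  have fin: "finite {x::complex. x ^ (m + 3) = 1}" by (rule finite_roots_unity) simp
  have "finite S" using finite_subset[OF sub fin] inj finite_imageD by blast
  moreover have "card S \<le> m + 3"
  proof -
    have "card S = card ((\<lambda>g. aut2 g z) ` S)" using inj by (simp add: card_image)
    also have "\<dots> \<le> card {x::complex. x ^ (m + 3) = 1}" by (rule card_mono[OF fin sub])
    also have "\<dots> \<le> m + 3" by (rule card_roots_unity) simp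
    finally show ?thesis .
  qed
  ultimately show ?thesis using m by simp
qed

text \<open>Fubini, then unfolding in w: \<open>A w\<close> is the area of the part of
  \<open>D\<close> inside the annulus around w. Summed over the translates of w it is at most the
  area of one annulus, because the translates of \<open>D\<close> do not overlap, and the invariance
  of \<open>v\<close> keeps its value at w.\<close>

lemma average_le:
  assumes [measurable]: "v \<in> borel_measurable borel"
    and inv: "\<And>g \<tau>. g \<in> G \<Longrightarrow> \<tau> \<in> upper_half_plane \<Longrightarrow> v (act g \<tau>) = v \<tau>"
  shows "(\<integral>\<^sup>+\<tau>. indicator D \<tau> * (\<integral>\<^sup>+w. indicator (ann \<tau>) w * v w \<partial>hyp) \<partial>hyp) \<le>
     emeasure hyp (ann \<i>) * (\<integral>\<^sup>+w. indicator D w * v w \<partial>hyp)"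
proof -
  interpret hyp: sigma_finite_measure hyp by (rule sigma_finite_hyp)
  interpret pair_sigma_finite hyp hyp ..
  define A where "A w = (\<integral>\<^sup>+\<tau>. indicator D \<tau> * indicator (ann \<tau>) w \<partial>hyp)" for w
  have meas [measurable]: "(\<lambda>(\<tau>, w). indicator D \<tau> * indicator (ann \<tau>) w :: ennreal) \<in> borel_measurable (hyp \<Otimes>\<^sub>M hyp)"
    using ann_pair_measurable unfolding case_prod_beta by measurable
  have meas2: "(\<lambda>(\<tau>, w). indicator D \<tau> * indicator (ann \<tau>) w * v w :: ennreal) \<in> borel_measurable (hyp \<Otimes>\<^sub>M hyp)"
    using ann_pair_measurable unfolding case_prod_beta by measurable
  have [measurable]: "A \<in> borel_measurable borel"
  proof -
    have "(\<lambda>(w, \<tau>). indicator D \<tau> * indicator (ann \<tau>) w :: ennreal) \<in> borel_measurable (hyp \<Otimes>\<^sub>M hyp)"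
      using measurable_pair_swap[OF meas] by (simp add: case_prod_beta)
    then have "A \<in> borel_measurable hyp" unfolding A_def[abs_def] by (rule hyp.borel_measurable_nn_integral)
    then show ?thesis by (simp cong: measurable_cong_sets)
  qed
  have "(\<integral>\<^sup>+\<tau>. indicator D \<tau> * (\<integral>\<^sup>+w. indicator (ann \<tau>) w * v w \<partial>hyp) \<partial>hyp) =
     (\<integral>\<^sup>+\<tau>. (\<integral>\<^sup>+w. indicator D \<tau> * indicator (ann \<tau>) w * v w \<partial>hyp) \<partial>hyp)"
    by (intro nn_integral_cong) (simp add: nn_integral_cmult mult.assoc)
  also have "\<dots> = (\<integral>\<^sup>+w. (\<integral>\<^sup>+\<tau>. indicator D \<tau> * indicator (ann \<tau>) w * v w \<partial>hyp) \<partial>hyp)"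
    using Fubini'[OF meas2] by simp
  also have "\<dots> = (\<integral>\<^sup>+w. A w * v w \<partial>hyp)"
  proof (rule nn_integral_cong)
    fix w
    have "(\<lambda>\<tau>. indicator D \<tau> * indicator (ann \<tau>) w :: ennreal) \<in> borel_measurable hyp"
      using measurable_compose[of "\<lambda>\<tau>. (\<tau>, w)" hyp "hyp \<Otimes>\<^sub>M hyp", OF _ meas] by simp
    then show "(\<integral>\<^sup>+\<tau>. indicator D \<tau> * indicator (ann \<tau>) w * v w \<partial>hyp) = A w * v w"
      unfolding A_def by (intro nn_integral_multc) simp
  qed
  also have "\<dots> \<le> (\<integral>\<^sup>+g. (\<integral>\<^sup>+w. indicator D w * (A (act g w) * v (act g w)) \<partial>hyp) \<partial>count_space G)"
    by (rule unfold_ge[where F = "\<lambda>w. A w * v w"]) measurable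
  also have "\<dots> = (\<integral>\<^sup>+g. (\<integral>\<^sup>+w. A (act g w) * (indicator D w * v w) \<partial>hyp) \<partial>count_space G)"
    by (rule nn_integral_cong, rule nn_integral_hyp_cong) (simp add: inv mult_ac)
  also have "\<dots> = (\<integral>\<^sup>+w. (\<integral>\<^sup>+g. A (act g w) * (indicator D w * v w) \<partial>count_space G) \<partial>hyp)"
  proof (rule nn_integral_count_space_nn_integral[symmetric])
    fix g assume "g \<in> G"
    then have [measurable]: "act g \<in> borel_measurable borel" by (simp add: act_measurable)
    show "(\<lambda>w. A (act g w) * (indicator D w * v w)) \<in> borel_measurable hyp" by measurable
  qed (rule countable_G)
  also have "\<dots> = (\<integral>\<^sup>+w. (\<integral>\<^sup>+g. A (act g w) \<partial>count_space G) * (indicator D w * v w) \<partial>hyp)"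
    by (intro nn_integral_cong nn_integral_multc) auto
  also have "\<dots> \<le> (\<integral>\<^sup>+w. emeasure hyp (ann \<i>) * (indicator D w * v w) \<partial>hyp)"
  proof (intro nn_integral_hyp_mono mult_right_mono)
    fix w assume w: "w \<in> upper_half_plane"
    then have wp: "Im w > 0" by (simp add: upper_half_plane_def)
    have "(\<integral>\<^sup>+g. A (act g w) \<partial>count_space G) = (\<integral>\<^sup>+g. A (act (inv\<^bsub>PSL2R\<^esub> g) w) \<partial>count_space G)"
    proof (rule nn_integral_bij_count_space[symmetric])
      show "bij_betw (\<lambda>g. inv\<^bsub>PSL2R\<^esub> g) G G"
        by (rule bij_betw_byWitness[where f' = "\<lambda>g. inv\<^bsub>PSL2R\<^esub> g"]) auto
    qed
    also have "\<dots> = (\<integral>\<^sup>+g. (\<integral>\<^sup>+\<tau>. indicator D \<tau> * indicator (ann w) (act g \<tau>) \<partial>hyp) \<partial>count_space G)"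
      unfolding A_def
    proof (rule nn_integral_cong, rule nn_integral_hyp_cong)
      fix g \<tau> assume "g \<in> space (count_space G)" and \<tau>: "\<tau> \<in> upper_half_plane"
      then have g: "g \<in> carrier PSL2R" by simp
      have "act (inv\<^bsub>PSL2R\<^esub> g) w \<in> ann \<tau> \<longleftrightarrow> act g (act (inv\<^bsub>PSL2R\<^esub> g) w) \<in> ann (act g \<tau>)"
        using g \<tau> w by (simp add: ann_act)
      also have "\<dots> \<longleftrightarrow> act g \<tau> \<in> ann w" using g \<tau> w wp by (simp add: act_inv ann_sym)
      finally show "indicator D \<tau> * indicator (ann \<tau>) (act (inv\<^bsub>PSL2R\<^esub> g) w) = (indicator D \<tau> * indicator (ann w) (act g \<tau>) :: ennreal)"
        by (simp add: indicator_def)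
    qed
    also have "\<dots> \<le> (\<integral>\<^sup>+\<tau>. indicator (ann w) \<tau> \<partial>hyp)" by (rule unfold_le[where F = "indicator (ann w)"]) measurable
    also have "\<dots> = emeasure hyp (ann \<i>)" using emeasure_hyp_ann[OF wp] by simp
    finally show "(\<integral>\<^sup>+g. A (act g w) \<partial>count_space G) \<le> emeasure hyp (ann \<i>)" .
  qed simp
  also have "\<dots> = emeasure hyp (ann \<i>) * (\<integral>\<^sup>+w. indicator D w * v w \<partial>hyp)"
    by (rule nn_integral_cmult) measurable
  finally show ?thesis .
qed

text \<open>Group elements are counted, not points of the orbit, so a point with nontrivial
  stabilizer counts repeatedly; \<open>stab_card\<close> compensates for this. The value is extended
  because the count might a priori be infinite.\<close>

definition orbit_count :: "complex \<Rightarrow> complex \<Rightarrow> ennreal" where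
  "orbit_count z \<tau> = (\<integral>\<^sup>+g. indicator (pball (act g z)) \<tau> \<partial>count_space G)"

lemma orbit_count_measurable: "orbit_count z \<in> borel_measurable borel"
  unfolding orbit_count_def [abs_def]
proof (rule sigma_finite_measure.borel_measurable_nn_integral)
  show "sigma_finite_measure (count_space G)"
    by (rule sigma_finite_measure_count_space_countable[OF countable_G])
  have "(\<lambda>(g, \<tau>). indicator (pball (act g z)) \<tau> :: ennreal) \<in> borel_measurable (count_space G \<Otimes>\<^sub>M borel)"
    by (rule measurable_pair_measure_countable1[OF countable_G]) simp
  from measurable_pair_swap[OF this]
  show "(\<lambda>(\<tau>, g). indicator (pball (act g z)) \<tau> :: ennreal) \<in> borel_measurable (borel \<Otimes>\<^sub>M count_space G)"
    by (simp add: case_prod_beta)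
qed

text \<open>Unfolding the indicator of a small disc around z; the invariance of the distance moves
  the group element from tau to z. So every orbit carries at least a fixed mass over
  \<open>D\<close>.\<close>

lemma orbit_count_integral:
  assumes z: "z \<in> upper_half_plane"
  shows "emeasure hyp (pball \<i>) \<le> (\<integral>\<^sup>+\<tau>. indicator D \<tau> * orbit_count z \<tau> \<partial>hyp)"
proof -
  have "emeasure hyp (pball \<i>) = (\<integral>\<^sup>+\<tau>. indicator (pball z) \<tau> \<partial>hyp)"
    using z emeasure_hyp_pball[of z] by (simp add: upper_half_plane_def)
  also have "\<dots> \<le> (\<integral>\<^sup>+g. (\<integral>\<^sup>+\<tau>. indicator D \<tau> * indicator (pball z) (act g \<tau>) \<partial>hyp) \<partial>count_space G)"
    by (rule unfold_ge[where F = "indicator (pball z)"]) measurable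
  also have "\<dots> = (\<integral>\<^sup>+g. (\<integral>\<^sup>+\<tau>. indicator D \<tau> * indicator (pball (act (inv\<^bsub>PSL2R\<^esub> g) z)) \<tau> \<partial>hyp) \<partial>count_space G)"
  proof (rule nn_integral_cong, rule nn_integral_hyp_cong)
    fix g \<tau> assume "g \<in> space (count_space G)" and \<tau>: "\<tau> \<in> upper_half_plane"
    then have g: "g \<in> carrier PSL2R" by simp
    have "\<tau> \<in> pball (act (inv\<^bsub>PSL2R\<^esub> g) z) \<longleftrightarrow> act g \<tau> \<in> pball (act g (act (inv\<^bsub>PSL2R\<^esub> g) z))"
      using g \<tau> z by (simp add: pball_act)
    also have "act g (act (inv\<^bsub>PSL2R\<^esub> g) z) = z" using g z by (simp add: act_inv upper_half_plane_def)
    finally show "indicator D \<tau> * indicator (pball z) (act g \<tau>) = (indicator D \<tau> * indicator (pball (act (inv\<^bsub>PSL2R\<^esub> g) z)) \<tau> :: ennreal)"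
      by (simp add: indicator_def)
  qed
  also have "\<dots> = (\<integral>\<^sup>+g. (\<integral>\<^sup>+\<tau>. indicator D \<tau> * indicator (pball (act g z)) \<tau> \<partial>hyp) \<partial>count_space G)"
  proof (rule nn_integral_bij_count_space[where g = "\<lambda>g. inv\<^bsub>PSL2R\<^esub> g" and
        f = "\<lambda>g. (\<integral>\<^sup>+\<tau>. indicator D \<tau> * indicator (pball (act g z)) \<tau> \<partial>hyp)"])
    show "bij_betw (\<lambda>g. inv\<^bsub>PSL2R\<^esub> g) G G"
      by (rule bij_betw_byWitness[where f' = "\<lambda>g. inv\<^bsub>PSL2R\<^esub> g"]) auto
  qed
  also have "\<dots> = (\<integral>\<^sup>+\<tau>. (\<integral>\<^sup>+g. indicator D \<tau> * indicator (pball (act g z)) \<tau> \<partial>count_space G) \<partial>hyp)"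
    by (rule nn_integral_count_space_nn_integral[symmetric]) (use countable_G in auto)
  also have "\<dots> = (\<integral>\<^sup>+\<tau>. indicator D \<tau> * orbit_count z \<tau> \<partial>hyp)"
    unfolding orbit_count_def by (intro nn_integral_cong nn_integral_cmult) auto
  finally show ?thesis .
qed

end

lemma ennreal_bounded_multiples:
  fixes q r :: ennreal
  assumes "\<And>n::nat. of_nat n * q \<le> r" "r < \<infinity>"
  shows "q = 0"
proof (rule ccontr)
  assume "q \<noteq> 0"
  have "(SUP n::nat. of_nat n * q) = (SUP n::nat. of_nat n) * q"
    by (rule SUP_mult_right_ennreal[symmetric])
  also have "\<dots> = \<infinity>" using \<open>q \<noteq> 0\<close> by (simp add: ennreal_SUP_of_nat_eq_top ennreal_top_mult)
  finally have "\<infinity> \<le> r" using assms(1) by (metis SUP_least)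
  then show False using assms(2) by simp
qed

text \<open>Exhaustion by the closed half planes Im z \<ge> 1/(n + 1), for the sake of
  \<open>holomorphic_countable_zeros\<close>.\<close>

lemma fsigma_upper: "fsigma upper_half_plane"
proof -
  have "upper_half_plane = (\<Union>n. {z. Im z \<ge> 1 / real (Suc n)})"
  proof (intro equalityI subsetI)
    fix z assume "z \<in> upper_half_plane"
    then obtain n where "1 / real (Suc n) < Im z" using nat_approx_posE[of "Im z"] by (auto simp: upper_half_plane_def)
    then show "z \<in> (\<Union>n. {z. Im z \<ge> 1 / real (Suc n)})" by (auto intro: less_imp_le)
  next
    fix z assume "z \<in> (\<Union>n. {z. Im z \<ge> 1 / real (Suc n)})"
    then obtain n where "Im z \<ge> 1 / real (Suc n)" by blast
    moreover have "1 / real (Suc n) > 0" by simp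
    ultimately show "z \<in> upper_half_plane" unfolding upper_half_plane_def by (simp only: mem_Collect_eq)
  qed
  moreover have "fsigma (\<Union>n. {z. Im z \<ge> 1 / real (Suc n)})"
    by (rule fsigma.intros) (rule closed_halfspace_Im_ge)
  ultimately show ?thesis by simp
qed

section \<open>Counting zeros modulo the group by area\<close>

context fuchsian_cusp
begin

context
  fixes f :: "complex \<Rightarrow> complex"
  assumes f: "f holomorphic_on upper_half_plane" "\<exists>w\<in>upper_half_plane. f w \<noteq> 0"
    and aut: "\<And>g \<tau>. g \<in> G \<Longrightarrow> \<tau> \<in> upper_half_plane \<Longrightarrow> f (act g \<tau>) = aut2 g \<tau> ^ 3 * f \<tau>"
    and bound: "\<And>\<tau>. \<tau> \<in> upper_half_plane \<Longrightarrow>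
      ennreal (ln (1 + (Im \<tau>)^3 * cmod (f \<tau>))) \<le> ennreal (3/2) * logsum \<tau>"
begin

text \<open>Restricting to finite sets keeps the sums finite; finiteness modulo \<open>G\<close>
  will follow from a common bound on the cardinalities of such sets.\<close>

definition inequivalent_zeros :: "complex set \<Rightarrow> bool" where
  "inequivalent_zeros Y \<longleftrightarrow> finite Y \<and> Y \<subseteq> {z\<in>upper_half_plane. f z = 0} \<and>
     (\<forall>z\<in>Y. \<forall>z'\<in>Y. \<forall>g\<in>G. act g z = z' \<longrightarrow> z = z')"

lemma invariant_height:
  assumes "g \<in> G" "\<tau> \<in> upper_half_plane"
  shows "(Im (act g \<tau>))^3 * cmod (f (act g \<tau>)) = (Im \<tau>)^3 * cmod (f \<tau>)"
  using assms by (simp add: aut Im_act upper_half_plane_def norm_mult norm_power power_divide)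

text \<open>A pair (z, g) with z in \<open>Y\<close> is determined by the point g z up to the
  stabilizer of that point, since \<open>Y\<close> meets each orbit at most once. So
  \<open>stab_card\<close> bounds the fibre over a zero by four times its order.\<close>

lemma card_le_zorder:
  assumes Y: "inequivalent_zeros Y" and W: "finite W" "W \<subseteq> Y \<times> G"
  shows "real (card W) \<le> 4 * (\<Sum>z\<in>(\<lambda>(z, g). act g z) ` W. real_of_int (zorder f z))"
proof -
  define Zs where "Zs = (\<lambda>(z, g). act g z) ` W"
  have fib: "int (card {p\<in>W. (\<lambda>(z, g). act g z) p = y}) \<le> 4 * zorder f y" if y: "y \<in> Zs" for y
  proof -
    obtain z0 g0 where zg: "(z0, g0) \<in> W" "y = act g0 z0" using y by (auto simp: Zs_def)
    then have z0: "z0 \<in> Y" "g0 \<in> G" "z0 \<in> upper_half_plane" "f z0 = 0"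
      using W Y by (auto simp: inequivalent_zeros_def)
    then have z0p: "Im z0 > 0" by (simp add: upper_half_plane_def)
    have yz: "y \<in> upper_half_plane" "f y = 0" using z0 aut[of g0 z0] zg by simp_all
    have same: "z = z0" if "(z, g) \<in> W" "act g z = y" for z g
    proof -
      have z: "z \<in> Y" "g \<in> G" "Im z > 0" using that W Y by (auto simp: inequivalent_zeros_def upper_half_plane_def)
      have "act (inv\<^bsub>PSL2R\<^esub> g0 \<otimes>\<^bsub>PSL2R\<^esub> g) z = z0"
        using z z0 z0p zg that by (simp add: act_mult act_inv)
      moreover have "inv\<^bsub>PSL2R\<^esub> g0 \<otimes>\<^bsub>PSL2R\<^esub> g \<in> G" using z z0 by simp
      ultimately show ?thesis using Y z z0 unfolding inequivalent_zeros_def by blast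
    qed
    define S where "S = (\<lambda>(z, g). g \<otimes>\<^bsub>PSL2R\<^esub> inv\<^bsub>PSL2R\<^esub> g0) ` {p\<in>W. (\<lambda>(z, g). act g z) p = y}"
    have "S \<subseteq> {g\<in>G. act g y = y}"
    proof
      fix s assume "s \<in> S"
      then obtain z g where s: "s = g \<otimes>\<^bsub>PSL2R\<^esub> inv\<^bsub>PSL2R\<^esub> g0" "(z, g) \<in> W" "act g z = y"
        by (auto simp: S_def)
      then have g: "g \<in> G" "z = z0" using W same by auto
      then have "act s y = act g (act (inv\<^bsub>PSL2R\<^esub> g0) y)" using s z0 yz by (simp add: act_mult upper_half_plane_def)
      also have "\<dots> = y" using s g zg z0 z0p by (simp add: act_inv)
      finally show "s \<in> {g\<in>G. act g y = y}" using s g z0 by simp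
    qed
    from stab_card[OF f aut yz this] have "int (card S) \<le> 4 * zorder f y" by simp
    moreover have "card S = card {p\<in>W. (\<lambda>(z, g). act g z) p = y}"
      unfolding S_def
    proof (rule card_image, rule inj_onI)
      fix p p' assume p: "p \<in> {p\<in>W. (\<lambda>(z, g). act g z) p = y}" "p' \<in> {p\<in>W. (\<lambda>(z, g). act g z) p = y}"
        and eq: "(case p of (z, g) \<Rightarrow> g \<otimes>\<^bsub>PSL2R\<^esub> inv\<^bsub>PSL2R\<^esub> g0) = (case p' of (z, g) \<Rightarrow> g \<otimes>\<^bsub>PSL2R\<^esub> inv\<^bsub>PSL2R\<^esub> g0)"
      obtain z g z' g' where pp: "p = (z, g)" "p' = (z', g')" by (cases p; cases p')
      then have "z = z0" "z' = z0" "g \<in> G" "g' \<in> G" using p same W by auto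
      moreover have "g \<otimes>\<^bsub>PSL2R\<^esub> inv\<^bsub>PSL2R\<^esub> g0 = g' \<otimes>\<^bsub>PSL2R\<^esub> inv\<^bsub>PSL2R\<^esub> g0" using eq pp by simp
      ultimately show "p = p'" using pp z0 by simp
    qed
    ultimately show ?thesis by simp
  qed
  have "card W = (\<Sum>y\<in>Zs. card {p\<in>W. (\<lambda>(z, g). act g z) p = y})"
    unfolding Zs_def using sum.group[OF W(1) finite_imageI[OF W(1)] order_refl, of "\<lambda>_. 1::nat" "\<lambda>(z, g). act g z"] by (simp only: card_eq_sum)
  then have "int (card W) \<le> (\<Sum>y\<in>Zs. 4 * zorder f y)"
    using sum_mono[OF fib, of Zs] by simp
  then have "real_of_int (int (card W)) \<le> real_of_int (\<Sum>y\<in>Zs. 4 * zorder f y)" by (simp only: of_int_le_iff)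
  then show ?thesis by (simp add: Zs_def sum_distrib_left)
qed

text \<open>\<open>annulus_mean_inequality\<close> takes a finite set of zeros, so it is applied to
  finite sets \<open>W\<close> of pairs. If infinitely many elements bring one zero near tau, the
  bound holds for every cardinality and the right side must be infinite.\<close>

lemma pointwise_inequality:
  assumes Y: "inequivalent_zeros Y" and \<tau>: "\<tau> \<in> upper_half_plane" and E: "E > 0" "E * (Im \<tau>)^3 * cmod (f \<tau>) \<ge> 1"
  shows "emeasure hyp (ann \<i>) * (ennreal (logp E f \<tau>) + ennreal (ln 2 / 4) * (\<Sum>z\<in>Y. orbit_count z \<tau>)) \<le>
    (\<integral>\<^sup>+w. indicator (ann \<tau>) w * ennreal (logp E f w) \<partial>hyp) + ennreal (3 * ln (4/3)) * emeasure hyp (ann \<i>)"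
    (is "?\<kappa> * _ \<le> ?R")
proof -
  have \<tau>p: "Im \<tau> > 0" using \<tau> by (simp add: upper_half_plane_def)
  define P where "P z = {g\<in>G. \<tau> \<in> pball (act g z)}" for z
  have finite_bound: "?\<kappa> * (ennreal (logp E f \<tau>) + ennreal (ln 2 / 4) * of_nat (card W)) \<le> ?R"
    if W: "finite W" "W \<subseteq> (SIGMA z:Y. P z)" for W
  proof -
    define Zs where "Zs = (\<lambda>(z, g). act g z) ` W"
    have "Zs \<subseteq> {z. f z = 0} \<inter> pball \<tau>"
    proof
      fix y assume "y \<in> Zs"
      then obtain z g where "(z, g) \<in> W" "y = act g z" by (auto simp: Zs_def)
      then have z: "z \<in> upper_half_plane" "f z = 0" "g \<in> G" "\<tau> \<in> pball y" "y = act g z"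
        using W Y by (auto simp: P_def inequivalent_zeros_def)
      then have "y \<in> upper_half_plane" by simp
      then show "y \<in> {z. f z = 0} \<inter> pball \<tau>" using z \<tau> aut[of g z] pball_sym by auto
    qed
    then have "ennreal (logp E f \<tau> + ln 2 * (\<Sum>z\<in>Zs. real_of_int (zorder f z))) * ?\<kappa> \<le> ?R"
      using W by (intro annulus_mean_inequality f \<tau>p E) (auto simp: Zs_def)
    moreover have "ln 2 / 4 * real (card W) \<le> ln 2 * (\<Sum>z\<in>Zs. real_of_int (zorder f z))"
    proof -
      have "W \<subseteq> Y \<times> G" using W by (auto simp: P_def)
      then have "real (card W) \<le> 4 * (\<Sum>z\<in>Zs. real_of_int (zorder f z))"
        unfolding Zs_def using W by (intro card_le_zorder[OF Y]) auto
      then have "ln 2 / 4 * real (card W) \<le> ln 2 / 4 * (4 * (\<Sum>z\<in>Zs. real_of_int (zorder f z)))"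
        by (intro mult_left_mono) auto
      then show ?thesis by simp
    qed
    then have "ennreal (logp E f \<tau> + ln 2 / 4 * real (card W)) \<le> ennreal (logp E f \<tau> + ln 2 * (\<Sum>z\<in>Zs. real_of_int (zorder f z)))"
      by (intro ennreal_leI) simp
    then have "ennreal (logp E f \<tau> + ln 2 / 4 * real (card W)) * ?\<kappa> \<le> ennreal (logp E f \<tau> + ln 2 * (\<Sum>z\<in>Zs. real_of_int (zorder f z))) * ?\<kappa>"
      by (rule mult_right_mono) simp
    ultimately have "ennreal (logp E f \<tau> + ln 2 / 4 * real (card W)) * ?\<kappa> \<le> ?R" by (rule order_trans[rotated])
    moreover have "ennreal (logp E f \<tau> + ln 2 / 4 * real (card W)) = ennreal (logp E f \<tau>) + ennreal (ln 2 / 4) * of_nat (card W)"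
    proof -
      have "ennreal (ln 2 / 4 * real (card W)) = ennreal (ln 2 / 4) * of_nat (card W)"
        unfolding ennreal_of_nat_eq_real_of_nat by (rule ennreal_mult) auto
      then show ?thesis by (subst ennreal_plus) auto
    qed
    ultimately show ?thesis by (simp add: mult.commute)
  qed
  have finY: "finite Y" using Y by (simp add: inequivalent_zeros_def)
  have oc: "orbit_count z \<tau> = emeasure (count_space G) (P z)" for z
  proof -
    have "orbit_count z \<tau> = (\<integral>\<^sup>+g. indicator (P z) g \<partial>count_space G)"
      unfolding orbit_count_def by (intro nn_integral_cong) (auto simp: P_def indicator_def)
    also have "\<dots> = emeasure (count_space G) (P z)" by (rule nn_integral_indicator) (auto simp: P_def)
    finally show ?thesis .
  qed
  show ?thesis
  proof (cases "\<forall>z\<in>Y. finite (P z)")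
    case True
    then have "(\<Sum>z\<in>Y. orbit_count z \<tau>) = (\<Sum>z\<in>Y. of_nat (card (P z)))"
      unfolding oc by (intro sum.cong) (auto simp: P_def emeasure_count_space_finite)
    also have "\<dots> = of_nat (card (SIGMA z:Y. P z))" using True finY by (simp add: card_SigmaI)
    finally show ?thesis using finite_bound[of "SIGMA z:Y. P z"] True finY by auto
  next
    case False
    then obtain z where z: "z \<in> Y" "infinite (P z)" by blast
    have "of_nat n * (?\<kappa> * ennreal (ln 2 / 4)) \<le> ?R" for n
    proof -
      obtain S where S: "finite S" "card S = n" "S \<subseteq> P z" using infinite_arbitrarily_large[OF z(2)] by blast
      have "?\<kappa> * (0 + ennreal (ln 2 / 4) * of_nat n) \<le> ?\<kappa> * (ennreal (logp E f \<tau>) + ennreal (ln 2 / 4) * of_nat n)"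
        by (intro mult_left_mono add_right_mono) auto
      also have "\<dots> \<le> ?R"
        using finite_bound[of "{z} \<times> S"] S z by (auto simp: card_cartesian_product)
      finally show ?thesis by (simp add: mult_ac)
    qed
    moreover have "?\<kappa> * ennreal (ln 2 / 4) \<noteq> 0" using emeasure_hyp_ann_pos by auto
    ultimately have "?R = \<infinity>" using ennreal_bounded_multiples by (metis less_top infinity_ennreal_def)
    then show ?thesis by (metis top_greatest infinity_ennreal_def)
  qed
qed

lemma logp_invariant:
  assumes "g \<in> G" "\<tau> \<in> upper_half_plane" shows "logp E f (act g \<tau>) = logp E f \<tau>"
  using assms invariant_height[OF assms] by (simp add: logp_def mult.assoc)

text \<open>Up to the constant ln E, \<open>logp\<close> is at most ln(1 + Im^3 |f|), hence
  controlled by \<open>logsum\<close>; the constant is integrable because \<open>D\<close> has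
  finite area.\<close>

lemma logp_integrable:
  assumes "E \<ge> 1"
  shows "(\<integral>\<^sup>+\<tau>. indicator D \<tau> * ennreal (logp E f \<tau>) \<partial>hyp) < \<infinity>"
proof -
  have "(\<integral>\<^sup>+\<tau>. indicator D \<tau> * ennreal (logp E f \<tau>) \<partial>hyp) \<le>
    (\<integral>\<^sup>+\<tau>. ennreal (ln E) * indicator D \<tau> + ennreal (3/2) * (indicator D \<tau> * logsum \<tau>) \<partial>hyp)"
  proof (rule nn_integral_hyp_mono)
    fix \<tau> assume \<tau>: "\<tau> \<in> upper_half_plane"
    then have "Im \<tau> > 0" by (simp add: upper_half_plane_def)
    define \<psi> where "\<psi> = (Im \<tau>)^3 * cmod (f \<tau>)"
    have \<psi>: "\<psi> \<ge> 0" using \<open>Im \<tau> > 0\<close> by (simp add: \<psi>_def)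
    then have "1 * 1 \<le> E * (1 + \<psi>)" using assms by (intro mult_mono) auto
    then have "max 1 (E * \<psi>) \<le> E * (1 + \<psi>)" using assms \<psi> by (simp add: algebra_simps)
    then have "ln (max 1 (E * \<psi>)) \<le> ln (E * (1 + \<psi>))" by (intro ln_mono) auto
    also have "\<dots> = ln E + ln (1 + \<psi>)" using assms \<psi> by (simp add: ln_mult)
    finally have "logp E f \<tau> \<le> ln E + ln (1 + \<psi>)" using \<tau> by (simp add: logp_def \<psi>_def mult.assoc)
    then have "ennreal (logp E f \<tau>) \<le> ennreal (ln E) + ennreal (ln (1 + \<psi>))"
      using assms \<psi> by (simp add: ennreal_leI flip: ennreal_plus)
    also have "\<dots> \<le> ennreal (ln E) + ennreal (3/2) * logsum \<tau>"
      using bound[OF \<tau>] by (intro add_left_mono) (simp add: \<psi>_def)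
    finally show "indicator D \<tau> * ennreal (logp E f \<tau>) \<le> ennreal (ln E) * indicator D \<tau> + ennreal (3/2) * (indicator D \<tau> * logsum \<tau>)"
      by (auto simp: indicator_def)
  qed
  also have "\<dots> = ennreal (ln E) * emeasure hyp D + ennreal (3/2) * (\<integral>\<^sup>+\<tau>. indicator D \<tau> * logsum \<tau> \<partial>hyp)"
    by (subst nn_integral_add) (auto simp: nn_integral_cmult)
  also have "\<dots> < \<infinity>"
    using logsum_integral_finite area hyperbolic_area_eq[OF D_measurable D_sub]
    by (simp add: ennreal_mult_less_top)
  finally show ?thesis .
qed

lemma AE_nonzero: "AE \<tau> in hyp. f \<tau> \<noteq> 0"
proof -
  define S where "S = {z\<in>upper_half_plane. f z = 0}"
  have "countable S"
  proof (cases "f constant_on upper_half_plane")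
    case True
    then have "S = {}" using f(2) unfolding constant_on_def S_def by (metis (mono_tags, lifting) empty_Collect_eq)
    then show ?thesis by simp
  next
    case False
    then show ?thesis unfolding S_def using f open_upper connected_upper fsigma_upper
      by (intro holomorphic_countable_zeros) auto
  qed
  then have null: "S \<in> null_sets lborel" by (rule countable_imp_null_set_lborel)
  then have "negligible S" by (simp add: negligible_iff_null_sets null_sets_completionI)
  moreover have "S \<in> sets borel" using null_setsD2[OF null] by simp
  ultimately have "AE \<tau> in hyp. \<tau> \<notin> S" by (intro AE_hyp_negligible)
  then show ?thesis using AE_hyp_upper by eventually_elim (auto simp: S_def)
qed

text \<open>The pointwise inequality is integrated over \<open>D\<close>. By
  \<open>average_le\<close> the annulus means of \<open>logp\<close> integrate to no more than
  \<open>\<kappa>\<close> times the integral of \<open>logp\<close>, and this quantity cancels on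
  both sides, leaving the zero count against the area.\<close>

lemma count_bound:
  assumes Y: "inequivalent_zeros Y"
  shows "of_nat (card Y) * (ennreal (ln 2 / 4) * emeasure hyp (pball \<i>)) \<le> ennreal (3 * ln (4/3)) * hyperbolic_area D"
proof -
  define S where "S \<tau> = (\<Sum>z\<in>Y. orbit_count z \<tau>)" for \<tau>
  have [measurable]: "S \<in> borel_measurable borel"
    unfolding S_def[abs_def] using orbit_count_measurable by measurable
  \<comment> \<open>The set where the truncation at level n + 1 is inactive. It grows with n to the
    complement of the zeros of \<open>f\<close>, and those form a null set.\<close>
  define Q where "Q n = {\<tau>\<in>upper_half_plane. real (Suc n) * ((Im \<tau>)^3 * cmod (f \<tau>)) \<ge> 1}" for n
  have [measurable]: "Q n \<in> sets borel" for n
  proof -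
    have "continuous_on upper_half_plane (\<lambda>\<tau>. real (Suc n) * ((Im \<tau>)^3 * cmod (f \<tau>)))"
      by (intro continuous_intros holomorphic_on_imp_continuous_on f)
    from borel_measurable_continuous_on_indicator[OF upper_measurable this]
    have [measurable]: "(\<lambda>\<tau>. indicator upper_half_plane \<tau> *\<^sub>R (real (Suc n) * ((Im \<tau>)^3 * cmod (f \<tau>)))) \<in> borel_measurable borel" .
    have "{\<tau>. indicator upper_half_plane \<tau> *\<^sub>R (real (Suc n) * ((Im \<tau>)^3 * cmod (f \<tau>))) \<ge> 1} \<in> sets borel"
      by measurable
    moreover have "Q n = {\<tau>. indicator upper_half_plane \<tau> *\<^sub>R (real (Suc n) * ((Im \<tau>)^3 * cmod (f \<tau>))) \<ge> 1}"
      by (auto simp: Q_def indicator_def)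
    ultimately show ?thesis by (simp only:)
  qed
  define \<kappa> where "\<kappa> = emeasure hyp (ann \<i>)"
  have \<kappa>: "\<kappa> \<noteq> 0" "\<kappa> \<noteq> \<infinity>" using emeasure_hyp_ann_pos emeasure_hyp_ann_finite by (auto simp: \<kappa>_def)
  define c where "c = ennreal (3 * ln (4/3))"
  define b where "b = ennreal (ln 2 / 4)"
  have step: "b * (\<integral>\<^sup>+\<tau>. indicator D \<tau> * (indicator (Q n) \<tau> * S \<tau>) \<partial>hyp) \<le> c * hyperbolic_area D" for n
  proof -
    define v where "v \<tau> = ennreal (logp (real (Suc n)) f \<tau>)" for \<tau>
    have [measurable]: "v \<in> borel_measurable borel" unfolding v_def[abs_def]
      by (rule measurable_compose[OF logp_measurable[OF f(1)] measurable_ennreal])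
    define I where "I = (\<integral>\<^sup>+\<tau>. indicator D \<tau> * v \<tau> \<partial>hyp)"
    \<comment> \<open>Finiteness is what permits the cancellation of I at the end of this
      step.\<close>
    have I: "I \<noteq> \<infinity>" unfolding I_def v_def using logp_integrable[of "real (Suc n)"] by simp
    have "\<kappa> * (I + b * (\<integral>\<^sup>+\<tau>. indicator D \<tau> * (indicator (Q n) \<tau> * S \<tau>) \<partial>hyp)) =
      (\<integral>\<^sup>+\<tau>. \<kappa> * (indicator D \<tau> * v \<tau> + b * (indicator D \<tau> * (indicator (Q n) \<tau> * S \<tau>))) \<partial>hyp)"
      unfolding I_def by (simp add: nn_integral_cmult nn_integral_add)
    also have "\<dots> \<le> (\<integral>\<^sup>+\<tau>. indicator D \<tau> * (\<integral>\<^sup>+w. indicator (ann \<tau>) w * v w \<partial>hyp) + (c * \<kappa>) * indicator D \<tau> \<partial>hyp)"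
    proof (rule nn_integral_hyp_mono)
      fix \<tau> assume \<tau>: "\<tau> \<in> upper_half_plane"
      show "\<kappa> * (indicator D \<tau> * v \<tau> + b * (indicator D \<tau> * (indicator (Q n) \<tau> * S \<tau>))) \<le>
         indicator D \<tau> * (\<integral>\<^sup>+w. indicator (ann \<tau>) w * v w \<partial>hyp) + (c * \<kappa>) * indicator D \<tau>"
      proof (cases "\<tau> \<in> Q n")
        case True
        then have "\<kappa> * (v \<tau> + b * S \<tau>) \<le> (\<integral>\<^sup>+w. indicator (ann \<tau>) w * v w \<partial>hyp) + c * \<kappa>"
          unfolding \<kappa>_def b_def c_def v_def S_def
          by (intro pointwise_inequality[OF Y \<tau>]) (auto simp: Q_def mult.assoc)
        then show ?thesis using True by (auto simp: indicator_def)
      next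
        \<comment> \<open>Off \<open>Q n\<close> the truncated logarithm is 0 and the count is
          masked, so the left side vanishes.\<close>
        case False
        then have "real (Suc n) * ((Im \<tau>)^3 * cmod (f \<tau>)) < 1" using \<tau> by (auto simp: Q_def)
        then have "max 1 (real (Suc n) * (Im \<tau>)^3 * cmod (f \<tau>)) = 1" by (simp add: mult.assoc)
        then have "v \<tau> = 0" unfolding v_def logp_def by simp
        then show ?thesis using False by simp
      qed
    qed
    also have "\<dots> = (\<integral>\<^sup>+\<tau>. indicator D \<tau> * (\<integral>\<^sup>+w. indicator (ann \<tau>) w * v w \<partial>hyp) \<partial>hyp) + (c * \<kappa>) * emeasure hyp D"
    proof -
      interpret hyp: sigma_finite_measure hyp by (rule sigma_finite_hyp)
      have "(\<lambda>(\<tau>, w). indicator (ann \<tau>) w * v w) \<in> borel_measurable (hyp \<Otimes>\<^sub>M hyp)"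
        using ann_pair_measurable unfolding case_prod_beta by measurable
      then have [measurable]: "(\<lambda>\<tau>. \<integral>\<^sup>+w. indicator (ann \<tau>) w * v w \<partial>hyp) \<in> borel_measurable hyp"
        by (rule hyp.borel_measurable_nn_integral)
      show ?thesis by (subst nn_integral_add) (auto simp: nn_integral_cmult)
    qed
    also have "\<dots> \<le> \<kappa> * I + (c * \<kappa>) * emeasure hyp D"
      unfolding \<kappa>_def I_def
      by (intro add_right_mono average_le) (measurable, simp add: v_def logp_invariant)
    also have "\<dots> = \<kappa> * (I + c * emeasure hyp D)" by (simp add: distrib_left mult_ac)
    finally have "I + b * (\<integral>\<^sup>+\<tau>. indicator D \<tau> * (indicator (Q n) \<tau> * S \<tau>) \<partial>hyp) \<le> I + c * emeasure hyp D"
      using \<kappa> by (subst (asm) ennreal_mult_le_mult_iff) auto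
    then show ?thesis using I hyperbolic_area_eq[OF D_measurable D_sub] by (simp add: ennreal_add_left_cancel_le)
  qed
  have "(\<integral>\<^sup>+\<tau>. indicator D \<tau> * S \<tau> \<partial>hyp) \<le> (\<integral>\<^sup>+\<tau>. (SUP n. indicator D \<tau> * (indicator (Q n) \<tau> * S \<tau>)) \<partial>hyp)"
  proof (rule nn_integral_mono_AE)
    show "AE \<tau> in hyp. indicator D \<tau> * S \<tau> \<le> (SUP n. indicator D \<tau> * (indicator (Q n) \<tau> * S \<tau>))"
      using AE_hyp_upper AE_nonzero
    proof eventually_elim
      case (elim \<tau>)
      then have "(Im \<tau>)^3 * cmod (f \<tau>) > 0" by (simp add: upper_half_plane_def)
      then obtain n where "1 < real n * ((Im \<tau>)^3 * cmod (f \<tau>))" using reals_Archimedean3 by blast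
      also have "\<dots> \<le> real (Suc n) * ((Im \<tau>)^3 * cmod (f \<tau>))"
        using \<open>(Im \<tau>)^3 * cmod (f \<tau>) > 0\<close> by (intro mult_right_mono) auto
      finally have "\<tau> \<in> Q n" using elim by (simp add: Q_def)
      then have "indicator D \<tau> * S \<tau> = indicator D \<tau> * (indicator (Q n) \<tau> * S \<tau>)" by simp
      also have "\<dots> \<le> (SUP n. indicator D \<tau> * (indicator (Q n) \<tau> * S \<tau>))" by (rule SUP_upper) simp
      finally show ?case .
    qed
  qed
  also have "\<dots> = (SUP n. \<integral>\<^sup>+\<tau>. indicator D \<tau> * (indicator (Q n) \<tau> * S \<tau>) \<partial>hyp)"
  proof (rule nn_integral_monotone_convergence_SUP)
    show "incseq (\<lambda>n \<tau>. indicator D \<tau> * (indicator (Q n) \<tau> * S \<tau>))"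
    proof (rule incseq_SucI, rule le_funI)
      fix n \<tau>
      have "\<tau> \<in> Q (Suc n)" if "\<tau> \<in> Q n"
      proof -
        have up: "\<tau> \<in> upper_half_plane" and 1: "1 \<le> real (Suc n) * ((Im \<tau>)^3 * cmod (f \<tau>))" using that by (auto simp: Q_def)
        note 1
        also have "real (Suc n) * ((Im \<tau>)^3 * cmod (f \<tau>)) \<le> real (Suc (Suc n)) * ((Im \<tau>)^3 * cmod (f \<tau>))"
          using up by (intro mult_right_mono) (auto simp: upper_half_plane_def)
        finally show ?thesis using up by (simp add: Q_def)
      qed
      then show "indicator D \<tau> * (indicator (Q n) \<tau> * S \<tau>) \<le> indicator D \<tau> * (indicator (Q (Suc n)) \<tau> * S \<tau>)"
        by (intro mult_left_mono mult_right_mono) (auto simp: indicator_def)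
    qed
  qed measurable
  finally have "b * (\<integral>\<^sup>+\<tau>. indicator D \<tau> * S \<tau> \<partial>hyp) \<le> b * (SUP n. \<integral>\<^sup>+\<tau>. indicator D \<tau> * (indicator (Q n) \<tau> * S \<tau>) \<partial>hyp)"
    by (rule mult_left_mono) simp
  also have "\<dots> = (SUP n. b * (\<integral>\<^sup>+\<tau>. indicator D \<tau> * (indicator (Q n) \<tau> * S \<tau>) \<partial>hyp))"
    by (rule SUP_mult_left_ennreal)
  also have "\<dots> \<le> c * hyperbolic_area D" using step by (intro SUP_least) auto
  finally have upper: "b * (\<integral>\<^sup>+\<tau>. indicator D \<tau> * S \<tau> \<partial>hyp) \<le> c * hyperbolic_area D" .
  have "of_nat (card Y) * emeasure hyp (pball \<i>) = (\<Sum>z\<in>Y. emeasure hyp (pball \<i>))" by simp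
  also have "\<dots> \<le> (\<Sum>z\<in>Y. (\<integral>\<^sup>+\<tau>. indicator D \<tau> * orbit_count z \<tau> \<partial>hyp))"
    using Y by (intro sum_mono orbit_count_integral) (auto simp: inequivalent_zeros_def)
  also have "\<dots> = (\<integral>\<^sup>+\<tau>. indicator D \<tau> * S \<tau> \<partial>hyp)"
    unfolding S_def sum_distrib_left using orbit_count_measurable by (subst nn_integral_sum) auto
  finally have "b * (of_nat (card Y) * emeasure hyp (pball \<i>)) \<le> b * (\<integral>\<^sup>+\<tau>. indicator D \<tau> * S \<tau> \<partial>hyp)"
    by (rule mult_left_mono) simp
  with upper show ?thesis unfolding b_def c_def by (simp add: mult_ac)
qed

text \<open>Otherwise inequivalent zeros could be added one at a time without end, against
  \<open>count_bound\<close>.\<close>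

proposition finitely_many_zeros:
  obtains Z where "finite Z" "Z \<subseteq> {z\<in>upper_half_plane. f z = 0}"
    "\<And>z. z \<in> upper_half_plane \<Longrightarrow> f z = 0 \<Longrightarrow> \<exists>z0\<in>Z. \<exists>g\<in>G. z = act g z0"
proof -
  have "\<exists>Z. inequivalent_zeros Z \<and> (\<forall>z\<in>upper_half_plane. f z = 0 \<longrightarrow> (\<exists>z0\<in>Z. \<exists>g\<in>G. z = act g z0))"
  proof (rule ccontr)
    assume no: "\<not> ?thesis"
    have "\<exists>Y. inequivalent_zeros Y \<and> card Y = n" for n
    proof (induction n)
      case 0
      show ?case by (rule exI[of _ "{}"]) (simp add: inequivalent_zeros_def)
    next
      case (Suc n)
      then obtain Y where Y: "inequivalent_zeros Y" "card Y = n" by blast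
      with no obtain z where z: "z \<in> upper_half_plane" "f z = 0" "\<And>z0 g. z0 \<in> Y \<Longrightarrow> g \<in> G \<Longrightarrow> z \<noteq> act g z0"
        by blast
      have "z \<notin> Y" using z(3)[of z "\<one>\<^bsub>PSL2R\<^esub>"] by auto
      have ne: "z' = z" if "z' \<in> Y" "g \<in> G" "act g z = z'" for z' g
      proof -
        have "z = act (inv\<^bsub>PSL2R\<^esub> g) z'" using that z act_inv(1)[of g z] by (simp add: upper_half_plane_def)
        then show ?thesis using z(3)[of z' "inv\<^bsub>PSL2R\<^esub> g"] that by simp
      qed
      have "inequivalent_zeros (insert z Y)"
        unfolding inequivalent_zeros_def
      proof (intro conjI ballI impI)
        show "finite (insert z Y)" "insert z Y \<subseteq> {z\<in>upper_half_plane. f z = 0}"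
          using Y z by (auto simp: inequivalent_zeros_def)
        fix a a' g assume a: "a \<in> insert z Y" "a' \<in> insert z Y" "g \<in> G" "act g a = a'"
        then consider "a = z" "a' = z" | "a = z" "a' \<in> Y" | "a \<in> Y" "a' = z" | "a \<in> Y" "a' \<in> Y" by blast
        then show "a = a'"
        proof cases
          case 2
          then show ?thesis using ne[of a' g] a by simp
        next
          case 3
          then show ?thesis using z(3)[of a g] a by simp
        next
          case 4
          then show ?thesis using Y a by (auto simp: inequivalent_zeros_def)
        qed simp
      qed
      moreover have "card (insert z Y) = Suc n" using Y \<open>z \<notin> Y\<close> by (simp add: inequivalent_zeros_def)
      ultimately show ?case by blast
    qed
    then have "of_nat n * (ennreal (ln 2 / 4) * emeasure hyp (pball \<i>)) \<le> ennreal (3 * ln (4/3)) * hyperbolic_area D" for n :: nat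
      using count_bound by metis
    moreover have "ennreal (3 * ln (4/3)) * hyperbolic_area D < \<infinity>" using area by (simp add: ennreal_mult_less_top)
    ultimately have "ennreal (ln 2 / 4) * emeasure hyp (pball \<i>) = 0" by (rule ennreal_bounded_multiples)
    then show False using emeasure_hyp_pball_pos by auto
  qed
  then obtain Z where Z: "inequivalent_zeros Z" "\<forall>z\<in>upper_half_plane. f z = 0 \<longrightarrow> (\<exists>z0\<in>Z. \<exists>g\<in>G. z = act g z0)"
    by blast
  show ?thesis
  proof (rule that[of Z])
    show "finite Z" "Z \<subseteq> {z\<in>upper_half_plane. f z = 0}" using Z(1) by (simp_all add: inequivalent_zeros_def)
  qed (use Z(2) in simp)
qed

end

end

section \<open>Expansions of periodic functions\<close>

abbreviation qexp :: "complex \<Rightarrow> complex" where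
  "qexp z \<equiv> exp (2 * of_real pi * \<i> * z)"

lemma norm_qexp: "cmod (qexp z) = exp (- 2 * pi * Im z)"
  by (simp add: norm_exp_eq_Re)

lemma norm_qexp_less_1: "z \<in> upper_half_plane \<Longrightarrow> cmod (qexp z) < 1"
  by (simp add: norm_qexp upper_half_plane_def)

lemma qexp_eq_iff: "qexp z = qexp w \<longleftrightarrow> (\<exists>n::int. z = w + of_int n)"
proof -
  have "2 * of_real pi * \<i> * z = 2 * of_real pi * \<i> * w + (of_int (2 * n) * pi) * \<i> \<longleftrightarrow> z = w + of_int n" for n :: int
  proof -
    have "2 * of_real pi * \<i> * w + (of_int (2 * n) * pi) * \<i> = 2 * of_real pi * \<i> * (w + of_int n)"
      by (simp add: algebra_simps)
    then show ?thesis by simp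
  qed
  then show ?thesis unfolding exp_eq by blast
qed

locale periodic_holomorphic =
  fixes S :: "complex \<Rightarrow> complex"
  assumes hol: "S holomorphic_on upper_half_plane"
    and periodic: "\<And>z. z \<in> upper_half_plane \<Longrightarrow> S (z + 1) = S z"
begin

lemma periodic_int:
  assumes "z \<in> upper_half_plane"
  shows "S (z + of_int n) = S z"
proof -
  have nat: "S (z + of_nat k) = S z" if "z \<in> upper_half_plane" for z and k :: nat
  proof (induction k)
    case (Suc k)
    have "z + of_nat k \<in> upper_half_plane" using that by (simp add: upper_half_plane_def)
    from periodic[OF this] Suc show ?case by (simp add: add_ac)
  qed simp
  show ?thesis
  proof (cases "n \<ge> 0")
    case True
    then show ?thesis using nat[OF assms, of "nat n"] by simp
  next
    case False
    have "z + of_int n \<in> upper_half_plane" using assms by (simp add: upper_half_plane_def)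
    from nat[OF this, of "nat (- n)"] False show ?thesis by (simp add: add.assoc)
  qed
qed

text \<open>The principal branch of \<open>Ln\<close> jumps across the negative axis, which does not
  show in \<open>F\<close> inside the unit disc because \<open>S\<close> has period 1.\<close>

definition F :: "complex \<Rightarrow> complex" where
  "F q = S (Ln q / (2 * of_real pi * \<i>))"

lemma F_qexp:
  assumes "z \<in> upper_half_plane"
  shows "F (qexp z) = S z"
proof -
  have "qexp (Ln (qexp z) / (2 * of_real pi * \<i>)) = qexp z" by simp
  then obtain n :: int where "Ln (qexp z) / (2 * of_real pi * \<i>) = z + of_int n" unfolding qexp_eq_iff by blast
  then show ?thesis using periodic_int[OF assms] by (simp add: F_def)
qed

lemma F_holomorphic: "F holomorphic_on (ball 0 1 - {0})"
proof (rule analytic_imp_holomorphic, unfold analytic_on_def, intro ballI)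
  fix q0 :: complex assume q0: "q0 \<in> ball 0 1 - {0}"
  \<comment> \<open>This radius keeps the disc inside the punctured unit disc; there q / q0 stays in
    the right half plane, so \<open>Ln (q / q0)\<close> is a holomorphic branch.\<close>
  define r where "r = min (cmod q0) (1 - cmod q0)"
  have r: "r > 0" using q0 by (simp add: r_def)
  define L where "L q = Ln q0 / (2 * of_real pi * \<i>) + Ln (q / q0) / (2 * of_real pi * \<i>)" for q
  have re: "q / q0 \<notin> \<real>\<^sub>\<le>\<^sub>0" "q \<noteq> 0" "cmod q < 1" if q: "q \<in> ball q0 r" for q
  proof -
    have d: "cmod (q - q0) < cmod q0" "cmod (q - q0) < 1 - cmod q0"
      using q by (auto simp: r_def dist_norm norm_minus_commute)
    then show "q \<noteq> 0" by auto
    show "cmod q < 1" using d norm_triangle_ineq[of q0 "q - q0"] by simp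
    have "cmod (q / q0 - 1) < 1"
    proof -
      have "q / q0 - 1 = (q - q0) / q0" using q0 by (simp add: field_simps)
      then show ?thesis using d q0 by (simp add: norm_divide)
    qed
    then have "Re (q / q0) > 0" using abs_Re_le_cmod[of "q / q0 - 1"] by simp
    then show "q / q0 \<notin> \<real>\<^sub>\<le>\<^sub>0" by (auto simp: complex_nonpos_Reals_iff)
  qed
  have qL: "qexp (L q) = q" if q: "q \<in> ball q0 r" for q
    using re[OF q] q0 by (simp add: L_def distrib_left exp_add)
  have Lup: "L q \<in> upper_half_plane" if q: "q \<in> ball q0 r" for q
  proof -
    have "exp (- 2 * pi * Im (L q)) < 1" using norm_qexp[of "L q"] qL[OF q] re[OF q] by simp
    then have "pi * Im (L q) > 0" by simp
    from zero_less_mult_pos[OF this pi_gt_zero] show ?thesis by (simp add: upper_half_plane_def)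
  qed
  have "L holomorphic_on ball q0 r"
    unfolding L_def using re q0 by (intro holomorphic_intros) auto
  then have "S \<circ> L holomorphic_on ball q0 r"
    using Lup by (intro holomorphic_on_compose_gen[OF _ hol]) auto
  moreover have "(S \<circ> L) q = F q" if q: "q \<in> ball q0 r" for q
    using F_qexp[OF Lup[OF q]] qL[OF q] by simp
  ultimately have "F holomorphic_on ball q0 r" by (rule holomorphic_transform)
  then show "\<exists>\<epsilon>>0. F holomorphic_on ball q0 \<epsilon>" using r by blast
qed

text \<open>Moderate growth in a vertical strip makes the singularity at q = 0 at most a pole.\<close>

lemma extension:
  assumes growth: "\<And>z. 0 \<le> Re z \<Longrightarrow> Re z \<le> 1 \<Longrightarrow> Im z \<ge> y0 \<Longrightarrow> cmod (S z) \<le> C * exp (K * Im z)"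
  obtains M0 :: nat where "\<And>M. M \<ge> M0 \<Longrightarrow> \<exists>g. g holomorphic_on ball 0 1 \<and>
    (\<forall>z\<in>upper_half_plane. qexp z ^ M * S z = g (qexp z))"
\<comment> \<open>Since |q| = exp(-2 pi Im z) and 2 pi > 1, a power of q with exponent M \<ge> |K|
  compensates the growth exp(K Im z).\<close>
proof (rule that[of "nat \<lceil>\<bar>K\<bar>\<rceil>"])
  fix M :: nat assume M: "M \<ge> nat \<lceil>\<bar>K\<bar>\<rceil>"
  then have MK: "real M \<ge> \<bar>K\<bar>" by linarith
  define y1 where "y1 = max 1 y0"
  have bd: "cmod (q ^ M * F q) \<le> \<bar>C\<bar>" if q: "q \<noteq> 0" "cmod q < exp (- 2 * pi * y1)" for q
  proof -
    define z0 where "z0 = Ln q / (2 * of_real pi * \<i>)"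
    \<comment> \<open>An integral shift moves z0 into the strip where the growth assumption
      applies.\<close>
    define z where "z = z0 - of_int \<lfloor>Re z0\<rfloor>"
    have "qexp z0 = q" using q by (simp add: z0_def)
    moreover have "qexp z = qexp z0" unfolding qexp_eq_iff by (rule exI[of _ "- \<lfloor>Re z0\<rfloor>"]) (simp add: z_def)
    ultimately have zq: "qexp z = q" by simp
    then have "exp (- 2 * pi * Im z) < exp (- 2 * pi * y1)" using q norm_qexp[of z] by simp
    then have Imz: "Im z > y1" by simp
    then have up: "z \<in> upper_half_plane" by (simp add: upper_half_plane_def y1_def)
    have Re: "0 \<le> Re z" "Re z \<le> 1" unfolding z_def using floor_correct[of "Re z0"] by simp_all linarith
    have "cmod (F q) = cmod (S z)" using F_qexp[OF up] zq by simp
    also have "\<dots> \<le> C * exp (K * Im z)" using growth[OF Re] Imz by (simp add: y1_def)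
    also have "\<dots> \<le> \<bar>C\<bar> * exp (real M * (2 * pi * Im z))"
    proof (intro mult_mono)
      have "K * Im z \<le> real M * Im z" using MK Imz by (intro mult_right_mono) (auto simp: y1_def)
      also have "\<dots> \<le> real M * (2 * pi * Im z)" using Imz pi_gt3 by (intro mult_left_mono) (auto simp: y1_def)
      finally show "exp (K * Im z) \<le> exp (real M * (2 * pi * Im z))" by simp
    qed auto
    finally have "cmod (F q) \<le> \<bar>C\<bar> * exp (real M * (2 * pi * Im z))" .
    then have "cmod (q ^ M) * cmod (F q) \<le> cmod (q ^ M) * (\<bar>C\<bar> * exp (real M * (2 * pi * Im z)))"
      by (rule mult_left_mono) simp
    moreover have "cmod (q ^ M) = exp (- (real M * (2 * pi * Im z)))"
      unfolding norm_power zq[symmetric] norm_qexp by (simp flip: exp_of_nat_mult)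
    then have "cmod (q ^ M) * exp (real M * (2 * pi * Im z)) = 1" by (simp flip: exp_add)
    then have "cmod (q ^ M) * (\<bar>C\<bar> * exp (real M * (2 * pi * Im z))) = \<bar>C\<bar>"
      by (metis mult.left_commute mult.right_neutral)
    ultimately show ?thesis by (simp add: norm_mult)
  qed
  have "(\<lambda>q. q ^ M * F q) holomorphic_on (ball 0 1 - {0})"
    by (intro holomorphic_intros F_holomorphic)
  moreover have "\<exists>B. \<forall>\<^sub>F q in at 0. cmod (q ^ M * F q) \<le> B"
  proof (intro exI)
    have "\<forall>\<^sub>F q in at (0::complex). q \<in> ball 0 (exp (- 2 * pi * y1)) - {0}"
      by (rule eventually_at_in_open) auto
    then show "\<forall>\<^sub>F q in at 0. cmod (q ^ M * F q) \<le> \<bar>C\<bar>"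
      by eventually_elim (rule bd, auto)
  qed
  ultimately obtain g where g: "g holomorphic_on ball 0 1" "\<And>q. q \<in> ball 0 1 - {0} \<Longrightarrow> g q = q ^ M * F q"
    using holomorphic_on_extend_bounded[of "\<lambda>q. q ^ M * F q" "ball 0 1" 0] by auto
  show "\<exists>g. g holomorphic_on ball 0 1 \<and> (\<forall>z\<in>upper_half_plane. qexp z ^ M * S z = g (qexp z))"
  proof (intro exI conjI ballI)
    fix z assume z: "z \<in> upper_half_plane"
    then show "qexp z ^ M * S z = g (qexp z)" using g(2)[of "qexp z"] norm_qexp_less_1[OF z] F_qexp[OF z] by simp
  qed (rule g)
qed

text \<open>Every order beyond a threshold is allowed, so that the components of a vector can later
  share one order. The coefficients are those of the power series of the extension, shifted by
  M.\<close>

lemma expansion: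
  assumes growth: "\<And>z. 0 \<le> Re z \<Longrightarrow> Re z \<le> 1 \<Longrightarrow> Im z \<ge> y0 \<Longrightarrow> cmod (S z) \<le> C * exp (K * Im z)"
  obtains M0 :: nat where "\<And>M. M \<ge> M0 \<Longrightarrow> \<exists>a::int \<Rightarrow> complex.
    (\<forall>z\<in>upper_half_plane. ((\<lambda>n. qexp z powi n * a n) has_sum S z) {- int M..})"
proof -
  obtain M0 where M0: "\<And>M. M \<ge> M0 \<Longrightarrow> \<exists>g. g holomorphic_on ball 0 1 \<and>
    (\<forall>z\<in>upper_half_plane. qexp z ^ M * S z = g (qexp z))"
    by (rule extension[OF growth]) blast+
  show ?thesis
  proof (rule that[of M0])
    fix M assume "M \<ge> M0"
    then obtain g where g: "g holomorphic_on ball 0 1" "\<And>z. z \<in> upper_half_plane \<Longrightarrow> qexp z ^ M * S z = g (qexp z)"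
      using M0 by blast
    define b where "b n = (deriv ^^ n) g 0 / fact n" for n
    define a where "a n = b (nat (n + int M))" for n :: int
    show "\<exists>a::int \<Rightarrow> complex. (\<forall>z\<in>upper_half_plane. ((\<lambda>n. qexp z powi n * a n) has_sum S z) {- int M..})"
    proof (intro exI ballI)
      fix z assume z: "z \<in> upper_half_plane"
      define q where "q = qexp z"
      have q: "cmod q < 1" "q \<noteq> 0" using norm_qexp_less_1[OF z] by (auto simp: q_def)
      have sums: "(\<lambda>n. b n * w ^ n) sums g w" if "cmod w < 1" for w
        using holomorphic_power_series[OF g(1), of w] that by (simp add: b_def)
      define r where "r = (1 + cmod q) / 2"
      have r: "cmod q < r" "r < 1" "r > 0" using q(1) by (auto simp: r_def add_pos_nonneg)
      have "summable (\<lambda>n. b n * (of_real r) ^ n)" using sums[of "of_real r"] r by (auto simp: sums_iff)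
      then have "summable (\<lambda>n. norm (b n * q ^ n))" by (rule powser_insidea) (use r in simp)
      then have "((\<lambda>n. b n * q ^ n) has_sum g q) UNIV"
        using sums[OF q(1)] by (rule norm_summable_imp_has_sum)
      then have "((\<lambda>n. (1 / q ^ M) * (b n * q ^ n)) has_sum ((1 / q ^ M) * g q)) UNIV"
        by (rule has_sum_cmult_right)
      moreover have "(1 / q ^ M) * g q = S z" using g(2)[OF z, folded q_def] q by (simp add: field_simps)
      ultimately have hs: "((\<lambda>n. (1 / q ^ M) * (b n * q ^ n)) has_sum S z) UNIV" by simp
      have bij: "bij_betw (\<lambda>n::nat. int n - int M) UNIV {- int M..}"
        by (rule bij_betw_byWitness[where f' = "\<lambda>n. nat (n + int M)"]) auto
      have "((\<lambda>n. q powi n * a n) has_sum S z) {- int M..} \<longleftrightarrow> ((\<lambda>n. q powi (int n - int M) * a (int n - int M)) has_sum S z) UNIV"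
        by (rule has_sum_reindex_bij_betw[OF bij, symmetric])
      also have "\<dots> \<longleftrightarrow> ((\<lambda>n. (1 / q ^ M) * (b n * q ^ n)) has_sum S z) UNIV"
        using q by (intro has_sum_cong) (simp add: a_def power_int_diff)
      finally show "((\<lambda>n. qexp z powi n * a n) has_sum S z) {- int M..}" using hs by (simp add: q_def)
    qed
  qed
qed

text \<open>The extension of q^M S across q = 0 is not identically zero, so near 0 it is comparable
  to |q|^m with m its order there; as |q| < 1, removing q^M only increases the modulus.\<close>

lemma lower_bound:
  assumes growth: "\<And>z. 0 \<le> Re z \<Longrightarrow> Re z \<le> 1 \<Longrightarrow> Im z \<ge> y0 \<Longrightarrow> cmod (S z) \<le> C * exp (K * Im z)"
    and nz: "z0 \<in> upper_half_plane" "S z0 \<noteq> 0"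
  obtains c k y1 where "c > 0" "k \<ge> 0" "\<And>z. z \<in> upper_half_plane \<Longrightarrow> Im z \<ge> y1 \<Longrightarrow> cmod (S z) \<ge> c * exp (- k * Im z)"
proof -
  obtain M0 where M0: "\<And>M. M \<ge> M0 \<Longrightarrow> \<exists>g. g holomorphic_on ball 0 1 \<and>
    (\<forall>z\<in>upper_half_plane. qexp z ^ M * S z = g (qexp z))"
    by (rule extension[OF growth]) blast+
  then obtain M g where g: "g holomorphic_on ball 0 1" "\<And>z. z \<in> upper_half_plane \<Longrightarrow> qexp z ^ M * S z = g (qexp z)"
    by blast
  have "g (qexp z0) \<noteq> 0" using g(2)[OF nz(1)] nz(2) by (metis exp_not_eq_zero mult_eq_0_iff power_not_zero)
  then have nc: "\<exists>w\<in>ball 0 1. g w \<noteq> 0" using norm_qexp_less_1[OF nz(1)] by (intro bexI[of _ "qexp z0"]) auto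
  obtain k where k: "k holomorphic_on ball 0 1" "k 0 \<noteq> 0" "\<And>w. w \<in> ball 0 1 \<Longrightarrow> g w = (w - 0) ^ nat (zorder g 0) * k w"
    using factor_one_zero[OF g(1) open_ball connected_ball _ nc, of 0] by auto
  define m where "m = nat (zorder g 0)"
  have "isCont k 0" using holomorphic_on_imp_continuous_on[OF k(1)] by (simp add: continuous_on_eq_continuous_at)
  then have "\<forall>\<^sub>F w in at 0. dist (k w) (k 0) < cmod (k 0) / 2"
    using k(2) unfolding isCont_def by (intro tendstoD) auto
  then obtain d where d: "d > 0" "\<And>w. w \<noteq> 0 \<Longrightarrow> dist w 0 < d \<Longrightarrow> dist (k w) (k 0) < cmod (k 0) / 2"
    unfolding eventually_at by blast
  define y1 where "y1 = max 1 (- ln d)"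
  show ?thesis
  proof (rule that[of "cmod (k 0) / 2" "2 * pi * real m" y1])
    fix z assume z: "z \<in> upper_half_plane" "Im z \<ge> y1"
    define q where "q = qexp z"
    have q: "q \<in> ball 0 1" "q \<noteq> 0" using norm_qexp_less_1[OF z(1)] by (auto simp: q_def)
    have nq: "cmod q = exp (- 2 * pi * Im z)" by (simp add: q_def norm_qexp)
    have "- 2 * pi * Im z < ln d"
    proof -
      have "Im z \<ge> 1" "Im z \<ge> - ln d" using z by (auto simp: y1_def)
      moreover have "1 * Im z < 2 * pi * Im z" using \<open>Im z \<ge> 1\<close> pi_gt3 by (intro mult_strict_right_mono) auto
      ultimately show ?thesis by linarith
    qed
    then have "cmod q < exp (ln d)" unfolding nq by (simp only: exp_less_cancel_iff)
    then have "dist (k q) (k 0) < cmod (k 0) / 2" using d q by simp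
    then have kq: "cmod (k q) \<ge> cmod (k 0) / 2"
      using norm_triangle_ineq2[of "k 0" "k q"] by (simp add: dist_norm norm_minus_commute)
    have eq: "q ^ M * S z = q ^ m * k q" using g(2)[OF z(1)] k(3)[OF q(1)] by (simp add: q_def m_def)
    have "cmod (q ^ m * k q) = cmod (q ^ M) * cmod (S z)" by (simp add: eq[symmetric] norm_mult)
    also have "\<dots> \<le> 1 * cmod (S z)" using q by (intro mult_right_mono) (auto simp: norm_power power_le_one)
    finally have le: "cmod q ^ m * cmod (k q) \<le> cmod (S z)" by (simp add: norm_mult norm_power)
    have "cmod q ^ m * (cmod (k 0) / 2) \<le> cmod q ^ m * cmod (k q)" using kq by (intro mult_left_mono) auto
    also note le
    finally have "cmod q ^ m * (cmod (k 0) / 2) \<le> cmod (S z)" .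
    moreover have "cmod q ^ m = exp (- (2 * pi * real m) * Im z)" unfolding nq by (simp flip: exp_of_nat_mult)
    ultimately show "cmod (S z) \<ge> cmod (k 0) / 2 * exp (- (2 * pi * real m) * Im z)" by (simp add: mult.commute)
  qed (use k in auto)
qed

end

section \<open>Stabilizers of cusps\<close>

text \<open>The infimum of the positive elements is attained, since two distinct elements close to
  it would differ by less than \<open>\<epsilon>\<close>. The remainder of any element modulo this
  minimum is then 0.\<close>

lemma discrete_real_subgroup:
  fixes L :: "real set"
  assumes diff: "\<And>s t. s \<in> L \<Longrightarrow> t \<in> L \<Longrightarrow> s - t \<in> L" and s0: "s0 \<in> L" "s0 \<noteq> 0"
    and eps: "\<epsilon> > 0" "\<And>s. s \<in> L \<Longrightarrow> \<bar>s\<bar> < \<epsilon> \<Longrightarrow> s = 0"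
  obtains h where "h > 0" "L = range (\<lambda>n::int. of_int n * h)"
proof -
  have zero: "0 \<in> L" using diff[OF s0(1) s0(1)] by simp
  have neg: "- s \<in> L" if "s \<in> L" for s using diff[OF zero that] by simp
  have add: "s + t \<in> L" if "s \<in> L" "t \<in> L" for s t using diff[OF that(1) neg[OF that(2)]] by simp
  define A where "A = {s \<in> L. s > 0}"
  have "\<bar>s0\<bar> \<in> A" using s0 neg by (auto simp: A_def abs_if)
  then have ne: "A \<noteq> {}" by blast
  have bd: "bdd_below A" by (rule bdd_belowI[of _ 0]) (auto simp: A_def)
  define h where "h = Inf A"
  obtain s where s: "s \<in> A" "s < h + \<epsilon>"
    using cInf_lessD[OF ne, of "h + \<epsilon>"] eps by (auto simp: h_def)
  have hs: "h \<le> s" unfolding h_def using s bd by (rule_tac cInf_lower)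
  have "h = s"
  proof (rule ccontr)
    assume "h \<noteq> s"
    then have "h < s" using hs by simp
    then obtain s' where s': "s' \<in> A" "s' < s" using cInf_lessD[OF ne, of s] by (auto simp: h_def)
    have "h \<le> s'" unfolding h_def using s' bd by (rule_tac cInf_lower)
    then have "s - s' = 0" using s s' by (intro eps diff) (auto simp: A_def)
    then show False using s' by simp
  qed
  then have h: "h \<in> L" "h > 0" using s by (auto simp: A_def)
  have nat: "of_nat n * h \<in> L" for n :: nat
    by (induction n) (auto simp: zero algebra_simps intro: add h)
  have int: "of_int n * h \<in> L" for n :: int
    by (cases n) (use nat neg[OF nat] in \<open>auto simp del: of_nat_Suc\<close>)
  have "s \<in> range (\<lambda>n::int. of_int n * h)" if "s \<in> L" for s
  proof -
    define t where "t = s - of_int \<lfloor>s / h\<rfloor> * h"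
    have t: "t \<in> L" unfolding t_def using that int by (rule diff)
    have "of_int \<lfloor>s / h\<rfloor> * h \<le> s" "s < (of_int \<lfloor>s / h\<rfloor> + 1) * h"
      using h floor_correct[of "s / h"] by (simp_all only: pos_le_divide_eq pos_divide_less_eq of_int_add of_int_1)
    then have t0: "0 \<le> t" "t < h" by (simp_all add: t_def algebra_simps)
    have "t = 0"
    proof (rule ccontr)
      assume "t \<noteq> 0"
      then have "t \<in> A" using t t0 by (simp add: A_def)
      then have "h \<le> t" unfolding h_def using bd by (rule cInf_lower)
      then show False using t0 by simp
    qed
    then show ?thesis by (auto simp: t_def)
  qed
  then show ?thesis using that h int by blast
qed

fun cmat :: "boundary_point \<Rightarrow> real^2^2" where
  "cmat Infty = mat 1"
| "cmat (Fin x) = mat22 x (-1) 1 0"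

lemma cusp_matrix_cmat: "cusp_matrix c = psl (cmat c)"
  by (cases c) (simp_all add: psl_one psl2r_mat22)

lemma det_cmat [simp]: "det (cmat c) = 1"
  by (cases c) simp_all

lemma cusp_matrix_carrier [simp]: "cusp_matrix c \<in> carrier PSL2R"
  by (simp add: cusp_matrix_cmat psl_in_carrier)

abbreviation tmat :: "real \<Rightarrow> real^2^2" where
  "tmat s \<equiv> mat22 1 s 0 1"

lemma tmat_mult: "tmat s ** tmat t = tmat (s + t)"
  by (simp add: mat22_mult add.commute)

lemma cusp_translation_psl: "cusp_translation c s = psl (cmat c ** tmat s ** adj2 (cmat c))"
  by (simp add: cusp_translation_def cusp_matrix_cmat psl2r_mat22 psl_inv psl_mult det_mul)

lemma cusp_translation_carrier [simp]: "cusp_translation c s \<in> carrier PSL2R"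
  by (simp add: cusp_translation_psl psl_in_carrier det_mul)

lemma cusp_translation_add: "cusp_translation c s \<otimes>\<^bsub>PSL2R\<^esub> cusp_translation c t = cusp_translation c (s + t)"
proof -
  have "cmat c ** tmat s ** adj2 (cmat c) ** (cmat c ** tmat t ** adj2 (cmat c)) =
    cmat c ** tmat s ** (adj2 (cmat c) ** cmat c) ** tmat t ** adj2 (cmat c)"
    by (simp only: matrix_mul_assoc)
  also have "\<dots> = cmat c ** (tmat s ** tmat t) ** adj2 (cmat c)"
    by (simp add: adj2_mult matrix_mul_assoc)
  finally show ?thesis by (simp add: cusp_translation_psl psl_mult det_mul tmat_mult)
qed

lemma cusp_translation_0: "cusp_translation c 0 = \<one>\<^bsub>PSL2R\<^esub>"
  by (simp add: cusp_translation_psl mat22_1 adj2_mult psl_one)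

lemma cusp_translation_inv: "inv\<^bsub>PSL2R\<^esub> (cusp_translation c s) = cusp_translation c (- s)"
  by (rule PSL.inv_equality) (simp_all add: cusp_translation_add cusp_translation_0)

lemma conj_cancel:
  assumes "det A = 1"
  shows "adj2 A ** (A ** N ** adj2 A) ** A = N" "A ** (adj2 A ** N ** A) ** adj2 A = N"
proof -
  have "adj2 A ** (A ** N ** adj2 A) ** A = (adj2 A ** A) ** N ** (adj2 A ** A)" by (simp only: matrix_mul_assoc)
  then show "adj2 A ** (A ** N ** adj2 A) ** A = N" using assms by (simp add: adj2_mult)
  have "A ** (adj2 A ** N ** A) ** adj2 A = (A ** adj2 A) ** N ** (A ** adj2 A)" by (simp only: matrix_mul_assoc)
  then show "A ** (adj2 A ** N ** A) ** adj2 A = N" using assms by (simp add: adj2_mult)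
qed

lemma conj_mult:
  assumes "det A = 1"
  shows "(A ** M ** adj2 A) ** (A ** N ** adj2 A) = A ** (M ** N) ** adj2 A"
proof -
  have "(A ** M ** adj2 A) ** (A ** N ** adj2 A) = A ** M ** (adj2 A ** A) ** N ** adj2 A" by (simp only: matrix_mul_assoc)
  then show ?thesis using assms by (simp add: adj2_mult matrix_mul_assoc)
qed

lemma cusp_translation_eq_iff: "cusp_translation c s = cusp_translation c t \<longleftrightarrow> s = t"
proof
  assume "cusp_translation c s = cusp_translation c t"
  then have "cusp_translation c (s - t) = \<one>\<^bsub>PSL2R\<^esub>"
    using cusp_translation_add[of c s "- t"] cusp_translation_inv[of c t] PSL.r_inv[of "cusp_translation c t"] by simp
  then have "cmat c ** tmat (s - t) ** adj2 (cmat c) = mat 1 \<or> cmat c ** tmat (s - t) ** adj2 (cmat c) = - mat 1"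
    by (simp add: cusp_translation_psl psl_one psl_eq_iff)
  then have "tmat (s - t) = adj2 (cmat c) ** mat 1 ** cmat c \<or> tmat (s - t) = adj2 (cmat c) ** (- mat 1) ** cmat c"
    using conj_cancel(1)[OF det_cmat] by metis
  then have "tmat (s - t) = mat 1 \<or> tmat (s - t) = - mat 1"
    by (simp add: adj2_mult matrix_mul_left_minus matrix_mul_right_minus)
  then show "s = t" by (auto simp: vec_eq_iff forall_2 mat1_nth)
qed simp

text \<open>Moving c and c' to infinity by their cusp matrices turns the claim into: the transported
  matrix fixes infinity, that is, its lower left entry is 0. Later arguments no longer distinguish
  finite from infinite points.\<close>

lemma boundary_map_iff:
  assumes "det M = 1"
  shows "boundary_act (psl M) c = c' \<longleftrightarrow> (adj2 (cmat c') ** M ** cmat c)$2$1 = 0"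
proof (cases c)
  case (Fin x)
  show ?thesis
  proof (cases c')
    case Infty
    then show ?thesis by (simp add: Fin boundary_act_psl mat2_mult_nth adj2_def mat1_nth)
  next
    case (Fin x')
    have e: "(adj2 (cmat c') ** M ** cmat c)$2$1 = x' * (M$2$1 * x + M$2$2) - (M$1$1 * x + M$1$2)"
      by (simp add: Fin \<open>c = boundary_point.Fin x\<close> mat2_mult_nth adj2_def algebra_simps)
    show ?thesis
    proof (cases "M$2$1 * x + M$2$2 = 0")
      case True
      have "M$1$1 * x + M$1$2 \<noteq> 0"
      proof
        assume "M$1$1 * x + M$1$2 = 0"
        then have "M$1$2 = - M$1$1 * x" "M$2$2 = - M$2$1 * x" using True by simp_all
        then have "det M = 0" by (simp add: det_2)
        with assms show False by simp
      qed
      then show ?thesis using True unfolding e by (simp add: Fin \<open>c = boundary_point.Fin x\<close> boundary_act_psl)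
    next
      case False
      then show ?thesis unfolding e
        by (simp add: Fin \<open>c = boundary_point.Fin x\<close> boundary_act_psl divide_eq_eq) argo
    qed
  qed
next
  case Infty
  show ?thesis
  proof (cases c')
    case Infty
    then show ?thesis by (simp add: \<open>c = boundary_point.Infty\<close> boundary_act_psl mat2_mult_nth adj2_def mat1_nth)
  next
    case (Fin x')
    have e: "(adj2 (cmat c') ** M ** cmat c)$2$1 = x' * M$2$1 - M$1$1"
      by (simp add: Fin \<open>c = boundary_point.Infty\<close> mat2_mult_nth adj2_def algebra_simps)
    show ?thesis
    proof (cases "M$2$1 = 0")
      case True
      then have "M$1$1 \<noteq> 0" using assms by (auto simp: det_2)
      then show ?thesis using True unfolding e by (simp add: Fin \<open>c = boundary_point.Infty\<close> boundary_act_psl)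
    next
      case False
      then show ?thesis unfolding e
        by (simp add: Fin \<open>c = boundary_point.Infty\<close> boundary_act_psl divide_eq_eq) argo
    qed
  qed
qed

lemmas boundary_fix_iff = boundary_map_iff[where c = c and c' = c for c]

text \<open>In coordinates at the two cusps both elements are upper triangular, and upper triangular
  matrices are closed under products and inverses.\<close>

lemma boundary_conj_fix:
  assumes g: "g \<in> carrier PSL2R" "boundary_act g c = c'" and t: "t \<in> carrier PSL2R" "boundary_act t c = c"
  shows "boundary_act (g \<otimes>\<^bsub>PSL2R\<^esub> t \<otimes>\<^bsub>PSL2R\<^esub> inv\<^bsub>PSL2R\<^esub> g) c' = c'"
proof -
  obtain M where M: "det M = 1" "g = psl M" using g carrier_PSL2R_cases by metis
  obtain N where N: "det N = 1" "t = psl N" using t carrier_PSL2R_cases by metis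
  let ?A = "cmat c" and ?B = "cmat c'"
  define U where "U = adj2 ?B ** M ** ?A"
  define V where "V = adj2 ?A ** N ** ?A"
  have U: "U$2$1 = 0" using g M boundary_map_iff by (simp add: U_def)
  have V: "V$2$1 = 0" using t N boundary_map_iff by (simp add: V_def)
  have adjU: "adj2 U = adj2 ?A ** adj2 M ** ?B"
    by (cases c; cases c') (intro mat2_eqI; simp add: U_def adj2_def mat2_mult_nth mat1_nth algebra_simps)+
  have "U ** V ** adj2 U = adj2 ?B ** M ** (?A ** adj2 ?A) ** N ** (?A ** adj2 ?A) ** adj2 M ** ?B"
    unfolding adjU by (simp only: U_def V_def matrix_mul_assoc)
  also have "\<dots> = adj2 ?B ** (M ** N ** adj2 M) ** ?B" by (simp add: adj2_mult matrix_mul_assoc)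
  finally have "(adj2 ?B ** (M ** N ** adj2 M) ** ?B)$2$1 = (U ** V ** adj2 U)$2$1" by simp
  also have "\<dots> = 0" using U V by (simp add: mat2_mult_nth adj2_def)
  finally show ?thesis using M N by (simp add: psl_inv psl_mult det_mul boundary_map_iff)
qed

text \<open>Conjugation rescales a translation by the square of the diagonal entry; if that square
  is below 1, iteration makes translations arbitrarily short.\<close>

lemma upper_triangular_conj:
  fixes N :: "real^2^2"
  assumes "det N = 1" "N$2$1 = 0"
  shows "N ** tmat s ** adj2 N = tmat ((N$1$1)\<^sup>2 * s)"
proof -
  have "N$1$1 * N$2$2 = 1" using assms by (simp add: det_2)
  then show ?thesis using assms(2)
    by (intro mat2_eqI) (simp_all add: mat2_mult_nth adj2_def power2_eq_square algebra_simps)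
qed

locale discrete_group =
  fixes G :: "(real^2^2) set set"
  assumes sub: "subgroup G PSL2R"
    and discrete: "subtopology PSL2R_topology G = discrete_topology G"
begin

text \<open>Discreteness is a statement about a subspace of the quotient; unwound at the identity it
  becomes a ball of matrices around 1.\<close>

lemma discrete_at_one:
  obtains \<epsilon> where "\<epsilon> > 0" "\<And>M. det M = 1 \<Longrightarrow> psl M \<in> G \<Longrightarrow> dist M (mat 1) < \<epsilon> \<Longrightarrow> psl M = \<one>\<^bsub>PSL2R\<^esub>"
proof -
  have one: "\<one>\<^bsub>PSL2R\<^esub> \<in> G" using sub by (rule subgroup.one_closed)
  have "openin (subtopology PSL2R_topology G) {\<one>\<^bsub>PSL2R\<^esub>}"
    unfolding discrete using one by simp
  then obtain U where U: "openin PSL2R_topology U" "{\<one>\<^bsub>PSL2R\<^esub>} = U \<inter> G"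
    unfolding openin_subtopology by blast
  then have "openin (top_of_set (carrier SL2R)) {M \<in> carrier SL2R. psl M \<in> U}"
    unfolding openin_PSL2R_topology by blast
  moreover have "mat 1 \<in> {M \<in> carrier SL2R. psl M \<in> U}" using U by (auto simp: SL2R_def psl_one)
  ultimately obtain \<epsilon> where e: "\<epsilon> > 0" "\<And>M. M \<in> carrier SL2R \<Longrightarrow> dist M (mat 1) < \<epsilon> \<Longrightarrow> M \<in> {M \<in> carrier SL2R. psl M \<in> U}"
    unfolding openin_euclidean_subtopology_iff by blast
  show ?thesis
  proof (rule that[OF e(1)])
    fix M assume "det M = 1" "psl M \<in> G" "dist M (mat 1) < \<epsilon>"
    then have "psl M \<in> U \<inter> G" using e(2)[of M] by (simp add: SL2R_def)
    then show "psl M = \<one>\<^bsub>PSL2R\<^esub>" using U by blast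
  qed
qed

text \<open>A conjugated translation depends affinely on s, hence continuously, so a short one in
  \<open>G\<close> is close to the identity and therefore trivial.\<close>

lemma discrete_translations:
  obtains \<epsilon> where "\<epsilon> > 0" "\<And>s. cusp_translation c s \<in> G \<Longrightarrow> \<bar>s\<bar> < \<epsilon> \<Longrightarrow> s = 0"
proof -
  obtain \<epsilon> where e: "\<epsilon> > 0" "\<And>M. det M = 1 \<Longrightarrow> psl M \<in> G \<Longrightarrow> dist M (mat 1) < \<epsilon> \<Longrightarrow> psl M = \<one>\<^bsub>PSL2R\<^esub>"
    by (rule discrete_at_one) blast
  define \<phi> where "\<phi> s = cmat c ** tmat s ** adj2 (cmat c)" for s
  have "\<phi> = (\<lambda>s. mat 1 + s *\<^sub>R (cmat c ** mat22 0 1 0 0 ** adj2 (cmat c)))"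
    unfolding \<phi>_def fun_eq_iff
    by (cases c) (intro allI mat2_eqI; simp add: mat2_mult_nth adj2_def mat1_nth algebra_simps)+
  then have "isCont \<phi> 0" by (simp add: continuous_intros)
  moreover have "\<phi> 0 = mat 1" by (simp add: \<phi>_def mat22_1 adj2_mult)
  ultimately have "\<forall>\<^sub>F s in at 0. dist (\<phi> s) (mat 1) < \<epsilon>"
    using e(1) unfolding isCont_def by (intro tendstoD) auto
  then obtain d where d: "d > 0" "\<And>s. s \<noteq> 0 \<Longrightarrow> \<bar>s\<bar> < d \<Longrightarrow> dist (\<phi> s) (mat 1) < \<epsilon>"
    unfolding eventually_at by (auto simp: dist_real_def)
  show ?thesis
  proof (rule that[OF d(1)])
    fix s assume s: "cusp_translation c s \<in> G" "\<bar>s\<bar> < d"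
    show "s = 0"
    proof (rule ccontr)
      assume "s \<noteq> 0"
      then have "cusp_translation c s = \<one>\<^bsub>PSL2R\<^esub>"
        using s d(2)[of s] e(2)[of "\<phi> s"] by (simp add: \<phi>_def cusp_translation_psl det_mul)
      then show False using \<open>s \<noteq> 0\<close> cusp_translation_eq_iff[of c s 0] by (simp add: cusp_translation_0)
    qed
  qed
qed

text \<open>In coordinates at c a stabilizing element is upper triangular. A parabolic one is a
  translation, so the translations in \<open>G\<close> form a nonzero discrete group, hence a cyclic
  one. What remains is to exclude diagonal entries other than 1 and -1, which
  \<open>contract\<close> does.\<close>

lemma cusp_stabilizer:
  assumes c: "c \<in> cusps G"
  obtains h where "h > 0" "{g\<in>G. boundary_act g c = c} = range (\<lambda>n::int. cusp_translation c (of_int n * h))"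
proof -
  let ?A = "cmat c"
  have closed: "g \<otimes>\<^bsub>PSL2R\<^esub> g' \<in> G" "inv\<^bsub>PSL2R\<^esub> g \<in> G" if "g \<in> G" "g' \<in> G" for g g'
    using sub that by (auto intro: subgroup.m_closed subgroup.m_inv_closed)
  have rep: "\<exists>N::real^2^2. det N = 1 \<and> N$2$1 = 0 \<and> g = psl (?A ** N ** adj2 ?A)"
    if g: "g \<in> carrier PSL2R" "boundary_act g c = c" for g
  proof -
    obtain M where M: "det M = 1" "g = psl M" using g carrier_PSL2R_cases by metis
    then have "(adj2 ?A ** M ** ?A)$2$1 = 0" using g boundary_fix_iff by simp
    moreover have "det (adj2 ?A ** M ** ?A) = 1" using M by (simp add: det_mul)
    moreover have "g = psl (?A ** (adj2 ?A ** M ** ?A) ** adj2 ?A)" using M by (simp add: conj_cancel)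
    ultimately show ?thesis by blast
  qed
  obtain g0 where g0: "g0 \<in> G" "parabolic g0" "boundary_act g0 c = c" using c by (auto simp: cusps_def)
  then obtain N0 :: "real^2^2" where N0: "det N0 = 1" "N0$2$1 = 0" "g0 = psl (?A ** N0 ** adj2 ?A)"
    using rep by (auto simp: parabolic_def)
  have tr: "trace (?A ** N0 ** adj2 ?A) = trace N0"
    by (cases c) (simp_all add: trace_def sum_2 mat2_mult_nth adj2_def mat1_nth algebra_simps)
  have "\<bar>trace N0\<bar> = 2" using g0 N0 tr by (auto simp: parabolic_def psl_eq)
  then have t2: "\<bar>N0$1$1 + N0$2$2\<bar> = 2" by (simp add: trace_def sum_2)
  have ad: "N0$1$1 * N0$2$2 = 1" using N0 by (simp add: det_2)
  \<comment> \<open>(a - d)^2 = (a + d)^2 - 4 a d vanishes because the trace is 2 up to sign and a d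
    = 1.\<close>
  have "(N0$1$1 - N0$2$2)\<^sup>2 = (N0$1$1 + N0$2$2)\<^sup>2 - 4 * (N0$1$1 * N0$2$2)" by (simp add: power2_eq_square algebra_simps)
  also have "(N0$1$1 + N0$2$2)\<^sup>2 = 2\<^sup>2" using t2 by (metis power2_abs)
  finally have eq: "N0$1$1 = N0$2$2" using ad by simp
  then have pm: "N0$1$1 = 1 \<or> N0$1$1 = -1" using ad by (simp add: square_eq_1_iff)
  define s0 where "s0 = N0$1$1 * N0$1$2"
  have "N0 = tmat s0 \<or> N0 = - tmat s0"
    using pm eq N0(2) by (auto simp: s0_def intro!: mat2_eqI)
  then have g0s: "g0 = cusp_translation c s0"
    by (auto simp: N0(3) cusp_translation_psl psl_eq_iff matrix_mul_left_minus matrix_mul_right_minus)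
  have s0: "s0 \<noteq> 0" using g0 g0s by (auto simp: parabolic_def cusp_translation_0)
  define L where "L = {s. cusp_translation c s \<in> G}"
  obtain \<epsilon> where e: "\<epsilon> > 0" "\<And>s. cusp_translation c s \<in> G \<Longrightarrow> \<bar>s\<bar> < \<epsilon> \<Longrightarrow> s = 0"
    by (rule discrete_translations) blast
  have s0L: "s0 \<in> L" using g0 g0s by (simp add: L_def)
  obtain h where h: "h > 0" "L = range (\<lambda>n::int. of_int n * h)"
  proof (rule discrete_real_subgroup[OF _ s0L s0 e(1)])
    fix s t assume "s \<in> L" "t \<in> L"
    then have "cusp_translation c s \<otimes>\<^bsub>PSL2R\<^esub> inv\<^bsub>PSL2R\<^esub> cusp_translation c t \<in> G"
      using closed by (simp add: L_def)
    then show "s - t \<in> L" by (simp add: L_def cusp_translation_inv cusp_translation_add)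
  next
    fix s assume "s \<in> L" "\<bar>s\<bar> < \<epsilon>"
    then show "s = 0" using e(2) by (simp add: L_def)
  qed blast
  have conj: "cusp_translation c ((N$1$1)\<^sup>2 * s) \<in> G"
    if N: "det N = 1" "N$2$1 = 0" "psl (?A ** N ** adj2 ?A) \<in> G" and s: "cusp_translation c s \<in> G" for N :: "real^2^2" and s
  proof -
    have adj: "adj2 (?A ** N ** adj2 ?A) = ?A ** adj2 N ** adj2 ?A"
      by (cases c) (intro mat2_eqI; simp add: adj2_def mat2_mult_nth mat1_nth algebra_simps)+
    have "psl (?A ** N ** adj2 ?A) \<otimes>\<^bsub>PSL2R\<^esub> cusp_translation c s \<otimes>\<^bsub>PSL2R\<^esub> inv\<^bsub>PSL2R\<^esub> psl (?A ** N ** adj2 ?A) \<in> G"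
      using closed N s by blast
    also have "psl (?A ** N ** adj2 ?A) \<otimes>\<^bsub>PSL2R\<^esub> cusp_translation c s \<otimes>\<^bsub>PSL2R\<^esub> inv\<^bsub>PSL2R\<^esub> psl (?A ** N ** adj2 ?A) =
       psl (?A ** (N ** tmat s ** adj2 N) ** adj2 ?A)"
      using N by (simp add: cusp_translation_psl psl_inv psl_mult det_mul adj conj_mult)
    finally show ?thesis using N by (simp add: upper_triangular_conj cusp_translation_psl)
  qed
  text \<open>A hyperbolic element fixing the cusp would contract the translations to the identity.\<close>
  have contract: "\<not> (N$1$1)\<^sup>2 < 1" if N: "det N = 1" "N$2$1 = 0" "psl (?A ** N ** adj2 ?A) \<in> G" for N :: "real^2^2"
  proof
    assume lt: "(N$1$1)\<^sup>2 < 1"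
    have nz: "(N$1$1)\<^sup>2 > 0" using N by (auto simp: det_2)
    have mem: "cusp_translation c (((N$1$1)\<^sup>2) ^ k * s0) \<in> G" for k
    proof (induction k)
      case (Suc k)
      from conj[OF N Suc] show ?case by (simp add: mult.assoc)
    qed (use g0 g0s in simp)
    have "(\<lambda>k. ((N$1$1)\<^sup>2) ^ k * s0) \<longlonglongrightarrow> 0 * s0"
      using lt by (intro tendsto_intros LIMSEQ_power_zero) simp
    then have "\<forall>\<^sub>F k in sequentially. dist (((N$1$1)\<^sup>2) ^ k * s0) 0 < \<epsilon>"
      using e(1) by (intro tendstoD) auto
    then obtain k where "\<bar>((N$1$1)\<^sup>2) ^ k * s0\<bar> < \<epsilon>" by (auto simp: eventually_sequentially dist_real_def)
    then have "((N$1$1)\<^sup>2) ^ k * s0 = 0" using e(2)[OF mem] by blast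
    then show False using nz s0 by simp
  qed
  have "{g\<in>G. boundary_act g c = c} = range (\<lambda>n::int. cusp_translation c (of_int n * h))"
  proof (intro equalityI subsetI)
    fix g assume "g \<in> {g\<in>G. boundary_act g c = c}"
    then have g: "g \<in> G" "boundary_act g c = c" by auto
    then have gc: "g \<in> carrier PSL2R" using sub by (meson subgroup.mem_carrier)
    obtain N :: "real^2^2" where N: "det N = 1" "N$2$1 = 0" "g = psl (?A ** N ** adj2 ?A)" using rep[OF gc g(2)] by blast
    have ad: "N$1$1 * N$2$2 = 1" using N by (simp add: det_2)
    \<comment> \<open>\<open>contract\<close> excludes |a| < 1; applied to the inverse it excludes
      |d| < 1, and a d = 1 then leaves only |a| = 1.\<close>
    have 1: "\<not> (N$1$1)\<^sup>2 < 1" using contract N g by blast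
    have "psl (?A ** adj2 N ** adj2 ?A) = inv\<^bsub>PSL2R\<^esub> g"
    proof (rule PSL.inv_equality[symmetric])
      show "psl (?A ** adj2 N ** adj2 ?A) \<otimes>\<^bsub>PSL2R\<^esub> g = \<one>\<^bsub>PSL2R\<^esub>"
        using N by (simp add: psl_mult det_mul conj_mult adj2_mult psl_one)
    qed (use gc N in \<open>auto intro!: psl_in_carrier simp: det_mul\<close>)
    then have "psl (?A ** adj2 N ** adj2 ?A) \<in> G" using g closed by simp
    moreover have "(adj2 N)$2$1 = 0" "(adj2 N)$1$1 = N$2$2" using N by (simp_all add: adj2_def)
    ultimately have 2: "\<not> (N$2$2)\<^sup>2 < 1" using contract[of "adj2 N"] N(1) det_adj2[of N] by simp
    have "(N$1$1)\<^sup>2 * (N$2$2)\<^sup>2 = 1" using ad by (simp flip: power_mult_distrib)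
    moreover have "(N$1$1)\<^sup>2 * 1 \<le> (N$1$1)\<^sup>2 * (N$2$2)\<^sup>2" using 2 by (intro mult_left_mono) auto
    ultimately have "(N$1$1)\<^sup>2 = 1" using 1 by simp
    then have pm: "N$1$1 = 1 \<or> N$1$1 = -1" by (simp add: power2_eq_1_iff)
    define s where "s = N$1$1 * N$1$2"
    have "N = tmat s \<or> N = - tmat s"
      using pm ad N(2) by (auto simp: s_def intro!: mat2_eqI)
    then have "g = cusp_translation c s"
      by (auto simp: N(3) cusp_translation_psl psl_eq_iff matrix_mul_left_minus matrix_mul_right_minus)
    moreover from this have "s \<in> L" using g by (simp add: L_def)
    ultimately show "g \<in> range (\<lambda>n::int. cusp_translation c (of_int n * h))" using h(2) by auto
  next
    fix g assume "g \<in> range (\<lambda>n::int. cusp_translation c (of_int n * h))"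
    then obtain n :: int where n: "g = cusp_translation c (of_int n * h)" by blast
    have "of_int n * h \<in> L" using h(2) by blast
    then have "g \<in> G" by (simp add: n L_def)
    moreover have "boundary_act g c = c"
      unfolding n cusp_translation_psl by (subst boundary_fix_iff) (simp_all add: det_mul conj_cancel)
    ultimately show "g \<in> {g\<in>G. boundary_act g c = c}" by simp
  qed
  with h(1) that show ?thesis by blast
qed

lemma cusp_translation_int_pow: "cusp_translation c s [^]\<^bsub>PSL2R\<^esub> (k::int) = cusp_translation c (of_int k * s)"
proof -
  have nat: "cusp_translation c s [^]\<^bsub>PSL2R\<^esub> (n::nat) = cusp_translation c (of_nat n * s)" for n
    by (induction n) (simp_all add: cusp_translation_0 cusp_translation_add algebra_simps)
  show ?thesis
    by (cases k rule: int_cases2) (simp_all add: int_pow_int PSL.int_pow_neg_int nat cusp_translation_inv)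
qed

lemma generate_cusp_translation:
  "generate PSL2R {cusp_translation c s} = range (\<lambda>n::int. cusp_translation c (of_int n * s))"
  by (subst PSL.generate_pow) (auto simp: cusp_translation_int_pow)

text \<open>\<open>cusp_width\<close> is a definite description, so uniqueness is at stake: two
  positive candidates are integral multiples of each other, and the product of the two positive
  multipliers is 1.\<close>

lemma cusp_width:
  assumes c: "c \<in> cusps G"
  shows "cusp_width G c > 0"
    "{g\<in>G. boundary_act g c = c} = range (\<lambda>n::int. cusp_translation c (of_int n * cusp_width G c))"
proof -
  obtain h where h: "h > 0" "{g\<in>G. boundary_act g c = c} = range (\<lambda>n::int. cusp_translation c (of_int n * h))"
    by (rule cusp_stabilizer[OF c])
  have st: "stabilizer (PSL2R\<lparr>carrier := G\<rparr>) boundary_act c = {g\<in>G. boundary_act g c = c}"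
    by (simp add: stabilizer_def)
  have "cusp_width G c = h"
    unfolding cusp_width_def st generate_cusp_translation
  proof (rule the_equality)
    show "0 < h \<and> {g\<in>G. boundary_act g c = c} = range (\<lambda>n::int. cusp_translation c (of_int n * h))" using h by blast
    fix h' assume h': "0 < h' \<and> {g\<in>G. boundary_act g c = c} = range (\<lambda>n::int. cusp_translation c (of_int n * h'))"
    then have eq: "range (\<lambda>n::int. cusp_translation c (of_int n * h)) = range (\<lambda>n::int. cusp_translation c (of_int n * h'))"
      using h by simp
    have "cusp_translation c (of_int 1 * h) \<in> range (\<lambda>n::int. cusp_translation c (of_int n * h'))" unfolding eq[symmetric] by blast
    then obtain n :: int where "cusp_translation c (of_int 1 * h) = cusp_translation c (of_int n * h')" by (rule imageE)
    then have n: "h = of_int n * h'" by (simp add: cusp_translation_eq_iff)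
    have "cusp_translation c (of_int 1 * h') \<in> range (\<lambda>n::int. cusp_translation c (of_int n * h))" unfolding eq by blast
    then obtain m :: int where "cusp_translation c (of_int 1 * h') = cusp_translation c (of_int m * h)" by (rule imageE)
    then have m: "h' = of_int m * h" by (simp add: cusp_translation_eq_iff)
    have "n > 0" using n h h' by (metis mult_pos_pos of_int_0_less_iff zero_less_mult_pos2)
    moreover have "m > 0" using m h h' by (metis of_int_0_less_iff zero_less_mult_pos2)
    moreover have "of_int (n * m) * h = 1 * h" using n m by (metis mult.assoc mult.commute mult_1 of_int_mult)
    then have "n * m = 1" using h by (metis mult_cancel_right of_int_1 of_int_eq_iff order_less_irrefl)
    ultimately have "m = 1" using zmult_eq_1_iff by auto
    then show "h' = h" using m by simp
  qed
  then show "cusp_width G c > 0"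
    "{g\<in>G. boundary_act g c = c} = range (\<lambda>n::int. cusp_translation c (of_int n * cusp_width G c))"
    using h by simp_all
qed

end

section \<open>Vector-valued forms\<close>

lemma infsum_finite_sum:
  fixes f :: "'k \<Rightarrow> 'a \<Rightarrow> complex"
  assumes "finite K" "\<And>k. k \<in> K \<Longrightarrow> f k summable_on A"
  shows "(\<Sum>\<^sub>\<infinity>x\<in>A. \<Sum>k\<in>K. f k x) = (\<Sum>k\<in>K. infsum (f k) A)"
proof -
  have "(\<lambda>x. \<Sum>k\<in>K. f k x) summable_on A \<and> (\<Sum>\<^sub>\<infinity>x\<in>A. \<Sum>k\<in>K. f k x) = (\<Sum>k\<in>K. infsum (f k) A)"
    using assms by (induction K rule: finite_induct) (auto simp: infsum_add intro: summable_on_add)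
  then show ?thesis by blast
qed

lemma higher_deriv_lincomb:
  assumes "finite I" "\<And>p. p \<in> I \<Longrightarrow> f p holomorphic_on S" "open S" "x \<in> S"
  shows "(deriv ^^ m) (\<lambda>w. \<Sum>p\<in>I. c p * f p w) x = (\<Sum>p\<in>I. c p * (deriv ^^ m) (f p) x)"
  using assms(1,2)
proof (induction I rule: finite_induct)
  case empty
  then show ?case by simp
next
  case (insert p I)
  have "(deriv ^^ m) (\<lambda>w. \<Sum>p\<in>insert p I. c p * f p w) x = (deriv ^^ m) (\<lambda>w. c p * f p w + (\<Sum>p\<in>I. c p * f p w)) x"
    using insert.hyps by simp
  also have "\<dots> = (deriv ^^ m) (\<lambda>w. c p * f p w) x + (deriv ^^ m) (\<lambda>w. \<Sum>p\<in>I. c p * f p w) x"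
    using insert.prems assms by (intro higher_deriv_add[of _ S]) (auto intro!: holomorphic_intros)
  also have "(deriv ^^ m) (\<lambda>w. c p * f p w) x = c p * (deriv ^^ m) (f p) x"
    using insert.prems assms by (intro higher_deriv_cmult[of _ S]) auto
  finally show ?case using insert by simp
qed

text \<open>Gaussian elimination with pivot k, by induction over the equations. The index types are
  arbitrary because the conditions will be indexed by a component, a zero and a derivative.\<close>

lemma homogeneous_system:
  fixes \<phi> :: "'c \<Rightarrow> 'n \<Rightarrow> complex"
  assumes "finite C" "finite I" "card C < card I"
  shows "\<exists>\<alpha>. (\<exists>n\<in>I. \<alpha> n \<noteq> 0) \<and> (\<forall>c\<in>C. (\<Sum>n\<in>I. \<alpha> n * \<phi> c n) = 0)"
  using assms
proof (induction C arbitrary: I \<phi> rule: finite_induct)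
  case empty
  then have "I \<noteq> {}" by auto
  then show ?case by (intro exI[of _ "\<lambda>_. 1"]) auto
next
  case (insert c C)
  show ?case
  proof (cases "\<exists>k\<in>I. \<phi> c k \<noteq> 0")
    case False
    have "card C < card I" using insert by simp
    from insert.IH[OF insert.prems(1) this, of \<phi>] obtain \<alpha> where
      "\<exists>n\<in>I. \<alpha> n \<noteq> 0" "\<forall>c\<in>C. (\<Sum>n\<in>I. \<alpha> n * \<phi> c n) = 0" by blast
    then show ?thesis using False by (intro exI[of _ \<alpha>]) auto
  next
    case True
    then obtain k where k: "k \<in> I" "\<phi> c k \<noteq> 0" by blast
    define \<phi>' where "\<phi>' c' n = \<phi> c' n - \<phi> c' k * \<phi> c n / \<phi> c k" for c' n
    have "card C < card (I - {k})" "finite (I - {k})" using insert k by auto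
    from insert.IH[OF this(2,1), of \<phi>'] obtain \<alpha>' where
      \<alpha>': "\<exists>n\<in>I - {k}. \<alpha>' n \<noteq> 0" "\<forall>c\<in>C. (\<Sum>n\<in>I - {k}. \<alpha>' n * \<phi>' c n) = 0" by blast
    define s where "s = - (\<Sum>n\<in>I - {k}. \<alpha>' n * \<phi> c n) / \<phi> c k"
    define \<alpha> where "\<alpha> = \<alpha>'(k := s)"
    have split: "(\<Sum>n\<in>I. \<alpha> n * \<phi> c' n) = s * \<phi> c' k + (\<Sum>n\<in>I - {k}. \<alpha>' n * \<phi> c' n)" for c'
    proof -
      have "(\<Sum>n\<in>I. \<alpha> n * \<phi> c' n) = \<alpha> k * \<phi> c' k + (\<Sum>n\<in>I - {k}. \<alpha> n * \<phi> c' n)"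
        using insert.prems k by (simp add: sum.remove)
      also have "(\<Sum>n\<in>I - {k}. \<alpha> n * \<phi> c' n) = (\<Sum>n\<in>I - {k}. \<alpha>' n * \<phi> c' n)"
        by (intro sum.cong) (auto simp: \<alpha>_def)
      finally show ?thesis by (simp add: \<alpha>_def)
    qed
    have "(\<Sum>n\<in>I. \<alpha> n * \<phi> c n) = 0" unfolding split using k by (simp add: s_def)
    moreover have "(\<Sum>n\<in>I. \<alpha> n * \<phi> c' n) = 0" if "c' \<in> C" for c'
    proof -
      have "0 = (\<Sum>n\<in>I - {k}. \<alpha>' n * \<phi>' c' n)" using \<alpha>' that by simp
      also have "\<dots> = (\<Sum>n\<in>I - {k}. \<alpha>' n * \<phi> c' n) - (\<Sum>n\<in>I - {k}. \<alpha>' n * \<phi> c n) * (\<phi> c' k / \<phi> c k)"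
        unfolding \<phi>'_def by (simp add: right_diff_distrib sum_subtractf sum_distrib_left sum_divide_distrib mult_ac)
      finally show ?thesis unfolding split by (simp add: s_def)
    qed
    moreover have "\<exists>n\<in>I. \<alpha> n \<noteq> 0" using \<alpha>'(1) by (auto simp: \<alpha>_def)
    ultimately show ?thesis by (intro exI[of _ \<alpha>]) auto
  qed
qed

text \<open>If f vanishes to at least the order of g, the same power of w - z splits off from both.
  The condition is phrased with derivatives because these are linear in f.\<close>

lemma quotient_has_limit:
  assumes f: "f holomorphic_on S" and g: "g holomorphic_on S" and S: "open S" "connected S" "z \<in> S"
    and nc: "\<exists>w\<in>S. g w \<noteq> 0" and der: "\<And>m. int m < zorder g z \<Longrightarrow> (deriv ^^ m) f z = 0"
  shows "\<exists>c. (\<lambda>w. f w / g w) \<midarrow>z\<rightarrow> c"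
proof -
  define n where "n = nat (zorder g z)"
  obtain k where k: "k holomorphic_on S" "k z \<noteq> 0" "\<And>w. w \<in> S \<Longrightarrow> g w = (w - z) ^ n * k w"
    using factor_one_zero[OF g S nc] unfolding n_def by blast
  have cont: "isCont u z" if "u holomorphic_on S" for u
    using holomorphic_on_imp_continuous_on[OF that] S by (simp add: continuous_on_eq_continuous_at)
  have "\<exists>u. u holomorphic_on S \<and> (\<forall>w\<in>S. f w = (w - z) ^ n * u w)"
  proof (cases "\<exists>w\<in>S. f w \<noteq> 0")
    case False
    then show ?thesis by (intro exI[of _ "\<lambda>_. 0"]) auto
  next
    case True
    obtain m0 where "(deriv ^^ m0) f z \<noteq> 0"
      using True holomorphic_fun_eq_0_on_connected[OF f S(1,2) _ S(3)] by blast
    define m where "m = (LEAST m. (deriv ^^ m) f z \<noteq> 0)"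
    have m: "(deriv ^^ m) f z \<noteq> 0" unfolding m_def by (rule LeastI) fact
    have ml: "(deriv ^^ i) f z = 0" if "i < m" for i using that not_less_Least unfolding m_def by blast
    have zf: "zorder f z = int m" by (rule zorder_zero_eqI[OF f S(1,3)]) (use m ml in auto)
    have "n \<le> m" using m der[of m] by (cases "int m < zorder g z") (auto simp: n_def)
    obtain v where v: "v holomorphic_on S" "\<And>w. w \<in> S \<Longrightarrow> f w = (w - z) ^ m * v w"
      using factor_one_zero[OF f S True] zf by auto
    have "f w = (w - z) ^ n * ((w - z) ^ (m - n) * v w)" if "w \<in> S" for w
      using v(2)[OF that] \<open>n \<le> m\<close> by (simp add: mult.assoc[symmetric] power_add[symmetric])
    moreover have "(\<lambda>w. (w - z) ^ (m - n) * v w) holomorphic_on S" by (intro holomorphic_intros v)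
    ultimately show ?thesis by blast
  qed
  then obtain u where u: "u holomorphic_on S" "\<And>w. w \<in> S \<Longrightarrow> f w = (w - z) ^ n * u w" by blast
  have "(\<lambda>w. u w / k w) \<midarrow>z\<rightarrow> u z / k z"
    using cont[OF u(1)] cont[OF k(1)] k(2) unfolding isCont_def by (intro tendsto_divide)
  then have "(\<lambda>w. f w / g w) \<midarrow>z\<rightarrow> u z / k z"
  proof (rule Lim_transform_within_open[OF _ S(1,3)])
    fix w assume "w \<in> S" "w \<noteq> z"
    then show "u w / k w = f w / g w" using u k by simp
  qed
  then show ?thesis by blast
qed

section \<open>The Eisenstein series of weight six\<close>

context fuchsian_cusp
begin

abbreviation eis :: "complex \<Rightarrow> complex" where
  "eis \<equiv> poincare_series (\<lambda>_. 1) (\<lambda>_. 1)"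

lemma T_invariant:
  assumes F: "\<And>g. g \<in> G \<Longrightarrow> F (T 1 \<otimes>\<^bsub>PSL2R\<^esub> g) = F g" and g: "g \<in> G"
  shows "F (T n \<otimes>\<^bsub>PSL2R\<^esub> g) = F g"
proof -
  have step: "F (T (n + 1) \<otimes>\<^bsub>PSL2R\<^esub> g) = F (T n \<otimes>\<^bsub>PSL2R\<^esub> g)" for n
    using F[of "T n \<otimes>\<^bsub>PSL2R\<^esub> g"] g by (simp add: T_add add.commute flip: PSL.m_assoc)
  show ?thesis
  proof (induction n rule: int_induct[where k = 0])
    case base
    then show ?case using g by (simp add: T_0)
  next
    case (step1 i)
    then show ?case using step by simp
  next
    case (step2 i)
    then show ?case using step[of "i - 1"] by simp
  qed
qed

lemma eis_holomorphic: "eis holomorphic_on upper_half_plane"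
  by (rule poincare_series_holomorphic[where ?B0.0 = 1 and C = 0]) auto

lemma eis_automorphic:
  assumes a: "a \<in> G" and \<tau>: "\<tau> \<in> upper_half_plane"
  shows "eis (act a \<tau>) = aut2 a \<tau> ^ 3 * eis \<tau>"
proof -
  have tp: "Im \<tau> > 0" using \<tau> by (simp add: upper_half_plane_def)
  have nz: "aut2 a \<tau> \<noteq> 0" using a tp by (simp add: Im_act)
  have "eis (act a \<tau>) = (\<Sum>\<^sub>\<infinity>r\<in>R. aut2 a \<tau> ^ 3 * (1 / aut2 (r \<otimes>\<^bsub>PSL2R\<^esub> a) \<tau> ^ 3))"
    unfolding poincare_series_def using a tp nz by (intro infsum_cong) (simp add: act_mult field_simps)
  also have "\<dots> = aut2 a \<tau> ^ 3 * (\<Sum>\<^sub>\<infinity>r\<in>R. 1 / aut2 (r \<otimes>\<^bsub>PSL2R\<^esub> a) \<tau> ^ 3)"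
    by (rule infsum_cmult_right')
  also have "(\<Sum>\<^sub>\<infinity>r\<in>R. 1 / aut2 (r \<otimes>\<^bsub>PSL2R\<^esub> a) \<tau> ^ 3) = (\<Sum>\<^sub>\<infinity>r\<in>R. 1 / aut2 r \<tau> ^ 3)"
    by (rule infsum_R_shift[OF a]) (use tp in \<open>simp add: act_T_mult\<close>)
  finally show ?thesis by (simp add: poincare_series_def)
qed

lemma eis_at_infinity:
  obtains K where "\<And>y. y \<ge> 1 \<Longrightarrow> cmod (eis (Complex 0 y) - 1) \<le> K / y\<^sup>2"
  using poincare_series_at_infinity[where ?B0.0 = 1 and C = 0 and b = "\<lambda>_. 1" and s = "\<lambda>_. 1"] by auto

text \<open>On the imaginary axis the series tends to 1, the term of the identity coset.\<close>

lemma eis_large: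
  obtains Y B where "Y \<ge> 1" "\<And>y. y \<ge> Y \<Longrightarrow> eis (Complex 0 y) \<noteq> 0 \<and> cmod (eis (Complex 0 y)) \<le> B"
proof -
  obtain K where K: "\<And>y. y \<ge> 1 \<Longrightarrow> cmod (eis (Complex 0 y) - 1) \<le> K / y\<^sup>2"
    by (rule eis_at_infinity) blast
  have "eis (Complex 0 y) \<noteq> 0 \<and> cmod (eis (Complex 0 y)) \<le> 2" if y: "y \<ge> max 1 (\<bar>K\<bar> + 1)" for y
  proof -
    have y1: "y \<ge> 1" "y > \<bar>K\<bar>" using y by auto
    have "y * 1 \<le> y * y" using y1 by (intro mult_left_mono) auto
    then have "y \<le> y\<^sup>2" by (simp add: power2_eq_square)
    then have "K < y\<^sup>2" using y1 by linarith
    then have "K / y\<^sup>2 < 1" using y1 by (simp add: divide_less_eq)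
    then have lt: "cmod (eis (Complex 0 y) - 1) < 1" using K[OF y1(1)] by linarith
    have "eis (Complex 0 y) \<noteq> 0" using lt by auto
    moreover have "cmod (eis (Complex 0 y)) \<le> cmod (eis (Complex 0 y) - 1) + 1"
      using norm_triangle_ineq[of "eis (Complex 0 y) - 1" 1] by simp
    ultimately show ?thesis using lt by simp
  qed
  then show ?thesis using that[of "max 1 (\<bar>K\<bar> + 1)" 2] by simp
qed

lemma eis_nonzero: "\<exists>w\<in>upper_half_plane. eis w \<noteq> 0"
proof -
  obtain Y B where "Y \<ge> 1" "\<And>y. y \<ge> Y \<Longrightarrow> eis (Complex 0 y) \<noteq> 0 \<and> cmod (eis (Complex 0 y)) \<le> B"
    by (rule eis_large) blast
  then show ?thesis by (intro bexI[of _ "Complex 0 Y"]) (auto simp: upper_half_plane_def)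
qed

text \<open>Equivalent to (1 + y^3)^2 \<le> (1 + y^2)^3. It brings the cube of the height, which
  weight six produces, under the square used in \<open>logsum\<close>; the factor 3/2 originates
  here.\<close>

lemma ln_cube_le:
  assumes "y \<ge> (0::real)" shows "ln (1 + y ^ 3) \<le> 3/2 * ln (1 + y\<^sup>2)"
proof -
  have "2 * y ^ 3 \<le> 3 * y\<^sup>2 + 3 * y ^ 4"
  proof -
    have "3 * y\<^sup>2 + 3 * y ^ 4 - 2 * y ^ 3 = y\<^sup>2 * ((y - 1)\<^sup>2 + 2 * y\<^sup>2 + 2)"
      by (simp add: power2_eq_square power3_eq_cube power4_eq_xxxx algebra_simps)
    moreover have "\<dots> \<ge> 0" by (intro mult_nonneg_nonneg add_nonneg_nonneg) auto
    ultimately show ?thesis by linarith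
  qed
  then have "(1 + y ^ 3)\<^sup>2 \<le> (1 + y\<^sup>2) ^ 3"
    by (simp add: power2_eq_square power3_eq_cube power4_eq_xxxx algebra_simps)
  moreover have p: "1 + y\<^sup>2 > 0" "1 + y ^ 3 > 0" using assms by (simp_all add: add_pos_nonneg)
  ultimately have "ln ((1 + y ^ 3)\<^sup>2) \<le> ln ((1 + y\<^sup>2) ^ 3)"
    by (intro ln_mono zero_less_power)
  then show ?thesis using p by (simp add: ln_realpow)
qed

lemma ln_1_plus_sum_le:
  assumes "finite F" "\<And>x. x \<in> F \<Longrightarrow> a x \<ge> (0::real)"
  shows "ln (1 + sum a F) \<le> (\<Sum>x\<in>F. ln (1 + a x))"
  using assms
proof (induction F rule: finite_induct)
  case (insert x F)
  have s: "sum a F \<ge> 0" using insert by (intro sum_nonneg) auto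
  have x: "a x \<ge> 0" using insert by simp
  have "1 + (a x + sum a F) \<le> (1 + a x) * (1 + sum a F)" using s x by (simp add: algebra_simps)
  then have "ln (1 + (a x + sum a F)) \<le> ln ((1 + a x) * (1 + sum a F))"
    using s x by (intro ln_mono) auto
  also have "\<dots> = ln (1 + a x) + ln (1 + sum a F)" using s x by (simp add: ln_mult)
  finally show ?case using insert by simp
qed simp

text \<open>Im^3 |E| is at most the sum of the cubes of the heights over the cosets. The logarithm
  of 1 plus a sum is at most the sum of the logarithms, and \<open>ln_cube_le\<close> compares each
  with a term of \<open>logsum\<close>. The infinite sum is reached as a limit of finite
  ones.\<close>

lemma eis_bound:
  assumes \<tau>: "\<tau> \<in> upper_half_plane"
  shows "ennreal (ln (1 + (Im \<tau>)^3 * cmod (eis \<tau>))) \<le> ennreal (3/2) * logsum \<tau>"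
proof -
  have tp: "Im \<tau> > 0" using \<tau> by (simp add: upper_half_plane_def)
  define a where "a r = (Im (act r \<tau>)) ^ 3" for r
  have a0: "a r \<ge> 0" if "r \<in> R" for r using that tp Im_act(2)[of r \<tau>] by (simp add: a_def)
  have aeq: "a r = (Im \<tau>)^3 * cmod (1 / aut2 r \<tau> ^ 3)" if "r \<in> R" for r
    using that tp by (simp add: a_def Im_act norm_divide norm_power power_divide)
  obtain m where m: "m summable_on R" "\<And>r \<tau>'. r \<in> R \<Longrightarrow> \<tau>' \<in> {\<tau>} \<Longrightarrow> cmod (1 * 1 / aut2 r \<tau>' ^ 3) \<le> m r"
    by (rule poincare_series_majorant[of "\<lambda>_. 1" 1 "\<lambda>_. 1" 0 "{\<tau>}"]) (use \<tau> in auto)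
  have s1: "(\<lambda>r. cmod (1 / aut2 r \<tau> ^ 3)) summable_on R"
    by (rule summable_on_comparison_test[OF m(1)]) (use m(2) in auto)
  then have as: "a summable_on R"
    using summable_on_cmult_right[OF s1, of "(Im \<tau>)^3"] summable_on_cong[of R a "\<lambda>r. (Im \<tau>)^3 * cmod (1 / aut2 r \<tau> ^ 3)"] aeq by simp
  have "cmod (eis \<tau>) \<le> (\<Sum>\<^sub>\<infinity>r\<in>R. cmod (1 / aut2 r \<tau> ^ 3))"
    unfolding poincare_series_def by (rule norm_infsum_le_infsum(2)[OF s1]) simp
  then have "(Im \<tau>)^3 * cmod (eis \<tau>) \<le> (Im \<tau>)^3 * (\<Sum>\<^sub>\<infinity>r\<in>R. cmod (1 / aut2 r \<tau> ^ 3))"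
    using tp by (intro mult_left_mono) auto
  also have "\<dots> = infsum a R"
    unfolding infsum_cmult_right'[symmetric] by (intro infsum_cong) (simp add: aeq)
  finally have le: "(Im \<tau>)^3 * cmod (eis \<tau>) \<le> infsum a R" .
  have "infsum a R \<ge> 0" by (rule infsum_nonneg) (use a0 in auto)
  have "((\<lambda>F. sum a F) \<longlongrightarrow> infsum a R) (finite_subsets_at_top R)"
    using has_sum_infsum[OF as] by (simp add: has_sum_def)
  then have "((\<lambda>F. ln (1 + sum a F)) \<longlongrightarrow> ln (1 + infsum a R)) (finite_subsets_at_top R)"
    using \<open>infsum a R \<ge> 0\<close> by (intro tendsto_intros) auto
  then have lim: "((\<lambda>F. ennreal (ln (1 + sum a F))) \<longlongrightarrow> ennreal (ln (1 + infsum a R))) (finite_subsets_at_top R)"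
    by (rule tendsto_ennrealI)
  have fin: "ennreal (ln (1 + sum a F)) \<le> ennreal (3/2) * logsum \<tau>" if F: "finite F" "F \<subseteq> R" for F
  proof -
    have "ln (1 + sum a F) \<le> (\<Sum>r\<in>F. ln (1 + a r))" using F a0 by (intro ln_1_plus_sum_le) auto
    also have "\<dots> \<le> (\<Sum>r\<in>F. 3/2 * ln (1 + (Im (act r \<tau>))\<^sup>2))"
      unfolding a_def using F tp by (intro sum_mono ln_cube_le) (auto intro!: less_imp_le Im_act(2))
    also have "\<dots> = 3/2 * (\<Sum>r\<in>F. ln (1 + (Im (act r \<tau>))\<^sup>2))" by (simp add: sum_distrib_left)
    finally have "ennreal (ln (1 + sum a F)) \<le> ennreal (3/2 * (\<Sum>r\<in>F. ln (1 + (Im (act r \<tau>))\<^sup>2)))" by (rule ennreal_leI)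
    also have "\<dots> = ennreal (3/2) * (\<Sum>r\<in>F. ennreal (ln (1 + (Im (act r \<tau>))\<^sup>2)))"
      by (subst ennreal_mult) (auto intro!: sum_nonneg simp: sum_ennreal)
    also have "\<dots> \<le> ennreal (3/2) * logsum \<tau>"
      unfolding logsum_def using F by (intro mult_left_mono sum_le_nn_integral_count_space) auto
    finally show ?thesis .
  qed
  have "ennreal (ln (1 + (Im \<tau>)^3 * cmod (eis \<tau>))) \<le> ennreal (ln (1 + infsum a R))"
    using le tp by (intro ennreal_leI ln_mono) (auto simp: add_pos_nonneg)
  also have "\<dots> \<le> ennreal (3/2) * logsum \<tau>"
    by (rule tendsto_upperbound[OF lim]) (use fin in \<open>auto intro: eventually_finite_subsets_at_top_weakI\<close>)
  finally show ?thesis .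
qed

lemma eis_zeros:
  obtains Z where "finite Z" "Z \<subseteq> {z\<in>upper_half_plane. eis z = 0}"
    "\<And>z. z \<in> upper_half_plane \<Longrightarrow> eis z = 0 \<Longrightarrow> \<exists>z0\<in>Z. \<exists>g\<in>G. z = act g z0"
  using finitely_many_zeros[OF eis_holomorphic eis_nonzero eis_automorphic eis_bound] by blast

lemma eis_isolated:
  assumes "z \<in> upper_half_plane"
  obtains e where "e > 0" "ball z e \<subseteq> upper_half_plane" "\<And>w. w \<in> ball z e - {z} \<Longrightarrow> eis w \<noteq> 0"
proof -
  obtain k where k: "k holomorphic_on upper_half_plane" "k z \<noteq> 0"
    "\<And>w. w \<in> upper_half_plane \<Longrightarrow> eis w = (w - z) ^ nat (zorder eis z) * k w"
    using factor_one_zero[OF eis_holomorphic open_upper connected_upper assms eis_nonzero] by blast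
  have "isCont k z" using holomorphic_on_imp_continuous_on[OF k(1)] assms open_upper by (simp add: continuous_on_eq_continuous_at)
  then obtain e1 where e1: "e1 > 0" "\<And>w. dist z w < e1 \<Longrightarrow> k w \<noteq> 0"
    using continuous_at_avoid[of z k 0] k(2) by blast
  obtain e2 where e2: "e2 > 0" "ball z e2 \<subseteq> upper_half_plane" using open_upper assms openE by blast
  show ?thesis
  proof (rule that[of "min e1 e2"])
    fix w assume w: "w \<in> ball z (min e1 e2) - {z}"
    then have "w \<in> upper_half_plane" using e2 by auto
    then show "eis w \<noteq> 0" using k(3)[of w] e1(2)[of w] w by simp
  qed (use e1 e2 in auto)
qed

end

section \<open>Poincare series with values in the representation\<close>

locale vector_forms = fuchsian_cusp G D h for G D h +
  fixes \<rho> :: "(real^2^2) set \<Rightarrow> complex^'d^'d" and l0 :: "real^'d"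
  assumes rho_mult: "\<And>a b. a \<in> G \<Longrightarrow> b \<in> G \<Longrightarrow> \<rho> (a \<otimes>\<^bsub>PSL2R\<^esub> b) = \<rho> a ** \<rho> b"
    and rho_T: "\<rho> (T 1) = diag_exp l0 1"
    and rho_finite: "finite (\<rho> ` G)"
    and l0: "\<And>j. 0 \<le> l0$j" "\<And>j. l0$j < 1"
    and rho_one: "\<rho> \<one>\<^bsub>PSL2R\<^esub> = mat 1"
begin

lemma rho_bounded:
  obtains B where "\<And>g i j. g \<in> G \<Longrightarrow> cmod (\<rho> g $ i $ j) \<le> B"
proof -
  define W where "W = (\<lambda>(M, i, j). cmod (M $ i $ j)) ` (\<rho> ` G \<times> UNIV \<times> UNIV)"
  have fin: "finite W" unfolding W_def by (intro finite_imageI finite_cartesian_product rho_finite) auto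
  have "cmod (\<rho> g $ i $ j) \<le> Max W" if "g \<in> G" for g i j
    by (rule Max_ge[OF fin]) (use that in \<open>auto simp: W_def intro!: image_eqI[of _ _ "(\<rho> g, i, j)"]\<close>)
  then show ?thesis by (rule that)
qed

text \<open>Whatever n, translation by \<open>h\<close> multiplies the seed by the eigenvalue of
  \<open>\<rho> (T 1)\<close> on the j-th basis vector. The shift n + 1 makes the frequency negative
  for all n, so every seed grows towards infinity.\<close>

definition seed :: "'d \<Rightarrow> nat \<Rightarrow> complex \<Rightarrow> complex" where
  "seed j n w = exp (2 * of_real pi * \<i> * of_real (l0$j - (real n + 1)) * (w / of_real h))"

text \<open>Component i of the sum of \<rho>(r)^-1 e_j times the transformed seed. Under a
  translation the eigenvalue from \<rho>(T)^-1 on e_j cancels the one from the seed, so each term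
  depends on the coset of r only.\<close>

definition vector_poincare :: "'d \<Rightarrow> 'd \<Rightarrow> nat \<Rightarrow> complex \<Rightarrow> complex" where
  "vector_poincare i j n = poincare_series (\<lambda>r. \<rho> (inv\<^bsub>PSL2R\<^esub> r) $ i $ j) (seed j n)"

lemma norm_seed: "cmod (seed j n w) = exp (2 * pi * (real n + 1 - l0$j) / h * Im w)"
proof -
  have "Re (2 * of_real pi * \<i> * of_real (l0$j - (real n + 1)) * (w / of_real h)) = 2 * pi * (real n + 1 - l0$j) / h * Im w"
    using h by (simp add: field_simps)
  then show ?thesis by (simp only: seed_def norm_exp_eq_Re)
qed

lemma seed_rate_pos: "2 * pi * (real n + 1 - l0$j) / h > 0"
  using l0(2)[of j] h by (intro divide_pos_pos mult_pos_pos) auto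

lemma seed_translate: "seed j n (w + of_real h) = diag_exp l0 1 $ j $ j * seed j n w"
proof -
  have "exp (2 * of_nat (n + 1) * of_real pi * \<i>) = (1::complex)"
    using exp_integer_2pi[OF Ints_of_nat[of "n + 1"]] by (simp only: of_real_mult of_real_of_nat_eq of_real_numeral)
  then have "exp (2 * of_real pi * \<i> * (of_nat n + 1)) = (1::complex)"
    by (simp only: of_nat_add of_nat_1 mult_ac)
  then have "exp (- (2 * of_real pi * \<i> * (of_nat n + 1))) = (1::complex)"
    by (simp only: exp_minus inverse_1)
  moreover have "2 * of_real pi * \<i> * of_real (l0$j - (real n + 1)) * ((w + of_real h) / of_real h) =
     2 * of_real pi * \<i> * of_real (l0$j - (real n + 1)) * (w / of_real h) + 2 * of_real pi * \<i> * of_real (l0$j)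
     + - (2 * of_real pi * \<i> * (of_nat n + 1))"
    using h by (simp add: field_simps)
  ultimately show ?thesis unfolding seed_def by (simp only: exp_add) (simp add: diag_exp_def)
qed

lemma seed_holomorphic: "seed j n holomorphic_on A"
  unfolding seed_def[abs_def] using h by (intro holomorphic_intros) auto

lemma vector_poincare_holomorphic: "vector_poincare i j n holomorphic_on upper_half_plane"
proof -
  obtain B where B: "\<And>g i j. g \<in> G \<Longrightarrow> cmod (\<rho> g $ i $ j) \<le> B" by (rule rho_bounded) blast
  show ?thesis unfolding vector_poincare_def
    by (rule poincare_series_holomorphic[where ?B0.0 = B and C = "2 * pi * (real n + 1 - l0$j) / h"])
      (use B seed_rate_pos[of n j] seed_holomorphic in \<open>auto simp: norm_seed\<close>)
qed

text \<open>Replacing r by r a permutes the cosets, and \<rho>(r^-1) = \<rho>(a) \<rho>((r a)^-1)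
  moves \<rho>(a) out of the sum. That the terms are functions on cosets rests on \<rho>(T) being
  diagonal.\<close>

lemma vector_poincare_automorphic:
  assumes a: "a \<in> G" and \<tau>: "\<tau> \<in> upper_half_plane"
  shows "vector_poincare i j n (act a \<tau>) = aut2 a \<tau> ^ 3 * (\<Sum>k\<in>UNIV. \<rho> a $ i $ k * vector_poincare k j n \<tau>)"
proof -
  have tp: "Im \<tau> > 0" using \<tau> by (simp add: upper_half_plane_def)
  have nz: "aut2 a \<tau> \<noteq> 0" using a tp by (simp add: Im_act)
  obtain B where B: "\<And>g i j. g \<in> G \<Longrightarrow> cmod (\<rho> g $ i $ j) \<le> B" by (rule rho_bounded) blast
  define t where "t k g = \<rho> (inv\<^bsub>PSL2R\<^esub> g) $ k $ j * seed j n (act g \<tau>) / aut2 g \<tau> ^ 3" for k g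
  have inv: "t k (T m \<otimes>\<^bsub>PSL2R\<^esub> g) = t k g" if g: "g \<in> G" for k m g
  proof (rule T_invariant[OF _ g])
    fix g assume g: "g \<in> G"
    have "inv\<^bsub>PSL2R\<^esub> (T 1 \<otimes>\<^bsub>PSL2R\<^esub> g) \<otimes>\<^bsub>PSL2R\<^esub> T 1 = inv\<^bsub>PSL2R\<^esub> g"
      using g by (simp add: PSL.inv_mult_group PSL.m_assoc)
    then have "\<rho> (inv\<^bsub>PSL2R\<^esub> g) = \<rho> (inv\<^bsub>PSL2R\<^esub> (T 1 \<otimes>\<^bsub>PSL2R\<^esub> g)) ** diag_exp l0 1"
      using rho_mult[of "inv\<^bsub>PSL2R\<^esub> (T 1 \<otimes>\<^bsub>PSL2R\<^esub> g)" "T 1"] g rho_T by simp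
    then have "\<rho> (inv\<^bsub>PSL2R\<^esub> g) $ k $ j = \<rho> (inv\<^bsub>PSL2R\<^esub> (T 1 \<otimes>\<^bsub>PSL2R\<^esub> g)) $ k $ j * diag_exp l0 1 $ j $ j"
      by (simp add: matrix_matrix_mult_def diag_exp_def if_distrib[of "\<lambda>x. _ * x"] cong: if_cong)
    moreover have "act (T 1 \<otimes>\<^bsub>PSL2R\<^esub> g) \<tau> = act g \<tau> + of_real h" "aut2 (T 1 \<otimes>\<^bsub>PSL2R\<^esub> g) \<tau> = aut2 g \<tau>"
      using g tp by (simp_all add: act_T_mult)
    ultimately show "t k (T 1 \<otimes>\<^bsub>PSL2R\<^esub> g) = t k g" by (simp add: t_def seed_translate mult_ac)
  qed
  have act_shift: "seed j n (act r (act a \<tau>)) / aut2 r (act a \<tau>) ^ 3 =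
      aut2 a \<tau> ^ 3 * (seed j n (act (r \<otimes>\<^bsub>PSL2R\<^esub> a) \<tau>) / aut2 (r \<otimes>\<^bsub>PSL2R\<^esub> a) \<tau> ^ 3)" if "r \<in> R" for r
    using that a tp nz by (simp add: act_mult field_simps)
  have summ: "(\<lambda>r. t k (r \<otimes>\<^bsub>PSL2R\<^esub> a)) summable_on R" for k
  proof -
    have "(\<lambda>r. \<rho> (inv\<^bsub>PSL2R\<^esub> (r \<otimes>\<^bsub>PSL2R\<^esub> a)) $ k $ j * seed j n (act r (act a \<tau>)) / aut2 r (act a \<tau>) ^ 3) summable_on R"
      by (rule poincare_series_summable[where ?B0.0 = B and C = "2 * pi * (real n + 1 - l0$j) / h"])
        (use B seed_rate_pos[of n j] a \<tau> in \<open>auto simp: norm_seed\<close>)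
    from summable_on_cmult_right[OF this, of "1 / aut2 a \<tau> ^ 3"]
    show ?thesis
    proof (rule summable_on_cong[THEN iffD1, rotated])
      fix r assume r: "r \<in> R"
      show "1 / aut2 a \<tau> ^ 3 * (\<rho> (inv\<^bsub>PSL2R\<^esub> (r \<otimes>\<^bsub>PSL2R\<^esub> a)) $ k $ j * seed j n (act r (act a \<tau>)) / aut2 r (act a \<tau>) ^ 3) = t k (r \<otimes>\<^bsub>PSL2R\<^esub> a)"
        unfolding t_def times_divide_eq_right[symmetric] act_shift[OF r] using nz by simp
    qed
  qed
  have "vector_poincare i j n (act a \<tau>) = (\<Sum>\<^sub>\<infinity>r\<in>R. \<Sum>k\<in>UNIV. (aut2 a \<tau> ^ 3 * \<rho> a $ i $ k) * t k (r \<otimes>\<^bsub>PSL2R\<^esub> a))"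
    unfolding vector_poincare_def poincare_series_def
  proof (rule infsum_cong)
    fix r assume r: "r \<in> R"
    have "a \<otimes>\<^bsub>PSL2R\<^esub> inv\<^bsub>PSL2R\<^esub> (r \<otimes>\<^bsub>PSL2R\<^esub> a) = inv\<^bsub>PSL2R\<^esub> r"
      using a r by (simp add: PSL.inv_mult_group flip: PSL.m_assoc)
    then have "\<rho> (inv\<^bsub>PSL2R\<^esub> r) = \<rho> a ** \<rho> (inv\<^bsub>PSL2R\<^esub> (r \<otimes>\<^bsub>PSL2R\<^esub> a))"
      using rho_mult[of a "inv\<^bsub>PSL2R\<^esub> (r \<otimes>\<^bsub>PSL2R\<^esub> a)"] a r by simp
    then have "\<rho> (inv\<^bsub>PSL2R\<^esub> r) $ i $ j = (\<Sum>k\<in>UNIV. \<rho> a $ i $ k * \<rho> (inv\<^bsub>PSL2R\<^esub> (r \<otimes>\<^bsub>PSL2R\<^esub> a)) $ k $ j)"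
      by (simp add: matrix_matrix_mult_def)
    then have "\<rho> (inv\<^bsub>PSL2R\<^esub> r) $ i $ j * seed j n (act r (act a \<tau>)) / aut2 r (act a \<tau>) ^ 3 =
      (\<Sum>k\<in>UNIV. \<rho> a $ i $ k * \<rho> (inv\<^bsub>PSL2R\<^esub> (r \<otimes>\<^bsub>PSL2R\<^esub> a)) $ k $ j) *
      (aut2 a \<tau> ^ 3 * (seed j n (act (r \<otimes>\<^bsub>PSL2R\<^esub> a) \<tau>) / aut2 (r \<otimes>\<^bsub>PSL2R\<^esub> a) \<tau> ^ 3))"
      unfolding times_divide_eq_right[symmetric] act_shift[OF r] by simp
    then show "\<rho> (inv\<^bsub>PSL2R\<^esub> r) $ i $ j * seed j n (act r (act a \<tau>)) / aut2 r (act a \<tau>) ^ 3 =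
      (\<Sum>k\<in>UNIV. (aut2 a \<tau> ^ 3 * \<rho> a $ i $ k) * t k (r \<otimes>\<^bsub>PSL2R\<^esub> a))"
      by (simp add: t_def sum_distrib_left sum_distrib_right sum_divide_distrib mult_ac)
  qed
  also have "\<dots> = (\<Sum>k\<in>UNIV. (\<Sum>\<^sub>\<infinity>r\<in>R. (aut2 a \<tau> ^ 3 * \<rho> a $ i $ k) * t k (r \<otimes>\<^bsub>PSL2R\<^esub> a)))"
    by (rule infsum_finite_sum) (auto intro: summable_on_cmult_right summ)
  also have "\<dots> = (\<Sum>k\<in>UNIV. (aut2 a \<tau> ^ 3 * \<rho> a $ i $ k) * (\<Sum>\<^sub>\<infinity>r\<in>R. t k (r \<otimes>\<^bsub>PSL2R\<^esub> a)))"
    by (intro sum.cong refl infsum_cmult_right')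
  also have "\<dots> = (\<Sum>k\<in>UNIV. (aut2 a \<tau> ^ 3 * \<rho> a $ i $ k) * (\<Sum>\<^sub>\<infinity>r\<in>R. t k r))"
    using infsum_R_shift[OF a, of "t k" for k] inv by simp
  also have "\<dots> = aut2 a \<tau> ^ 3 * (\<Sum>k\<in>UNIV. \<rho> a $ i $ k * vector_poincare k j n \<tau>)"
    by (simp add: vector_poincare_def poincare_series_def t_def sum_distrib_left mult_ac)
  finally show ?thesis .
qed

lemma vector_poincare_growth:
  assumes A: "A \<in> carrier PSL2R" and h': "h' \<ge> 0"
  obtains K1 K2 where "\<And>w. 0 \<le> Re w \<Longrightarrow> Re w \<le> h' \<Longrightarrow> Im w \<ge> 1 \<Longrightarrow>
    cmod (vector_poincare i j n (act A w) / aut2 A w ^ 3) \<le> K1 * exp (K2 * Im w)"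
proof -
  obtain B where B: "\<And>g i j. g \<in> G \<Longrightarrow> cmod (\<rho> g $ i $ j) \<le> B" by (rule rho_bounded) blast
  have "\<exists>K1 K2. \<forall>w. 0 \<le> Re w \<longrightarrow> Re w \<le> h' \<longrightarrow> Im w \<ge> 1 \<longrightarrow>
    cmod (poincare_series (\<lambda>r. \<rho> (inv\<^bsub>PSL2R\<^esub> r) $ i $ j) (seed j n) (act A w) / aut2 A w ^ 3) \<le> K1 * exp (K2 * Im w)"
    by (rule poincare_series_growth[where b = "\<lambda>r. \<rho> (inv\<^bsub>PSL2R\<^esub> r) $ i $ j" and s = "seed j n" and ?B0.0 = B and C = "2 * pi * (real n + 1 - l0$j) / h" and A = A and h' = h'],
      use B in simp, simp add: norm_seed, use seed_rate_pos[of n j] in simp, rule A, rule h', blast)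
  then show ?thesis using that unfolding vector_poincare_def by blast
qed

text \<open>The identity coset contributes the seed in component j and nothing in the others; the
  remaining cosets together stay bounded on the imaginary axis.\<close>

lemma vector_poincare_at_infinity:
  obtains K where "\<And>y. y \<ge> 1 \<Longrightarrow> cmod (vector_poincare i j n (Complex 0 y) - (if i = j then seed j n (Complex 0 y) else 0)) \<le> K"
proof -
  obtain B where B: "\<And>g i j. g \<in> G \<Longrightarrow> cmod (\<rho> g $ i $ j) \<le> B" by (rule rho_bounded) blast
  obtain K where K: "\<And>y. y \<ge> 1 \<Longrightarrow> cmod (poincare_series (\<lambda>r. \<rho> (inv\<^bsub>PSL2R\<^esub> r) $ i $ j) (seed j n) (Complex 0 y) -
      \<rho> (inv\<^bsub>PSL2R\<^esub> \<one>\<^bsub>PSL2R\<^esub>) $ i $ j * seed j n (Complex 0 y)) \<le> K / y\<^sup>2"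
    by (rule poincare_series_at_infinity[where b = "\<lambda>r. \<rho> (inv\<^bsub>PSL2R\<^esub> r) $ i $ j" and s = "seed j n" and ?B0.0 = B and C = "2 * pi * (real n + 1 - l0$j) / h"])
      (use B seed_rate_pos[of n j] in \<open>auto simp: norm_seed\<close>)
  show ?thesis
  proof (rule that)
    fix y :: real assume y: "y \<ge> 1"
    have "K / y\<^sup>2 \<le> \<bar>K\<bar> / 1" using y by (intro frac_le) auto
    then show "cmod (vector_poincare i j n (Complex 0 y) - (if i = j then seed j n (Complex 0 y) else 0)) \<le> \<bar>K\<bar>"
      using K[OF y] by (auto simp: vector_poincare_def rho_one mat_def)
  qed
qed

definition H :: "('d \<times> nat) set \<Rightarrow> ('d \<times> nat \<Rightarrow> complex) \<Rightarrow> 'd \<Rightarrow> complex \<Rightarrow> complex" where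
  "H Q \<alpha> i \<tau> = (\<Sum>p\<in>Q. \<alpha> p * vector_poincare i (fst p) (snd p) \<tau>)"

lemma H_holomorphic: "H Q \<alpha> i holomorphic_on upper_half_plane"
  unfolding H_def[abs_def] by (intro holomorphic_intros vector_poincare_holomorphic)

lemma H_automorphic:
  assumes "a \<in> G" "\<tau> \<in> upper_half_plane"
  shows "H Q \<alpha> i (act a \<tau>) = aut2 a \<tau> ^ 3 * (\<Sum>k\<in>UNIV. \<rho> a $ i $ k * H Q \<alpha> k \<tau>)"
proof -
  have "H Q \<alpha> i (act a \<tau>) = (\<Sum>p\<in>Q. \<Sum>k\<in>UNIV. aut2 a \<tau> ^ 3 * (\<rho> a $ i $ k * (\<alpha> p * vector_poincare k (fst p) (snd p) \<tau>)))"
    unfolding H_def using assms by (simp add: vector_poincare_automorphic sum_distrib_left mult_ac)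
  also have "\<dots> = (\<Sum>k\<in>UNIV. \<Sum>p\<in>Q. aut2 a \<tau> ^ 3 * (\<rho> a $ i $ k * (\<alpha> p * vector_poincare k (fst p) (snd p) \<tau>)))"
    by (rule sum.swap)
  also have "\<dots> = aut2 a \<tau> ^ 3 * (\<Sum>k\<in>UNIV. \<rho> a $ i $ k * H Q \<alpha> k \<tau>)"
    by (simp add: H_def sum_distrib_left)
  finally show ?thesis .
qed

lemma H_growth:
  assumes Q: "finite Q" and A: "A \<in> carrier PSL2R" and h': "h' \<ge> 0"
  obtains K1 K2 where "\<And>i w. 0 \<le> Re w \<Longrightarrow> Re w \<le> h' \<Longrightarrow> Im w \<ge> 1 \<Longrightarrow>
    cmod (H Q \<alpha> i (act A w) / aut2 A w ^ 3) \<le> K1 * exp (K2 * Im w)"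
proof -
  have "\<exists>K1 K2. \<forall>w. 0 \<le> Re w \<longrightarrow> Re w \<le> h' \<longrightarrow> Im w \<ge> 1 \<longrightarrow>
    cmod (vector_poincare i j n (act A w) / aut2 A w ^ 3) \<le> K1 * exp (K2 * Im w)" for i j n
    by (rule vector_poincare_growth[OF A h', of i j n]) blast
  then obtain K1 K2 where K: "\<And>i j n w. 0 \<le> Re w \<Longrightarrow> Re w \<le> h' \<Longrightarrow> Im w \<ge> 1 \<Longrightarrow>
    cmod (vector_poincare i j n (act A w) / aut2 A w ^ 3) \<le> K1 i j n * exp (K2 i j n * Im w)" by metis
  define k2 where "k2 = (\<Sum>i\<in>UNIV. \<Sum>p\<in>Q. \<bar>K2 i (fst p) (snd p)\<bar>)"
  define k1 where "k1 = (\<Sum>i\<in>UNIV. \<Sum>p\<in>Q. cmod (\<alpha> p) * \<bar>K1 i (fst p) (snd p)\<bar>)"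
  have k2: "K2 i (fst p) (snd p) \<le> k2" if "p \<in> Q" for i p
  proof -
    have "\<bar>K2 i (fst p) (snd p)\<bar> \<le> (\<Sum>p\<in>Q. \<bar>K2 i (fst p) (snd p)\<bar>)"
      using that Q by (intro member_le_sum) auto
    also have "\<dots> \<le> k2" unfolding k2_def
      by (rule member_le_sum[of i UNIV "\<lambda>i. \<Sum>p\<in>Q. \<bar>K2 i (fst p) (snd p)\<bar>"]) (auto intro: sum_nonneg)
    finally show ?thesis by simp
  qed
  show ?thesis
  proof (rule that[of k1 k2])
    fix i w assume w: "0 \<le> Re w" "Re w \<le> h'" "Im w \<ge> 1"
    have "cmod (H Q \<alpha> i (act A w) / aut2 A w ^ 3) = cmod (\<Sum>p\<in>Q. \<alpha> p * (vector_poincare i (fst p) (snd p) (act A w) / aut2 A w ^ 3))"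
      by (simp add: H_def sum_divide_distrib)
    also have "\<dots> \<le> (\<Sum>p\<in>Q. cmod (\<alpha> p) * \<bar>K1 i (fst p) (snd p)\<bar> * exp (k2 * Im w))"
    proof (rule sum_norm_le)
      fix p assume p: "p \<in> Q"
      have "cmod (vector_poincare i (fst p) (snd p) (act A w) / aut2 A w ^ 3) \<le> K1 i (fst p) (snd p) * exp (K2 i (fst p) (snd p) * Im w)"
        by (rule K[OF w])
      also have "\<dots> \<le> \<bar>K1 i (fst p) (snd p)\<bar> * exp (k2 * Im w)"
        using k2[OF p, of i] w by (intro mult_mono) (auto intro: mult_right_mono)
      finally show "cmod (\<alpha> p * (vector_poincare i (fst p) (snd p) (act A w) / aut2 A w ^ 3)) \<le> cmod (\<alpha> p) * \<bar>K1 i (fst p) (snd p)\<bar> * exp (k2 * Im w)"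
        unfolding norm_mult[of "\<alpha> p"] mult.assoc by (rule mult_left_mono) simp
    qed
    also have "\<dots> = (\<Sum>p\<in>Q. cmod (\<alpha> p) * \<bar>K1 i (fst p) (snd p)\<bar>) * exp (k2 * Im w)" by (simp add: sum_distrib_right)
    also have "\<dots> \<le> k1 * exp (k2 * Im w)"
      unfolding k1_def by (intro mult_right_mono member_le_sum[of i UNIV "\<lambda>i. \<Sum>p\<in>Q. cmod (\<alpha> p) * \<bar>K1 i (fst p) (snd p)\<bar>"])
        (auto intro!: sum_nonneg)
    finally show "cmod (H Q \<alpha> i (act A w) / aut2 A w ^ 3) \<le> k1 * exp (k2 * Im w)" .
  qed
qed

text \<open>A limit over punctured neighbourhoods, so that removable singularities at zeros of the
  Eisenstein series are filled in by the definition itself.\<close>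

definition X :: "('d \<times> nat) set \<Rightarrow> ('d \<times> nat \<Rightarrow> complex) \<Rightarrow> complex \<Rightarrow> complex^'d" where
  "X Q \<alpha> \<tau> = (\<chi> i. Lim (at \<tau>) (\<lambda>w. H Q \<alpha> i w / eis w))"

context
  fixes Q :: "('d \<times> nat) set" and \<alpha> :: "'d \<times> nat \<Rightarrow> complex" and Z :: "complex set"
  assumes Q: "finite Q"
    and Z: "Z \<subseteq> upper_half_plane" "\<And>z. z \<in> upper_half_plane \<Longrightarrow> eis z = 0 \<Longrightarrow> \<exists>z0\<in>Z. \<exists>g\<in>G. z = act g z0"
    and vanish: "\<And>i z m. z \<in> Z \<Longrightarrow> int m < zorder eis z \<Longrightarrow> (deriv ^^ m) (H Q \<alpha> i) z = 0"
begin

lemma quotient_automorphic: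
  assumes "g \<in> G" "w \<in> upper_half_plane"
  shows "H Q \<alpha> i (act g w) / eis (act g w) = (\<Sum>k\<in>UNIV. \<rho> g $ i $ k * (H Q \<alpha> k w / eis w))"
proof -
  have nz: "aut2 g w \<noteq> 0" using assms by (simp add: Im_act upper_half_plane_def)
  have "H Q \<alpha> i (act g w) / eis (act g w) = (\<Sum>k\<in>UNIV. \<rho> g $ i $ k * H Q \<alpha> k w) / eis w"
    using assms nz by (simp add: H_automorphic eis_automorphic)
  then show ?thesis by (simp add: sum_divide_distrib)
qed

lemma act_filterlim:
  assumes "g \<in> G" "z \<in> upper_half_plane"
  shows "filterlim (act g) (at (act g z)) (at z)"
proof -
  have "isCont (act g) z"
    using holomorphic_on_imp_continuous_on[OF holomorphic_act(1)[OF _ order_refl]] assms open_upper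
    by (simp add: continuous_on_eq_continuous_at)
  moreover have "\<forall>\<^sub>F w in at z. act g w \<noteq> act g z"
  proof -
    have "\<forall>\<^sub>F w in at z. w \<in> upper_half_plane - {z}"
      by (rule eventually_at_in_open) (use open_upper assms in auto)
    then show ?thesis
    proof eventually_elim
      case (elim w)
      then show ?case using act_inv(1)[of g w] act_inv(1)[of g z] assms by (auto simp: upper_half_plane_def)
    qed
  qed
  ultimately show ?thesis by (simp add: filterlim_at isCont_def)
qed

text \<open>The vanishing conditions are imposed at the points of \<open>Z\<close> only. Near
  another zero g z0 each component of the quotient is a combination of the components near z0, which
  have limits there.\<close>

lemma quotient_limit:
  assumes z: "z \<in> upper_half_plane"
  shows "(\<lambda>w. H Q \<alpha> i w / eis w) \<midarrow>z\<rightarrow> X Q \<alpha> z $ i"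
proof -
  have "\<exists>c. (\<lambda>w. H Q \<alpha> i w / eis w) \<midarrow>z\<rightarrow> c"
  proof (cases "eis z = 0")
    case False
    have "isCont u z" if "u holomorphic_on upper_half_plane" for u :: "complex \<Rightarrow> complex"
      using holomorphic_on_imp_continuous_on[OF that] z open_upper by (simp add: continuous_on_eq_continuous_at)
    from tendsto_divide[OF this[OF H_holomorphic, unfolded isCont_def] this[OF eis_holomorphic, unfolded isCont_def] False]
    show ?thesis by (rule exI)
  next
    case True
    then obtain z0 g where zg: "z0 \<in> Z" "g \<in> G" "z = act g z0" using Z(2)[OF z] by blast
    then have z0: "z0 \<in> upper_half_plane" using Z by blast
    have "\<exists>c. (\<lambda>w. H Q \<alpha> k w / eis w) \<midarrow>z0\<rightarrow> c" for k
      by (rule quotient_has_limit[OF H_holomorphic eis_holomorphic open_upper connected_upper z0 eis_nonzero])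
        (use vanish zg in auto)
    then obtain c where c: "\<And>k. (\<lambda>w. H Q \<alpha> k w / eis w) \<midarrow>z0\<rightarrow> c k" by metis
    have gz: "act (inv\<^bsub>PSL2R\<^esub> g) z = z0" using zg z0 by (simp add: act_inv upper_half_plane_def)
    have fl: "filterlim (act (inv\<^bsub>PSL2R\<^esub> g)) (at z0) (at z)"
      using act_filterlim[of "inv\<^bsub>PSL2R\<^esub> g" z] zg z gz by simp
    have "((\<lambda>w. \<Sum>k\<in>UNIV. \<rho> g $ i $ k * (H Q \<alpha> k (act (inv\<^bsub>PSL2R\<^esub> g) w) / eis (act (inv\<^bsub>PSL2R\<^esub> g) w))) \<longlongrightarrow> (\<Sum>k\<in>UNIV. \<rho> g $ i $ k * c k)) (at z)"
      by (intro tendsto_sum tendsto_mult tendsto_const filterlim_compose[OF c fl])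
    then have "(\<lambda>w. H Q \<alpha> i w / eis w) \<midarrow>z\<rightarrow> (\<Sum>k\<in>UNIV. \<rho> g $ i $ k * c k)"
    proof (rule Lim_transform_within_open[OF _ open_upper z])
      fix w assume w: "w \<in> upper_half_plane"
      then show "(\<Sum>k\<in>UNIV. \<rho> g $ i $ k * (H Q \<alpha> k (act (inv\<^bsub>PSL2R\<^esub> g) w) / eis (act (inv\<^bsub>PSL2R\<^esub> g) w))) = H Q \<alpha> i w / eis w"
        using quotient_automorphic[of g "act (inv\<^bsub>PSL2R\<^esub> g) w" i] zg by (simp add: act_inv upper_half_plane_def Im_act(2))
    qed
    then show ?thesis by blast
  qed
  then obtain c where c: "(\<lambda>w. H Q \<alpha> i w / eis w) \<midarrow>z\<rightarrow> c" by blast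
  then have "X Q \<alpha> z $ i = c" unfolding X_def by (simp add: tendsto_Lim)
  with c show ?thesis by simp
qed

lemma X_eq:
  assumes "z \<in> upper_half_plane" "eis z \<noteq> 0"
  shows "X Q \<alpha> z $ i = H Q \<alpha> i z / eis z"
proof -
  have "isCont u z" if "u holomorphic_on upper_half_plane" for u :: "complex \<Rightarrow> complex"
    using holomorphic_on_imp_continuous_on[OF that] assms open_upper by (simp add: continuous_on_eq_continuous_at)
  from tendsto_divide[OF this[OF H_holomorphic, unfolded isCont_def] this[OF eis_holomorphic, unfolded isCont_def] assms(2)]
  have "(\<lambda>w. H Q \<alpha> i w / eis w) \<midarrow>z\<rightarrow> H Q \<alpha> i z / eis z" .
  with quotient_limit[OF assms(1)] show ?thesis by (rule LIM_unique)
qed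

lemma X_holomorphic: "(\<lambda>\<tau>. X Q \<alpha> \<tau> $ i) holomorphic_on upper_half_plane"
proof (rule analytic_imp_holomorphic, unfold analytic_on_def, intro ballI)
  fix z assume z: "z \<in> upper_half_plane"
  obtain e where e: "e > 0" "ball z e \<subseteq> upper_half_plane" "\<And>w. w \<in> ball z e - {z} \<Longrightarrow> eis w \<noteq> 0"
    by (rule eis_isolated[OF z]) blast
  have q: "(\<lambda>w. H Q \<alpha> i w / eis w) holomorphic_on (ball z e - {z})"
    using e by (intro holomorphic_on_divide holomorphic_on_subset[OF H_holomorphic] holomorphic_on_subset[OF eis_holomorphic]) auto
  have hol: "(\<lambda>\<tau>. X Q \<alpha> \<tau> $ i) holomorphic_on (ball z e - {z})"
    by (rule holomorphic_transform[OF q]) (use e X_eq in auto)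
  have "(\<lambda>w. X Q \<alpha> w $ i) \<midarrow>z\<rightarrow> X Q \<alpha> z $ i"
  proof (rule Lim_transform_within_open[OF quotient_limit[OF z]])
    fix w assume "w \<in> ball z e" "w \<noteq> z"
    then show "H Q \<alpha> i w / eis w = X Q \<alpha> w $ i" using X_eq[of w i] e by auto
  qed (use e in auto)
  then have "((\<lambda>w. X Q \<alpha> w $ i) \<longlongrightarrow> X Q \<alpha> z $ i) (at z within ball z e)"
    using tendsto_within_subset by blast
  then have "(\<lambda>\<tau>. X Q \<alpha> \<tau> $ i) holomorphic_on ball z e"
    using hol by (intro no_isolated_singularity'[of "{z}" "\<lambda>\<tau>. X Q \<alpha> \<tau> $ i" "ball z e"]) simp_all
  then show "\<exists>\<epsilon>>0. (\<lambda>\<tau>. X Q \<alpha> \<tau> $ i) holomorphic_on ball z \<epsilon>" using e by blast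
qed

lemma X_equivariant:
  assumes g: "g \<in> G" and z: "z \<in> upper_half_plane"
  shows "X Q \<alpha> (act g z) = \<rho> g *v X Q \<alpha> z"
proof -
  have "X Q \<alpha> (act g z) $ i = (\<Sum>k\<in>UNIV. \<rho> g $ i $ k * X Q \<alpha> z $ k)" for i
  proof (rule LIM_unique)
    have gz: "act g z \<in> upper_half_plane" using g z by simp
    show "(\<lambda>w. H Q \<alpha> i (act g w) / eis (act g w)) \<midarrow>z\<rightarrow> X Q \<alpha> (act g z) $ i"
      by (rule filterlim_compose[OF quotient_limit[OF gz] act_filterlim[OF g z]])
    have "(\<lambda>w. \<Sum>k\<in>UNIV. \<rho> g $ i $ k * (H Q \<alpha> k w / eis w)) \<midarrow>z\<rightarrow> (\<Sum>k\<in>UNIV. \<rho> g $ i $ k * X Q \<alpha> z $ k)"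
      by (intro tendsto_sum tendsto_mult tendsto_const quotient_limit z)
    then show "(\<lambda>w. H Q \<alpha> i (act g w) / eis (act g w)) \<midarrow>z\<rightarrow> (\<Sum>k\<in>UNIV. \<rho> g $ i $ k * X Q \<alpha> z $ k)"
      by (rule Lim_transform_within_open[OF _ open_upper z]) (simp add: quotient_automorphic g)
  qed
  then show ?thesis by (simp add: vec_eq_iff matrix_vector_mult_def)
qed

text \<open>In the coordinate at the cusp, with the weight-six factor of \<open>A\<close> divided
  out, the Eisenstein series is periodic and not identically zero, so it is bounded below by an
  exponential even if it vanishes at the cusp. The numerator carries the same factor, which cancels
  in the quotient.\<close>

lemma X_growth:
  assumes A: "A \<in> carrier PSL2R" and h': "h' > 0"
    and per: "A \<otimes>\<^bsub>PSL2R\<^esub> psl (tmat h') \<otimes>\<^bsub>PSL2R\<^esub> inv\<^bsub>PSL2R\<^esub> A \<in> G"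
  obtains K1 K2 Y where "K1 \<ge> 0" "\<And>i w. 0 \<le> Re w \<Longrightarrow> Re w \<le> h' \<Longrightarrow> Im w \<ge> Y \<Longrightarrow>
    cmod (X Q \<alpha> (act A w) $ i) \<le> K1 * exp (K2 * Im w)"
proof -
  define t where "t = A \<otimes>\<^bsub>PSL2R\<^esub> psl (tmat h') \<otimes>\<^bsub>PSL2R\<^esub> inv\<^bsub>PSL2R\<^esub> A"
  have tc: "psl (tmat h') \<in> carrier PSL2R" by (simp add: psl_in_carrier)
  have tA: "t \<otimes>\<^bsub>PSL2R\<^esub> A = A \<otimes>\<^bsub>PSL2R\<^esub> psl (tmat h')" using A tc by (simp add: t_def PSL.m_assoc)
  have tG: "t \<in> G" using per by (simp add: t_def)
  have shift: "act (psl (tmat h')) w = w + of_real h'" "aut2 (psl (tmat h')) w = 1" for w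
    by (simp_all add: act_psl aut2_psl mob_def aut_def)
  define E where "E z = eis (act A (of_real h' * z)) / aut2 A (of_real h' * z) ^ 3" for z
  have up: "of_real h' * z \<in> upper_half_plane" if "z \<in> upper_half_plane" for z
    using that h' by (simp add: upper_half_plane_def)
  interpret E: periodic_holomorphic E
  proof
    have s: "(\<lambda>z. of_real h' * z) ` upper_half_plane \<subseteq> upper_half_plane" using up by auto
    have "act A \<circ> (\<lambda>z. of_real h' * z) holomorphic_on upper_half_plane" "aut2 A \<circ> (\<lambda>z. of_real h' * z) holomorphic_on upper_half_plane"
      by (intro holomorphic_on_compose_gen[OF _ _ s] holomorphic_act A holomorphic_intros order_refl)+
    then have 1: "(\<lambda>z. act A (of_real h' * z)) holomorphic_on upper_half_plane" "(\<lambda>z. aut2 A (of_real h' * z)) holomorphic_on upper_half_plane"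
      by (simp_all add: o_def)
    have "eis \<circ> (\<lambda>z. act A (of_real h' * z)) holomorphic_on upper_half_plane"
      by (rule holomorphic_on_compose_gen[OF 1(1) eis_holomorphic]) (use A up in auto)
    then show "E holomorphic_on upper_half_plane"
      unfolding E_def[abs_def] using 1(2) A up by (intro holomorphic_intros) (auto simp: o_def Im_act upper_half_plane_def)
    fix z assume z: "z \<in> upper_half_plane"
    define w where "w = of_real h' * z"
    have w: "w \<in> upper_half_plane" "Im w > 0" using up[OF z] by (auto simp: w_def upper_half_plane_def)
    have "act A (w + of_real h') = act t (act A w)"
      using act_mult(1)[of t A w] act_mult(1)[of A "psl (tmat h')" w] tA A tc tG w by (simp add: shift)
    moreover have "aut2 A (w + of_real h') = aut2 t (act A w) * aut2 A w"
      using act_mult(2)[of t A w] act_mult(2)[of A "psl (tmat h')" w] tA A tc tG w by (simp add: shift)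
    moreover have "aut2 t (act A w) \<noteq> 0" using tG A w by (simp add: Im_act)
    ultimately have "eis (act A (w + of_real h')) / aut2 A (w + of_real h') ^ 3 = eis (act A w) / aut2 A w ^ 3"
      using eis_automorphic[OF tG, of "act A w"] A w by (simp add: power_mult_distrib)
    then show "E (z + 1) = E z" by (simp add: E_def w_def distrib_left)
  qed
  obtain k1 k2 where k: "\<And>w. 0 \<le> Re w \<Longrightarrow> Re w \<le> h' \<Longrightarrow> Im w \<ge> 1 \<Longrightarrow>
    cmod (eis (act A w) / aut2 A w ^ 3) \<le> k1 * exp (k2 * Im w)"
    by (rule poincare_series_growth[where b = "\<lambda>_. 1" and s = "\<lambda>_. 1" and ?B0.0 = 1 and C = 0 and A = A and h' = h']) (use A h' in auto)
  have growth: "cmod (E z) \<le> k1 * exp ((k2 * h') * Im z)" if "0 \<le> Re z" "Re z \<le> 1" "1 / h' \<le> Im z" for z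
    using k[of "of_real h' * z"] that h' by (simp add: E_def field_simps mult.assoc)
  obtain w0 where w0: "w0 \<in> upper_half_plane" "eis w0 \<noteq> 0" using eis_nonzero by blast
  \<comment> \<open>Pulling a nonzero of the Eisenstein series back by \<open>A\<close> shows that E
    is not identically zero.\<close>
  define z0 where "z0 = act (inv\<^bsub>PSL2R\<^esub> A) w0 / of_real h'"
  have hz0: "of_real h' * z0 = act (inv\<^bsub>PSL2R\<^esub> A) w0" using h' by (simp add: z0_def)
  have w0': "act (inv\<^bsub>PSL2R\<^esub> A) w0 \<in> upper_half_plane" using A w0 by simp
  have z0: "z0 \<in> upper_half_plane" using w0' h' by (simp add: z0_def upper_half_plane_def)
  have "E z0 \<noteq> 0" unfolding E_def hz0 using A w0 w0' by (simp add: act_inv upper_half_plane_def Im_act)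
  from E.lower_bound[OF growth z0 this] obtain c k y1 where c: "c > 0" "k \<ge> 0"
    "\<And>z. z \<in> upper_half_plane \<Longrightarrow> Im z \<ge> y1 \<Longrightarrow> cmod (E z) \<ge> c * exp (- k * Im z)"
    by blast
  obtain K1 K2 where K: "\<And>i w. 0 \<le> Re w \<Longrightarrow> Re w \<le> h' \<Longrightarrow> Im w \<ge> 1 \<Longrightarrow>
    cmod (H Q \<alpha> i (act A w) / aut2 A w ^ 3) \<le> K1 * exp (K2 * Im w)"
    by (rule H_growth[OF Q A, of h' \<alpha>]) (use h' in simp, blast)
  show ?thesis
  proof (rule that[of "\<bar>K1\<bar> / c" "max 1 (h' * y1)" "K2 + k / h'"])
    show "\<bar>K1\<bar> / c \<ge> 0" using c by simp
    fix i w assume w: "0 \<le> Re w" "Re w \<le> h'" "Im w \<ge> max 1 (h' * y1)"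
    then have wu: "w \<in> upper_half_plane" "Im w > 0" by (auto simp: upper_half_plane_def)
    define z where "z = w / of_real h'"
    have z: "z \<in> upper_half_plane" "of_real h' * z = w" "Im z = Im w / h'" "Im z \<ge> y1"
      using w wu h' by (auto simp: z_def upper_half_plane_def field_simps)
    have lower: "cmod (eis (act A w) / aut2 A w ^ 3) \<ge> c * exp (- k * (Im w / h'))"
      using c(3)[OF z(1,4)] z by (simp add: E_def)
    have pos: "c * exp (- k * (Im w / h')) > 0" using c by simp
    then have Enz: "eis (act A w) \<noteq> 0" using lower by auto
    have anz: "aut2 A w \<noteq> 0" using A wu by (simp add: Im_act)
    have "X Q \<alpha> (act A w) $ i = (H Q \<alpha> i (act A w) / aut2 A w ^ 3) / (eis (act A w) / aut2 A w ^ 3)"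
      using X_eq[of "act A w" i] Enz A wu anz by simp
    then have "cmod (X Q \<alpha> (act A w) $ i) = cmod (H Q \<alpha> i (act A w) / aut2 A w ^ 3) / cmod (eis (act A w) / aut2 A w ^ 3)"
      by (simp only: norm_divide)
    also have "\<dots> \<le> (\<bar>K1\<bar> * exp (K2 * Im w)) / (c * exp (- k * (Im w / h')))"
    proof (rule frac_le)
      have "K1 * exp (K2 * Im w) \<le> \<bar>K1\<bar> * exp (K2 * Im w)" by (rule mult_right_mono) auto
      then show "cmod (H Q \<alpha> i (act A w) / aut2 A w ^ 3) \<le> \<bar>K1\<bar> * exp (K2 * Im w)"
        using K[OF w(1,2), of i] w(3) by (meson max.bounded_iff order_trans)
    qed (use lower pos in auto)
    also have "\<dots> = \<bar>K1\<bar> / c * exp ((K2 + k / h') * Im w)"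
    proof -
      have "exp ((K2 + k / h') * Im w) = exp (K2 * Im w) * exp (k * (Im w / h'))"
        by (simp add: distrib_right flip: exp_add)
      then show ?thesis using c by (simp add: exp_minus field_simps)
    qed
    finally show "cmod (X Q \<alpha> (act A w) $ i) \<le> \<bar>K1\<bar> / c * exp ((K2 + k / h') * Im w)" .
  qed
qed

end

end

lemma diag_exp_add: "diag_exp l (z + w) = diag_exp l z ** diag_exp l w"
  by (auto simp: diag_exp_def matrix_matrix_mult_def vec_eq_iff if_distrib[of "\<lambda>x. _ * x"] distrib_left exp_add cong: if_cong)

lemma diag_exp_0: "diag_exp l 0 = mat 1"
  by (simp add: diag_exp_def mat_def cong: if_cong)

lemma conj_diag_nth: "(P ** diag_exp l z ** B) $ i $ j = (\<Sum>k\<in>UNIV. P $ i $ k * exp (2 * of_real pi * \<i> * of_real (l$k) * z) * B $ k $ j)"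
  by (simp add: matrix_matrix_mult_def diag_exp_def if_distrib[of "\<lambda>x. _ * x"] if_distribR cong: if_cong)

lemma has_sum_vec:
  fixes f :: "'b \<Rightarrow> complex^'n"
  assumes "\<And>i. ((\<lambda>n. f n $ i) has_sum S $ i) A"
  shows "(f has_sum S) A"
  using assms unfolding has_sum_def by (intro vec_tendstoI) (simp add: sum_component)

lemma exp_neg_tendsto_0:
  assumes "k < 0"
  shows "((\<lambda>y::real. exp (k * y)) \<longlongrightarrow> 0) at_top"
  by (rule filterlim_compose[OF exp_at_bot]) (rule filterlim_tendsto_neg_mult_at_bot[OF tendsto_const assms filterlim_ident])

text \<open>Divide by the fastest exponential with nonzero coefficient: the bounded sum then tends
  to 0, while on the other side all slower terms vanish in the limit and only this coefficient
  remains.\<close>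

lemma bounded_exponential_sum:
  fixes c :: "'p \<Rightarrow> complex" and \<mu> :: "'p \<Rightarrow> real"
  assumes fin: "finite I" and inj: "inj_on \<mu> I" and pos: "\<And>p. p \<in> I \<Longrightarrow> \<mu> p > 0"
    and bound: "\<And>y. y \<ge> Y \<Longrightarrow> cmod (\<Sum>p\<in>I. c p * of_real (exp (\<mu> p * y))) \<le> B"
    and p: "p \<in> I"
  shows "c p = 0"
proof (rule ccontr)
  assume cp: "c p \<noteq> 0"
  define J where "J = {p\<in>I. c p \<noteq> 0}"
  have J: "finite J" "p \<in> J" using fin p cp by (auto simp: J_def)
  then have "Max (\<mu> ` J) \<in> \<mu> ` J" by (intro Max_in) auto
  then obtain p0 where p0: "p0 \<in> J" "\<mu> p0 = Max (\<mu> ` J)" by auto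
  have less: "\<mu> p - \<mu> p0 < 0" if "p \<in> J - {p0}" for p
  proof -
    have "\<mu> p \<le> \<mu> p0" using that J p0 by simp
    moreover have "\<mu> p \<noteq> \<mu> p0" using that p0(1) inj by (auto simp: J_def inj_on_def)
    ultimately show ?thesis by simp
  qed
  define F where "F y = (\<Sum>p\<in>I. c p * of_real (exp (\<mu> p * y)))" for y :: real
  have F: "F y * of_real (exp (- \<mu> p0 * y)) = c p0 + (\<Sum>p\<in>J - {p0}. c p * of_real (exp ((\<mu> p - \<mu> p0) * y)))" for y
  proof -
    have "F y = (\<Sum>p\<in>J. c p * of_real (exp (\<mu> p * y)))"
      unfolding F_def by (rule sum.mono_neutral_right) (use fin in \<open>auto simp: J_def\<close>)
    then have "F y * of_real (exp (- \<mu> p0 * y)) = (\<Sum>p\<in>J. c p * of_real (exp (\<mu> p * y) * exp (- \<mu> p0 * y)))"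
      by (simp only: sum_distrib_right of_real_mult mult.assoc)
    also have "\<dots> = (\<Sum>p\<in>J. c p * of_real (exp ((\<mu> p - \<mu> p0) * y)))"
      by (simp add: algebra_simps flip: exp_add)
    finally show ?thesis using J p0 by (simp add: sum.remove[of J p0])
  qed
  have "((\<lambda>y. c p0 + (\<Sum>p\<in>J - {p0}. c p * of_real (exp ((\<mu> p - \<mu> p0) * y)))) \<longlongrightarrow> c p0 + (\<Sum>p\<in>J - {p0}. c p * of_real 0)) at_top"
    by (intro tendsto_intros exp_neg_tendsto_0 less)
  then have 1: "((\<lambda>y. F y * of_real (exp (- \<mu> p0 * y))) \<longlongrightarrow> c p0) at_top" unfolding F by simp
  have 2: "((\<lambda>y. F y * of_real (exp (- \<mu> p0 * y))) \<longlongrightarrow> 0) at_top"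
  proof (rule Lim_null_comparison)
    show "((\<lambda>y. B * exp (- \<mu> p0 * y)) \<longlongrightarrow> 0) at_top"
      using tendsto_mult[OF tendsto_const[of B] exp_neg_tendsto_0[of "- \<mu> p0"]] p0(1) pos[of p0] by (simp add: J_def)
    show "\<forall>\<^sub>F y in at_top. cmod (F y * of_real (exp (- \<mu> p0 * y))) \<le> B * exp (- \<mu> p0 * y)"
      using eventually_ge_at_top[of Y]
    proof eventually_elim
      case (elim y)
      then show ?case using bound[OF elim] by (simp add: norm_mult F_def mult_right_mono)
    qed
  qed
  have "c p0 = 0" by (rule tendsto_unique[OF _ 1 2]) simp
  then show False using p0 by (simp add: J_def)
qed

context vector_forms
begin

text \<open>A condition is a component, a zero in \<open>Z\<close> and a derivative below the order
  of that zero, so their number is the same for every j. One more seed than conditions gives a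
  nontrivial combination.\<close>

lemma good_coefficients:
  obtains Q \<alpha> Z where "finite Q" "inj_on snd Q" "\<And>j. \<exists>n. (j, n) \<in> Q \<and> \<alpha> (j, n) \<noteq> 0"
    "Z \<subseteq> upper_half_plane" "\<And>z. z \<in> upper_half_plane \<Longrightarrow> eis z = 0 \<Longrightarrow> \<exists>z0\<in>Z. \<exists>g\<in>G. z = act g z0"
    "\<And>i z m. z \<in> Z \<Longrightarrow> int m < zorder eis z \<Longrightarrow> (deriv ^^ m) (H Q \<alpha> i) z = 0"
proof -
  obtain Z where Z: "finite Z" "Z \<subseteq> {z\<in>upper_half_plane. eis z = 0}"
    "\<And>z. z \<in> upper_half_plane \<Longrightarrow> eis z = 0 \<Longrightarrow> \<exists>z0\<in>Z. \<exists>g\<in>G. z = act g z0"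
    by (rule eis_zeros) blast
  define C where "C = (UNIV :: 'd set) \<times> (SIGMA z:Z. {..<nat (zorder eis z)})"
  have C: "finite C" unfolding C_def using Z(1) by (intro finite_cartesian_product finite_SigmaI) auto
  define K where "K = card C + 1"
  obtain e :: "'d \<Rightarrow> nat" where e: "inj e" using finite_imp_inj_to_nat_seg[of "UNIV :: 'd set"] by auto
  \<comment> \<open>Consecutive blocks of length K, one for each index j: n div K identifies the
    block, so n determines j. This is the injectivity of \<open>snd\<close> that keeps the leading
    exponentials apart.\<close>
  define block where "block j = {e j * K..<e j * K + K}" for j
  have block: "finite (block j)" "card C < card (block j)" for j by (simp_all add: block_def K_def)
  have block_div: "n div K = e j" if "n \<in> block j" for n j
    by (rule div_nat_eqI) (use that in \<open>simp_all add: block_def mult.commute\<close>)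
  define \<phi> where "\<phi> j = (\<lambda>(i, z, m) n. (deriv ^^ m) (vector_poincare i j n) z)" for j
  have "\<forall>j. \<exists>\<alpha>. (\<exists>n\<in>block j. \<alpha> n \<noteq> 0) \<and> (\<forall>c\<in>C. (\<Sum>n\<in>block j. \<alpha> n * \<phi> j c n) = 0)"
    using homogeneous_system[OF C block] by blast
  then obtain \<beta> where \<beta>: "\<And>j. \<exists>n\<in>block j. \<beta> j n \<noteq> 0" "\<And>j c. c \<in> C \<Longrightarrow> (\<Sum>n\<in>block j. \<beta> j n * \<phi> j c n) = 0" by metis
  define Q where "Q = (SIGMA j:UNIV. block j)"
  define \<alpha> where "\<alpha> = (\<lambda>(j, n). \<beta> j n)"
  show ?thesis
  proof (rule that[of Q \<alpha> Z])
    show finQ: "finite Q" unfolding Q_def using block by (intro finite_SigmaI) auto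
    show "inj_on snd Q"
    proof (rule inj_onI)
      fix p p' assume "p \<in> Q" "p' \<in> Q" "snd p = snd p'"
      then have "e (fst p) = e (fst p')"
        using block_div[of "snd p" "fst p"] block_div[of "snd p'" "fst p'"] by (auto simp: Q_def)
      then show "p = p'" using \<open>snd p = snd p'\<close> by (simp add: prod_eq_iff inj_eq[OF e])
    qed
    show "\<exists>n. (j, n) \<in> Q \<and> \<alpha> (j, n) \<noteq> 0" for j using \<beta>(1)[of j] by (auto simp: Q_def \<alpha>_def)
    fix i z m assume z: "z \<in> Z" and m: "int m < zorder eis z"
    then have c: "(i, z, m) \<in> C" by (simp add: C_def)
    have "(deriv ^^ m) (\<lambda>w. \<Sum>p\<in>Q. \<alpha> p * vector_poincare i (fst p) (snd p) w) z = (\<Sum>p\<in>Q. \<alpha> p * (deriv ^^ m) (vector_poincare i (fst p) (snd p)) z)"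
      by (rule higher_deriv_lincomb[OF finQ vector_poincare_holomorphic open_upper]) (use z Z in auto)
    also have "\<dots> = (\<Sum>j\<in>UNIV. \<Sum>n\<in>block j. \<beta> j n * \<phi> j (i, z, m) n)"
      unfolding Q_def by (subst sum.Sigma) (auto simp: block \<alpha>_def \<phi>_def split_def)
    also have "\<dots> = 0" using \<beta>(2)[OF c] by simp
    finally show "(deriv ^^ m) (H Q \<alpha> i) z = 0" by (simp add: H_def[abs_def])
  qed (use Z in auto)
qed

lemma seed_imaginary: "seed j n (Complex 0 y) = of_real (exp (2 * pi * (real n + 1 - l0$j) / h * y))"
proof -
  have "Complex 0 y = \<i> * of_real y" by (simp add: complex_eq_iff)
  then have "2 * of_real pi * \<i> * of_real (l0$j - (real n + 1)) * (Complex 0 y / of_real h) =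
      of_real (2 * pi * (real n + 1 - l0$j) / h * y)"
    by (simp add: field_simps)
  then show ?thesis by (simp only: seed_def exp_of_real)
qed

context
  fixes Q :: "('d \<times> nat) set" and \<alpha> :: "'d \<times> nat \<Rightarrow> complex" and Z :: "complex set"
  assumes Q: "finite Q"
    and Z: "Z \<subseteq> upper_half_plane" "\<And>z. z \<in> upper_half_plane \<Longrightarrow> eis z = 0 \<Longrightarrow> \<exists>z0\<in>Z. \<exists>g\<in>G. z = act g z0"
    and vanish: "\<And>i z m. z \<in> Z \<Longrightarrow> int m < zorder eis z \<Longrightarrow> (deriv ^^ m) (H Q \<alpha> i) z = 0"
begin

text \<open>A linear relation, multiplied by the Eisenstein series and restricted to the imaginary
  axis, says that a combination of seeds is bounded there, since each Poincare series differs from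
  its seed vector by something bounded. The seeds have distinct positive rates, so all coefficients
  vanish.\<close>

lemma X_independent:
  assumes inj: "inj_on snd Q" and nz: "\<And>j. \<exists>n. (j, n) \<in> Q \<and> \<alpha> (j, n) \<noteq> 0"
  shows "independent_components (X Q \<alpha>)"
  unfolding independent_components_def
proof (intro allI impI)
  fix a :: "'d \<Rightarrow> complex" and j
  assume zero: "\<forall>\<tau>\<in>upper_half_plane. (\<Sum>i\<in>UNIV. a i * X Q \<alpha> \<tau> $ i) = 0"
  define \<mu> where "\<mu> p = 2 * pi * (real (snd p) + 1 - l0$(fst p)) / h" for p
  have \<mu>: "seed (fst p) (snd p) (Complex 0 y) = of_real (exp (\<mu> p * y))" for p y
    by (simp add: \<mu>_def seed_imaginary)
  have inj': "inj_on \<mu> Q"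
  proof (rule inj_onI)
    fix p p' assume p: "p \<in> Q" "p' \<in> Q" and "\<mu> p = \<mu> p'"
    then have "real (snd p) - l0$(fst p) = real (snd p') - l0$(fst p')" using h by (simp add: \<mu>_def)
    \<comment> \<open>The entries of \<open>l0\<close> lie in [0, 1), so equal rates force integers
      n that differ by less than 1.\<close>
    then have "snd p = snd p'" using l0[of "fst p"] l0[of "fst p'"] by linarith
    then show "p = p'" using inj p by (auto simp: inj_on_def)
  qed
  have "\<exists>K. \<forall>y\<ge>1. cmod (vector_poincare i j n (Complex 0 y) - (if i = j then seed j n (Complex 0 y) else 0)) \<le> K" for i j n
    by (rule vector_poincare_at_infinity[of i j n]) blast
  then obtain K where K: "\<And>i j n y. y \<ge> 1 \<Longrightarrow> cmod (vector_poincare i j n (Complex 0 y) - (if i = j then seed j n (Complex 0 y) else 0)) \<le> K i j n"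
    by metis
  obtain Y B where Y: "Y \<ge> 1" "\<And>y. y \<ge> Y \<Longrightarrow> eis (Complex 0 y) \<noteq> 0 \<and> cmod (eis (Complex 0 y)) \<le> B"
    by (rule eis_large) blast
  define E where "E i p y = vector_poincare i (fst p) (snd p) (Complex 0 y) - (if i = fst p then seed (fst p) (snd p) (Complex 0 y) else 0)" for i p y
  define B' where "B' = (\<Sum>i\<in>UNIV. \<Sum>p\<in>Q. cmod (a i) * cmod (\<alpha> p) * K i (fst p) (snd p))"
  have bound: "cmod (\<Sum>p\<in>Q. (a (fst p) * \<alpha> p) * of_real (exp (\<mu> p * y))) \<le> B'" if y: "y \<ge> Y" for y
  proof -
    have \<tau>: "Complex 0 y \<in> upper_half_plane" using y Y(1) by (simp add: upper_half_plane_def)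
    have enz: "eis (Complex 0 y) \<noteq> 0" using Y(2)[OF y] by simp
    have "0 = (\<Sum>i\<in>UNIV. a i * X Q \<alpha> (Complex 0 y) $ i)" using zero \<tau> by simp
    also have "\<dots> = (\<Sum>i\<in>UNIV. a i * H Q \<alpha> i (Complex 0 y)) / eis (Complex 0 y)"
      by (simp add: X_eq[OF Q Z vanish \<tau> enz] sum_divide_distrib)
    finally have "0 = (\<Sum>i\<in>UNIV. a i * H Q \<alpha> i (Complex 0 y))" using enz by simp
    also have "\<dots> = (\<Sum>i\<in>UNIV. \<Sum>p\<in>Q. a i * (\<alpha> p * E i p y) + (if i = fst p then (a i * \<alpha> p) * of_real (exp (\<mu> p * y)) else 0))"
      unfolding H_def sum_distrib_left by (intro sum.cong refl) (simp add: E_def \<mu> algebra_simps)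
    also have "\<dots> = (\<Sum>i\<in>UNIV. \<Sum>p\<in>Q. a i * (\<alpha> p * E i p y)) + (\<Sum>p\<in>Q. \<Sum>i\<in>UNIV. if i = fst p then (a i * \<alpha> p) * of_real (exp (\<mu> p * y)) else 0)"
      unfolding sum.distrib by (simp only: sum.swap[of _ Q UNIV])
    also have "(\<Sum>p\<in>Q. \<Sum>i\<in>UNIV. if i = fst p then (a i * \<alpha> p) * of_real (exp (\<mu> p * y)) else 0) = (\<Sum>p\<in>Q. (a (fst p) * \<alpha> p) * of_real (exp (\<mu> p * y)))"
      by simp
    finally have "(\<Sum>p\<in>Q. (a (fst p) * \<alpha> p) * of_real (exp (\<mu> p * y))) = - (\<Sum>i\<in>UNIV. \<Sum>p\<in>Q. a i * (\<alpha> p * E i p y))"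
      by (simp add: eq_neg_iff_add_eq_0 add.commute)
    then have "cmod (\<Sum>p\<in>Q. (a (fst p) * \<alpha> p) * of_real (exp (\<mu> p * y))) = cmod (\<Sum>i\<in>UNIV. \<Sum>p\<in>Q. a i * (\<alpha> p * E i p y))"
      by (simp only: norm_minus_cancel)
    also have "\<dots> \<le> B'" unfolding B'_def
    proof (intro sum_norm_le)
      fix i p
      have "cmod (E i p y) \<le> K i (fst p) (snd p)" using K[of y i "fst p" "snd p"] y Y(1) by (simp add: E_def)
      then show "cmod (a i * (\<alpha> p * E i p y)) \<le> cmod (a i) * cmod (\<alpha> p) * K i (fst p) (snd p)"
        by (simp add: norm_mult mult.assoc mult_left_mono)
    qed
    finally show ?thesis .
  qed
  obtain n where n: "(j, n) \<in> Q" "\<alpha> (j, n) \<noteq> 0" using nz[of j] by blast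
  have "a (fst (j, n)) * \<alpha> (j, n) = 0"
    by (rule bounded_exponential_sum[OF Q inj' _ bound n(1)]) (use seed_rate_pos in \<open>simp_all add: \<mu>_def\<close>)
  with n show "a j = 0" by simp
qed

end

end

section \<open>Diagonal matrices and the expansion at a cusp\<close>

lemma matrix_inv_mult:
  fixes P :: "complex^'n^'n"
  assumes "invertible P"
  shows "P ** matrix_inv P = mat 1" "matrix_inv P ** P = mat 1"
  using someI_ex[of "\<lambda>B. P ** B = mat 1 \<and> B ** P = mat 1"] assms
  by (auto simp: matrix_inv_def invertible_def)

lemma matrix_inv_eqI:
  fixes P :: "complex^'n^'n"
  assumes "P ** B = mat 1" "B ** P = mat 1"
  shows "invertible P" "matrix_inv P = B"
proof -
  show inv: "invertible P" using assms by (auto simp: invertible_def)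
  have "matrix_inv P = matrix_inv P ** (P ** B)" using assms by simp
  also have "\<dots> = (matrix_inv P ** P) ** B" by (simp only: matrix_mul_assoc)
  finally show "matrix_inv P = B" using matrix_inv_mult[OF inv] by simp
qed

lemma matrix_conj_mult:
  fixes P :: "complex^'n^'n"
  assumes "P ** B = mat 1"
  shows "(B ** M ** P) ** (B ** N ** P) = B ** (M ** N) ** P"
proof -
  have "(B ** M ** P) ** (B ** N ** P) = B ** M ** (P ** B) ** N ** P" by (simp only: matrix_mul_assoc)
  then show ?thesis using assms by (simp add: matrix_mul_assoc)
qed

lemma is_diagonal_mult_nth:
  fixes M N :: "complex^'n^'n"
  assumes "is_diagonal M"
  shows "(N ** M) $ i $ j = N $ i $ j * M $ j $ j"
proof -
  have "(N ** M) $ i $ j = (\<Sum>k\<in>UNIV. if k = j then N $ i $ j * M $ j $ j else 0)"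
    unfolding matrix_matrix_mult_def vec_lambda_beta
    by (intro sum.cong refl) (use assms in \<open>auto simp: is_diagonal_def\<close>)
  then show ?thesis by simp
qed

lemma is_diagonal_mult: "is_diagonal N \<Longrightarrow> is_diagonal M \<Longrightarrow> is_diagonal (N ** M)"
  unfolding is_diagonal_def[of "N ** M"] by (simp add: is_diagonal_mult_nth) (simp add: is_diagonal_def)

lemma is_diagonal_inverse:
  fixes M N :: "complex^'n^'n"
  assumes "is_diagonal M" "N ** M = mat 1"
  shows "is_diagonal N" "M $ i $ i \<noteq> 0"
proof -
  have 1: "N $ i $ j * M $ j $ j = (if i = j then 1 else 0)" for i j
    using is_diagonal_mult_nth[OF assms(1), of N i j] assms(2) by (simp add: mat_def)
  show nz: "M $ i $ i \<noteq> 0" for i using 1[of i i] by auto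
  show "is_diagonal N" unfolding is_diagonal_def using 1 nz by (metis mult_eq_0_iff)
qed

lemma unimodular_diag_exp:
  fixes M :: "complex^'n^'n"
  assumes "is_diagonal M" "\<And>i. cmod (M $ i $ i) = 1"
  shows "\<exists>l :: real^'n. (\<forall>i. 0 \<le> l $ i \<and> l $ i < 1) \<and> M = diag_exp l 1"
proof -
  have "\<exists>x. 0 \<le> x \<and> x < 1 \<and> M $ i $ i = exp (2 * of_real pi * \<i> * of_real x)" for i
  proof -
    obtain t where t: "0 \<le> t" "t < 2 * pi" "M $ i $ i = Complex (cos t) (sin t)"
      by (rule complex_unimodular_polar[OF assms(2)[of i]]) blast
    then have "M $ i $ i = exp (\<i> * of_real t)" by (simp add: complex_eq_iff cis_conv_exp[symmetric])
    then show ?thesis using t by (intro exI[of _ "t / (2 * pi)"]) (simp add: field_simps)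
  qed
  then obtain l where l: "\<And>i. 0 \<le> l i" "\<And>i. l i < 1" "\<And>i. M $ i $ i = exp (2 * of_real pi * \<i> * of_real (l i))"
    by metis
  have "M = diag_exp (vec_lambda l) 1"
    using assms(1) l(3) by (auto simp: vec_eq_iff diag_exp_def is_diagonal_def)
  with l show ?thesis by (intro exI[of _ "vec_lambda l"]) auto
qed

text \<open>Multiplying by exp(-2 pi i Lambda z), conjugated by \<open>P\<close>, cancels \<rho> of
  the cusp generator. The result \<open>Sv\<close> is periodic and of moderate growth, so it has a
  Laurent expansion in q with finite principal part; multiplying back gives the claim.\<close>

lemma (in vector_forms) X_cusp_expansion:
  assumes Q: "finite Q"
    and Z: "Z \<subseteq> upper_half_plane" "\<And>z. z \<in> upper_half_plane \<Longrightarrow> eis z = 0 \<Longrightarrow> \<exists>z0\<in>Z. \<exists>g\<in>G. z = act g z0"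
    and vanish: "\<And>i z m. z \<in> Z \<Longrightarrow> int m < zorder eis z \<Longrightarrow> (deriv ^^ m) (H Q \<alpha> i) z = 0"
    and width: "cusp_width G c > 0" and gen: "cusp_generator G c \<in> G"
    and diag: "cusp_diagonalization G \<rho> c P l"
  shows "has_cusp_expansion G c P l (X Q \<alpha>)"
proof -
  define h' where "h' = cusp_width G c"
  define A where "A = cusp_matrix c"
  define B where "B = matrix_inv P"
  define t where "t = cusp_generator G c"
  have h': "h' > 0" using width by (simp add: h'_def)
  have A: "A \<in> carrier PSL2R" by (simp add: A_def)
  have tc: "psl (tmat h') \<in> carrier PSL2R" by (simp add: psl_in_carrier)
  have t: "t \<in> G" "t = A \<otimes>\<^bsub>PSL2R\<^esub> psl (tmat h') \<otimes>\<^bsub>PSL2R\<^esub> inv\<^bsub>PSL2R\<^esub> A"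
    using gen by (simp_all add: t_def cusp_generator_def cusp_translation_def A_def h'_def psl2r_mat22)
  have tA: "t \<otimes>\<^bsub>PSL2R\<^esub> A = A \<otimes>\<^bsub>PSL2R\<^esub> psl (tmat h')" using A tc t by (simp add: PSL.m_assoc)
  have PB: "P ** B = mat 1" "B ** P = mat 1" and l: "\<And>k. 0 \<le> l$k" "\<And>k. l$k < 1" and rt: "B ** \<rho> t ** P = diag_exp l 1"
    using diag matrix_inv_mult[of P] by (auto simp: cusp_diagonalization_def B_def t_def)
  define M where "M z = P ** diag_exp l z ** B" for z
  have M_mult: "M z ** M w = M (z + w)" for z w
    unfolding M_def matrix_conj_mult[OF PB(2)] diag_exp_add ..
  have M_0: "M 0 = mat 1" by (simp add: M_def diag_exp_0 PB)
  have "M 1 = (P ** B) ** \<rho> t ** (P ** B)" unfolding M_def rt[symmetric] by (simp only: matrix_mul_assoc)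
  then have M_1: "M 1 = \<rho> t" by (simp add: PB)
  have up: "of_real h' * z \<in> upper_half_plane" if "z \<in> upper_half_plane" for z
    using that h' by (simp add: upper_half_plane_def)
  define Sv where "Sv z = M (- z) *v X Q \<alpha> (act A (of_real h' * z))" for z
  have Sv_nth: "Sv z $ i = (\<Sum>j\<in>UNIV. (\<Sum>k\<in>UNIV. P $ i $ k * exp (2 * of_real pi * \<i> * of_real (l$k) * (- z)) * B $ k $ j) * X Q \<alpha> (act A (of_real h' * z)) $ j)" for z i
    by (simp add: Sv_def matrix_vector_mult_def M_def conj_diag_nth)
  have shift: "act (psl (tmat h')) w = w + of_real h'" for w by (simp add: act_psl mob_def)
  have per: "Sv (z + 1) = Sv z" if z: "z \<in> upper_half_plane" for z
  proof -
    define w where "w = of_real h' * z"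
    have w: "w \<in> upper_half_plane" "Im w > 0" using up[OF z] by (auto simp: w_def upper_half_plane_def)
    have "act A (w + of_real h') = act t (act A w)"
      using act_mult(1)[of t A w] act_mult(1)[of A "psl (tmat h')" w] tA A tc t(1) w by (simp add: shift)
    then have "X Q \<alpha> (act A (of_real h' * (z + 1))) = M 1 *v X Q \<alpha> (act A w)"
      using X_equivariant[OF Q Z vanish t(1), of "act A w"] A w by (simp add: w_def distrib_left M_1)
    then have "Sv (z + 1) = (M (- (z + 1)) ** M 1) *v X Q \<alpha> (act A w)" by (simp add: Sv_def matrix_vector_mul_assoc)
    then show ?thesis by (simp add: M_mult Sv_def w_def)
  qed
  have hol: "(\<lambda>z. Sv z $ i) holomorphic_on upper_half_plane" for i
  proof -
    have s: "(\<lambda>z. of_real h' * z) ` upper_half_plane \<subseteq> upper_half_plane" using up by auto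
    have "act A \<circ> (\<lambda>z. of_real h' * z) holomorphic_on upper_half_plane"
      by (intro holomorphic_on_compose_gen[OF _ _ s] holomorphic_act A holomorphic_intros order_refl)
    then have 1: "(\<lambda>z. act A (of_real h' * z)) holomorphic_on upper_half_plane" by (simp add: o_def)
    have "(\<lambda>\<tau>. X Q \<alpha> \<tau> $ j) \<circ> (\<lambda>z. act A (of_real h' * z)) holomorphic_on upper_half_plane" for j
      by (rule holomorphic_on_compose_gen[OF 1 X_holomorphic[OF Q Z vanish]]) (use A up in auto)
    then have "(\<lambda>z. X Q \<alpha> (act A (of_real h' * z)) $ j) holomorphic_on upper_half_plane" for j by (simp add: o_def)
    then show ?thesis unfolding Sv_nth by (intro holomorphic_intros)
  qed
  obtain K1 K2 Y where K: "K1 \<ge> 0" "\<And>i w. 0 \<le> Re w \<Longrightarrow> Re w \<le> h' \<Longrightarrow> Im w \<ge> Y \<Longrightarrow>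
    cmod (X Q \<alpha> (act A w) $ i) \<le> K1 * exp (K2 * Im w)"
    by (rule X_growth[OF Q Z vanish A h' t(1)[unfolded t(2)]]) blast+
  have "\<exists>M0::nat. \<forall>N\<ge>M0. \<exists>a::int \<Rightarrow> complex. \<forall>z\<in>upper_half_plane. ((\<lambda>n. qexp z powi n * a n) has_sum Sv z $ i) {- int N..}" for i
  proof -
    interpret S: periodic_holomorphic "\<lambda>z. Sv z $ i"
      by unfold_locales (use hol per in auto)
    define C where "C = (\<Sum>j\<in>UNIV. (\<Sum>k\<in>UNIV. cmod (P $ i $ k) * cmod (B $ k $ j)) * K1)"
    have "cmod (Sv z $ i) \<le> C * exp ((2 * pi + K2 * h') * Im z)"
      if z: "0 \<le> Re z" "Re z \<le> 1" "Im z \<ge> max 0 (Y / h')" for z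
    proof -
      \<comment> \<open>As l < 1 and Im z \<ge> 0, removing the fractional power costs at most a
        factor exp(2 pi Im z).\<close>
      have e: "cmod (exp (2 * of_real pi * \<i> * of_real (l$k) * (- z))) \<le> exp (2 * pi * Im z)" for k
      proof -
        have "l $ k * Im z \<le> 1 * Im z" using l[of k] z by (intro mult_right_mono) auto
        then show ?thesis by (simp add: norm_exp_eq_Re mult.assoc)
      qed
      have x: "cmod (X Q \<alpha> (act A (of_real h' * z)) $ j) \<le> K1 * exp (K2 * h' * Im z)" for j
        using K(2)[of "of_real h' * z" j] z h' by (simp add: field_simps mult.assoc)
      have "cmod (Sv z $ i) \<le> (\<Sum>j\<in>UNIV. (\<Sum>k\<in>UNIV. cmod (P $ i $ k) * exp (2 * pi * Im z) * cmod (B $ k $ j)) * (K1 * exp (K2 * h' * Im z)))"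
        unfolding Sv_nth
      proof (rule sum_norm_le)
        fix j
        have "cmod (\<Sum>k\<in>UNIV. P $ i $ k * exp (2 * of_real pi * \<i> * of_real (l$k) * (- z)) * B $ k $ j)
            \<le> (\<Sum>k\<in>UNIV. cmod (P $ i $ k) * exp (2 * pi * Im z) * cmod (B $ k $ j))"
          unfolding norm_mult[of "P $ i $ k * x" for k x] norm_mult[of "P $ i $ k" for k]
          by (rule sum_norm_le, unfold norm_mult[of "P $ i $ k * x" for k x] norm_mult[of "P $ i $ k" for k])
            (intro mult_right_mono mult_left_mono e norm_ge_zero)
        then show "cmod ((\<Sum>k\<in>UNIV. P $ i $ k * exp (2 * of_real pi * \<i> * of_real (l$k) * (- z)) * B $ k $ j) * X Q \<alpha> (act A (of_real h' * z)) $ j)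
          \<le> (\<Sum>k\<in>UNIV. cmod (P $ i $ k) * exp (2 * pi * Im z) * cmod (B $ k $ j)) * (K1 * exp (K2 * h' * Im z))"
          unfolding norm_mult[of "sum f A" for f A] by (intro mult_mono x) (auto intro: sum_nonneg)
      qed
      also have "\<dots> = C * (exp (2 * pi * Im z) * exp (K2 * h' * Im z))"
        by (simp add: C_def sum_distrib_left sum_distrib_right mult_ac)
      also have "\<dots> = C * exp ((2 * pi + K2 * h') * Im z)" by (simp add: distrib_right flip: exp_add)
      finally show ?thesis .
    qed
    from S.expansion[OF this] show ?thesis by blast
  qed
  then obtain M0 where M0: "\<And>i N. N \<ge> M0 i \<Longrightarrow> \<exists>a::int \<Rightarrow> complex. \<forall>z\<in>upper_half_plane. ((\<lambda>n. qexp z powi n * a n) has_sum Sv z $ i) {- int N..}"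
    by metis
  \<comment> \<open>One order for all components, the largest of their thresholds.\<close>
  define N where "N = Max (range M0)"
  have "M0 i \<le> N" for i by (simp add: N_def)
  with M0 have "\<forall>i. \<exists>a::int \<Rightarrow> complex. \<forall>z\<in>upper_half_plane. ((\<lambda>n. qexp z powi n * a n) has_sum Sv z $ i) {- int N..}" by blast
  then obtain a where a: "\<And>i z. z \<in> upper_half_plane \<Longrightarrow> ((\<lambda>n. qexp z powi n * a i n) has_sum Sv z $ i) {- int N..}" by metis
  show ?thesis unfolding has_cusp_expansion_def
  proof (intro exI ballI conjI)
    fix \<tau> assume \<tau>: "\<tau> \<in> upper_half_plane"
    define z where "z = cusp_coord G c \<tau>"
    have hz: "of_real h' * z = act (inv\<^bsub>PSL2R\<^esub> A) \<tau>" using h' by (simp add: z_def cusp_coord_def h'_def A_def)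
    have "act (inv\<^bsub>PSL2R\<^esub> A) \<tau> \<in> upper_half_plane" using A \<tau> by simp
    then have z: "z \<in> upper_half_plane" using h' unfolding hz[symmetric] by (simp add: upper_half_plane_def zero_less_mult_iff)
    have q: "cusp_q G c \<tau> = qexp z" by (simp add: cusp_q_def z_def)
    show "((\<lambda>n. (cusp_q G c \<tau> powi n) *s (\<chi> i. a i n)) has_sum Sv z) {- int N..}"
      by (rule has_sum_vec) (simp add: q a[OF z])
    have "act A (of_real h' * z) = \<tau>" using A \<tau> by (simp add: hz act_inv upper_half_plane_def)
    then have "M z *v Sv z = X Q \<alpha> \<tau>" by (simp add: Sv_def matrix_vector_mul_assoc M_mult M_0)
    then show "X Q \<alpha> \<tau> = (P ** diag_exp l (cusp_coord G c \<tau>) ** matrix_inv P) *v Sv z"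
      by (simp add: M_def z_def B_def)
  qed
qed

section \<open>Diagonalization at the cusps\<close>

locale finite_representation = discrete_group G for G +
  fixes \<rho> :: "(real^2^2) set \<Rightarrow> complex^'d^'d"
  assumes rep: "representation G \<rho>" and fin: "finite (\<rho> ` G)"
begin

lemma G_car [simp]: "g \<in> G \<Longrightarrow> g \<in> carrier PSL2R"
  using sub by (rule subgroup.mem_carrier)

lemma G_mult_inv [simp]:
  "g \<in> G \<Longrightarrow> g' \<in> G \<Longrightarrow> g \<otimes>\<^bsub>PSL2R\<^esub> g' \<in> G" "g \<in> G \<Longrightarrow> inv\<^bsub>PSL2R\<^esub> g \<in> G" "\<one>\<^bsub>PSL2R\<^esub> \<in> G"
  using sub by (simp_all add: subgroup.m_closed subgroup.m_inv_closed subgroup.one_closed)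

lemma rho_mult: "a \<in> G \<Longrightarrow> b \<in> G \<Longrightarrow> \<rho> (a \<otimes>\<^bsub>PSL2R\<^esub> b) = \<rho> a ** \<rho> b"
  using rep by (auto simp: representation_def hom_def GL_def)

lemma rho_one: "\<rho> \<one>\<^bsub>PSL2R\<^esub> = mat 1"
proof -
  have inv: "invertible (\<rho> \<one>\<^bsub>PSL2R\<^esub>)" using rep by (auto simp: representation_def hom_def GL_def)
  have "\<rho> \<one>\<^bsub>PSL2R\<^esub> ** \<rho> \<one>\<^bsub>PSL2R\<^esub> = \<rho> \<one>\<^bsub>PSL2R\<^esub>"
    using rho_mult[of "\<one>\<^bsub>PSL2R\<^esub>" "\<one>\<^bsub>PSL2R\<^esub>"] by simp
  then have "matrix_inv (\<rho> \<one>\<^bsub>PSL2R\<^esub>) ** \<rho> \<one>\<^bsub>PSL2R\<^esub> ** \<rho> \<one>\<^bsub>PSL2R\<^esub> = matrix_inv (\<rho> \<one>\<^bsub>PSL2R\<^esub>) ** \<rho> \<one>\<^bsub>PSL2R\<^esub>"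
    by (simp flip: matrix_mul_assoc)
  then show ?thesis by (simp add: matrix_inv_mult[OF inv])
qed

lemma rho_inv: "a \<in> G \<Longrightarrow> \<rho> a ** \<rho> (inv\<^bsub>PSL2R\<^esub> a) = mat 1" "a \<in> G \<Longrightarrow> \<rho> (inv\<^bsub>PSL2R\<^esub> a) ** \<rho> a = mat 1"
  using rho_mult[of a "inv\<^bsub>PSL2R\<^esub> a"] rho_mult[of "inv\<^bsub>PSL2R\<^esub> a" a] by (simp_all add: rho_one)

lemma cusp_generator_fix:
  assumes "c \<in> cusps G"
  shows "cusp_generator G c \<in> G" "boundary_act (cusp_generator G c) c = c"
proof -
  have "cusp_generator G c \<in> range (\<lambda>n::int. cusp_translation c (of_int n * cusp_width G c))"
    by (rule range_eqI[of _ _ 1]) (simp add: cusp_generator_def)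
  then show "cusp_generator G c \<in> G" "boundary_act (cusp_generator G c) c = c"
    unfolding cusp_width(2)[OF assms, symmetric] by simp_all
qed

text \<open>The powers of \<rho> t take finitely many values, so two different powers of the
  eigenvalue agree; being nonzero, it is a root of unity.\<close>

lemma eigenvalue_unimodular:
  fixes P B :: "complex^'d^'d"
  assumes t: "t \<in> G" and PB: "P ** B = mat 1" "B ** P = mat 1" and diag: "is_diagonal (B ** \<rho> t ** P)"
  shows "cmod ((B ** \<rho> t ** P) $ i $ i) = 1"
proof -
  define D where "D = B ** \<rho> t ** P"
  have tn: "t [^]\<^bsub>PSL2R\<^esub> n \<in> G" for n :: nat using t by (induction n) simp_all
  have pow: "(B ** \<rho> (t [^]\<^bsub>PSL2R\<^esub> n) ** P) $ i $ i = (D $ i $ i) ^ n" for n :: nat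
  proof (induction n)
    case 0
    then show ?case by (simp add: rho_one PB) (simp add: mat_def)
  next
    case (Suc n)
    have "B ** \<rho> (t [^]\<^bsub>PSL2R\<^esub> Suc n) ** P = (B ** \<rho> (t [^]\<^bsub>PSL2R\<^esub> n) ** P) ** D"
      unfolding D_def matrix_conj_mult[OF PB(1)] using tn t by (simp add: rho_mult)
    then show ?case using Suc is_diagonal_mult_nth[OF diag] by (simp add: D_def)
  qed
  have nz: "D $ i $ i \<noteq> 0"
  proof -
    have "(B ** \<rho> (inv\<^bsub>PSL2R\<^esub> t) ** P) ** D = mat 1"
      unfolding D_def matrix_conj_mult[OF PB(1)] using t by (simp add: rho_inv PB)
    then show ?thesis using is_diagonal_inverse(2)[of D] diag by (simp add: D_def)
  qed
  have "range (\<lambda>n. (D $ i $ i) ^ n) \<subseteq> (\<lambda>M. (B ** M ** P) $ i $ i) ` (\<rho> ` G)"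
    using pow tn by (force simp flip: pow)
  then have "finite (range (\<lambda>n. (D $ i $ i) ^ n))" using fin by (meson finite_imageI finite_subset)
  then have "\<not> inj (\<lambda>n. (D $ i $ i) ^ n)" using finite_imageD infinite_UNIV_nat by blast
  then obtain m n where mn: "m < n" "(D $ i $ i) ^ m = (D $ i $ i) ^ n"
    by (metis injI linorder_neqE_nat)
  have "cmod (D $ i $ i) ^ (n - m) = 1"
    using mn nz by (simp add: power_diff flip: norm_power)
  then show ?thesis using mn(1) power_eq_imp_eq_base[of "cmod (D $ i $ i)" "n - m" 1] by (simp add: D_def)
qed

lemma cusp_diagonalizationI:
  fixes P B :: "complex^'d^'d"
  assumes c: "c \<in> cusps G" and PB: "P ** B = mat 1" "B ** P = mat 1" and P1: "c = Infty \<Longrightarrow> P = mat 1"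
    and diag: "is_diagonal (B ** \<rho> (cusp_generator G c) ** P)"
  shows "\<exists>P l. cusp_diagonalization G \<rho> c P l"
  using unimodular_diag_exp[OF diag eigenvalue_unimodular[OF cusp_generator_fix(1)[OF c] PB diag]] P1 matrix_inv_eqI[OF PB]
  unfolding cusp_diagonalization_def by metis

text \<open>Nonnegative multiples are powers of one diagonal matrix; negative ones are the inverses
  of these, again diagonal.\<close>

lemma diagonal_translations:
  fixes P B :: "complex^'d^'d"
  assumes c: "c \<in> cusps G" and PB: "P ** B = mat 1" "B ** P = mat 1"
    and diag: "is_diagonal (B ** \<rho> (cusp_generator G c) ** P)"
  shows "is_diagonal (B ** \<rho> (cusp_translation c (of_int k * cusp_width G c)) ** P)"
proof -
  define t where "t k = cusp_translation c (of_int k * cusp_width G c)" for k :: int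
  have tG: "t k \<in> G" for k using cusp_width(2)[OF c] by (auto simp: t_def)
  have add: "t (j + k) = t j \<otimes>\<^bsub>PSL2R\<^esub> t k" for j k by (simp add: t_def cusp_translation_add distrib_right)
  have nonneg: "is_diagonal (B ** \<rho> (t (int n)) ** P)" for n
  proof (induction n)
    case 0
    then show ?case by (simp add: t_def cusp_translation_0 rho_one PB) (simp add: is_diagonal_def mat_def)
  next
    case (Suc n)
    have "B ** \<rho> (t (int n + 1)) ** P = (B ** \<rho> (t (int n)) ** P) ** (B ** \<rho> (t 1) ** P)"
      unfolding matrix_conj_mult[OF PB(1)] add rho_mult[OF tG tG] ..
    moreover have "t 1 = cusp_generator G c" by (simp add: t_def cusp_generator_def)
    ultimately show ?case using is_diagonal_mult[OF Suc diag] by (simp add: add.commute)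
  qed
  have "is_diagonal (B ** \<rho> (t (- int n)) ** P)" for n
  proof (rule is_diagonal_inverse(1)[OF nonneg[of n]])
    have "t (- int n) \<otimes>\<^bsub>PSL2R\<^esub> t (int n) = \<one>\<^bsub>PSL2R\<^esub>"
      using add[of "- int n" "int n"] by (simp add: t_def cusp_translation_0)
    then have "\<rho> (t (- int n)) ** \<rho> (t (int n)) = mat 1"
      using rho_mult[OF tG[of "- int n"] tG[of "int n"]] rho_one by metis
    then show "(B ** \<rho> (t (- int n)) ** P) ** (B ** \<rho> (t (int n)) ** P) = mat 1"
      unfolding matrix_conj_mult[OF PB(1)] by (simp add: PB)
  qed
  with nonneg have "is_diagonal (B ** \<rho> (t k) ** P)" by (cases k rule: int_cases2) auto
  then show ?thesis by (simp add: t_def)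
qed

text \<open>Admissibility concerns representatives only. If g takes c to the representative r,
  conjugation by g takes the generator at c to an element fixing r, hence to a power of the
  generator at r, and \<rho>(g) transports the diagonalizing matrix.\<close>

lemma diagonalization_exists:
  assumes adm: "admissible G \<rho>" and c: "c \<in> cusps G"
  shows "\<exists>P l. cusp_diagonalization G \<rho> c P l"
proof (cases "c = Infty")
  case True
  then show ?thesis using adm c by (intro cusp_diagonalizationI[of c "mat 1" "mat 1"]) (auto simp: admissible_def)
next
  case False
  obtain C where C: "cusp_representatives G C" "\<And>c. c \<in> C \<Longrightarrow> c \<noteq> Infty \<Longrightarrow> diagonalizable (\<rho> (cusp_generator G c))"
    using adm unfolding admissible_def by blast
  then obtain r where "r \<in> C" "r \<in> orbit (PSL2R\<lparr>carrier := G\<rparr>) boundary_act c"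
    using c unfolding cusp_representatives_def by blast
  then obtain g where r: "r \<in> C" "r \<in> cusps G" and g: "g \<in> G" "boundary_act g c = r"
    using C(1) by (auto simp: orbit_def cusp_representatives_def)
  have "\<exists>P B :: complex^'d^'d. P ** B = mat 1 \<and> B ** P = mat 1 \<and> is_diagonal (B ** \<rho> (cusp_generator G r) ** P)"
  proof (cases "r = Infty")
    case True
    then show ?thesis using adm by (intro exI[of _ "mat 1 :: complex^'d^'d"]) (auto simp: admissible_def)
  next
    case False
    then obtain P :: "complex^'d^'d" where "invertible P" "is_diagonal (matrix_inv P ** \<rho> (cusp_generator G r) ** P)"
      using C(2)[OF r(1)] by (auto simp: diagonalizable_def)
    then show ?thesis using matrix_inv_mult by blast
  qed
  then obtain P B :: "complex^'d^'d" where PB: "P ** B = mat 1" "B ** P = mat 1" and diag: "is_diagonal (B ** \<rho> (cusp_generator G r) ** P)"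
    by blast
  define t where "t = cusp_generator G c"
  have t: "t \<in> G" "boundary_act t c = c" using cusp_generator_fix[OF c] by (simp_all add: t_def)
  have "g \<otimes>\<^bsub>PSL2R\<^esub> t \<otimes>\<^bsub>PSL2R\<^esub> inv\<^bsub>PSL2R\<^esub> g \<in> {g\<in>G. boundary_act g r = r}"
    using g t boundary_conj_fix[OF _ g(2) _ t(2)] by simp
  then obtain k :: int where k: "g \<otimes>\<^bsub>PSL2R\<^esub> t \<otimes>\<^bsub>PSL2R\<^esub> inv\<^bsub>PSL2R\<^esub> g = cusp_translation r (of_int k * cusp_width G r)"
    unfolding cusp_width(2)[OF r(2)] by blast
  define P' where "P' = \<rho> (inv\<^bsub>PSL2R\<^esub> g) ** P"
  define B' where "B' = B ** \<rho> g"
  have "P' ** B' = \<rho> (inv\<^bsub>PSL2R\<^esub> g) ** (P ** B) ** \<rho> g" unfolding P'_def B'_def by (simp only: matrix_mul_assoc)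
  then have 1: "P' ** B' = mat 1" using g by (simp add: PB rho_inv)
  have "B' ** P' = B ** (\<rho> g ** \<rho> (inv\<^bsub>PSL2R\<^esub> g)) ** P" unfolding P'_def B'_def by (simp only: matrix_mul_assoc)
  then have 2: "B' ** P' = mat 1" using g by (simp add: PB rho_inv)
  have "B' ** \<rho> t ** P' = B ** (\<rho> g ** \<rho> t ** \<rho> (inv\<^bsub>PSL2R\<^esub> g)) ** P"
    unfolding P'_def B'_def by (simp only: matrix_mul_assoc)
  also have "\<dots> = B ** \<rho> (cusp_translation r (of_int k * cusp_width G r)) ** P"
    unfolding k[symmetric] using g t by (simp add: rho_mult)
  finally have "is_diagonal (B' ** \<rho> t ** P')" using diagonal_translations[OF r(2) PB diag] by simp
  then show ?thesis using cusp_diagonalizationI[OF c 1 2] False by (simp add: t_def)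
qed

end

theorem theorem5p1:
  fixes G :: "(real^2^2) set set"
    and \<rho> :: "(real^2^2) set \<Rightarrow> complex^'d^'d"
  assumes "fuchsian_first_kind G"
    and "Infty \<in> cusps G"
    and "admissible G \<rho>"
    and "finite (\<rho> ` G)"
  shows "(\<exists>P l. \<forall>c\<in>cusps G. cusp_diagonalization G \<rho> c (P c) (l c)) \<and>
    (\<forall>P l. (\<forall>c\<in>cusps G. cusp_diagonalization G \<rho> c (P c) (l c)) \<longrightarrow>
      (\<exists>X\<in>weakly_holomorphic_modular_functions G \<rho> P l. independent_components X))"
proof -
  interpret R: finite_representation G \<rho>
    using assms by (intro finite_representation.intro discrete_group.intro finite_representation_axioms.intro)
      (simp_all add: fuchsian_first_kind_def admissible_def)
  obtain D where D: "fundamental_domain G D" "hyperbolic_area D < \<infinity>"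
    using assms(1) by (auto simp: fuchsian_first_kind_def)
  define h where "h = cusp_width G Infty"
  have translation: "cusp_translation Infty s = psl2r 1 s 0 1" for s
    by (simp add: cusp_translation_def psl2r_mat22 psl_in_carrier)
  interpret C: fuchsian_cusp G D h
    by (rule fuchsian_cusp.intro[OF R.sub D]) (use R.cusp_width[OF assms(2)] in \<open>simp_all add: h_def translation\<close>)
  show ?thesis
  proof (intro conjI allI impI)
    \<comment> \<open>This existence keeps the universal statement that follows from holding
      vacuously.\<close>
    show "\<exists>P l. \<forall>c\<in>cusps G. cusp_diagonalization G \<rho> c (P c) (l c)"
      using R.diagonalization_exists[OF assms(3)] by metis
    fix P :: "boundary_point \<Rightarrow> complex^'d^'d" and l
    assume diag: "\<forall>c\<in>cusps G. cusp_diagonalization G \<rho> c (P c) (l c)"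
    then have inf: "cusp_diagonalization G \<rho> Infty (P Infty) (l Infty)" using assms(2) by blast
    \<comment> \<open>The normalisation at infinity makes \<rho> of the generator itself equal to
      \<open>diag_exp (l Infty) 1\<close>, as the seeds require.\<close>
    then have P: "P Infty = mat 1" by (simp add: cusp_diagonalization_def)
    have "matrix_inv (mat 1 :: complex^'d^'d) = mat 1" by (rule matrix_inv_eqI) simp_all
    then have gen: "\<rho> (cusp_generator G Infty) = diag_exp (l Infty) 1"
      using inf by (simp add: cusp_diagonalization_def P)
    have "C.T 1 = cusp_generator G Infty" unfolding C.T_def by (simp add: cusp_generator_def translation h_def)
    then interpret V: vector_forms G D h \<rho> "l Infty"
      using inf assms(4) gen by (intro vector_forms.intro C.fuchsian_cusp_axioms vector_forms_axioms.intro)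
        (simp_all add: R.rho_mult R.rho_one cusp_diagonalization_def)
    obtain Q \<alpha> Z where Q: "finite Q" "inj_on snd Q" "\<And>j. \<exists>n. (j, n) \<in> Q \<and> \<alpha> (j, n) \<noteq> 0"
      and Z: "Z \<subseteq> upper_half_plane" "\<And>z. z \<in> upper_half_plane \<Longrightarrow> C.poincare_series (\<lambda>_. 1) (\<lambda>_. 1) z = 0 \<Longrightarrow> \<exists>z0\<in>Z. \<exists>g\<in>G. z = act g z0"
        "\<And>i z m. z \<in> Z \<Longrightarrow> int m < zorder (C.poincare_series (\<lambda>_. 1) (\<lambda>_. 1)) z \<Longrightarrow> (deriv ^^ m) (V.H Q \<alpha> i) z = 0"
      by (rule V.good_coefficients) blast
    have "V.X Q \<alpha> \<in> weakly_holomorphic_modular_functions G \<rho> P l"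
      unfolding weakly_holomorphic_modular_functions_def
      using V.X_holomorphic[OF Q(1) Z] V.X_equivariant[OF Q(1) Z] diag
        V.X_cusp_expansion[OF Q(1) Z R.cusp_width(1) R.cusp_generator_fix(1)] by blast
    moreover have "independent_components (V.X Q \<alpha>)" by (rule V.X_independent[OF Q(1) Z Q(2,3)])
    ultimately show "\<exists>X\<in>weakly_holomorphic_modular_functions G \<rho> P l. independent_components X" by blast
  qed
qed

end
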